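(* Let $m\ge3$ be an integer, $(\alpha,\beta)\in\mathbb{C}^2\setminus\{(0,0)\}$, and let $1\le j\le\frac{m+1}{2}$ be a fixed integer. Then the asymptotic expansions of the eigenvalues $E_n$ of $H_P^{\alpha,\beta}$ of the type $$E_n=E_{n,0}+\sum_{i=1}^{j}e_i(a)\,E_{n,0}^{1-\frac im}+o\left(n^{\frac{2m-2j}{m+2}}\right),\quad n\to+\infty,$$ uniquely and explicitly determine the coefficients $a_k$ of $P$ for all $1\le k\le j$.
   Context: Operator. For $a=(a_1,\dots,a_{m-1})\in\mathbb{C}^{m-1}$ let $P(x)=a_1x^{m-1}+a_2x^{m-2}+\cdots+a_{m-1}x$. $H_P^{\alpha,\beta}$ denotes the eigenvalue problem $-u''(x)+(x^m+P(x))u(x)=Eu(x)$ on $0\le x<+\infty$ with boundary conditions $\alpha u(0)+\beta u'(0)=0$ and $u(+\infty)=0$. A number $E\in\mathbb{C}$ is an eigenvalue if a nonconstant solution $u$ exists; the set of eigenvalues is infinite and discrete. The eigenvalues are numbered $\{E_n\}_{n\ge n_0}$ (with $n_0$ an integer that may depend on the potential and boundary condition) in order of nondecreasing magnitude, counted with algebraic multiplicity. Leading term. $E_{n,0}=\left(\frac{2\sqrt\pi\,\Gamma(\frac32+\frac1m)}{\Gamma(1+\frac1m)}\right)^{\frac{2m}{m+2}}(n-\frac14)^{\frac{2m}{m+2}}$ if $\beta=0$, and the same with $n+\frac14$ in place of $n-\frac14$ if $\beta\ne0$. Multi-indices. $\xi=(\xi_1,\dots,\xi_{m-1})\in(\mathbb{N}\cup\{0\})^{m-1}$,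 $\eta=(1,2,\dots,m-1)$, $|\xi|=\sum_j\xi_j$, $\xi!=\prod_j\xi_j!$, $a^\xi=\prod_j a_j^{\xi_j}$ (similarly $e(a)^\xi$), $\xi\cdot\eta=\sum_j j\xi_j$; $\binom{s}{k}$ is the generalized binomial coefficient. Constants. $b_{j,k}(a)=\binom{1/2}{k}\sum_{|\xi|=k,\ \xi\cdot\eta=j}\frac{k!}{\xi!}a^\xi$ for $1\le k\le j\le\frac{m+2}{2}$. $K_{m,0}(a)=\frac{B(\frac12,1+\frac1m)}{2\cos(\pi/m)}$ ($B$ the beta function), $K_{m,j}(a)=\sum_{k=1}^j b_{j,k}(a)\int_0^\infty\left(\frac{t^{mk-j}}{(t^m+1)^{k-1/2}}-t^{\frac m2-j}\right)dt$ for $1\le j\le\frac{m+1}{2}$, and $d_j(a)=\cos\left(\frac{(j-1)\pi}{m}\right)K_{m,j}(a)$ for $0\le j\le\frac{m+1}{2}$. The coefficients $e_j(a)$ are defined recurrently for $1\le j\le\frac{m+1}{2}$ by $$e_j(a)=-\frac{2m}{m+2}\left(\frac{d_j(a)}{d_0(a)}+\sum_{\substack{|\xi|=k\ge2\\ \xi\cdot\eta=j}}\binom{\frac12+\frac1m}{k}\frac{k!}{\xi!}e(a)^\xi+\sum_{r=1}^{j-1}\frac{d_r(a)}{d_0(a)}\sum_{\substack{|\xi|=k\\ \xi\cdot\eta=j-r}}\binom{\frac12+\frac{1-r}{m}}{k}\frac{k!}{\xi!}e(a)^\xi\right),$$ with $e(a)=(e_1(a),\dots,e_{m-1}(a))$,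 sums over all multi-indices $\xi$ (with $k:=|\xi|$) satisfying the constraints; only $e_\ell(a)$ with $\ell<j$ occur on the right. Algebraic multiplicity. Put $b_j(a)=\sum_{k=1}^j b_{j,k}(a)$ and $r_m=-\frac m4$ if $m$ is odd, $r_m=-\frac m4-b_{\frac m2+1}(a)$ if $m$ is even. With $\lambda=-E$, let $f(z,a,\lambda)$ be Sibuya's solution, entire in $(z,a,\lambda)$, of $-f''+[z^m+P(z)+\lambda]f=0$ characterized by $f(z,a,\lambda)=z^{r_m}(1+O(z^{-1/2}))\exp\left[-\frac{2}{m+2}z^{\frac m2+1}-\sum_{1\le j<\frac m2+1}\frac{2}{m+2-2j}b_j(a)z^{\frac{m+2-2j}{2}}\right]$ as $z\to\infty$ in $|\arg z|\le\frac{3\pi}{m+2}-\varepsilon$ (any $\varepsilon>0$). The eigenvalues are the $E=-\lambda$ for zeros $\lambda$ of the entire function $\lambda\mapsto\alpha f(0,a,\lambda)+\beta f'(0,a,\lambda)$ (with $f'=\partial f/\partial z$), and the algebraic multiplicity of $E$ is the multiplicity of that zero. *)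

theory Defs
  imports "HOL-Complex_Analysis.Complex_Analysis" "HOL-Library.Landau_Symbols"
begin

text \<open>A coefficient vector \<open>(a_1, ..., a_(m-1))\<close>, and likewise a multi-index, is a function on
  \<^typ>\<open>nat\<close> of which only the values at \<open>{1..m-1}\<close> matter.\<close>

definition lower_part :: "nat \<Rightarrow> (nat \<Rightarrow> complex) \<Rightarrow> complex \<Rightarrow> complex" where
  "lower_part m a x = (\<Sum>i=1..m-1. a i * x ^ (m - i))"

subsection \<open>Multi-indices\<close>

text \<open>All \<open>\<xi>\<close> with \<open>|\<xi>| = k\<close> and \<open>\<xi> \<cdot> \<eta> = s\<close>.\<close>

definition multi_indices :: "nat \<Rightarrow> nat \<Rightarrow> nat \<Rightarrow> (nat \<Rightarrow> nat) set" where
  "multi_indices m k s =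
     {\<xi>. (\<forall>i. i \<notin> {1..m-1} \<longrightarrow> \<xi> i = 0) \<and> (\<Sum>i=1..m-1. \<xi> i) = k \<and> (\<Sum>i=1..m-1. i * \<xi> i) = s}"

lemma finite_multi_indices: "finite (multi_indices m k s)"
proof (rule finite_subset)
  show "multi_indices m k s \<subseteq> {\<xi>. \<forall>i. (i \<in> {1..m-1} \<longrightarrow> \<xi> i \<in> {..k}) \<and> (i \<notin> {1..m-1} \<longrightarrow> \<xi> i = 0)}"
    using member_le_sum[of _ "{1..m-1}"] by (fastforce simp: multi_indices_def)
  show "finite {\<xi>. \<forall>i. (i \<in> {1..m-1} \<longrightarrow> \<xi> i \<in> {..k}) \<and> (i \<notin> {1..m-1} \<longrightarrow> \<xi> i = (0::nat))}"
    by (rule finite_set_of_finite_funs) auto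
qed

definition multi_pow :: "nat \<Rightarrow> (nat \<Rightarrow> complex) \<Rightarrow> (nat \<Rightarrow> nat) \<Rightarrow> complex" where
  "multi_pow m v \<xi> = (\<Prod>i=1..m-1. v i ^ \<xi> i)"

definition multi_sum :: "nat \<Rightarrow> (nat \<Rightarrow> complex) \<Rightarrow> nat \<Rightarrow> nat \<Rightarrow> complex" where
  "multi_sum m v k s =
     (\<Sum>\<xi>\<in>multi_indices m k s. fact k / (\<Prod>i=1..m-1. fact (\<xi> i)) * multi_pow m v \<xi>)"

subsection \<open>The constants\<close>

definition b_coeff :: "nat \<Rightarrow> (nat \<Rightarrow> complex) \<Rightarrow> nat \<Rightarrow> nat \<Rightarrow> complex" where
  "b_coeff m a j k = ((1/2) gchoose k) * multi_sum m a k j"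

definition K_int :: "nat \<Rightarrow> nat \<Rightarrow> nat \<Rightarrow> real" where
  "K_int m j k =
     (LBINT t:{0<..}. t ^ (m * k - j) / (t ^ m + 1) powr (real k - 1/2) - t powr (real m / 2 - real j))"

definition K_coeff :: "nat \<Rightarrow> (nat \<Rightarrow> complex) \<Rightarrow> nat \<Rightarrow> complex" where
  "K_coeff m a j =
     (if j = 0 then of_real (Beta (1/2) (1 + 1 / real m) / (2 * cos (pi / real m)))
      else (\<Sum>k=1..j. b_coeff m a j k * of_real (K_int m j k)))"

definition d_coeff :: "nat \<Rightarrow> (nat \<Rightarrow> complex) \<Rightarrow> nat \<Rightarrow> complex" where
  "d_coeff m a j = of_real (cos ((real j - 1) * pi / real m)) * K_coeff m a j"

text \<open>The recursion for \<open>e_j(a)\<close>. In the sums below \<open>k = |\<xi>|\<close> is at most \<open>\<xi> \<cdot> \<eta>\<close>, so it ranges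
  over a finite interval. Only \<open>e_i(a)\<close> with \<open>i < j\<close> contribute; the guard \<open>i < j\<close> is there for
  termination only, see \<open>e_coeff_rec\<close>.\<close>

function e_coeff :: "nat \<Rightarrow> (nat \<Rightarrow> complex) \<Rightarrow> nat \<Rightarrow> complex" where
  "e_coeff m a j = - of_real (2 * real m / (real m + 2)) *
     (d_coeff m a j / d_coeff m a 0
      + (\<Sum>k=2..j. of_real ((1/2 + 1 / real m) gchoose k)
           * multi_sum m (\<lambda>i. if i < j then e_coeff m a i else 0) k j)
      + (\<Sum>r=1..<j. d_coeff m a r / d_coeff m a 0 *
           (\<Sum>k=1..j-r. of_real ((1/2 + (1 - real r) / real m) gchoose k)
              * multi_sum m (\<lambda>i. if i < j then e_coeff m a i else 0) k (j - r))))"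
  by auto
termination by (relation "Wellfounded.measure (\<lambda>(m, a, j). j)") auto

declare e_coeff.simps [simp del]

lemma multi_sum_cong:
  assumes "\<And>\<xi> i. \<xi> \<in> multi_indices m k s \<Longrightarrow> \<xi> i \<noteq> 0 \<Longrightarrow> v i = w i"
  shows "multi_sum m v k s = multi_sum m w k s"
proof -
  have "v i ^ \<xi> i = w i ^ \<xi> i" if "\<xi> \<in> multi_indices m k s" for \<xi> i
    using assms[OF that, of i] by (cases "\<xi> i = 0") auto
  then have "multi_pow m v \<xi> = multi_pow m w \<xi>" if "\<xi> \<in> multi_indices m k s" for \<xi>
    using that by (simp add: multi_pow_def)
  then show ?thesis by (simp add: multi_sum_def)
qed

lemma multi_index_small:
  assumes "\<xi> \<in> multi_indices m k s" "\<xi> i \<noteq> 0" and "s < j \<or> (s = j \<and> 2 \<le> k)"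
  shows "i < j"
proof -
  have i: "i \<in> {1..m-1}" and k: "(\<Sum>i=1..m-1. \<xi> i) = k" and s: "(\<Sum>i=1..m-1. i * \<xi> i) = s"
    using assms(1,2) by (auto simp: multi_indices_def)
  have "i * \<xi> i + (\<Sum>l\<in>{1..m-1}-{i}. l * \<xi> l) = s" "\<xi> i + (\<Sum>l\<in>{1..m-1}-{i}. \<xi> l) = k"
    using sum.remove[OF _ i, of "\<lambda>l. l * \<xi> l"] sum.remove[OF _ i, of \<xi>] k s by simp_all
  moreover have "(\<Sum>l\<in>{1..m-1}-{i}. \<xi> l) \<le> (\<Sum>l\<in>{1..m-1}-{i}. l * \<xi> l)"
    by (rule sum_mono) auto
  moreover have "i + \<xi> i \<le> i * \<xi> i + 1"
    using i assms(2) by (cases i; cases "\<xi> i") auto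
  ultimately have "i + k \<le> s + 1" by linarith
  moreover have "i \<le> i * \<xi> i" "i * \<xi> i \<le> s"
    using assms(2) \<open>i * \<xi> i + _ = s\<close> by auto
  ultimately show ?thesis using assms(3) by linarith
qed

lemma e_coeff_rec:
  "e_coeff m a j = - of_real (2 * real m / (real m + 2)) *
     (d_coeff m a j / d_coeff m a 0
      + (\<Sum>k=2..j. of_real ((1/2 + 1 / real m) gchoose k) * multi_sum m (e_coeff m a) k j)
      + (\<Sum>r=1..<j. d_coeff m a r / d_coeff m a 0 *
           (\<Sum>k=1..j-r. of_real ((1/2 + (1 - real r) / real m) gchoose k)
              * multi_sum m (e_coeff m a) k (j - r))))"
proof -
  have 1: "multi_sum m (\<lambda>i. if i < j then e_coeff m a i else 0) k j = multi_sum m (e_coeff m a) k j"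
    if "k \<in> {2..j}" for k
    using that by (intro multi_sum_cong) (auto dest: multi_index_small[where j = j])
  have 2: "multi_sum m (\<lambda>i. if i < j then e_coeff m a i else 0) k (j - r)
         = multi_sum m (e_coeff m a) k (j - r)" if "r \<in> {1..<j}" for k r
    using that by (intro multi_sum_cong) (auto dest: multi_index_small[where j = j])
  show ?thesis
    unfolding e_coeff.simps[of m a j]
    by (intro arg_cong2[where f = "(*)"] arg_cong2[where f = "(+)"] sum.cong refl)
       (simp_all add: 1 2)
qed

subsection \<open>The eigenvalue problem\<close>

definition is_eigenvalue ::
  "nat \<Rightarrow> (nat \<Rightarrow> complex) \<Rightarrow> complex \<Rightarrow> complex \<Rightarrow> complex \<Rightarrow> bool" where
  "is_eigenvalue m a \<alpha> \<beta> E \<longleftrightarrow>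
     (\<exists>(u :: real \<Rightarrow> complex) u' u''.
        (\<forall>x\<ge>0. (u has_vector_derivative u' x) (at x within {0..})) \<and>
        (\<forall>x\<ge>0. (u' has_vector_derivative u'' x) (at x within {0..})) \<and>
        (\<forall>x\<ge>0. - u'' x + (of_real x ^ m + lower_part m a (of_real x)) * u x = E * u x) \<and>
        \<alpha> * u 0 + \<beta> * u' 0 = 0 \<and>
        (u \<longlongrightarrow> 0) at_top \<and>
        \<not> u constant_on {0..})"

subsection \<open>Sibuya's solution and algebraic multiplicity\<close>

definition b_total :: "nat \<Rightarrow> (nat \<Rightarrow> complex) \<Rightarrow> nat \<Rightarrow> complex" where
  "b_total m a j = (\<Sum>k=1..j. b_coeff m a j k)"

definition r_exp :: "nat \<Rightarrow> (nat \<Rightarrow> complex) \<Rightarrow> complex" where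
  "r_exp m a = (if odd m then - of_nat m / 4 else - of_nat m / 4 - b_total m a (m div 2 + 1))"

text \<open>The condition \<open>1 \<le> j < m/2 + 1\<close> is rendered as \<open>2 j < m + 2\<close>; powers are principal branches.\<close>

definition sibuya_main :: "nat \<Rightarrow> (nat \<Rightarrow> complex) \<Rightarrow> complex \<Rightarrow> complex" where
  "sibuya_main m a z = z powr r_exp m a *
     exp (- (2 / (of_nat m + 2)) * z powr (of_nat m / 2 + 1)
          - (\<Sum>j | 1 \<le> j \<and> 2 * j < m + 2.
               2 / of_nat (m + 2 - 2 * j) * b_total m a j * z powr (of_nat (m + 2 - 2 * j) / 2)))"

text \<open>Being entire in \<open>(z, a, \<lambda>)\<close> is expressed as continuity together with holomorphy in each
  complex variable separately (Osgood's lemma). The last condition reads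
  \<open>f(z,a,\<lambda>) = sibuya_main m a z (1 + O(z^(-1/2)))\<close> uniformly in the closed sector.\<close>

definition sibuya_solution ::
  "nat \<Rightarrow> (complex \<Rightarrow> (nat \<Rightarrow> complex) \<Rightarrow> complex \<Rightarrow> complex) \<Rightarrow> bool" where
  "sibuya_solution m f \<longleftrightarrow>
     continuous_on UNIV (\<lambda>(z, a, l). f z a l) \<and>
     (\<forall>a l. (\<lambda>z. f z a l) holomorphic_on UNIV) \<and>
     (\<forall>z a. (\<lambda>l. f z a l) holomorphic_on UNIV) \<and>
     (\<forall>z a l. \<forall>k\<in>{1..m-1}. (\<lambda>w. f z (a(k := w)) l) holomorphic_on UNIV) \<and>
     (\<forall>z a l. - deriv (deriv (\<lambda>z. f z a l)) z + (z ^ m + lower_part m a z + l) * f z a l = 0) \<and>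
     (\<forall>a l. \<forall>\<epsilon>>0.
        (\<lambda>z. f z a l / sibuya_main m a z - 1)
          \<in> O[inf at_infinity (principal {z. \<bar>Arg z\<bar> \<le> 3 * pi / (real m + 2) - \<epsilon>})](\<lambda>z. z powr (-1/2)))"

definition alg_mult ::
  "(complex \<Rightarrow> (nat \<Rightarrow> complex) \<Rightarrow> complex \<Rightarrow> complex) \<Rightarrow> (nat \<Rightarrow> complex) \<Rightarrow> complex \<Rightarrow> complex
     \<Rightarrow> complex \<Rightarrow> nat" where
  "alg_mult f a \<alpha> \<beta> E = nat (zorder (\<lambda>l. \<alpha> * f 0 a l + \<beta> * deriv (\<lambda>z. f z a l) 0) (- E))"

text \<open>\<open>(E_n)\<close>, \<open>n \<ge> n0\<close>, lists the eigenvalues by nondecreasing modulus, each one as often as its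
  algebraic multiplicity. Values \<open>E n\<close> with \<open>n < n0\<close> are irrelevant.\<close>

definition eigenvalue_numbering ::
  "nat \<Rightarrow> (nat \<Rightarrow> complex) \<Rightarrow> complex \<Rightarrow> complex \<Rightarrow>
   (complex \<Rightarrow> (nat \<Rightarrow> complex) \<Rightarrow> complex \<Rightarrow> complex) \<Rightarrow> int \<Rightarrow> (int \<Rightarrow> complex) \<Rightarrow> bool" where
  "eigenvalue_numbering m a \<alpha> \<beta> f n0 E \<longleftrightarrow>
     (\<forall>n\<ge>n0. is_eigenvalue m a \<alpha> \<beta> (E n)) \<and>
     (\<forall>x. is_eigenvalue m a \<alpha> \<beta> x \<longrightarrow>
        finite {n. n \<ge> n0 \<and> E n = x} \<and> card {n. n \<ge> n0 \<and> E n = x} = alg_mult f a \<alpha> \<beta> x) \<and>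
     (\<forall>n\<ge>n0. \<forall>n'\<ge>n. norm (E n) \<le> norm (E n'))"

subsection \<open>Asymptotic expansions and recovery of the potential\<close>

definition E_lead :: "nat \<Rightarrow> complex \<Rightarrow> int \<Rightarrow> real" where
  "E_lead m \<beta> n =
     (2 * sqrt pi * Gamma (3/2 + 1 / real m) / Gamma (1 + 1 / real m)) powr (2 * real m / (real m + 2)) *
     (if \<beta> = 0 then real_of_int n - 1/4 else real_of_int n + 1/4) powr (2 * real m / (real m + 2))"

text \<open>\<open>E_n = E_(n,0) + \<Sum>i\<le>j. c_i E_(n,0)^(1-i/m) + o(n^((2m-2j)/(m+2)))\<close> with given coefficients \<open>c_i\<close>.\<close>

definition has_expansion ::
  "nat \<Rightarrow> complex \<Rightarrow> nat \<Rightarrow> (nat \<Rightarrow> complex) \<Rightarrow> (int \<Rightarrow> complex) \<Rightarrow> bool" where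
  "has_expansion m \<beta> j c E \<longleftrightarrow>
     (\<lambda>n. E n - (of_real (E_lead m \<beta> n)
                 + (\<Sum>i=1..j. c i * of_real (E_lead m \<beta> n powr (1 - real i / real m)))))
       \<in> o[at_top](\<lambda>n. of_real (real_of_int n powr ((2 * real m - 2 * real j) / (real m + 2))))"

text \<open>The explicit formula for \<open>a_k\<close> in terms of expansion coefficients \<open>c_1, ..., c_k\<close>: the relation
  \<open>c_k = e_k(a)\<close> is solved for \<open>d_k(a)/d_0\<close>, and then \<open>d_k(a) = cos((k-1)\<pi>/m) K_(m,k)(a)\<close> is solved for
  \<open>a_k\<close>, which occurs only in the summand \<open>b_(k,1)(a) = a_k/2\<close> of \<open>K_(m,k)(a)\<close>; the summands
  \<open>b_(k,l)(a)\<close> with \<open>l \<ge> 2\<close> and the \<open>d_r(a)\<close> with \<open>r < k\<close> involve \<open>a_1, ..., a_(k-1)\<close> only.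
  \<open>d_0\<close> does not depend on \<open>a\<close>.\<close>

definition ratio_from_expansion ::
  "nat \<Rightarrow> (nat \<Rightarrow> complex) \<Rightarrow> (nat \<Rightarrow> complex) \<Rightarrow> nat \<Rightarrow> complex" where
  "ratio_from_expansion m c a k =
     - of_real ((real m + 2) / (2 * real m)) * c k
     - (\<Sum>l=2..k. of_real ((1/2 + 1 / real m) gchoose l) * multi_sum m c l k)
     - (\<Sum>r=1..<k. d_coeff m a r / d_coeff m a 0 *
          (\<Sum>l=1..k-r. of_real ((1/2 + (1 - real r) / real m) gchoose l) * multi_sum m c l (k - r)))"

function recovered_coeff :: "nat \<Rightarrow> (nat \<Rightarrow> complex) \<Rightarrow> nat \<Rightarrow> complex" where
  "recovered_coeff m c k =
     (let a = (\<lambda>i. if i < k then recovered_coeff m c i else 0) in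
      2 / of_real (K_int m k 1) *
        (d_coeff m a 0 * ratio_from_expansion m c a k / of_real (cos ((real k - 1) * pi / real m))
         - (\<Sum>l=2..k. b_coeff m a k l * of_real (K_int m k l))))"
  by auto
termination by (relation "Wellfounded.measure (\<lambda>(m, c, k). k)") auto

declare recovered_coeff.simps [simp del]

end

theory Submission
  imports Defs "HOL-Real_Asymp.Real_Asymp"
begin

text \<open>The eigenvalues are the numbers \<open>-\<lambda>\<close> for the zeros \<open>\<lambda>\<close> of the entire function
  \<open>D(\<lambda>) = \<alpha> f(0,a,\<lambda>) + \<beta> f'(0,a,\<lambda>)\<close>, whose order is at most \<open>1/2 + 1/m < 1\<close>. Hence \<open>D'/D\<close> is the sum of
  \<open>1/(\<lambda> + E_n)\<close> over \<open>n\<close>. Inserting an expansion of \<open>E_n\<close> with coefficients \<open>c_i\<close> and replacing the sum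
  by Beta integrals expands \<open>D'/D\<close> for \<open>\<lambda> \<rightarrow> +\<infinity>\<close> in the powers \<open>\<lambda>^(s_i - 1)\<close>, \<open>s_i = 1/2 + (1-i)/m\<close>; the
  \<open>i\<close>-th coefficient is a multiple of the coefficient of \<open>y^i\<close> in \<open>(1 + c_1 y + c_2 y^2 + \<dots>)^(-s_i)\<close>. On the
  other hand the WKB approximation of \<open>f\<close> gives \<open>log D(\<lambda>)\<close> in terms of the integral of
  \<open>sqrt(x^m + P(x) + \<lambda>)\<close>, where the coefficient of \<open>\<lambda>^(s_i)\<close> is \<open>K_(m,i)(a)\<close>. By Lagrange inversion the
  resulting relations between the \<open>c_i\<close> and the \<open>d_i(a)\<close> are equivalent to the recursion for \<open>e_i(a)\<close>.
  They can be solved for \<open>a_i\<close> because the integral multiplying \<open>a_i/2\<close> in \<open>K_(m,i)(a)\<close> is negative.\<close>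

text \<open>Precise asymptotics are needed only for real positive \<open>\<lambda>\<close>. There
  \<open>x^m + P(x) + \<lambda>\<close> stays close to the positive model
  \<open>x^m + \<lambda>\<close>, and WKB holds on the whole half line without turning points. For
  other \<open>\<lambda>\<close> a crude growth bound suffices; the formula for \<open>D'/D\<close>
  follows from it by removing the zeros in growing discs. The action integral up to infinity
  diverges, so it is taken relative to a fixed parameter \<open>\<Lambda>\<close>; this is possible
  because Sibuya's normalization at infinity does not contain \<open>\<lambda>\<close>. An expansion
  of \<open>log D\<close> may not be differentiated, hence the expansion of the sum over
  \<open>E_n\<close> is integrated and two expansions of \<open>log D\<close> are compared.
  Constants, logarithms and terms with index above \<open>(m+1)/2\<close> contribute
  \<open>O(\<lambda>^(1/(4m)))\<close>, whereas \<open>2j <= m+1\<close> gives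
  \<open>s_j >= 1/(2m)\<close>. The same condition keeps the effect of the shift by 1/4 in
  \<open>E_(n,0)\<close> below the precision of the expansion. Coefficients are compared for
  \<open>i >= 1\<close> only; the normalization enters through
  \<open>d_0 = pi / lead_const m\<close>.\<close>

unbundle no vec_syntax

section \<open>The recursion for the coefficients\<close>

text \<open>The formal power \<open>(1 + A)^s\<close> with a complex exponent, for series with
  \<open>A $ 0 = 0\<close>. As a composition with the binomial series it inherits the exponent
  laws.\<close>

definition fps_cpow :: "complex fps \<Rightarrow> complex \<Rightarrow> complex fps" where
  "fps_cpow A s = fps_binomial s oo A"

lemma fps_cpow_nth: "fps_cpow A s $ n = (\<Sum>k=0..n. (s gchoose k) * (A ^ k $ n))"
  by (simp add: fps_cpow_def fps_compose_nth)

lemma fps_cpow_nth_0: "fps_cpow A s $ 0 = 1"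
  by (simp add: fps_cpow_nth)

lemma fps_cpow_add:
  assumes "A $ 0 = 0"
  shows "fps_cpow A (s + t) = fps_cpow A s * fps_cpow A t"
  by (simp add: fps_cpow_def fps_binomial_add_mult fps_compose_mult_distrib[OF assms])

lemma fps_cpow_0: "fps_cpow A 0 = 1"
  by (simp add: fps_cpow_def)

text \<open>The factor \<open>A' / (1 + A)\<close> is independent of \<open>s\<close>, so
  derivatives of powers with different exponents share it.\<close>

lemma fps_deriv_cpow:
  assumes "A $ 0 = 0"
  shows "fps_deriv (fps_cpow A s) = fps_const s * fps_cpow A s * (fps_deriv A * fps_cpow A (-1))"
proof -
  have "fps_deriv (fps_binomial s) = fps_const s * fps_binomial s * fps_binomial (-1)"
    by (simp add: fps_binomial_deriv fps_binomial_minus_one fps_divide_unit)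
  then have "fps_deriv (fps_cpow A s) = ((fps_const s * fps_binomial s * fps_binomial (-1)) oo A) * fps_deriv A"
    by (simp add: fps_cpow_def fps_compose_deriv[OF assms])
  also have "\<dots> = fps_const s * fps_cpow A s * (fps_deriv A * fps_cpow A (-1))"
    by (simp add: fps_cpow_def fps_compose_mult_distrib[OF assms])
  finally show ?thesis .
qed

text \<open>A form of Lagrange inversion. Although the exponents \<open>s r\<close> vary, multiplying by the power
  \<open>- s i\<close> and the logarithmic derivative factor \<open>U\<close> of the proof annihilates, in degree \<open>i\<close>, all
  summands but the last.\<close>

lemma fps_Lagrange_powers:
  fixes A :: "complex fps" and q s :: "nat \<Rightarrow> complex"
  assumes A0: "A $ 0 = 0" and m: "m \<noteq> 0"
    and s: "\<And>r. s r = \<rho> - of_nat r / m"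
    and q: "\<And>n. n \<le> i \<Longrightarrow> (\<Sum>r\<le>n. q r * fps_cpow A (s r) $ (n - r)) = (if n = 0 then 1 else 0)"
  shows "s i * q i = \<rho> * fps_cpow A (- s i) $ i"
proof -
  define L where "L = fps_deriv A * fps_cpow A (-1)"
  define U where "U = 1 - fps_const (1/m) * (fps_X * L)"
  define F where "F = (\<Sum>r\<le>i. fps_const (q r) * (fps_X ^ r * fps_cpow A (s r)))"
  \<comment> \<open>By hypothesis \<open>F = 1 + O(X^(i+1))\<close>. The operator
    \<open>\<rho> - (1/m) X d/dX\<close> sends \<open>X^r (1 + A)^(s r)\<close> to
    \<open>s r X^r (1 + A)^(s r) U\<close>, because \<open>\<rho> - r/m = s r\<close>; the factor
    \<open>U\<close> is the same for every \<open>r\<close>.\<close>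
  define G where "G = fps_const \<rho> * F - fps_const (1/m) * (fps_X * fps_deriv F)"
  have XP: "(fps_X ^ r * H) $ n = (if n < r then 0 else H $ (n - r))" for r n and H :: "complex fps"
    by (simp add: fps_X_power_mult_nth)
  have F_nth: "F $ n = (if n = 0 then 1 else 0)" if "n \<le> i" for n
  proof -
    have "F $ n = (\<Sum>r\<le>i. q r * (if n < r then 0 else fps_cpow A (s r) $ (n - r)))"
      by (simp add: F_def fps_sum_nth XP)
    also have "\<dots> = (\<Sum>r\<le>n. q r * fps_cpow A (s r) $ (n - r))"
      using that by (intro sum.mono_neutral_cong_right) auto
    finally show ?thesis using q[OF that] by simp
  qed
  have G_nth: "G $ n = (if n = 0 then \<rho> else 0)" if "n \<le> i" for n
    using F_nth[OF that] that by (cases n) (simp_all add: G_def)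
  have dF: "fps_deriv F = (\<Sum>r\<le>i. fps_const (q r) * (fps_const (of_nat r) * fps_X ^ (r - 1) * fps_cpow A (s r)
      + fps_X ^ r * (fps_const (s r) * fps_cpow A (s r) * L)))"
    unfolding F_def fps_deriv_sum
    by (intro sum.cong refl) (simp add: fps_deriv_cpow[OF A0] fps_deriv_power L_def algebra_simps)
  have XX: "fps_X * (fps_const (of_nat r :: complex) * fps_X ^ (r - 1)) = fps_const (of_nat r) * fps_X ^ r" for r
    by (cases r) (simp_all add: mult.left_commute)
  have XF: "fps_X * fps_deriv F = (\<Sum>r\<le>i. fps_const (q r) * (fps_const (of_nat r) * fps_X ^ r * fps_cpow A (s r)
      + fps_X ^ r * (fps_const (s r) * fps_cpow A (s r) * (fps_X * L))))"
    unfolding dF sum_distrib_left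
    by (intro sum.cong refl, subst XX[symmetric]) (simp add: algebra_simps)
  have \<rho>: "fps_const \<rho> = fps_const (s r) + fps_const (1/m) * fps_const (of_nat r)" for r
    using m by (simp add: s)
  have "fps_const \<rho> * (fps_const (q r) * (fps_X ^ r * fps_cpow A (s r)))
      - fps_const (1/m) * (fps_const (q r) * (fps_const (of_nat r) * fps_X ^ r * fps_cpow A (s r)
      + fps_X ^ r * (fps_const (s r) * fps_cpow A (s r) * (fps_X * L))))
      = fps_const (q r) * (fps_const (s r) * (fps_X ^ r * (fps_cpow A (s r) * U)))" for r
    unfolding \<rho>[of r] U_def by (simp add: algebra_simps del: fps_const_mult fps_const_add)
  then have "G = (\<Sum>r\<le>i. fps_const (q r) * (fps_const (s r) * (fps_X ^ r * (fps_cpow A (s r) * U))))"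
    unfolding G_def XF unfolding F_def sum_distrib_left sum_subtractf[symmetric]
    by (intro sum.cong refl)
  then have "G * fps_cpow A (- s i) = (\<Sum>r\<le>i. fps_const (q r * s r) * (fps_X ^ r * (fps_cpow A (s r - s i) * U)))"
    by (simp add: sum_distrib_right sum_distrib_left fps_cpow_add[OF A0, of _ "- s i", simplified] mult_ac flip: fps_const_mult)
  then have *: "(G * fps_cpow A (- s i)) $ i = (\<Sum>r\<le>i. q r * s r * (fps_cpow A (s r - s i) * U) $ (i - r))"
    by (simp add: fps_sum_nth XP)
  \<comment> \<open>For \<open>t = s r - s i = (i - r)/m\<close> and \<open>H = (1 + A)^t\<close>
    the product \<open>H U\<close> is \<open>H - X H' / (i - r)\<close>, whose coefficient of
    \<open>X^(i - r)\<close> cancels.\<close>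
  have "(fps_cpow A (s r - s i) * U) $ (i - r) = 0" if "r < i" for r
  proof -
    define t where "t = s r - s i"
    have t: "m * t = of_nat (i - r)" using that m by (simp add: t_def s field_simps of_nat_diff)
    then have t0: "t \<noteq> 0" using that by auto
    have "fps_cpow A t * U = fps_cpow A t - fps_const (1/(m*t)) * (fps_X * fps_deriv (fps_cpow A t))"
    proof -
      have "fps_const (1/m) * H = fps_const (1/(m*t)) * (fps_const t * H)" for H :: "complex fps"
        using t0 m by (simp flip: mult.assoc)
      then show ?thesis
        unfolding U_def fps_deriv_cpow[OF A0] L_def[symmetric] right_diff_distrib by (simp add: mult_ac)
    qed
    then have "(fps_cpow A t * U) $ (i - r) = fps_cpow A t $ (i - r) - 1/(m*t) * (of_nat (i - r) * fps_cpow A t $ (i - r))"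
      using that by (cases "i - r") simp_all
    also have "\<dots> = 0" unfolding t using that by simp
    finally show ?thesis by (simp add: t_def)
  qed
  then have "(\<Sum>r\<le>i. q r * s r * (fps_cpow A (s r - s i) * U) $ (i - r))
      = (\<Sum>r\<le>i. if r = i then q i * s i * (fps_cpow A 0 * U) $ 0 else 0)"
    by (intro sum.cong) auto
  also have "\<dots> = q i * s i" by (simp add: fps_cpow_0 U_def)
  finally have "q i * s i = (G * fps_cpow A (- s i)) $ i" using * by simp
  also have "\<dots> = (\<Sum>n=0..i. if n = 0 then \<rho> * fps_cpow A (- s i) $ i else 0)"
    unfolding fps_mult_nth by (intro sum.cong) (auto simp: G_nth)
  finally show ?thesis by (simp add: mult.commute)
qed

section \<open>Multi-index sums as coefficients of powers of a series\<close>

definition supported_indices :: "nat set \<Rightarrow> nat \<Rightarrow> nat \<Rightarrow> (nat \<Rightarrow> nat) set" where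
  "supported_indices I k s = {\<xi>. (\<forall>i. i \<notin> I \<longrightarrow> \<xi> i = 0) \<and> (\<Sum>i\<in>I. \<xi> i) = k \<and> (\<Sum>i\<in>I. i * \<xi> i) = s}"

lemma finite_supported_indices:
  assumes "finite I"
  shows "finite (supported_indices I k s)"
proof (rule finite_subset)
  show "supported_indices I k s \<subseteq> {\<xi>. \<forall>i. (i \<in> I \<longrightarrow> \<xi> i \<in> {..k}) \<and> (i \<notin> I \<longrightarrow> \<xi> i = 0)}"
    using member_le_sum[of _ I] assms by (fastforce simp: supported_indices_def)
  show "finite {\<xi>. \<forall>i. (i \<in> I \<longrightarrow> \<xi> i \<in> {..k}) \<and> (i \<notin> I \<longrightarrow> \<xi> i = (0::nat))}"
    using assms by (intro finite_set_of_finite_funs) auto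
qed

text \<open>The multinomial theorem, over an arbitrary finite index set so that an induction can add
  one index at a time. Division by the factorials turns the step into the binomial theorem for
  \<open>u + w\<close>, with \<open>l\<close> the exponent of the new index.\<close>

lemma power_sum_nth_supported_indices:
  fixes v :: "nat \<Rightarrow> complex"
  assumes "finite I"
  shows "(\<Sum>\<xi>\<in>supported_indices I k s. \<Prod>i\<in>I. v i ^ \<xi> i / fact (\<xi> i))
       = (\<Sum>i\<in>I. fps_const (v i) * fps_X ^ i) ^ k $ s / fact k"
  using assms
proof (induction I arbitrary: k s)
  case empty
  have "supported_indices {} k s = (if k = 0 \<and> s = 0 then {\<lambda>_. 0} else {})"
    by (auto simp: supported_indices_def fun_eq_iff)
  then show ?case by (cases k) auto
next
  case (insert x I)
  let ?h = "\<lambda>k s. (\<Sum>\<xi>\<in>supported_indices I k s. \<Prod>i\<in>I. v i ^ \<xi> i / fact (\<xi> i))"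
  let ?u = "fps_const (v x) * fps_X ^ x" and ?w = "\<Sum>i\<in>I. fps_const (v i) * fps_X ^ i"
  \<comment> \<open>Within \<open>L\<close> the subtractions \<open>k - l\<close> and
    \<open>s - x * l\<close> of naturals are not truncated.\<close>
  define L where "L = {l. l \<le> k \<and> x * l \<le> s}"
  have finL: "finite L" by (rule finite_subset[of _ "{..k}"]) (auto simp: L_def)
  have upd: "(\<Sum>i\<in>I. (\<xi>(x := l)) i) = (\<Sum>i\<in>I. \<xi> i)" "(\<Sum>i\<in>I. i * (\<xi>(x := l)) i) = (\<Sum>i\<in>I. i * \<xi> i)"
    "(\<Prod>i\<in>I. v i ^ (\<xi>(x := l)) i / fact ((\<xi>(x := l)) i)) = (\<Prod>i\<in>I. v i ^ \<xi> i / fact (\<xi> i))" for \<xi> l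
    using insert.hyps by (auto intro!: sum.cong prod.cong)
  have "(\<Sum>\<xi>\<in>supported_indices (insert x I) k s. \<Prod>i\<in>insert x I. v i ^ \<xi> i / fact (\<xi> i))
      = (\<Sum>(l, \<xi>)\<in>Sigma L (\<lambda>l. supported_indices I (k - l) (s - x * l)).
           v x ^ l / fact l * (\<Prod>i\<in>I. v i ^ \<xi> i / fact (\<xi> i)))"
    using insert.hyps
    by (intro sum.reindex_bij_witness[where i = "\<lambda>(l, \<xi>). \<xi>(x := l)" and j = "\<lambda>\<xi>. (\<xi> x, \<xi>(x := 0))"])
       (auto simp: supported_indices_def L_def upd fun_upd_idem simp del: fun_upd_apply simp: fun_upd_same fun_upd_other,
        metis fun_upd_apply)
  also have "\<dots> = (\<Sum>l\<in>L. v x ^ l / fact l * ?h (k - l) (s - x * l))"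
    by (subst sum.Sigma[symmetric]) (auto simp: finL finite_supported_indices insert.hyps sum_distrib_left)
  also have "\<dots> = (\<Sum>l\<in>L. v x ^ l / fact l * (?w ^ (k - l) $ (s - x * l) / fact (k - l)))"
    by (simp add: insert.IH)
  also have "\<dots> = (\<Sum>l\<le>k. if x * l \<le> s then v x ^ l / fact l * (?w ^ (k - l) $ (s - x * l) / fact (k - l)) else 0)"
    by (subst sum.inter_filter[symmetric]) (auto simp: L_def intro!: sum.cong)
  also have "\<dots> = (\<Sum>l\<le>k. of_nat (k choose l) * (?u ^ l * ?w ^ (k - l)) $ s / fact k)"
  proof (rule sum.cong[OF refl])
    fix l assume l: "l \<in> {..k}"
    have "?u ^ l * H = fps_const (v x ^ l) * (fps_X ^ (x * l) * H)" for H
      unfolding power_mult_distrib power_mult fps_const_power mult.assoc ..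
    then have "(?u ^ l * ?w ^ (k - l)) $ s = (if x * l \<le> s then v x ^ l * ?w ^ (k - l) $ (s - x * l) else 0)"
      by (simp only: fps_mult_left_const_nth fps_X_power_mult_nth) simp
    then show "(if x * l \<le> s then v x ^ l / fact l * (?w ^ (k - l) $ (s - x * l) / fact (k - l)) else 0)
        = of_nat (k choose l) * (?u ^ l * ?w ^ (k - l)) $ s / fact k"
      using l by (simp add: binomial_fact)
  qed
  also have "\<dots> = (?u + ?w) ^ k $ s / fact k"
  proof -
    have "(of_nat (k choose l) * ?u ^ l * ?w ^ (k - l)) $ s = of_nat (k choose l) * (?u ^ l * ?w ^ (k - l)) $ s" for l
      unfolding fps_of_nat[symmetric] mult.assoc fps_mult_left_const_nth ..
    then show ?thesis unfolding binomial_ring fps_sum_nth sum_divide_distrib by simp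
  qed
  finally show ?case using insert.hyps by simp
qed

definition coeff_fps :: "nat \<Rightarrow> (nat \<Rightarrow> complex) \<Rightarrow> complex fps" where
  "coeff_fps m v = (\<Sum>i=1..m-1. fps_const (v i) * fps_X ^ i)"

lemma coeff_fps_nth: "coeff_fps m v $ n = (if n \<in> {1..m-1} then v n else 0)"
proof -
  have "coeff_fps m v $ n = (\<Sum>i=1..m-1. if i = n then v n else 0)"
    unfolding coeff_fps_def fps_sum_nth by (intro sum.cong) auto
  then show ?thesis by simp
qed

lemma coeff_fps_nth_0 [simp]: "coeff_fps m v $ 0 = 0"
  by (simp add: coeff_fps_nth)

text \<open>Makes the recursion for \<open>e_coeff\<close> a statement about formal powers of
  \<open>1 + \<Sum> v_i X^i\<close>.\<close>

lemma multi_sum_eq_nth: "multi_sum m v k s = coeff_fps m v ^ k $ s"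
proof -
  have "multi_sum m v k s = fact k * (\<Sum>\<xi>\<in>supported_indices {1..m-1} k s. \<Prod>i=1..m-1. v i ^ \<xi> i / fact (\<xi> i))"
    unfolding multi_sum_def sum_distrib_left supported_indices_def multi_indices_def multi_pow_def
    by (intro sum.cong) (simp_all add: prod_dividef)
  also have "\<dots> = coeff_fps m v ^ k $ s"
    by (subst power_sum_nth_supported_indices) (simp_all add: coeff_fps_def)
  finally show ?thesis .
qed

lemma multi_sum_0: "multi_sum m v 0 s = (if s = 0 then 1 else 0)"
  unfolding multi_sum_eq_nth by simp

lemma multi_sum_1: "multi_sum m v 1 s = (if s \<in> {1..m-1} then v s else 0)"
  unfolding multi_sum_eq_nth power_one_right coeff_fps_nth ..

lemma multi_sum_less: "s < k \<Longrightarrow> multi_sum m v k s = 0"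
  unfolding multi_sum_eq_nth using startsby_zero_power_prefix[OF coeff_fps_nth_0] by blast


lemma fps_cpow_coeff_fps_nth:
  "fps_cpow (coeff_fps m v) s $ n = (\<Sum>k=0..n. (s gchoose k) * multi_sum m v k n)"
  by (simp add: fps_cpow_nth multi_sum_eq_nth)

section \<open>Triangular structure and inversion of the recursion\<close>

lemma of_real_gbinomial: "of_real (x gchoose k) = ((of_real x :: complex) gchoose k)"
  by (simp add: gbinomial_prod_rev)

lemma b_coeff_cong:
  assumes "\<And>i. i \<le> j \<Longrightarrow> a i = a' i"
  shows "b_coeff m a j k = b_coeff m a' j k"
  unfolding b_coeff_def
proof (intro arg_cong2[where f = "(*)"] refl multi_sum_cong)
  fix \<xi> i assume \<xi>: "\<xi> \<in> multi_indices m k j" "\<xi> i \<noteq> 0"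
  then have "i < j + 1" by (intro multi_index_small[OF \<xi>]) auto
  then show "a i = a' i" using assms by auto
qed

text \<open>Two or more factors of total weight \<open>j\<close> leave no room for the index
  \<open>j\<close> itself. This makes the dependence of \<open>K_coeff\<close> on \<open>a\<close>
  triangular.\<close>

lemma b_coeff_cong_strict:
  assumes "\<And>i. i < j \<Longrightarrow> a i = a' i" "2 \<le> k"
  shows "b_coeff m a j k = b_coeff m a' j k"
  unfolding b_coeff_def
proof (intro arg_cong2[where f = "(*)"] refl multi_sum_cong)
  fix \<xi> i assume \<xi>: "\<xi> \<in> multi_indices m k j" "\<xi> i \<noteq> 0"
  then have "i < j" using assms(2) by (intro multi_index_small[OF \<xi>]) auto
  then show "a i = a' i" using assms by auto
qed

lemma d_coeff_cong:
  assumes "\<And>i. i \<le> j \<Longrightarrow> a i = a' i"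
  shows "d_coeff m a j = d_coeff m a' j"
  unfolding d_coeff_def K_coeff_def using b_coeff_cong[of j a a' m] assms by (simp cong: if_cong)

text \<open>The cosine in the denominator of \<open>K_coeff m a 0\<close> cancels against
  \<open>cos (- pi / m)\<close>; it is positive for \<open>m \<ge> 3\<close>.\<close>

lemma d_coeff_0_nonzero:
  assumes "3 \<le> m"
  shows "d_coeff m a 0 = of_real (Beta (1/2) (1 + 1 / real m) / 2)" "d_coeff m a 0 \<noteq> 0"
proof -
  have "0 < pi / real m" "pi / real m < pi / 2" using assms by (auto simp: field_simps)
  then have "cos (pi / real m) > 0" by (intro cos_gt_zero) auto
  moreover have "Beta (1/2) (1 + 1 / real m) > 0"
    by (auto simp: Beta_def intro!: divide_pos_pos mult_pos_pos Gamma_real_pos add_pos_nonneg)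
  ultimately show "d_coeff m a 0 = of_real (Beta (1/2) (1 + 1 / real m) / 2)" "d_coeff m a 0 \<noteq> 0"
    by (simp_all add: d_coeff_def K_coeff_def flip: of_real_mult of_real_divide)
qed

lemma rho_inverse:
  fixes x :: real
  assumes "x > 0"
  shows "1/2 + 1/x = (x + 2) / (2 * x)" "(x + 2) / (2 * x) * (2 * x / (x + 2)) = 1"
  using assms by (simp_all add: field_simps add_pos_pos less_imp_neq[symmetric])

text \<open>The hypothesis on \<open>c\<close> is the inverted form of the recursion. Lagrange
  inversion is used in the converse direction to recover the convolution relations \<open>Q\<close>;
  these, solved for the term linear in \<open>c n\<close>, are the recursion for
  \<open>e_coeff\<close>.\<close>

lemma e_coeff_unique:
  assumes m: "3 \<le> m" and j: "j \<le> m - 1"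
    and c: "\<And>i. 1 \<le> i \<Longrightarrow> i \<le> j \<Longrightarrow>
      of_real (1/2 + 1 / real m) * fps_cpow (coeff_fps m c) (- of_real (1/2 + (1 - real i) / real m)) $ i
      = of_real (1/2 + (1 - real i) / real m) * (d_coeff m a i / d_coeff m a 0)"
    and nz: "\<And>i. i \<le> j \<Longrightarrow> 1/2 + (1 - real i) / real m \<noteq> 0"
    and k: "1 \<le> k" "k \<le> j"
  shows "c k = e_coeff m a k"
proof -
  define s :: "nat \<Rightarrow> complex" where "s r = of_real (1/2 + (1 - real r) / real m)" for r
  define A where "A = coeff_fps m c"
  define q where "q = (\<lambda>i. d_coeff m a i / d_coeff m a 0)"
  have s0: "s 0 = of_real (1/2 + 1 / real m)" by (simp add: s_def)
  have s_alt: "s r = s 0 - of_nat r / of_nat m" for r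
    using m by (simp add: s_def field_simps)
  have q0: "q 0 = 1" using d_coeff_0_nonzero[OF m] by (simp add: q_def)
  have Q: "(\<Sum>r\<le>n. q r * fps_cpow A (s r) $ (n - r)) = (if n = 0 then 1 else 0)" if "n \<le> j" for n
    using that
  proof (induction n rule: less_induct)
    case (less n)
    show ?case
    proof (cases "n = 0")
      case True
      then show ?thesis by (simp add: q0 fps_cpow_nth_0)
    next
      case False
      \<comment> \<open>The value of \<open>q\<close> at \<open>n\<close> is replaced by the one
        that satisfies the \<open>n\<close>-th relation. Lagrange inversion then determines
        \<open>s n * q' n\<close>, which the hypothesis equates with \<open>s n * q n\<close>; since
        \<open>s n\<close> is nonzero, nothing was changed.\<close>
      define q' where "q' = q(n := - (\<Sum>r<n. q r * fps_cpow A (s r) $ (n - r)))"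
      have "(\<Sum>r\<le>l. q' r * fps_cpow A (s r) $ (l - r)) = (if l = 0 then 1 else 0)" if "l \<le> n" for l
      proof (cases "l < n")
        case True
        then have "(\<Sum>r\<le>l. q' r * fps_cpow A (s r) $ (l - r)) = (\<Sum>r\<le>l. q r * fps_cpow A (s r) $ (l - r))"
          by (intro sum.cong) (auto simp: q'_def)
        then show ?thesis using less True by auto
      next
        case l: False
        then have l: "l = n" using that by simp
        have "(\<Sum>r\<le>n. q' r * fps_cpow A (s r) $ (n - r))
            = (\<Sum>r<n. q r * fps_cpow A (s r) $ (n - r)) + q' n"
          by (simp add: lessThan_Suc_atMost[symmetric] fps_cpow_nth_0 q'_def)
        then show ?thesis using False l by (simp add: q'_def)
      qed
      from fps_Lagrange_powers[OF _ _ s_alt this, of n] m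
      have "s n * q' n = s 0 * fps_cpow A (- s n) $ n" by (simp add: A_def)
      also have "\<dots> = s n * q n"
        using c[of n] False less.prems by (simp add: s_def A_def q_def)
      finally have "q' n = q n"
        using nz[of n] less.prems unfolding s_def mult_cancel_left of_real_eq_0_iff by blast
      then have "q n = - (\<Sum>r<n. q r * fps_cpow A (s r) $ (n - r))" by (simp add: q'_def)
      then show ?thesis using False
        by (simp add: lessThan_Suc_atMost[symmetric] fps_cpow_nth_0)
    qed
  qed
  show ?thesis using k
  proof (induction k rule: less_induct)
    case (less n)
    have n: "1 \<le> n" "n \<le> m - 1" using less.prems j by auto
    have e1: "multi_sum m c k n = multi_sum m (e_coeff m a) k n" if "2 \<le> k" for k
    proof (rule multi_sum_cong)
      fix \<xi> i assume \<xi>: "\<xi> \<in> multi_indices m k n" "\<xi> i \<noteq> 0"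
      then have "i < n" "i \<in> {1..m-1}"
        using that multi_index_small[OF \<xi>, of n] by (auto simp: multi_indices_def)
      then show "c i = e_coeff m a i" using less by auto
    qed
    have e2: "multi_sum m c k (n - r) = multi_sum m (e_coeff m a) k (n - r)" if "1 \<le> r" for k r
    proof (rule multi_sum_cong)
      fix \<xi> i assume \<xi>: "\<xi> \<in> multi_indices m k (n - r)" "\<xi> i \<noteq> 0"
      then have "i < n" "i \<in> {1..m-1}"
        using that n multi_index_small[OF \<xi>, of n] by (auto simp: multi_indices_def)
      then show "c i = e_coeff m a i" using less by auto
    qed
    have A1: "fps_cpow A (s r) $ (n - r) = (\<Sum>k=1..n-r. (s r gchoose k) * multi_sum m (e_coeff m a) k (n - r))"
      if "r \<in> {1..<n}" for r
    proof -
      have "fps_cpow A (s r) $ (n - r) = (\<Sum>k=0..n-r. (s r gchoose k) * multi_sum m c k (n - r))"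
        by (simp add: A_def fps_cpow_coeff_fps_nth)
      also have "\<dots> = (\<Sum>k=1..n-r. (s r gchoose k) * multi_sum m c k (n - r))"
        using that by (simp add: sum.atLeast_Suc_atMost[of 0] multi_sum_0)
      finally show ?thesis using that by (simp add: e2)
    qed
    have "fps_cpow A (s 0) $ n = (\<Sum>k=0..n. (s 0 gchoose k) * multi_sum m c k n)"
      by (simp add: A_def fps_cpow_coeff_fps_nth)
    also have "\<dots> = s 0 * c n + (\<Sum>k=2..n. (s 0 gchoose k) * multi_sum m c k n)"
      using n multi_sum_1[of m c n]
      by (simp add: sum.atLeast_Suc_atMost[of 0] sum.atLeast_Suc_atMost[of "Suc 0"] multi_sum_0 numeral_2_eq_2)
    finally have A0: "fps_cpow A (s 0) $ n = s 0 * c n + (\<Sum>k=2..n. (s 0 gchoose k) * multi_sum m (e_coeff m a) k n)"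
      by (simp add: e1)
    \<comment> \<open>In the \<open>n\<close>-th relation \<open>c n\<close> occurs only in the
      summand \<open>r = 0\<close>, and there only for \<open>k = 1\<close>; the summand
      \<open>r = n\<close> is \<open>q n\<close>. All other values of \<open>c\<close> have a
      smaller index.\<close>
    have "{..n} = insert 0 (insert n {1..<n})" using n by auto
    then have "(\<Sum>r\<le>n. q r * fps_cpow A (s r) $ (n - r))
        = fps_cpow A (s 0) $ n + q n + (\<Sum>r=1..<n. q r * fps_cpow A (s r) $ (n - r))"
      using n by (simp add: q0 fps_cpow_nth_0)
    also have "\<dots> = s 0 * c n + (q n + (\<Sum>k=2..n. (s 0 gchoose k) * multi_sum m (e_coeff m a) k n)
        + (\<Sum>r=1..<n. q r * (\<Sum>k=1..n-r. (s r gchoose k) * multi_sum m (e_coeff m a) k (n - r))))"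
      by (simp add: A0 A1)
    also have "(\<Sum>r\<le>n. q r * fps_cpow A (s r) $ (n - r)) = 0"
      using Q[of n] less.prems n by simp
    finally have "s 0 * c n = - (q n + (\<Sum>k=2..n. (s 0 gchoose k) * multi_sum m (e_coeff m a) k n)
        + (\<Sum>r=1..<n. q r * (\<Sum>k=1..n-r. (s r gchoose k) * multi_sum m (e_coeff m a) k (n - r))))"
      by (simp only: eq_neg_iff_add_eq_0)
    also have "\<dots> = s 0 * e_coeff m a n"
    proof -
      have "s 0 * (- of_real (2 * real m / (real m + 2))) = -1"
        using rho_inverse[of "real m"] m unfolding s0
        by (simp only: mult_minus_right of_real_mult[symmetric]) simp
      then have *: "s 0 * (- of_real (2 * real m / (real m + 2)) * z) = - z" for z
        by (simp only: mult.assoc[symmetric]) simp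
      show ?thesis
        unfolding e_coeff_rec[of m a n] * by (simp add: s_def q_def of_real_gbinomial)
    qed
    finally show ?case
      using nz[of 0] unfolding s_def mult_cancel_left of_real_eq_0_iff by blast
  qed
qed

lemma recovered_coeff_eq:
  assumes m: "3 \<le> m" and j: "j \<le> m - 1" "real j \<le> (real m + 1) / 2"
    and c: "\<And>k. 1 \<le> k \<Longrightarrow> k \<le> j \<Longrightarrow> c k = e_coeff m a k"
    and K: "\<And>k. 1 \<le> k \<Longrightarrow> k \<le> j \<Longrightarrow> K_int m k 1 \<noteq> 0"
    and k: "1 \<le> k" "k \<le> j"
  shows "a k = recovered_coeff m c k"
  using k
proof (induction k rule: less_induct)
  case (less k)
  define a' where "a' = (\<lambda>i. if i < k then recovered_coeff m c i else 0)"
  have a': "a' i = (if i = 0 then a' 0 else a i)" if "i < k" for i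
    using that less by (auto simp: a'_def)
  have supp: "multi_sum m (\<lambda>i. if i = 0 then z else v i) n s = multi_sum m v n s" for z v n s
    by (rule multi_sum_cong) (auto simp: multi_indices_def)
  \<comment> \<open>Below \<open>k\<close> the sequences \<open>a'\<close> and \<open>a\<close>
    agree except possibly at 0. Multi-indices vanish at 0, so \<open>a''\<close>, which takes that
    value from \<open>a'\<close>, has the same coefficients as \<open>a\<close>.\<close>
  define a'' where "a'' = (\<lambda>i. if i = 0 then a' 0 else a i)"
  have b'': "b_coeff m a'' r l = b_coeff m a r l" for r l
    by (simp add: b_coeff_def a''_def supp)
  then have d'': "d_coeff m a'' r = d_coeff m a r" for r
    by (simp add: d_coeff_def K_coeff_def)
  have a'_less: "a' i = a'' i" if "i < k" for i using a'[OF that] by (simp add: a''_def)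
  have d: "d_coeff m a' r = d_coeff m a r" if "r < k" for r
    using d_coeff_cong[of r a' a'' m] a'_less that by (simp add: d'')
  have b: "b_coeff m a' k l = b_coeff m a k l" if "2 \<le> l" for l
    using b_coeff_cong_strict[of k a' a'' l m] a'_less that by (simp add: b'')
  note d0 = d_coeff_0_nonzero(2)[OF m, of a]
  have mc: "multi_sum m c l s = multi_sum m (e_coeff m a) l s" if "s < k \<or> (s = k \<and> 2 \<le> l)" for l s
  proof (rule multi_sum_cong)
    fix \<xi> i assume \<xi>: "\<xi> \<in> multi_indices m l s" "\<xi> i \<noteq> 0"
    then have "i < k" "i \<in> {1..m-1}"
      using that multi_index_small[OF \<xi>, of k] by (auto simp: multi_indices_def)
    then show "c i = e_coeff m a i" using less c by auto
  qed
  have "ratio_from_expansion m c a' k = d_coeff m a k / d_coeff m a 0"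
  proof -
    have "- of_real ((real m + 2) / (2 * real m)) * (- of_real (2 * real m / (real m + 2)) * z) = z" for z :: complex
    proof -
      have "- ((real m + 2) / (2 * real m)) * - (2 * real m / (real m + 2)) = 1"
        using rho_inverse[of "real m"] m by (simp only: minus_mult_minus)
      then show ?thesis
        by (simp only: mult.assoc[symmetric] of_real_minus[symmetric] of_real_mult[symmetric]) simp
    qed
    then have "- of_real ((real m + 2) / (2 * real m)) * c k = d_coeff m a k / d_coeff m a 0
      + (\<Sum>k'=2..k. of_real ((1/2 + 1 / real m) gchoose k') * multi_sum m (e_coeff m a) k' k)
      + (\<Sum>r=1..<k. d_coeff m a r / d_coeff m a 0 *
           (\<Sum>l=1..k-r. of_real ((1/2 + (1 - real r) / real m) gchoose l)
              * multi_sum m (e_coeff m a) l (k - r)))"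
      using c[of k] less.prems e_coeff_rec[of m a k] by simp
    then show ?thesis
      unfolding ratio_from_expansion_def using less.prems by (simp add: d mc)
  qed
  \<comment> \<open>From \<open>k \<le> (m + 1) / 2\<close> the angle lies below
    \<open>pi / 2\<close>, so the cosine may be divided out.\<close>
  moreover have "cos ((real k - 1) * pi / real m) > 0"
  proof (rule cos_gt_zero_pi)
    have "(real k - 1) * pi \<ge> 0" using less.prems by simp
    then show "- (pi / 2) < (real k - 1) * pi / real m"
      using m pi_gt_zero divide_nonneg_nonneg[of "(real k - 1) * pi" "real m"] by linarith
    have "real k \<le> real j" using less.prems by simp
    then have "(real k - 1) * 2 < real m" using j by (simp add: field_simps)
    then have "(real k - 1) * 2 * pi < real m * pi" by simp
    then show "(real k - 1) * pi / real m < pi / 2" using m by (simp add: field_simps)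
  qed
  moreover have "d_coeff m a k = of_real (cos ((real k - 1) * pi / real m)) * (\<Sum>l=1..k. b_coeff m a k l * of_real (K_int m k l))"
    using less.prems by (simp add: d_coeff_def K_coeff_def)
  moreover have "(\<Sum>l=1..k. b_coeff m a k l * of_real (K_int m k l)) =
     a k / 2 * of_real (K_int m k 1) + (\<Sum>l=2..k. b_coeff m a k l * of_real (K_int m k l))"
    using less.prems j multi_sum_1[of m a k]
    by (simp add: sum.atLeast_Suc_atMost[of "Suc 0"] b_coeff_def numeral_2_eq_2)
  moreover have "(\<Sum>l=2..k. b_coeff m a' k l * of_real (K_int m k l)) = (\<Sum>l=2..k. b_coeff m a k l * of_real (K_int m k l))"
    by (simp add: b)
  ultimately show ?case
    unfolding recovered_coeff.simps[of m c k] Let_def a'_def[symmetric]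
    using d0 d[of 0] K[of k] less.prems by simp
qed

section \<open>Logarithmic derivatives of entire functions of order less than one\<close>

text \<open>The exponent is 0 where \<open>g\<close> does not vanish; the nonzero value at
  \<open>w\<close> excludes a zero of infinite order.\<close>

lemma entire_factor_zero:
  assumes g: "g holomorphic_on UNIV" and nz: "g w \<noteq> 0"
  obtains n h where "h holomorphic_on UNIV" "h \<zeta> \<noteq> 0" "\<And>z. g z = (z - \<zeta>) ^ n * h z"
proof (cases "g \<zeta> = 0")
  case False
  then show ?thesis using that[of g 0] g by simp
next
  case True
  then have "\<not> g constant_on UNIV" using nz unfolding constant_on_def by (metis UNIV_I)
  then obtain k r n where k: "0 < n" "0 < r" "k holomorphic_on ball \<zeta> r"
    "\<And>w. w \<in> ball \<zeta> r \<Longrightarrow> g w = (w - \<zeta>) ^ n * k w" "\<And>w. w \<in> ball \<zeta> r \<Longrightarrow> k w \<noteq> 0"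
    using holomorphic_factor_zero_nonconstant[OF g open_UNIV connected_UNIV UNIV_I True] by metis
  define h where "h = (\<lambda>z. if z = \<zeta> then k \<zeta> else g z / (z - \<zeta>) ^ n)"
  have hk: "h z = k z" if "z \<in> ball \<zeta> r" for z using k(4)[OF that] by (simp add: h_def)
  have "h holomorphic_on ball \<zeta> r"
    using k(3) by (rule holomorphic_transform) (simp add: hk)
  moreover have "h holomorphic_on (UNIV - {\<zeta>})"
  proof (rule holomorphic_transform[of "\<lambda>z. g z / (z - \<zeta>) ^ n"])
    show "(\<lambda>z. g z / (z - \<zeta>) ^ n) holomorphic_on UNIV - {\<zeta>}"
      by (intro holomorphic_intros holomorphic_on_subset[OF g]) auto
  qed (simp add: h_def)
  ultimately have "h holomorphic_on (ball \<zeta> r \<union> (UNIV - {\<zeta>}))"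
    by (intro holomorphic_on_Un) auto
  moreover have "ball \<zeta> r \<union> (UNIV - {\<zeta>}) = UNIV" using k(2) by auto
  ultimately have "h holomorphic_on UNIV" by simp
  moreover have "g z = (z - \<zeta>) ^ n * h z" for z
    using k(1) True by (auto simp: h_def)
  moreover have "h \<zeta> \<noteq> 0" using k(2,5) by (simp add: h_def)
  ultimately show ?thesis using that by blast
qed

text \<open>Zeros are divided out one at a time. The nonvanishing cofactor shows that each exponent
  is the order of \<open>D\<close> itself, which is the multiplicity that the numbering
  counts.\<close>

lemma entire_factor_zeros:
  assumes D: "D holomorphic_on UNIV" and nz: "D w \<noteq> 0" and Z: "finite Z"
  obtains g where "g holomorphic_on UNIV" "\<And>\<zeta>. \<zeta> \<in> Z \<Longrightarrow> g \<zeta> \<noteq> 0"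
    "\<And>z. D z = (\<Prod>\<zeta>\<in>Z. (z - \<zeta>) ^ nat (zorder D \<zeta>)) * g z"
proof -
  have "\<exists>g. g holomorphic_on UNIV \<and> (\<forall>\<zeta>\<in>Z. g \<zeta> \<noteq> 0) \<and> (\<forall>z. D z = (\<Prod>\<zeta>\<in>Z. (z - \<zeta>) ^ nat (zorder D \<zeta>)) * g z)"
    using Z
  proof (induction Z)
    case empty
    then show ?case using D by auto
  next
    case (insert x Z)
    then obtain g where g: "g holomorphic_on UNIV" "\<forall>\<zeta>\<in>Z. g \<zeta> \<noteq> 0"
      "\<And>z. D z = (\<Prod>\<zeta>\<in>Z. (z - \<zeta>) ^ nat (zorder D \<zeta>)) * g z" by blast
    have "g w \<noteq> 0" using nz g(3)[of w] by auto
    with entire_factor_zero[OF g(1), of w x] obtain n h where h: "h holomorphic_on UNIV" "h x \<noteq> 0"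
      "\<And>z. g z = (z - x) ^ n * h z" by metis
    let ?p = "\<lambda>z. \<Prod>\<zeta>\<in>Z. (z - \<zeta>) ^ nat (zorder D \<zeta>)"
    have "zorder D x = int n"
    proof (rule zorder_eqI[of UNIV x "\<lambda>z. ?p z * h z"])
      show "(\<lambda>z. ?p z * h z) holomorphic_on UNIV" by (intro holomorphic_intros h)
      show "?p x * h x \<noteq> 0" using h(2) insert.hyps by auto
      show "D z = ?p z * h z * (z - x) powi int n" if "z \<in> UNIV" "z \<noteq> x" for z
        using g(3)[of z] h(3)[of z] by (simp add: mult_ac)
    qed auto
    then have "D z = (\<Prod>\<zeta>\<in>insert x Z. (z - \<zeta>) ^ nat (zorder D \<zeta>)) * h z" for z
      using g(3)[of z] h(3)[of z] insert.hyps by (simp add: mult_ac)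
    moreover have "h \<zeta> \<noteq> 0" if "\<zeta> \<in> insert x Z" for \<zeta>
    proof (cases "\<zeta> = x")
      case False
      then have "g \<zeta> \<noteq> 0" using that g(2) by auto
      then show ?thesis using h(3)[of \<zeta>] by auto
    qed (use h in auto)
    ultimately show ?case using h(1) by blast
  qed
  then show ?thesis using that by blast
qed

lemma prod_powers_has_field_derivative:
  fixes l :: complex
  assumes "finite Z" "l \<notin> Z"
  shows "((\<lambda>z. \<Prod>\<zeta>\<in>Z. (z - \<zeta>) ^ n \<zeta>) has_field_derivative
          (\<Prod>\<zeta>\<in>Z. (l - \<zeta>) ^ n \<zeta>) * (\<Sum>\<zeta>\<in>Z. of_nat (n \<zeta>) / (l - \<zeta>))) (at l)"
  using assms
proof (induction Z)
  case (insert x Z)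
  have lx: "l \<noteq> x" using insert by auto
  have "((\<lambda>z. (z - x) ^ n x) has_field_derivative (l - x) ^ n x * (of_nat (n x) / (l - x))) (at l)"
  proof -
    have "(l - x) ^ n x * (of_nat (n x) / (l - x)) = of_nat (n x) * (l - x) ^ (n x - 1)"
      using lx by (cases "n x") auto
    then show ?thesis by (auto intro!: derivative_eq_intros)
  qed
  from DERIV_mult[OF this insert.IH] insert
  show ?case by (simp add: algebra_simps)
qed auto

text \<open>Borel-Caratheodory: the Moebius map \<open>u / (2 * M - u)\<close> takes the half plane
  \<open>Re u < M\<close> into the unit disc. Cauchy's estimate on half the radius bounds the
  derivative of \<open>\<psi>\<close> at \<open>l\<close>, which is
  \<open>deriv k l / (2 * M)\<close>.\<close>

lemma deriv_bound_of_Re_bound: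
  fixes k :: "complex \<Rightarrow> complex"
  assumes k: "k holomorphic_on ball l r" and r: "0 < r" and M: "0 < M"
    and Re: "\<And>z. z \<in> ball l r \<Longrightarrow> Re (k z - k l) < M"
  shows "norm (deriv k l) \<le> 4 * M / r"
proof -
  define u where "u = (\<lambda>z. k z - k l)"
  define \<psi> where "\<psi> = (\<lambda>z. u z / (of_real (2 * M) - u z))"
  have u: "u holomorphic_on ball l r" unfolding u_def by (intro holomorphic_intros k)
  have ne: "of_real (2 * M) - u z \<noteq> 0" if "z \<in> ball l r" for z
    using Re[OF that] M by (auto simp: u_def complex_eq_iff)
  have \<psi>: "\<psi> holomorphic_on ball l r" unfolding \<psi>_def using ne by (intro holomorphic_intros u) auto
  have lt: "norm (\<psi> z) < 1" if "z \<in> ball l r" for z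
  proof -
    have "Re (u z) < M" using Re[OF that] by (simp add: u_def)
    then have "0 < 4 * M * (M - Re (u z))" using M by simp
    also have "\<dots> = norm (of_real (2 * M) - u z) ^ 2 - norm (u z) ^ 2"
      unfolding cmod_power2 by (simp add: power2_eq_square algebra_simps)
    finally have "norm (u z) ^ 2 < norm (of_real (2 * M) - u z) ^ 2" by simp
    then have "norm (u z) < norm (of_real (2 * M) - u z)" by (rule power_less_imp_less_base) simp
    then show ?thesis using ne[OF that] by (simp add: \<psi>_def norm_divide)
  qed
  have "norm ((deriv ^^ 1) \<psi> l) \<le> fact 1 * 1 / (r / 2) ^ 1"
  proof (rule Cauchy_higher_deriv_bound[where y = 0])
    show "\<psi> holomorphic_on ball l (r/2)" by (rule holomorphic_on_subset[OF \<psi>]) (use r in auto)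
    show "continuous_on (cball l (r/2)) \<psi>"
      by (rule holomorphic_on_imp_continuous_on[OF holomorphic_on_subset[OF \<psi>]]) (use r in auto)
    show "\<psi> w \<in> ball 0 1" if "w \<in> ball l (r/2)" for w
      using lt[of w] that r by auto
  qed (use r in auto)
  then have d: "norm (deriv \<psi> l) \<le> 2 / r" by simp
  have kd: "(k has_field_derivative deriv k l) (at l)"
    using k r by (intro holomorphic_derivI[of _ "ball l r"]) auto
  have "(\<psi> has_field_derivative deriv k l / of_real (2 * M)) (at l)"
    unfolding \<psi>_def u_def using M
    by (auto intro!: derivative_eq_intros kd simp: power2_eq_square)
  then have "deriv \<psi> l = deriv k l / of_real (2 * M)" by (rule DERIV_imp_deriv)
  with d M r show ?thesis by (simp add: norm_divide field_simps)
qed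

text \<open>Dividing out the factors \<open>(z - \<zeta>)/(l - \<zeta>)\<close> only decreases the modulus on the circle of radius \<open>R\<close>.\<close>

lemma log_deriv_minus_zeros_bound:
  assumes D: "D holomorphic_on UNIV" and nz: "D l \<noteq> 0" and R: "0 < R"
    and bd: "\<And>z. z \<in> cball l R \<Longrightarrow> norm (D z) \<le> exp M"
  shows "finite {\<zeta>. D \<zeta> = 0 \<and> dist l \<zeta> < R / 2}"
    and "norm (deriv D l / D l - (\<Sum>\<zeta> | D \<zeta> = 0 \<and> dist l \<zeta> < R / 2. of_nat (nat (zorder D \<zeta>)) / (l - \<zeta>)))
         \<le> 8 * (M - ln (norm (D l)) + 1) / R"
proof -
  define Z where "Z = {\<zeta>. D \<zeta> = 0 \<and> dist l \<zeta> < R / 2}"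
  have "finite Z"
  proof (cases "D constant_on UNIV")
    case True
    then have "Z = {}" using nz unfolding constant_on_def Z_def by (metis (mono_tags, lifting) UNIV_I Collect_empty_eq)
    then show ?thesis by simp
  next
    case False
    have "finite {z \<in> cball l (R/2). D z = 0}"
      using holomorphic_compact_finite_zeros[OF D open_UNIV connected_UNIV compact_cball[of l "R/2"] _ False]
      by (simp add: Int_def)
    then show ?thesis by (rule rev_finite_subset) (auto simp: Z_def)
  qed
  then show "finite {\<zeta>. D \<zeta> = 0 \<and> dist l \<zeta> < R / 2}" by (simp add: Z_def)
  from entire_factor_zeros[OF D nz \<open>finite Z\<close>] obtain g where g: "g holomorphic_on UNIV"
    "\<And>\<zeta>. \<zeta> \<in> Z \<Longrightarrow> g \<zeta> \<noteq> 0" "\<And>z. D z = (\<Prod>\<zeta>\<in>Z. (z - \<zeta>) ^ nat (zorder D \<zeta>)) * g z"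
    by metis
  define p where "p = (\<lambda>z. \<Prod>\<zeta>\<in>Z. (z - \<zeta>) ^ nat (zorder D \<zeta>))"
  have lZ: "l \<notin> Z" using nz by (auto simp: Z_def)
  have pg: "D z = p z * g z" for z using g(3) by (simp add: p_def)
  have pl: "p l \<noteq> 0" and gl: "g l \<noteq> 0" using nz pg[of l] by auto
  have gz: "g z \<noteq> 0" if "dist l z < R/2" for z
    using that g(2)[of z] pg[of z] by (cases "z \<in> Z") (auto simp: Z_def)
  have p_ge: "norm (p l) \<le> norm (p z)" if "dist l z = R" for z
    unfolding p_def prod_norm[symmetric] norm_power
  proof (intro prod_mono conjI power_mono)
    fix \<zeta> assume "\<zeta> \<in> Z"
    then have "dist l \<zeta> < R/2" by (simp add: Z_def)
    moreover have "dist l z \<le> dist l \<zeta> + dist z \<zeta>" by (rule dist_triangle2)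
    ultimately show "norm (l - \<zeta>) \<le> norm (z - \<zeta>)" using that by (simp add: dist_norm)
  qed auto
  \<comment> \<open>On the circle \<open>|g| = |D| / |p|\<close> with
    \<open>|p| \<ge> |p l|\<close>; the maximum principle extends the bound to the disc.\<close>
  have g_le: "norm (g z) \<le> exp M / norm (p l)" if "z \<in> cball l R" for z
  proof (rule maximum_modulus_frontier[of g "cball l R"])
    show "g holomorphic_on interior (cball l R)" by (rule holomorphic_on_subset[OF g(1)]) auto
    show "continuous_on (closure (cball l R)) g"
      by (rule holomorphic_on_imp_continuous_on[OF holomorphic_on_subset[OF g(1)]]) auto
    fix z assume "z \<in> frontier (cball l R)"
    then have z: "dist l z = R" using R by auto
    have "norm (p l) * norm (g z) \<le> norm (p z) * norm (g z)"
      using p_ge[OF z] by (rule mult_right_mono) simp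
    also have "\<dots> = norm (D z)" by (simp add: pg norm_mult)
    also have "\<dots> \<le> exp M" using z by (intro bd) auto
    finally show "norm (g z) \<le> exp M / norm (p l)" using pl by (simp add: field_simps)
  qed (use that in auto)
  \<comment> \<open>On the disc of radius \<open>R / 2\<close> all zeros have been removed, so
    \<open>g\<close> has a logarithm \<open>k\<close> there, and the bound on \<open>|g|\<close>
    becomes a one-sided bound on \<open>Re (k z - k l)\<close>.\<close>
  obtain k where k: "k holomorphic_on ball l (R/2)" "\<And>z. z \<in> ball l (R/2) \<Longrightarrow> g z = exp (k z)"
    using contractible_imp_holomorphic_log[of g "ball l (R/2)"] g(1) gz
    by (metis UNIV_I convex_ball convex_imp_contractible holomorphic_on_subset mem_ball subsetI)
  \<comment> \<open>The summand 1 makes \<open>M1\<close> positive and the bound on the real part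
    strict.\<close>
  define M1 where "M1 = M - ln (norm (D l)) + 1"
  have "norm (D l) \<le> exp M" using R by (intro bd) auto
  then have "ln (norm (D l)) \<le> ln (exp M)" using nz by (subst ln_le_cancel_iff) auto
  then have M1: "M1 > 0" by (simp add: M1_def)
  have "norm (deriv k l) \<le> 4 * M1 / (R/2)"
  proof (rule deriv_bound_of_Re_bound[OF k(1) _ M1])
    fix z assume z: "z \<in> ball l (R/2)"
    have "exp (Re (k z - k l)) = norm (g z) / norm (g l)"
      using k(2)[OF z] k(2)[of l] R by (simp add: exp_diff norm_divide[symmetric] flip: norm_exp_eq_Re)
    also have "\<dots> \<le> exp M / norm (p l) / norm (g l)"
      using g_le[of z] z R gl by (intro divide_right_mono) auto
    also have "\<dots> = exp (M - ln (norm (D l)))"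
      using nz pl gl by (simp add: exp_diff pg norm_mult)
    finally show "Re (k z - k l) < M1" by (simp add: M1_def)
  qed (use R in auto)
  moreover have "deriv D l / D l = (\<Sum>\<zeta>\<in>Z. of_nat (nat (zorder D \<zeta>)) / (l - \<zeta>)) + deriv k l"
  proof -
    have kd: "(k has_field_derivative deriv k l) (at l)"
      using k(1) R by (intro holomorphic_derivI[of _ "ball l (R/2)"]) auto
    have "((\<lambda>z. exp (k z)) has_field_derivative exp (k l) * deriv k l) (at l)"
      by (auto intro!: derivative_eq_intros kd)
    then have "(g has_field_derivative exp (k l) * deriv k l) (at l)"
      by (rule has_field_derivative_transform_within_open[of _ _ _ "ball l (R/2)"]) (use R k(2) in auto)
    moreover have "exp (k l) = g l" using k(2)[of l] R by simp
    ultimately have "(g has_field_derivative g l * deriv k l) (at l)" by simp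
    moreover have "(p has_field_derivative p l * (\<Sum>\<zeta>\<in>Z. of_nat (nat (zorder D \<zeta>)) / (l - \<zeta>))) (at l)"
      unfolding p_def by (rule prod_powers_has_field_derivative[OF \<open>finite Z\<close> lZ])
    moreover have "D = (\<lambda>z. p z * g z)" using pg by auto
    ultimately have "(D has_field_derivative p l * (\<Sum>\<zeta>\<in>Z. of_nat (nat (zorder D \<zeta>)) / (l - \<zeta>)) * g l + g l * deriv k l * p l) (at l)"
      using DERIV_mult by blast
    then have "deriv D l = p l * (\<Sum>\<zeta>\<in>Z. of_nat (nat (zorder D \<zeta>)) / (l - \<zeta>)) * g l + g l * deriv k l * p l"
      by (rule DERIV_imp_deriv)
    then show ?thesis using pl gl by (simp add: pg field_simps)
  qed
  ultimately show "norm (deriv D l / D l - (\<Sum>\<zeta> | D \<zeta> = 0 \<and> dist l \<zeta> < R / 2. of_nat (nat (zorder D \<zeta>)) / (l - \<zeta>)))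
         \<le> 8 * (M - ln (norm (D l)) + 1) / R"
    by (simp add: Z_def M1_def)
qed

text \<open>Growth of order \<open>\<rho> < 1\<close> makes the error of the preceding estimate of
  size \<open>R^(\<rho> - 1)\<close>, so the finite sums over the zeros in growing discs tend to the
  logarithmic derivative. Summability identifies their limit with the unordered infinite
  sum.\<close>

lemma log_deriv_eq_infsum:
  fixes E :: "int \<Rightarrow> complex"
  assumes D: "D holomorphic_on UNIV" and nz: "D l \<noteq> 0"
    and growth: "\<And>z. norm (D z) \<le> exp (C * (1 + norm z) powr \<rho>)" and \<rho>: "0 < \<rho>" "\<rho> < 1"
    and zeros: "\<And>x. D x = 0 \<longleftrightarrow> (\<exists>n\<ge>n0. - E n = x)"
    and mult: "\<And>x. D x = 0 \<Longrightarrow> finite {n. n \<ge> n0 \<and> - E n = x} \<and> card {n. n \<ge> n0 \<and> - E n = x} = nat (zorder D x)"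
    and summ: "(\<lambda>n. 1 / (l + E n)) summable_on {n0..}"
  shows "deriv D l / D l = (\<Sum>\<^sub>\<infinity>n\<in>{n0..}. 1 / (l + E n))"
proof (rule tendsto_unique[OF trivial_limit_at_top_linorder])
  \<comment> \<open>Indices are collected rather than zeros, so that repetitions in the numbering
    account for multiplicities.\<close>
  define A where "A = (\<lambda>R. {n. n \<ge> n0 \<and> dist l (- E n) < R / 2})"
  define Z where "Z = (\<lambda>R. {\<zeta>. D \<zeta> = 0 \<and> dist l \<zeta> < R / 2})"
  define S where "S = (\<lambda>R. \<Sum>n\<in>A R. 1 / (l + E n))"
  define M where "M = (\<lambda>R. \<bar>C\<bar> * (1 + norm l + R) powr \<rho>)"
  have bd: "norm (D z) \<le> exp (M R)" if "z \<in> cball l R" for z R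
  proof -
    have "norm z \<le> norm l + R" using that norm_triangle_ineq2[of z l] by (simp add: dist_norm norm_minus_commute)
    then have "C * (1 + norm z) powr \<rho> \<le> M R"
      unfolding M_def using \<rho> by (intro mult_mono powr_mono2) auto
    then show ?thesis using growth[of z] by (meson exp_le_cancel_iff order_trans)
  qed
  have Z: "finite (Z R)" if "R > 0" for R
    using log_deriv_minus_zeros_bound(1)[OF D nz that bd] by (simp add: Z_def)
  have AZ: "(\<lambda>n. - E n) ` A R = Z R" for R
    using zeros by (auto simp: A_def Z_def)
  have A_Un: "A R = (\<Union>x\<in>Z R. {n. n \<ge> n0 \<and> - E n = x})" for R
    using zeros by (auto simp: A_def Z_def)
  have finA: "finite (A R)" if "R > 0" for R
    unfolding A_Un using Z[OF that] mult by (intro finite_UN_I) (auto simp: Z_def)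
  have S_eq: "S R = (\<Sum>\<zeta>\<in>Z R. of_nat (nat (zorder D \<zeta>)) / (l - \<zeta>))" if "R > 0" for R
  proof -
    have "S R = (\<Sum>\<zeta>\<in>Z R. \<Sum>n | n \<in> A R \<and> - E n = \<zeta>. 1 / (l + E n))"
      unfolding S_def AZ[symmetric] by (rule sum.image_gen[OF finA[OF that]])
    also have "\<dots> = (\<Sum>\<zeta>\<in>Z R. of_nat (nat (zorder D \<zeta>)) / (l - \<zeta>))"
    proof (rule sum.cong[OF refl])
      fix \<zeta> assume \<zeta>: "\<zeta> \<in> Z R"
      have eq: "{n. n \<in> A R \<and> - E n = \<zeta>} = {n. n \<ge> n0 \<and> - E n = \<zeta>}"
        using \<zeta> by (auto simp: A_def Z_def)
      have "(\<Sum>n | n \<in> A R \<and> - E n = \<zeta>. 1 / (l + E n)) = (\<Sum>n | n \<in> A R \<and> - E n = \<zeta>. 1 / (l - \<zeta>))"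
        by (intro sum.cong) auto
      also have "\<dots> = of_nat (nat (zorder D \<zeta>)) / (l - \<zeta>)"
        using mult[of \<zeta>] \<zeta> unfolding eq by (simp add: Z_def)
      finally show "(\<Sum>n | n \<in> A R \<and> - E n = \<zeta>. 1 / (l + E n)) = of_nat (nat (zorder D \<zeta>)) / (l - \<zeta>)" .
    qed
    finally show ?thesis .
  qed
  show "(S \<longlongrightarrow> deriv D l / D l) at_top"
  proof (rule Lim_transform2[OF tendsto_const])
    show "((\<lambda>R. deriv D l / D l - S R) \<longlongrightarrow> 0) at_top"
    proof (rule Lim_null_comparison)
      show "eventually (\<lambda>R. norm (deriv D l / D l - S R) \<le> 8 * (M R - ln (norm (D l)) + 1) / R) at_top"
        using eventually_gt_at_top[of 0]
      proof eventually_elim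
        case (elim R)
        show ?case using log_deriv_minus_zeros_bound(2)[OF D nz elim bd, of R] S_eq[OF elim] by (simp add: Z_def)
      qed
      show "((\<lambda>R. 8 * (M R - ln (norm (D l)) + 1) / R) \<longlongrightarrow> 0) at_top"
        unfolding M_def using \<rho> by real_asymp
    qed
  qed
  have "((\<lambda>n. 1 / (l + E n)) has_sum (\<Sum>\<^sub>\<infinity>n\<in>{n0..}. 1 / (l + E n))) {n0..}"
    using summ by (rule has_sum_infsum)
  then have lim: "(sum (\<lambda>n. 1 / (l + E n)) \<longlongrightarrow> (\<Sum>\<^sub>\<infinity>n\<in>{n0..}. 1 / (l + E n))) (finite_subsets_at_top {n0..})"
    by (simp add: has_sum_def)
  \<comment> \<open>The sets \<open>A R\<close> eventually contain every given finite set of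
    indices, so the sums over them follow the net of finite partial sums.\<close>
  have "filterlim A (finite_subsets_at_top {n0..}) at_top"
    unfolding filterlim_iff
  proof (intro allI impI)
    fix P assume "eventually P (finite_subsets_at_top {n0..})"
    then obtain F where F: "finite F" "F \<subseteq> {n0..}"
      "\<And>Y. finite Y \<Longrightarrow> F \<subseteq> Y \<Longrightarrow> Y \<subseteq> {n0..} \<Longrightarrow> P Y"
      unfolding eventually_finite_subsets_at_top by metis
    have "eventually (\<lambda>R. \<forall>n\<in>F. dist l (- E n) < R / 2) at_top"
    proof (rule eventually_ball_finite[OF F(1)], rule ballI)
      fix n assume "n \<in> F"
      show "eventually (\<lambda>R. dist l (- E n) < R / 2) at_top"
        using eventually_gt_at_top[of "2 * dist l (- E n)"] by eventually_elim simp
    qed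
    then show "eventually (\<lambda>R. P (A R)) at_top"
      using eventually_gt_at_top[of 0]
    proof eventually_elim
      case (elim R)
      show ?case by (rule F(3)[OF finA[OF elim(2)]]) (use elim F(2) in \<open>auto simp: A_def\<close>)
    qed
  qed
  from filterlim_compose[OF lim this]
  show "(S \<longlongrightarrow> (\<Sum>\<^sub>\<infinity>n\<in>{n0..}. 1 / (l + E n))) at_top"
    by (simp add: S_def o_def)
qed

section \<open>Decaying solutions of linear second-order equations\<close>

text \<open>The mean value inequality for vector-valued functions, obtained by projecting onto the
  direction of \<open>f b - f a\<close>.\<close>

lemma norm_diff_le_of_deriv_le:
  fixes f :: "real \<Rightarrow> 'a::real_inner"
  assumes ab: "a \<le> b"
    and f: "\<And>x. a \<le> x \<Longrightarrow> x \<le> b \<Longrightarrow> (f has_vector_derivative f' x) (at x)"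
    and g: "\<And>x. a \<le> x \<Longrightarrow> x \<le> b \<Longrightarrow> (g has_real_derivative g' x) (at x)"
    and le: "\<And>x. a \<le> x \<Longrightarrow> x \<le> b \<Longrightarrow> norm (f' x) \<le> g' x"
  shows "norm (f b - f a) \<le> g b - g a"
proof (cases "f b = f a")
  case True
  have "g a \<le> g b"
    by (rule DERIV_nonneg_imp_nondecreasing[OF ab]) (meson g le norm_ge_zero order_trans)
  then show ?thesis using True by simp
next
  case False
  define u where "u = (f b - f a) /\<^sub>R norm (f b - f a)"
  have u: "norm u = 1" using False by (simp add: u_def)
  have d: "((\<lambda>x. g x - inner u (f x)) has_real_derivative g' x - inner u (f' x)) (at x)" if "a \<le> x" "x \<le> b" for x
    using bounded_linear.has_vector_derivative[OF bounded_linear_inner_right f[OF that], of u] g[OF that]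
    by (intro DERIV_diff) (simp_all add: has_real_derivative_iff_has_vector_derivative)
  have "g a - inner u (f a) \<le> g b - inner u (f b)"
  proof (rule DERIV_nonneg_imp_nondecreasing[OF ab])
    fix x assume x: "a \<le> x" "x \<le> b"
    have "inner u (f' x) \<le> norm u * norm (f' x)" by (rule norm_cauchy_schwarz)
    then have "g' x - inner u (f' x) \<ge> 0" using le[OF x] u by simp
    then show "\<exists>y. ((\<lambda>x. g x - inner u (f x)) has_real_derivative y) (at x) \<and> 0 \<le> y"
      using d[OF x] by blast
  qed
  moreover have "inner u (f b) - inner u (f a) = norm (f b - f a)"
  proof -
    have "inner u (f b) - inner u (f a) = inner u (f b - f a)" by (simp add: inner_diff_right)
    also have "\<dots> = (norm (f b - f a))\<^sup>2 / norm (f b - f a)"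
      unfolding u_def inner_scaleR_left power2_norm_eq_inner by (simp add: divide_inverse_commute)
    finally have "inner u (f b) - inner u (f a) = (norm (f b - f a))\<^sup>2 / norm (f b - f a)" .
    then show ?thesis using False by (simp add: power2_eq_square)
  qed
  ultimately show ?thesis by simp
qed

lemma power_times_exp_neg_tendsto_0:
  "((\<lambda>x::real. (1 + x) ^ k * exp (- (x - x0) / 2)) \<longlongrightarrow> 0) at_top"
proof -
  have "filterlim (\<lambda>x::real. (1 + x) / 2) at_top at_top" by real_asymp
  from filterlim_compose[OF tendsto_power_div_exp_0[of k] this]
  have "((\<lambda>x. 2 ^ k * exp ((1 + x0) / 2) * (((1 + x) / 2) ^ k / exp ((1 + x) / 2))) \<longlongrightarrow> 2 ^ k * exp ((1 + x0) / 2) * 0) at_top"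
    by (intro tendsto_mult tendsto_const)
  moreover have "2 ^ k * exp ((1 + x0) / 2) * (((1 + x) / 2) ^ k / exp ((1 + x) / 2)) = (1 + x) ^ k * exp (- (x - x0) / 2)" for x :: real
  proof -
    have "exp ((1 + x0) / 2) / exp ((1 + x) / 2) = exp (- (x - x0) / 2)"
      by (simp add: exp_diff[symmetric] field_simps)
    then have "(1 + x) ^ k * (exp ((1 + x0) / 2) / exp ((1 + x) / 2)) = (1 + x) ^ k * exp (- (x - x0) / 2)"
      by simp
    then show ?thesis by (simp add: power_divide mult.commute)
  qed
  ultimately show ?thesis by simp
qed

text \<open>With \<open>F = |f|^2\<close> and \<open>G = F' / 2\<close> the equation gives
  \<open>G' = |f'|^2 + Re Q |f|^2 \<ge> 0\<close>. A positive value of \<open>G\<close> would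
  persist and force \<open>F\<close> to grow linearly, against the decay of \<open>f\<close>; hence
  \<open>G \<le> 0\<close>.\<close>

lemma norm_antimono_of_decaying_solution:
  fixes f f' Q :: "real \<Rightarrow> complex"
  assumes f: "\<And>x. x0 \<le> x \<Longrightarrow> (f has_vector_derivative f' x) (at x)"
    and f': "\<And>x. x0 \<le> x \<Longrightarrow> (f' has_vector_derivative Q x * f x) (at x)"
    and Q: "\<And>x. x0 \<le> x \<Longrightarrow> 0 \<le> Re (Q x)"
    and lim: "(f \<longlongrightarrow> 0) at_top"
    and xy: "x0 \<le> x" "x \<le> y"
  shows "norm (f y) \<le> norm (f x)"
proof -
  define F where "F = (\<lambda>x. inner (f x) (f x))"
  define G where "G = (\<lambda>x. inner (f x) (f' x))"
  have dF: "(F has_real_derivative 2 * G x) (at x)" if "x0 \<le> x" for x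
    using bounded_bilinear.has_vector_derivative[OF bounded_bilinear_inner f[OF that] f[OF that]]
    by (simp add: F_def G_def has_real_derivative_iff_has_vector_derivative inner_commute)
  have dG: "(G has_real_derivative (norm (f' x))\<^sup>2 + Re (Q x) * (norm (f x))\<^sup>2) (at x)" if "x0 \<le> x" for x
  proof -
    have "inner a (c * a) = Re c * (norm a)\<^sup>2" for a c :: complex
      unfolding inner_complex_def cmod_power2 times_complex.sel by (simp add: power2_eq_square algebra_simps)
    then show ?thesis
      using bounded_bilinear.has_vector_derivative[OF bounded_bilinear_inner f[OF that] f'[OF that]]
      by (simp add: G_def has_real_derivative_iff_has_vector_derivative power2_norm_eq_inner add.commute)
  qed
  have G_mono: "G a \<le> G b" if "x0 \<le> a" "a \<le> b" for a b
  proof (rule DERIV_nonneg_imp_nondecreasing[OF that(2)])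
    fix x assume "a \<le> x" "x \<le> b"
    then have "x0 \<le> x" using that by simp
    then show "\<exists>y. (G has_real_derivative y) (at x) \<and> 0 \<le> y"
      using dG[of x] Q[of x] by (intro exI[of _ "(norm (f' x))\<^sup>2 + Re (Q x) * (norm (f x))\<^sup>2"]) auto
  qed
  have F0: "(F \<longlongrightarrow> 0) at_top"
    using tendsto_inner[OF lim lim] by (simp add: F_def)
  have G_le: "G a \<le> 0" if a: "x0 \<le> a" for a
  proof (rule ccontr)
    assume "\<not> G a \<le> 0"
    then have Ga: "G a > 0" by simp
    have le: "F b \<ge> 2 * G a * (b - a)" if "a \<le> b" for b
    proof -
      have "F a - 2 * G a * a \<le> F b - 2 * G a * b"
      proof (rule DERIV_nonneg_imp_nondecreasing[OF that])
        fix x assume x: "a \<le> x" "x \<le> b"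
        show "\<exists>y. ((\<lambda>x. F x - 2 * G a * x) has_real_derivative y) (at x) \<and> 0 \<le> y"
          using G_mono[of a x] x a by (intro exI[of _ "2 * G x - 2 * G a"]) (auto intro!: derivative_eq_intros dF)
      qed
      moreover have "F a \<ge> 0" by (simp add: F_def)
      ultimately show ?thesis by (simp add: algebra_simps)
    qed
    have ev: "eventually (\<lambda>b. F b < 1) at_top" using order_tendstoD(2)[OF F0, of 1] by simp
    have "eventually (\<lambda>b. F b < 1 \<and> a \<le> b \<and> a + 1 / (2 * G a) \<le> b) at_top"
      using ev eventually_ge_at_top[of a] eventually_ge_at_top[of "a + 1 / (2 * G a)"]
      by (simp add: eventually_conj_iff)
    then obtain b where b: "F b < 1" "a \<le> b" "a + 1 / (2 * G a) \<le> b"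
      using eventually_happens'[OF trivial_limit_at_top_linorder] by blast
    have "2 * G a * (1 / (2 * G a)) \<le> 2 * G a * (b - a)"
      using Ga b(3) by (intro mult_left_mono) auto
    then show False using le[OF b(2)] b(1) Ga by simp
  qed
  have "F y \<le> F x"
  proof (rule DERIV_nonpos_imp_nonincreasing[OF xy(2)])
    fix z assume "x \<le> z" "z \<le> y"
    then have "x0 \<le> z" using xy by simp
    then show "\<exists>l. (F has_real_derivative l) (at z) \<and> l \<le> 0"
      using dF[of z] G_le[of z] by (intro exI[of _ "2 * G z"]) auto
  qed
  then show ?thesis by (simp add: F_def flip: power2_norm_eq_inner)
qed

text \<open>At a point \<open>z\<close> where \<open>|N|\<close> is maximal, integrating the bound
  gives \<open>|N z| \<le> |N x0| + \<epsilon> |N z|\<close>, hence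
  \<open>|N z| \<le> 2 |N x0|\<close> for \<open>\<epsilon> \<le> 1/2\<close>. This is the source of
  the factor 2.\<close>

lemma nearly_constant_of_deriv_bound:
  fixes N :: "real \<Rightarrow> complex"
  assumes x0: "0 \<le> x0" and X: "x0 \<le> X" and \<epsilon>: "0 \<le> \<epsilon>" "\<epsilon> \<le> 1/2"
    and N: "\<And>x. x0 \<le> x \<Longrightarrow> (N has_vector_derivative N' x) (at x)"
    and bd: "\<And>x. x0 \<le> x \<Longrightarrow> norm (N' x) \<le> norm (N x) * (\<epsilon> / (1 + x)\<^sup>2)"
  shows "norm (N X - N x0) \<le> 2 * \<epsilon> * norm (N x0)"
proof -
  have "continuous_on {x0..X} (\<lambda>x. norm (N x))"
    using N by (intro continuous_on_norm continuous_at_imp_continuous_on ballI)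
      (auto intro: has_vector_derivative_continuous)
  then obtain z where z: "z \<in> {x0..X}" "\<And>x. x \<in> {x0..X} \<Longrightarrow> norm (N x) \<le> norm (N z)"
    using continuous_attains_sup[of "{x0..X}"] X by (metis atLeastatMost_empty_iff2 compact_Icc not_less)
  have *: "norm (N y - N x0) \<le> norm (N z) * \<epsilon>" if y: "y \<in> {x0..X}" for y
  proof -
    have "norm (N y - N x0) \<le> (- (norm (N z) * \<epsilon>) / (1 + y)) - (- (norm (N z) * \<epsilon>) / (1 + x0))"
    proof (rule norm_diff_le_of_deriv_le)
      fix x assume x: "x0 \<le> x" "x \<le> y"
      show "(N has_vector_derivative N' x) (at x)" using N x by simp
      show "((\<lambda>x. - (norm (N z) * \<epsilon>) / (1 + x)) has_real_derivative norm (N z) * (\<epsilon> / (1 + x)\<^sup>2)) (at x)"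
        using x x0 by (auto intro!: derivative_eq_intros simp: power2_eq_square)
      show "norm (N' x) \<le> norm (N z) * (\<epsilon> / (1 + x)\<^sup>2)"
        using bd[OF x(1)] by (rule order_trans) (use z(2)[of x] x y \<epsilon> in \<open>intro mult_right_mono; auto\<close>)
    qed (use y in auto)
    also have "\<dots> \<le> norm (N z) * \<epsilon> / (1 + x0)" using y x0 \<epsilon> by simp
    also have "\<dots> \<le> norm (N z) * \<epsilon> / 1" using x0 \<epsilon> by (intro divide_left_mono) auto
    finally show ?thesis by simp
  qed
  have "norm (N z) \<le> norm (N z - N x0) + norm (N x0)" by (metis add.commute norm_triangle_sub)
  also have "\<dots> \<le> norm (N z) * \<epsilon> + norm (N x0)" using *[OF z(1)] by simp
  also have "\<dots> \<le> norm (N z) * (1/2) + norm (N x0)"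
    using \<epsilon> by (intro add_right_mono mult_left_mono) auto
  finally have "norm (N z) \<le> 2 * norm (N x0)" by simp
  then have "norm (N z) * \<epsilon> \<le> 2 * norm (N x0) * \<epsilon>" using \<epsilon> by (intro mult_right_mono)
  then show ?thesis using *[of X] X by (simp add: mult_ac)
qed

text \<open>The functions \<open>y = Q^(-1/4) exp S\<close> and
  \<open>y = Q^(-1/4) exp (- S)\<close> solve \<open>y'' = (Q - h) y\<close> with a small error
  \<open>h\<close>, so their Wronskians with \<open>f\<close> have derivative \<open>h y f\<close>.
  The Wronskian with the decaying function vanishes at infinity; integrated backwards it gives the
  bound on \<open>f'\<close>. The one with the growing function is then nearly constant, and it is
  about \<open>- 2 f Q^(1/4) exp S\<close>.\<close>

lemma WKB_estimate:
  fixes f f' Q Q1 Q2 S :: "real \<Rightarrow> complex" and m :: nat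
  assumes x0: "0 \<le> x0" and \<mu>: "1 \<le> \<mu>" and B: "0 \<le> B"
    and f: "\<And>x. x0 \<le> x \<Longrightarrow> (f has_vector_derivative f' x) (at x)"
    and f': "\<And>x. x0 \<le> x \<Longrightarrow> (f' has_vector_derivative Q x * f x) (at x)"
    and Q: "\<And>x. x0 \<le> x \<Longrightarrow> (Q has_vector_derivative Q1 x) (at x)"
    and Q1: "\<And>x. x0 \<le> x \<Longrightarrow> (Q1 has_vector_derivative Q2 x) (at x)"
    and near: "\<And>x. x0 \<le> x \<Longrightarrow> norm (Q x - of_real (x ^ m + \<mu>)) \<le> (x ^ m + \<mu>) / 2"
    and bd: "\<And>x. x0 \<le> x \<Longrightarrow> norm (Q2 x) / norm (Q x) + (norm (Q1 x) / norm (Q x))\<^sup>2 \<le> B / (1 + x)\<^sup>2"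
    and small: "64 * B \<le> sqrt (\<mu> / 2)"
    and lim: "(f \<longlongrightarrow> 0) at_top"
    and S: "\<And>x. x0 \<le> x \<Longrightarrow> (S has_vector_derivative csqrt (Q x)) (at x)" and S0: "S x0 = 0"
  shows "\<And>x y. x0 \<le> x \<Longrightarrow> x \<le> y \<Longrightarrow> norm (f y) \<le> norm (f x)"
    and "norm (f' x0 + (csqrt (Q x0) + Q1 x0 / (4 * Q x0)) * f x0) \<le> 2 * B * norm (f x0)"
    and "\<And>X. x0 \<le> X \<Longrightarrow> norm (f X * csqrt (csqrt (Q X)) * exp (S X) - f x0 * csqrt (csqrt (Q x0)))
           \<le> 1/8 * norm (f x0 * csqrt (csqrt (Q x0)))"
proof -
  define T where "T = (\<lambda>x. x ^ m + \<mu>)"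
  have T1: "1 \<le> T x" if "x0 \<le> x" for x using that x0 \<mu> by (simp add: T_def add_increasing)
  have T_mono: "T x \<le> T y" if "x0 \<le> x" "x \<le> y" for x y
    using that x0 by (simp add: T_def power_mono)
  have near': "norm (Q x - of_real (T x)) \<le> T x / 2" if "x0 \<le> x" for x
    using near[OF that] by (simp add: T_def)
  have ReQ: "T x / 2 \<le> Re (Q x)" if "x0 \<le> x" for x
    using near'[OF that] abs_Re_le_cmod[of "Q x - of_real (T x)"] by simp
  have Q_lo: "T x / 2 \<le> norm (Q x)" if "x0 \<le> x" for x
    using ReQ[OF that] complex_Re_le_cmod[of "Q x"] by simp
  have Q_hi: "norm (Q x) \<le> 2 * T x" if "x0 \<le> x" for x
    using near'[OF that] norm_triangle_ineq2[of "Q x" "of_real (T x)"] T1[OF that] by simp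
  have Qpos: "0 < norm (Q x)" and Q0: "Q x \<noteq> 0" if "x0 \<le> x" for x
    using Q_lo[OF that] T1[OF that] by auto
  show mono: "norm (f y) \<le> norm (f x)" if "x0 \<le> x" "x \<le> y" for x y
    by (rule norm_antimono_of_decaying_solution[OF f f' _ lim that]) (use ReQ T1 in \<open>force+\<close>)
  \<comment> \<open>The logarithmic derivative of \<open>r = Q^(1/4)\<close> is \<open>l\<close>,
    that of \<open>q = Q^(1/2)\<close> is \<open>2 * l\<close>.\<close>
  define q where "q = (\<lambda>x. csqrt (Q x))"
  define r where "r = (\<lambda>x. csqrt (q x))"
  define l where "l = (\<lambda>x. Q1 x / (4 * Q x))"
  define l' where "l' = (\<lambda>x. Q2 x / (4 * Q x) - (Q1 x)\<^sup>2 / (4 * (Q x)\<^sup>2))"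
  define h where "h = (\<lambda>x. l' x - (l x)\<^sup>2)"
  have q2: "q x * q x = Q x" and r2: "r x * r x = q x" for x
    by (simp_all add: q_def r_def flip: power2_eq_square)
  have Re_q: "1 / 2 \<le> Re (q x)" if "x0 \<le> x" for x
  proof -
    have "1 / 4 \<le> (norm (Q x) + Re (Q x)) / 2" using Q_lo[OF that] ReQ[OF that] T1[OF that] by simp
    then have "sqrt (1 / 4) \<le> Re (q x)" unfolding q_def csqrt.simps by (rule real_sqrt_le_mono)
    moreover have "sqrt (1 / 4) = 1 / (2::real)" by (simp add: real_sqrt_divide)
    ultimately show ?thesis by simp
  qed
  have q0: "q x \<noteq> 0" if "x0 \<le> x" for x using Q0[OF that] by (simp add: q_def)
  have r0: "r x \<noteq> 0" if "x0 \<le> x" for x using q0[OF that] by (simp add: r_def)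
  have q_lo: "sqrt (\<mu> / 2) \<le> norm (q x)" if "x0 \<le> x" for x
  proof -
    have "0 \<le> x ^ m" using that x0 by simp
    then have "\<mu> / 2 \<le> norm (Q x)" using Q_lo[OF that] by (simp add: T_def)
    then show ?thesis unfolding q_def norm_csqrt by (rule real_sqrt_le_mono)
  qed
  have nr2: "norm (r x) ^ 2 = norm (q x)" for x by (simp add: r_def)
  have nr4: "norm (r x) ^ 4 = norm (Q x)" for x
  proof -
    have "norm (r x) ^ 4 = (norm (r x) ^ 2) ^ 2" by simp
    also have "\<dots> = norm (q x * q x)" unfolding nr2 norm_mult by (simp add: power2_eq_square)
    finally show ?thesis by (simp only: q2)
  qed
  have dq: "(q has_vector_derivative 2 * q x * l x) (at x)" if "x0 \<le> x" for x
  proof -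
    have "Q x \<notin> \<real>\<^sub>\<le>\<^sub>0" using ReQ[OF that] T1[OF that] by (auto simp: complex_nonpos_Reals_iff)
    from field_vector_diff_chain_at[OF Q[OF that] has_field_derivative_csqrt[OF this]]
    have "(q has_vector_derivative Q1 x * inverse (2 * q x)) (at x)" by (simp add: q_def o_def)
    moreover have "Q1 x * inverse (2 * q x) = 2 * q x * l x"
      using q0[OF that] unfolding l_def q2[symmetric] by (simp add: field_simps)
    ultimately show ?thesis by (simp only:)
  qed
  have dr: "(r has_vector_derivative r x * l x) (at x)" if "x0 \<le> x" for x
  proof -
    have "q x \<notin> \<real>\<^sub>\<le>\<^sub>0" using Re_q[OF that] by (auto simp: complex_nonpos_Reals_iff)
    from field_vector_diff_chain_at[OF dq[OF that] has_field_derivative_csqrt[OF this]]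
    have "(r has_vector_derivative 2 * q x * l x * inverse (2 * r x)) (at x)" by (simp add: r_def o_def)
    moreover have "2 * q x * l x * inverse (2 * r x) = r x * l x"
      using r0[OF that] unfolding r2[symmetric] by (simp add: field_simps)
    ultimately show ?thesis by (simp only:)
  qed
  have dri: "((\<lambda>x. inverse (r x)) has_vector_derivative - l x * inverse (r x)) (at x)" if "x0 \<le> x" for x
  proof -
    have "(inverse has_field_derivative - (inverse (r x) * inverse (r x))) (at (r x))"
      using DERIV_inverse[OF r0[OF that]] by (simp add: power2_eq_square)
    from field_vector_diff_chain_at[OF dr[OF that] this]
    show ?thesis using r0[OF that] by (simp add: o_def field_simps)
  qed
  have dl: "(l has_vector_derivative l' x) (at x)" if "x0 \<le> x" for x
  proof -
    have "(inverse has_field_derivative - (inverse (Q x) * inverse (Q x))) (at (Q x))"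
      using DERIV_inverse[OF Q0[OF that]] by (simp add: power2_eq_square)
    from field_vector_diff_chain_at[OF Q[OF that] this]
    have "((\<lambda>x. inverse (Q x)) has_vector_derivative Q1 x * - (inverse (Q x) * inverse (Q x))) (at x)"
      by (simp add: o_def)
    from has_vector_derivative_mult[OF Q1[OF that] this]
    have "((\<lambda>x. Q1 x * inverse (Q x) / 4) has_vector_derivative l' x) (at x)"
      by (intro has_vector_derivative_eq_rhs[OF has_vector_derivative_divide])
        (use Q0[OF that] in \<open>auto simp: l'_def power2_eq_square field_simps\<close>)
    then show ?thesis by (simp add: l_def[abs_def] field_simps)
  qed
  have h_le: "norm (h x) \<le> B / (1 + x)\<^sup>2" if "x0 \<le> x" for x
  proof -
    have "norm (h x) \<le> norm (Q2 x / (4 * Q x)) + norm (5 / 16 * (Q1 x / Q x)\<^sup>2)"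
      using norm_triangle_ineq4[of "Q2 x / (4 * Q x)" "5 / 16 * (Q1 x / Q x)\<^sup>2"]
      by (simp add: h_def l_def l'_def power_divide power_mult_distrib)
    also have "\<dots> \<le> norm (Q2 x) / norm (Q x) + (norm (Q1 x) / norm (Q x))\<^sup>2"
    proof -
      have e: "norm (Q2 x / (4 * Q x)) = norm (Q2 x) / norm (Q x) / 4"
        "norm (5 / 16 * (Q1 x / Q x)\<^sup>2) = 5 / 16 * (norm (Q1 x) / norm (Q x))\<^sup>2"
        by (simp_all add: norm_divide norm_mult norm_power)
      have aux: "a / 4 + 5 / 16 * b \<le> a + b" if "0 \<le> a" "0 \<le> b" for a b :: real
        using that by simp
      show ?thesis unfolding e by (rule aux) simp_all
    qed
    also have "\<dots> \<le> B / (1 + x)\<^sup>2" by (rule bd[OF that])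
    finally show ?thesis .
  qed
  \<comment> \<open>The products \<open>ym * p\<close> and \<open>yp * n\<close> are the Wronskians
    of \<open>f\<close> with \<open>ym\<close> and \<open>yp\<close>.\<close>
  define p where "p = (\<lambda>x. f' x + (q x + l x) * f x)"
  define n where "n = (\<lambda>x. f' x - (q x - l x) * f x)"
  define yp where "yp = (\<lambda>x. exp (S x) * inverse (r x))"
  define ym where "ym = (\<lambda>x. exp (- S x) * inverse (r x))"
  have dyp: "(yp has_vector_derivative (q x - l x) * yp x) (at x)" if "x0 \<le> x" for x
  proof -
    have "((\<lambda>x. exp (S x)) has_vector_derivative q x * exp (S x)) (at x)"
      using field_vector_diff_chain_at[OF S[OF that] DERIV_exp] by (simp add: o_def q_def)
    from has_vector_derivative_mult[OF this dri[OF that]]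
    show ?thesis by (simp add: yp_def algebra_simps)
  qed
  have dym: "(ym has_vector_derivative - (q x + l x) * ym x) (at x)" if "x0 \<le> x" for x
  proof -
    have "((\<lambda>x. - S x) has_vector_derivative - q x) (at x)"
      using has_vector_derivative_minus[OF S[OF that]] by (simp add: q_def)
    from field_vector_diff_chain_at[OF this DERIV_exp]
    have "((\<lambda>x. exp (- S x)) has_vector_derivative - q x * exp (- S x)) (at x)"
      by (simp add: o_def)
    from has_vector_derivative_mult[OF this dri[OF that]]
    show ?thesis by (simp add: ym_def algebra_simps)
  qed
  have dypn: "((\<lambda>x. yp x * n x) has_vector_derivative yp x * f x * h x) (at x)" if "x0 \<le> x" for x
  proof -
    have "(n has_vector_derivative Q x * f x - ((q x - l x) * f' x + (2 * q x * l x - l' x) * f x)) (at x)"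
      unfolding n_def using that by (intro derivative_intros f f' dq dl)
    from has_vector_derivative_mult[OF dyp[OF that] this]
    have "((\<lambda>x. yp x * n x) has_vector_derivative
       yp x * (Q x * f x - ((q x - l x) * f' x + (2 * q x * l x - l' x) * f x)) + (q x - l x) * yp x * n x) (at x)" .
    moreover have "yp x * (Q x * f x - ((q x - l x) * f' x + (2 * q x * l x - l' x) * f x)) + (q x - l x) * yp x * n x
       = yp x * f x * h x"
      unfolding q2[symmetric] h_def n_def by (simp add: algebra_simps power2_eq_square)
    ultimately show ?thesis by simp
  qed
  have dymp: "((\<lambda>x. ym x * p x) has_vector_derivative ym x * f x * h x) (at x)" if "x0 \<le> x" for x
  proof -
    have "(p has_vector_derivative Q x * f x + ((q x + l x) * f' x + (2 * q x * l x + l' x) * f x)) (at x)"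
      unfolding p_def using that by (intro derivative_intros f f' dq dl)
    from has_vector_derivative_mult[OF dym[OF that] this]
    have "((\<lambda>x. ym x * p x) has_vector_derivative
       ym x * (Q x * f x + ((q x + l x) * f' x + (2 * q x * l x + l' x) * f x)) + - (q x + l x) * ym x * p x) (at x)" .
    moreover have "ym x * (Q x * f x + ((q x + l x) * f' x + (2 * q x * l x + l' x) * f x)) + - (q x + l x) * ym x * p x
       = ym x * f x * h x"
      unfolding q2[symmetric] h_def p_def by (simp add: algebra_simps power2_eq_square)
    ultimately show ?thesis by simp
  qed
  have Re_S: "Re (S y) - Re (S x) \<ge> (y - x) / 2" if "x0 \<le> x" "x \<le> y" for x y
  proof -
    have "Re (S x) - x / 2 \<le> Re (S y) - y / 2"
    proof (rule DERIV_nonneg_imp_nondecreasing[OF that(2)])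
      fix z assume "x \<le> z" "z \<le> y"
      then have z: "x0 \<le> z" using that by simp
      have "((\<lambda>z. Re (S z)) has_real_derivative Re (q z)) (at z)"
        using bounded_linear.has_vector_derivative[OF bounded_linear_Re S[OF z]]
        by (simp add: has_real_derivative_iff_has_vector_derivative q_def del: csqrt.simps)
      then have "((\<lambda>z. Re (S z) - z / 2) has_real_derivative Re (q z) - 1 / 2) (at z)"
        by (intro DERIV_diff) (auto intro!: derivative_eq_intros)
      then show "\<exists>y. ((\<lambda>z. Re (S z) - z / 2) has_real_derivative y) (at z) \<and> 0 \<le> y"
        using Re_q[OF z] by (intro exI[of _ "Re (q z) - 1 / 2"]) auto
    qed
    then show ?thesis by (simp add: field_simps)
  qed
  \<comment> \<open>The modulus of \<open>Q\<close> stays between \<open>T / 2\<close> and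
    \<open>2 * T\<close> with \<open>T\<close> increasing, so \<open>|r|\<close> can drop by a
    bounded factor only.\<close>
  have r_ratio: "norm (r x) \<le> 2 * norm (r y)" if "x0 \<le> x" "x \<le> y" for x y
  proof -
    have "norm (Q x) \<le> 2 * T x" by (rule Q_hi[OF that(1)])
    also have "\<dots> \<le> 2 * T y" using T_mono[OF that] by simp
    also have "\<dots> \<le> 16 * norm (Q y)" using Q_lo[of y] T1[of y] that by simp
    finally have "norm (r x) ^ 4 \<le> (2 * norm (r y)) ^ 4"
      by (simp add: nr4 power_mult_distrib)
    then show ?thesis by (rule power_le_imp_le_base[where n = 3, simplified]) simp
  qed
  have r_lo: "1 / 2 \<le> norm (r x)" if "x0 \<le> x" for x
  proof (rule power2_le_imp_le)
    have "1 / 2 \<le> norm (q x)" using Re_q[OF that] complex_Re_le_cmod[of "q x"] by simp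
    then show "(1 / 2)\<^sup>2 \<le> (norm (r x))\<^sup>2" unfolding nr2 by (simp add: power2_eq_square)
  qed simp
  \<comment> \<open>The factor \<open>exp (- S)\<close> decays exponentially. Against it
    \<open>f\<close> is bounded by monotonicity, \<open>f'\<close> grows at most polynomially since
    \<open>f'' = Q f\<close> does, and \<open>q\<close> and \<open>l\<close> are polynomially
    bounded as well.\<close>
  have p_lim: "((\<lambda>x. ym x * p x) \<longlongrightarrow> 0) at_top"
  proof (rule Lim_null_comparison)
    define C where "C = 2 * (norm (f' x0) + 2 * (1 + \<mu>) * norm (f x0) + (2 * (1 + \<mu>) + (2 + B)) * norm (f x0))"
    show "((\<lambda>x. C * ((1 + x) ^ Suc m * exp (- (x - x0) / 2))) \<longlongrightarrow> 0) at_top"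
      using tendsto_mult[OF tendsto_const[of C] power_times_exp_neg_tendsto_0[of "Suc m" x0]] by simp
    show "eventually (\<lambda>x. norm (ym x * p x) \<le> C * ((1 + x) ^ Suc m * exp (- (x - x0) / 2))) at_top"
      using eventually_ge_at_top[of x0]
    proof eventually_elim
      case (elim x)
      then have x: "0 \<le> x" using x0 by simp
      define P where "P = (1 + x) ^ Suc m"
      have x1: "1 \<le> 1 + x" using x by simp
      have P1: "1 \<le> (1 + x) ^ m" by (rule one_le_power[OF x1])
      have P2: "1 \<le> P" unfolding P_def by (rule one_le_power[OF x1])
      have TP: "T x \<le> (1 + \<mu>) * (1 + x) ^ m"
      proof -
        have "x ^ m \<le> (1 + x) ^ m" using x by (intro power_mono) auto
        moreover have "\<mu> * 1 \<le> \<mu> * (1 + x) ^ m" using P1 \<mu> by (intro mult_left_mono) auto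
        ultimately show ?thesis by (simp add: T_def algebra_simps)
      qed
      have TP': "T x * y \<le> (1 + \<mu>) * P" if "0 \<le> y" "y \<le> 1 + x" for y
        using mult_mono[OF TP that(2)] that T1[OF elim] x \<mu> by (simp add: P_def mult_ac)
      have "norm (f' x - f' x0) \<le> 2 * T x * norm (f x0) * x - 2 * T x * norm (f x0) * x0"
      proof (rule norm_diff_le_of_deriv_le[OF elim])
        fix z assume z: "x0 \<le> z" "z \<le> x"
        show "(f' has_vector_derivative Q z * f z) (at z)" using f'[OF z(1)] .
        show "((\<lambda>x'. 2 * T x * norm (f x0) * x') has_real_derivative 2 * T x * norm (f x0)) (at z)"
          by (auto intro!: derivative_eq_intros)
        show "norm (Q z * f z) \<le> 2 * T x * norm (f x0)"
          unfolding norm_mult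
        proof (intro mult_mono)
          show "norm (Q z) \<le> 2 * T x" using Q_hi[OF z(1)] T_mono[OF z] by simp
        qed (use mono[of x0 z] z T1[OF elim] in auto)
      qed
      also have "\<dots> = 2 * norm (f x0) * (T x * (x - x0))" by (simp add: algebra_simps)
      also have "\<dots> \<le> 2 * norm (f x0) * ((1 + \<mu>) * P)"
        using elim x0 by (intro mult_left_mono TP') auto
      finally have "norm (f' x) \<le> norm (f' x0) + 2 * norm (f x0) * ((1 + \<mu>) * P)"
        using norm_triangle_sub[of "f' x" "f' x0"] by simp
      also have "\<dots> \<le> norm (f' x0) * P + 2 * norm (f x0) * ((1 + \<mu>) * P)"
        using mult_left_mono[OF P2, of "norm (f' x0)"] by simp
      finally have F1: "norm (f' x) \<le> (norm (f' x0) + 2 * (1 + \<mu>) * norm (f x0)) * P"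
        by (simp add: algebra_simps)
      have "norm (q x) \<le> 1 + norm (Q x)"
        unfolding q_def norm_csqrt by (rule real_le_lsqrt) (simp_all add: power2_eq_square algebra_simps)
      then have q_hi: "norm (q x) \<le> 1 + 2 * (1 + \<mu>) * P"
        using Q_hi[OF elim] TP'[of 1] x by (simp add: algebra_simps)
      have "(norm (Q1 x) / norm (Q x))\<^sup>2 \<le> B"
      proof -
        have "(norm (Q1 x) / norm (Q x))\<^sup>2 \<le> B / (1 + x)\<^sup>2"
        proof -
          have "0 \<le> norm (Q2 x) / norm (Q x)" by simp
          then show ?thesis using bd[OF elim] by linarith
        qed
        also have "\<dots> \<le> B"
        proof -
          have "1 \<le> (1 + x)\<^sup>2" using x by (intro one_le_power) simp
          then have "B * 1 \<le> B * (1 + x)\<^sup>2" using B by (intro mult_left_mono)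
          moreover have "0 < (1 + x)\<^sup>2" using x by simp
          ultimately show ?thesis by (simp add: pos_divide_le_eq)
        qed
        finally show ?thesis .
      qed
      then have "norm (Q1 x) / norm (Q x) \<le> 1 + B"
      proof -
        have "(norm (Q1 x) / norm (Q x))\<^sup>2 \<le> (1 + B)\<^sup>2"
        proof (rule order_trans)
          show "B \<le> (1 + B)\<^sup>2" using B by (simp add: power2_eq_square algebra_simps)
        qed (rule \<open>(norm (Q1 x) / norm (Q x))\<^sup>2 \<le> B\<close>)
        then show ?thesis by (rule power2_le_imp_le) (use B in simp)
      qed
      moreover have "norm (l x) = norm (Q1 x) / norm (Q x) / 4" by (simp add: l_def norm_divide norm_mult)
      moreover have "(1 + B) * 1 \<le> (1 + B) * P" using B P2 by (intro mult_left_mono) auto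
      moreover have "l' \<le> (1 + B) * P" if "y \<le> 1 + B" "l' = y / 4" "(1 + B) * 1 \<le> (1 + B) * P" for l' y :: real
      proof -
        have "l' \<le> 1 + B" using that(1,2) B by simp
        then show ?thesis using that(3) by simp
      qed
      ultimately have l_hi: "norm (l x) \<le> (1 + B) * P" by blast
      have "norm ((q x + l x) * f x) \<le> (2 * (1 + \<mu>) + (2 + B)) * P * norm (f x0)"
        unfolding norm_mult
      proof (intro mult_mono)
        show "norm (q x + l x) \<le> (2 * (1 + \<mu>) + (2 + B)) * P"
          using norm_triangle_ineq[of "q x" "l x"] q_hi l_hi P2 by (simp add: algebra_simps)
        have "0 \<le> P" using P2 by simp
        then show "0 \<le> (2 * (1 + \<mu>) + (2 + B)) * P" using \<mu> B by (intro mult_nonneg_nonneg) auto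
      qed (use mono[of x0 x] elim in simp_all)
      then have p_hi: "2 * norm (p x) \<le> C * P"
        using F1 norm_triangle_ineq[of "f' x" "(q x + l x) * f x"] by (simp add: p_def C_def algebra_simps)
      have "norm (ym x) = exp (- Re (S x)) * inverse (norm (r x))" by (simp add: ym_def norm_mult norm_inverse)
      also have "\<dots> \<le> exp (- (x - x0) / 2) * 2"
      proof (intro mult_mono)
        show "exp (- Re (S x)) \<le> exp (- (x - x0) / 2)" using Re_S[of x0 x] elim S0 by simp
        show "inverse (norm (r x)) \<le> 2" using r_lo[OF elim] le_imp_inverse_le[of "1/2" "norm (r x)"] by simp
      qed auto
      finally have "norm (ym x * p x) \<le> exp (- (x - x0) / 2) * (2 * norm (p x))"
        unfolding norm_mult by (metis mult.assoc mult_right_mono norm_ge_zero)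
      also have "\<dots> \<le> exp (- (x - x0) / 2) * (C * P)" using p_hi by (intro mult_left_mono) auto
      finally show ?case by (simp add: mult_ac P_def)
    qed
  qed
  \<comment> \<open>Integration of the Wronskian identity from \<open>x\<close> to infinity. On this
    range \<open>|f|\<close> is largest at \<open>x\<close>, and so is \<open>|ym|\<close> up to the
    factor 2 from \<open>r_ratio\<close>.\<close>
  have p_le: "norm (p x) \<le> 2 * B * norm (f x)" if x: "x0 \<le> x" for x
  proof -
    define K where "K = 2 * norm (ym x) * norm (f x) * B"
    have K: "0 \<le> K" using B by (simp add: K_def)
    have *: "norm (ym X * p X - ym x * p x) \<le> K" if X: "x \<le> X" for X
    proof -
      have "norm (ym X * p X - ym x * p x) \<le> (- K / (1 + X)) - (- K / (1 + x))"
      proof (rule norm_diff_le_of_deriv_le[OF X])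
        fix z assume z: "x \<le> z" "z \<le> X"
        then have z0: "x0 \<le> z" using x by simp
        show "((\<lambda>x. ym x * p x) has_vector_derivative ym z * f z * h z) (at z)" by (rule dymp[OF z0])
        show "((\<lambda>z. - K / (1 + z)) has_real_derivative K / (1 + z)\<^sup>2) (at z)"
          using z0 x0 by (auto intro!: derivative_eq_intros simp: power2_eq_square)
        have "norm (ym z) = exp (- Re (S z)) * inverse (norm (r z))" by (simp add: ym_def norm_mult norm_inverse)
        also have "\<dots> \<le> exp (- Re (S x)) * (2 * inverse (norm (r x)))"
        proof (intro mult_mono)
          show "exp (- Re (S z)) \<le> exp (- Re (S x))" using Re_S[OF x z(1)] z by simp
          show "inverse (norm (r z)) \<le> 2 * inverse (norm (r x))"
          proof -
            have "0 < norm (r x)" using r_lo[OF x] by linarith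
            from le_imp_inverse_le[OF r_ratio[OF x z(1)] this] show ?thesis by simp
          qed
        qed auto
        finally have "norm (ym z) \<le> 2 * norm (ym x)" by (simp add: ym_def norm_mult norm_inverse)
        then have "norm (ym z) * norm (f z) * norm (h z) \<le> 2 * norm (ym x) * norm (f x) * (B / (1 + z)\<^sup>2)"
          using mono[OF x z(1)] h_le[OF z0] by (intro mult_mono) auto
        then show "norm (ym z * f z * h z) \<le> K / (1 + z)\<^sup>2" by (simp add: norm_mult K_def)
      qed
      also have "\<dots> \<le> K / (1 + x)" using X x x0 K by simp
      also have "\<dots> \<le> K / 1" using K x x0 by (intro divide_left_mono) auto
      finally show ?thesis by simp
    qed
    have "norm (0 - ym x * p x) \<le> K"
    proof (rule tendsto_upperbound)
      show "((\<lambda>X. norm (ym X * p X - ym x * p x)) \<longlongrightarrow> norm (0 - ym x * p x)) at_top"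
        by (intro tendsto_intros p_lim)
      show "eventually (\<lambda>X. norm (ym X * p X - ym x * p x) \<le> K) at_top"
        by (rule eventually_mono[OF eventually_ge_at_top[of x] *])
    qed simp
    then have "norm (ym x) * norm (p x) \<le> norm (ym x) * (2 * B * norm (f x))"
      by (simp add: K_def norm_mult mult_ac)
    moreover have "0 < norm (ym x)" using r0[OF x] by (simp add: ym_def)
    ultimately show ?thesis by simp
  qed
  show "norm (f' x0 + (csqrt (Q x0) + Q1 x0 / (4 * Q x0)) * f x0) \<le> 2 * B * norm (f x0)"
    using p_le[of x0] by (simp add: p_def q_def l_def)
  fix X assume X: "x0 \<le> X"
  \<comment> \<open>Since \<open>n = p - 2 q f\<close>, the Wronskian \<open>N\<close> satisfies
    \<open>N + 2 v = yp * p\<close>; as \<open>p\<close> is small compared with \<open>q f\<close>,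
    this puts \<open>N\<close> close to \<open>- 2 v\<close>.\<close>
  define N where "N = (\<lambda>x. yp x * n x)"
  define v where "v = (\<lambda>x. f x * r x * exp (S x))"
  have n_eq: "n x = p x - 2 * q x * f x" for x by (simp add: n_def p_def algebra_simps)
  have Bq: "64 * B \<le> norm (q x)" if "x0 \<le> x" for x using small q_lo[OF that] by simp
  have NX: "norm (N X - N x0) \<le> 2 * (1/64) * norm (N x0)"
  proof (rule nearly_constant_of_deriv_bound[OF x0 X])
    fix x assume x: "x0 \<le> x"
    show "(N has_vector_derivative yp x * f x * h x) (at x)" unfolding N_def by (rule dypn[OF x])
    have "norm (q x) * norm (f x) \<le> norm (n x)"
    proof -
      have "2 * norm (q x) * norm (f x) \<le> norm (n x) + norm (p x)"
        using norm_triangle_ineq2[of "2 * q x * f x" "p x"] by (simp add: n_eq norm_mult norm_minus_commute)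
      moreover have "norm (p x) \<le> norm (q x) * norm (f x)"
        using p_le[OF x] mult_right_mono[OF Bq[OF x], of "norm (f x)"] B
        by (smt (verit) mult_right_mono norm_ge_zero)
      ultimately show ?thesis by simp
    qed
    then have "norm (f x) \<le> norm (n x) / norm (q x)" using q0[OF x] by (simp add: field_simps)
    then have "norm (f x) * norm (h x) \<le> norm (n x) / norm (q x) * (B / (1 + x)\<^sup>2)"
      using h_le[OF x] B by (intro mult_mono) auto
    also have "\<dots> = norm (n x) * ((B / norm (q x)) / (1 + x)\<^sup>2)" by simp
    also have "\<dots> \<le> norm (n x) * ((1/64) / (1 + x)\<^sup>2)"
      using Bq[OF x] q0[OF x] by (intro mult_left_mono divide_right_mono) (auto simp: field_simps)
    finally have "norm (yp x) * (norm (f x) * norm (h x)) \<le> norm (yp x) * (norm (n x) * ((1/64) / (1 + x)\<^sup>2))"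
      by (intro mult_left_mono) auto
    then show "norm (yp x * f x * h x) \<le> norm (N x) * ((1/64) / (1 + x)\<^sup>2)"
      by (simp add: N_def norm_mult mult_ac)
  qed auto
  have Nv: "norm (N x + 2 * v x) \<le> 1/32 * norm (v x)" if x: "x0 \<le> x" for x
  proof -
    have "inverse (r x) * q x = r x" using r0[OF x] unfolding r2[symmetric] by simp
    then have "N x + 2 * v x = yp x * p x"
      by (simp add: N_def n_eq yp_def v_def algebra_simps)
    also have "norm \<dots> \<le> norm (yp x) * (2 * B * norm (f x))"
      unfolding norm_mult using p_le[OF x] by (intro mult_left_mono) auto
    also have "\<dots> = norm (v x) * (2 * B / norm (q x))"
      using r0[OF x] unfolding nr2[of x, symmetric] by (simp add: yp_def v_def norm_mult norm_inverse norm_divide power2_eq_square field_simps)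
    also have "\<dots> \<le> norm (v x) * (1 / 32)"
      using Bq[OF x] q0[OF x] by (intro mult_left_mono) (auto simp: field_simps)
    finally show ?thesis by simp
  qed
  have "2 * norm (v X - v x0) = norm (2 * (v X - v x0))" by (simp only: norm_mult) simp
  also have "2 * (v X - v x0) = (N X + 2 * v X) - (N x0 + 2 * v x0) - (N X - N x0)" by simp
  also have "norm \<dots> \<le> norm (N X + 2 * v X) + norm (N x0 + 2 * v x0) + norm (N X - N x0)"
    by (meson norm_triangle_ineq4 order_trans add_mono_thms_linordered_semiring(3))
  also have "\<dots> \<le> 1/32 * norm (v X) + 1/32 * norm (v x0) + 1/32 * norm (N x0)"
    using Nv[OF X] Nv[of x0] NX by simp
  finally have 1: "2 * norm (v X - v x0) \<le> 1/32 * norm (v X) + 1/32 * norm (v x0) + 1/32 * norm (N x0)" .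
  have "norm (N x0) \<le> norm (N x0 + 2 * v x0) + norm (2 * v x0)"
    using norm_triangle_ineq4[of "N x0 + 2 * v x0" "2 * v x0"] by simp
  moreover have "norm (2 * v x0) = 2 * norm (v x0)" by (simp add: norm_mult)
  ultimately have 2: "norm (N x0) \<le> 3 * norm (v x0)"
    using Nv[OF order_refl] norm_ge_zero[of "v x0"] by linarith
  have 3: "norm (v X) \<le> norm (v X - v x0) + norm (v x0)" by (metis add.commute norm_triangle_sub)
  have "norm (v X - v x0) \<le> 1/8 * norm (v x0)" using 1 2 3 norm_ge_zero[of "v x0"] by linarith
  then show "norm (f X * csqrt (csqrt (Q X)) * exp (S X) - f x0 * csqrt (csqrt (Q x0)))
           \<le> 1/8 * norm (f x0 * csqrt (csqrt (Q x0)))"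
    by (simp add: v_def r_def q_def S0)
qed

section \<open>Sibuya's solution\<close>

definition Qpoly :: "nat \<Rightarrow> (nat \<Rightarrow> complex) \<Rightarrow> complex \<Rightarrow> complex \<Rightarrow> complex" where
  "Qpoly m a l z = z ^ m + lower_part m a z + l"

text \<open>Dividing the exponent by the top power \<open>x^(m/2+1)\<close> leaves, up to sign, a
  function \<open>h\<close> with limit \<open>2 / (m + 2) > 0\<close>; the logarithm and the lower
  powers disappear in the limit.\<close>

lemma sibuya_main_tendsto_0:
  "((\<lambda>x::real. sibuya_main m a (of_real x)) \<longlongrightarrow> 0) at_top"
proof -
  define p where "p = real m / 2 + 1"
  define J where "J = {j. 1 \<le> j \<and> 2 * j < m + 2}"
  define e where "e = (\<lambda>j. real (m + 2 - 2 * j) / 2)"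
  define c where "c = (\<lambda>j. Re (2 / of_nat (m + 2 - 2 * j) * b_total m a j))"
  define h where "h = (\<lambda>x. 2 / (real m + 2) - Re (r_exp m a) * (ln x / x powr p) + (\<Sum>j\<in>J. c j * x powr (e j - p)))"
  have p: "p > 0" by (simp add: p_def add_nonneg_pos)
  have eJ: "e j < p" if "j \<in> J" for j using that by (auto simp: J_def e_def p_def)
  have norm_eq: "norm (sibuya_main m a (of_real x)) = exp (- (x powr p * h x))" if x: "x > 0" for x
  proof -
    have pw: "(of_real x :: complex) powr (of_nat m / 2 + 1) = of_real (x powr p)"
      using x powr_of_real[of x p] by (simp add: p_def)
    have pw': "(of_real x :: complex) powr (of_nat (m + 2 - 2 * j) / 2) = of_real (x powr (e j))" for j
      using x powr_of_real[of x "e j"] by (simp add: e_def)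
    have "norm (sibuya_main m a (of_real x)) = exp (Re (r_exp m a) * ln x)
        * exp (- (2 / (real m + 2)) * x powr p - (\<Sum>j\<in>J. c j * x powr (e j)))"
    proof -
      have "Re (2 / (of_nat m + 2)) = 2 / (real m + 2)"
        using Re_complex_of_real[of "2 / (real m + 2)"] by simp
      then show ?thesis
        using x unfolding sibuya_main_def norm_mult norm_exp_eq_Re pw pw'
        by (simp add: powr_def norm_exp_eq_Re Ln_of_real J_def c_def)
    qed
    also have "\<dots> = exp (- (x powr p * h x))"
    proof -
      have "x powr e j = x powr p * x powr (e j - p)" for j by (simp add: powr_add[symmetric])
      then have "(\<Sum>j\<in>J. c j * x powr (e j)) = x powr p * (\<Sum>j\<in>J. c j * x powr (e j - p))"
        by (simp add: sum_distrib_left mult_ac)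
      then have "Re (r_exp m a) * ln x + (- (2 / (real m + 2)) * x powr p - (\<Sum>j\<in>J. c j * x powr (e j))) = - (x powr p * h x)"
        using x by (simp add: h_def algebra_simps)
      then show ?thesis by (simp add: exp_add[symmetric])
    qed
    finally show ?thesis .
  qed
  have "((\<lambda>x. ln x / x powr p) \<longlongrightarrow> 0) at_top" using p by real_asymp
  moreover have "((\<lambda>x. x powr (e j - p)) \<longlongrightarrow> 0) at_top" if "j \<in> J" for j
    using eJ[OF that] by (intro tendsto_neg_powr filterlim_ident) auto
  ultimately have "(h \<longlongrightarrow> 2 / (real m + 2) - Re (r_exp m a) * 0 + (\<Sum>j\<in>J. c j * 0)) at_top"
    unfolding h_def by (intro tendsto_intros)
  then have "(h \<longlongrightarrow> 2 / (real m + 2)) at_top" by simp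
  moreover have "filterlim (\<lambda>x::real. x powr p) at_top at_top" using p by real_asymp
  ultimately have "filterlim (\<lambda>x. h x * x powr p) at_top at_top"
    by (intro filterlim_tendsto_pos_mult_at_top) (auto simp: add_nonneg_pos)
  then have "filterlim (\<lambda>x. - (x powr p * h x)) at_bot at_top"
    by (simp add: filterlim_uminus_at_bot mult.commute)
  from filterlim_compose[OF exp_at_bot this]
  have "((\<lambda>x. norm (sibuya_main m a (of_real x))) \<longlongrightarrow> 0) at_top"
  proof (rule Lim_transform_eventually)
    show "eventually (\<lambda>x. exp (- (x powr p * h x)) = norm (sibuya_main m a (of_real x))) at_top"
      using eventually_gt_at_top[of 0] by eventually_elim (simp add: norm_eq)
  qed
  then show ?thesis by (simp add: tendsto_norm_zero_iff)
qed

lemma sibuya_main_nonzero: "x > 0 \<Longrightarrow> sibuya_main m a (of_real x) \<noteq> 0"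
  by (simp add: sibuya_main_def)

lemma sibuya_ratio_tendsto_1:
  assumes "sibuya_solution m f"
  shows "((\<lambda>x::real. f (of_real x) a l / sibuya_main m a (of_real x)) \<longlongrightarrow> 1) at_top"
proof -
  \<comment> \<open>This value shrinks the sector to the half line \<open>Arg z = 0\<close>.\<close>
  define \<epsilon> where "\<epsilon> = 3 * pi / (real m + 2)"
  have \<epsilon>: "\<epsilon> > 0" by (simp add: \<epsilon>_def add_nonneg_pos)
  let ?F = "inf at_infinity (principal {z. \<bar>Arg z\<bar> \<le> 3 * pi / (real m + 2) - \<epsilon>})"
  have bigo: "(\<lambda>z. f z a l / sibuya_main m a z - 1) \<in> O[?F](\<lambda>z. z powr (-1/2))"
    using assms \<epsilon> by (auto simp: sibuya_solution_def)
  have F: "filterlim (of_real :: real \<Rightarrow> complex) ?F at_top"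
    unfolding filterlim_inf filterlim_principal
  proof
    show "filterlim (of_real :: real \<Rightarrow> complex) at_infinity at_top" by (rule filterlim_of_real_at_infinity)
    show "eventually (\<lambda>x. complex_of_real x \<in> {z. \<bar>Arg z\<bar> \<le> 3 * pi / (real m + 2) - \<epsilon>}) at_top"
      using eventually_gt_at_top[of 0] by eventually_elim (simp add: Arg_of_real \<epsilon>_def)
  qed
  from landau_o.big.compose[OF bigo F]
  have "(\<lambda>x. f (of_real x) a l / sibuya_main m a (of_real x) - 1) \<in> O(\<lambda>x::real. of_real x powr (-1/2) :: complex)" .
  moreover have "((\<lambda>x::real. of_real x powr (-1/2) :: complex) \<longlongrightarrow> 0) at_top"
  proof -
    have "((\<lambda>x::real. x powr (-1/2)) \<longlongrightarrow> 0) at_top" by real_asymp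
    then have "((\<lambda>x::real. of_real (x powr (-1/2)) :: complex) \<longlongrightarrow> of_real 0) at_top" by (rule tendsto_of_real)
    moreover have "eventually (\<lambda>x. of_real (x powr (-1/2)) = (of_real x powr (-1/2) :: complex)) at_top"
      using eventually_gt_at_top[of 0] by eventually_elim (simp add: powr_of_real[symmetric])
    ultimately show ?thesis using Lim_transform_eventually by fastforce
  qed
  ultimately have "((\<lambda>x. f (of_real x) a l / sibuya_main m a (of_real x) - 1) \<longlongrightarrow> 0) at_top"
  proof -
    assume bo: "(\<lambda>x. f (of_real x) a l / sibuya_main m a (of_real x) - 1) \<in> O(\<lambda>x::real. of_real x powr (-1/2) :: complex)"
      and lim: "((\<lambda>x::real. of_real x powr (-1/2) :: complex) \<longlongrightarrow> 0) at_top"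
    obtain C where
      "eventually (\<lambda>x. norm (f (of_real x) a l / sibuya_main m a (of_real x) - 1) \<le> C * norm (of_real x powr (-1/2) :: complex)) at_top"
      using landau_o.bigE[OF bo] by blast
    moreover have "((\<lambda>x::real. C * norm (of_real x powr (-1/2) :: complex)) \<longlongrightarrow> C * 0) at_top"
      using lim by (intro tendsto_mult tendsto_const) (simp add: tendsto_norm_zero_iff)
    ultimately show ?thesis using Lim_null_comparison by fastforce
  qed
  from tendsto_add[OF this tendsto_const[of 1]] show ?thesis by simp
qed

lemma sibuya_tendsto_0:
  assumes "sibuya_solution m f"
  shows "((\<lambda>x::real. f (of_real x) a l) \<longlongrightarrow> 0) at_top"
proof -
  have "((\<lambda>x::real. f (of_real x) a l / sibuya_main m a (of_real x) * sibuya_main m a (of_real x)) \<longlongrightarrow> 1 * 0) at_top"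
    by (intro tendsto_mult sibuya_ratio_tendsto_1[OF assms] sibuya_main_tendsto_0)
  moreover have "eventually (\<lambda>x. f (of_real x) a l / sibuya_main m a (of_real x) * sibuya_main m a (of_real x) = f (of_real x) a l) at_top"
    using eventually_gt_at_top[of 0] by eventually_elim (simp add: sibuya_main_nonzero)
  ultimately show ?thesis using Lim_transform_eventually by fastforce
qed

lemma sibuya_eventually_nonzero:
  assumes "sibuya_solution m f"
  shows "eventually (\<lambda>x::real. f (of_real x) a l \<noteq> 0) at_top"
  using tendsto_imp_eventually_ne[OF sibuya_ratio_tendsto_1[OF assms, of a l], of 0]
  by (auto elim: eventually_mono)

text \<open>The spectral parameter does not occur in \<open>sibuya_main\<close>, which therefore
  cancels in the quotient. This makes amplitudes at different parameters comparable.\<close>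

lemma sibuya_ratio_lambda:
  assumes "sibuya_solution m f"
  shows "((\<lambda>x::real. f (of_real x) a l / f (of_real x) a l') \<longlongrightarrow> 1) at_top"
proof -
  have "((\<lambda>x::real. (f (of_real x) a l / sibuya_main m a (of_real x)) / (f (of_real x) a l' / sibuya_main m a (of_real x))) \<longlongrightarrow> 1 / 1) at_top"
    by (intro tendsto_divide sibuya_ratio_tendsto_1[OF assms]) auto
  moreover have "eventually (\<lambda>x. (f (of_real x) a l / sibuya_main m a (of_real x)) / (f (of_real x) a l' / sibuya_main m a (of_real x))
      = f (of_real x) a l / f (of_real x) a l') at_top"
    using eventually_gt_at_top[of 0] by eventually_elim (simp add: sibuya_main_nonzero)
  ultimately show ?thesis using Lim_transform_eventually by fastforce
qed

lemma sibuya_ode: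
  assumes "sibuya_solution m f"
  shows "((\<lambda>z. f z a l) has_field_derivative deriv (\<lambda>z. f z a l) z) (at z)"
    and "(deriv (\<lambda>z. f z a l) has_field_derivative Qpoly m a l z * f z a l) (at z)"
proof -
  have h: "(\<lambda>z. f z a l) holomorphic_on UNIV" using assms by (simp add: sibuya_solution_def)
  then show "((\<lambda>z. f z a l) has_field_derivative deriv (\<lambda>z. f z a l) z) (at z)"
    by (intro holomorphic_derivI[of _ UNIV]) auto
  have "deriv (\<lambda>z. f z a l) holomorphic_on UNIV" using h by (intro holomorphic_deriv) auto
  then have "(deriv (\<lambda>z. f z a l) has_field_derivative deriv (deriv (\<lambda>z. f z a l)) z) (at z)"
    by (intro holomorphic_derivI[of _ UNIV]) auto
  moreover have "deriv (deriv (\<lambda>z. f z a l)) z = Qpoly m a l z * f z a l"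
  proof -
    let ?A = "deriv (deriv (\<lambda>z. f z a l)) z"
    have e: "- ?A + (z ^ m + lower_part m a z + l) * f z a l = 0"
      using assms unfolding sibuya_solution_def by blast
    have "?A = ?A + (- ?A + (z ^ m + lower_part m a z + l) * f z a l)" unfolding e by simp
    then show ?thesis by (simp add: Qpoly_def)
  qed
  ultimately show "(deriv (\<lambda>z. f z a l) has_field_derivative Qpoly m a l z * f z a l) (at z)" by simp
qed

lemma sibuya_ode_real:
  assumes "sibuya_solution m f"
  shows "((\<lambda>x::real. f (of_real x) a l) has_vector_derivative deriv (\<lambda>z. f z a l) (of_real x)) (at x)"
    and "((\<lambda>x::real. deriv (\<lambda>z. f z a l) (of_real x)) has_vector_derivative Qpoly m a l (of_real x) * f (of_real x) a l) (at x)"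
  by (rule has_vector_derivative_real_field[OF sibuya_ode(1)[OF assms]],
      rule has_vector_derivative_real_field[OF sibuya_ode(2)[OF assms]])

text \<open>The difference quotients at 0 are holomorphic in \<open>l\<close> and converge locally
  uniformly: the equation bounds the second derivative in \<open>z\<close> by the continuous
  function \<open>Qpoly * f\<close>, so the quotient with step \<open>h\<close> is off by at most
  \<open>M * h\<close>.\<close>

lemma sibuya_deriv_holomorphic:
  assumes sib: "sibuya_solution m f"
  shows "(\<lambda>l. deriv (\<lambda>z. f z a l) 0) holomorphic_on UNIV"
proof (rule holomorphic_uniform_sequence[OF open_UNIV])
  define g where "g = (\<lambda>n l. of_nat (Suc n) * (f (of_real (1 / real (Suc n))) a l - f 0 a l))"
  show "g n holomorphic_on UNIV" for n
    unfolding g_def using sib by (intro holomorphic_intros) (auto simp: sibuya_solution_def)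
  fix l0 :: complex
  have cont: "continuous_on UNIV (\<lambda>(z, l). Qpoly m a l z * f z a l)"
  proof -
    have "continuous_on UNIV (\<lambda>x. f (fst x) (fst (snd x)) (snd (snd x)))"
      using sib unfolding sibuya_solution_def case_prod_unfold by blast
    from continuous_on_compose2[OF this, of UNIV "\<lambda>x. (fst x, a, snd x)"]
    have "continuous_on UNIV (\<lambda>x. f (fst x) a (snd x))"
      by (simp add: continuous_on_Pair continuous_on_fst continuous_on_snd continuous_on_const continuous_on_id)
    then show ?thesis
      unfolding Qpoly_def lower_part_def case_prod_unfold by (intro continuous_intros)
  qed
  have "compact ((of_real ` {0..1::real}) \<times> cball l0 1 :: (complex \<times> complex) set)"
    by (intro compact_Times compact_continuous_image continuous_intros) auto
  from compact_imp_bounded[OF compact_continuous_image[OF continuous_on_subset[OF cont subset_UNIV] this]]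
  obtain M where M: "M > 0" "\<And>x l. x \<in> {0..1::real} \<Longrightarrow> l \<in> cball l0 1 \<Longrightarrow> norm (Qpoly m a l (of_real x) * f (of_real x) a l) \<le> M"
    unfolding bounded_pos by fastforce
  have bound: "norm (f (of_real h) a l - f 0 a l - of_real h * deriv (\<lambda>z. f z a l) 0) \<le> M * h\<^sup>2"
    if h: "h \<in> {0..1}" and l: "l \<in> cball l0 1" for h l
  proof -
    let ?D = "\<lambda>x::real. deriv (\<lambda>z. f z a l) (of_real x)"
    have D: "norm (?D x - ?D 0) \<le> M * h" if x: "0 \<le> x" "x \<le> h" for x
    proof -
      have "norm (?D x - ?D 0) \<le> M * x - M * 0"
        by (rule norm_diff_le_of_deriv_le[OF x(1) sibuya_ode_real(2)[OF sib]])
          (use x h l M(2) in \<open>auto intro!: derivative_eq_intros\<close>)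
      also have "\<dots> \<le> M * h" using x M(1) by simp
      finally show ?thesis .
    qed
    have "norm ((f (of_real h) a l - of_real h * ?D 0) - (f (of_real 0) a l - of_real 0 * ?D 0)) \<le> (M * h) * h - (M * h) * 0"
    proof (rule norm_diff_le_of_deriv_le)
      fix x assume x: "0 \<le> x" "x \<le> h"
      have "((\<lambda>z. z * ?D 0) has_field_derivative ?D 0) (at (of_real x))"
        by (auto intro!: derivative_eq_intros)
      from has_vector_derivative_real_field[OF this]
      have "((\<lambda>x::real. of_real x * ?D 0) has_vector_derivative ?D 0) (at x)" .
      from has_vector_derivative_diff[OF sibuya_ode_real(1)[OF sib] this]
      show "((\<lambda>x. f (of_real x) a l - of_real x * ?D 0) has_vector_derivative ?D x - ?D 0) (at x)" .
      show "norm (?D x - ?D 0) \<le> M * h" by (rule D[OF x])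
    qed (use h in \<open>auto intro!: derivative_eq_intros\<close>)
    then show ?thesis by (simp add: power2_eq_square mult_ac algebra_simps)
  qed
  show "\<exists>d>0. cball l0 d \<subseteq> UNIV \<and> uniform_limit (cball l0 d) g (\<lambda>l. deriv (\<lambda>z. f z a l) 0) sequentially"
  proof (intro exI[of _ 1] conjI)
    show "uniform_limit (cball l0 1) g (\<lambda>l. deriv (\<lambda>z. f z a l) 0) sequentially"
    proof (rule uniform_limitI)
      fix e :: real assume e: "e > 0"
      have "(\<lambda>n. M / real (Suc n)) \<longlonglongrightarrow> 0" by real_asymp
      then have "eventually (\<lambda>n. M / real (Suc n) < e) sequentially" using e by (simp add: order_tendstoD)
      then show "eventually (\<lambda>n. \<forall>l\<in>cball l0 1. dist (g n l) (deriv (\<lambda>z. f z a l) 0) < e) sequentially"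
      proof (eventually_elim, intro ballI)
        fix n l assume n: "M / real (Suc n) < e" and l: "l \<in> cball l0 1"
        let ?h = "1 / real (Suc n)"
        have "g n l - deriv (\<lambda>z. f z a l) 0 = of_nat (Suc n) * (f (of_real ?h) a l - f 0 a l - of_real ?h * deriv (\<lambda>z. f z a l) 0)"
          by (simp add: g_def algebra_simps del: of_nat_Suc)
        then have "dist (g n l) (deriv (\<lambda>z. f z a l) 0) = real (Suc n) * norm (f (of_real ?h) a l - f 0 a l - of_real ?h * deriv (\<lambda>z. f z a l) 0)"
          by (simp only: dist_norm norm_mult norm_of_nat)
        also have "\<dots> \<le> real (Suc n) * (M * ?h\<^sup>2)" using l by (intro mult_left_mono bound) auto
        also have "\<dots> = M / real (Suc n)" by (simp add: power2_eq_square del: of_nat_Suc)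
        finally show "dist (g n l) (deriv (\<lambda>z. f z a l) 0) < e" using n by simp
      qed
    qed
  qed auto
qed

section \<open>The potential and its model on the half line\<close>

lemma power_le_one_plus_power:
  fixes x :: real
  assumes "0 \<le> x" "k \<le> n"
  shows "x ^ k \<le> (1 + x) ^ n"
proof -
  have "x ^ k \<le> (1 + x) ^ k" using assms by (intro power_mono) auto
  also have "\<dots> \<le> (1 + x) ^ n" using assms by (intro power_increasing) auto
  finally show ?thesis .
qed

lemma one_plus_power_le:
  fixes x :: real
  assumes "0 \<le> x"
  shows "(1 + x) ^ n \<le> 2 ^ n * (x ^ n + 1)"
proof -
  have "(1 + x) ^ n \<le> (2 * max 1 x) ^ n" using assms by (intro power_mono) auto
  also have "\<dots> = 2 ^ n * max 1 x ^ n" by (simp add: power_mult_distrib)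
  also have "\<dots> \<le> 2 ^ n * (x ^ n + 1)" using assms by (intro mult_left_mono) (auto simp: max_def)
  finally show ?thesis .
qed

lemma norm_sum_powers_le:
  fixes c :: "'b \<Rightarrow> complex" and x :: real
  assumes "0 \<le> x" "\<And>i. i \<in> I \<Longrightarrow> k i \<le> n"
  shows "norm (\<Sum>i\<in>I. c i * of_real x ^ k i) \<le> (\<Sum>i\<in>I. norm (c i)) * (1 + x) ^ n"
proof -
  have "norm (\<Sum>i\<in>I. c i * of_real x ^ k i) \<le> (\<Sum>i\<in>I. norm (c i * of_real x ^ k i))" by (rule norm_sum)
  also have "\<dots> \<le> (\<Sum>i\<in>I. norm (c i) * (1 + x) ^ n)"
    using assms power_le_one_plus_power[of x] by (intro sum_mono) (simp add: norm_mult norm_power mult_left_mono)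
  finally show ?thesis by (simp add: sum_distrib_right)
qed

lemma lower_part_bound:
  obtains A where "0 \<le> A" "\<And>x::real. 0 \<le> x \<Longrightarrow> norm (lower_part m a (of_real x)) \<le> A * (1 + x) ^ (m - 1)"
proof
  show "norm (lower_part m a (of_real x)) \<le> (\<Sum>i=1..m-1. norm (a i)) * (1 + x) ^ (m - 1)" if "0 \<le> x" for x :: real
    unfolding lower_part_def using that by (intro norm_sum_powers_le) auto
qed (simp add: sum_nonneg)

text \<open>The parameter \<open>l\<close> enters the polynomial as a constant, so
  \<open>Q1\<close>, \<open>Q2\<close> and their bounds are uniform in \<open>l\<close>.\<close>

lemma Qpoly_derivs:
  assumes m: "3 \<le> m"
  obtains A Q1 Q2 where "0 \<le> A"
    "\<And>l z. (Qpoly m a l has_field_derivative Q1 z) (at z)"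
    "\<And>z. (Q1 has_field_derivative Q2 z) (at z)"
    "\<And>x::real. 0 \<le> x \<Longrightarrow> norm (Q1 (of_real x)) \<le> A * (1 + x) ^ (m - 1)"
    "\<And>x::real. 0 \<le> x \<Longrightarrow> norm (Q2 (of_real x)) \<le> A * (1 + x) ^ (m - 2)"
proof -
  define c where "c = (\<lambda>k. if k = m then 1 else if 1 \<le> k \<and> k < m then a (m - k) else 0)"
  have Q_eq: "Qpoly m a l z = (\<Sum>k\<le>m. c k * z ^ k) + l" for l z
  proof -
    have "lower_part m a z = (\<Sum>k=1..m-1. a (m - k) * z ^ k)"
      unfolding lower_part_def
      by (rule sum.reindex_bij_witness[of _ "\<lambda>k. m - k" "\<lambda>k. m - k"]) auto
    also have "\<dots> = (\<Sum>k<m. c k * z ^ k)"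
      using m by (intro sum.mono_neutral_cong_left) (auto simp: c_def)
    finally show ?thesis by (simp add: Qpoly_def c_def lessThan_Suc_atMost[symmetric])
  qed
  define Q1 where "Q1 = (\<lambda>z. \<Sum>k\<le>m. (c k * of_nat k) * z ^ (k - 1))"
  define Q2 where "Q2 = (\<lambda>z. \<Sum>k\<le>m. (c k * of_nat k * of_nat (k - 1)) * z ^ (k - 2))"
  define A where "A = (\<Sum>k\<le>m. norm (c k * of_nat k)) + (\<Sum>k\<le>m. norm (c k * of_nat k * of_nat (k - 1)))"
  show ?thesis
  proof (rule that[of A Q1 Q2])
    show "(Qpoly m a l has_field_derivative Q1 z) (at z)" for l z
    proof -
      have "((\<lambda>z. \<Sum>k\<le>m. c k * z ^ k) has_field_derivative Q1 z) (at z)"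
        unfolding Q1_def by (rule DERIV_sum) (auto intro!: derivative_eq_intros simp: mult.assoc)
      from DERIV_add[OF this DERIV_const[of l]] show ?thesis by (simp add: Q_eq[abs_def])
    qed
    show "(Q1 has_field_derivative Q2 z) (at z)" for z
      unfolding Q1_def Q2_def
      by (rule DERIV_sum) (auto intro!: derivative_eq_intros simp: mult.assoc numeral_2_eq_2)
    have 0: "0 \<le> (\<Sum>k\<le>m. norm (c k * of_nat k))" "0 \<le> (\<Sum>k\<le>m. norm (c k * of_nat k * of_nat (k - 1)))"
      by (rule sum_nonneg, rule norm_ge_zero)+
    show "0 \<le> A" unfolding A_def by (intro add_nonneg_nonneg 0)
    fix x :: real assume x: "0 \<le> x"
    have "norm (Q1 (of_real x)) \<le> (\<Sum>k\<le>m. norm (c k * of_nat k)) * (1 + x) ^ (m - 1)"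
      unfolding Q1_def using x by (intro norm_sum_powers_le) auto
    also have "\<dots> \<le> A * (1 + x) ^ (m - 1)"
      unfolding A_def using x 0 by (intro mult_right_mono) auto
    finally show "norm (Q1 (of_real x)) \<le> A * (1 + x) ^ (m - 1)" .
    have "norm (Q2 (of_real x)) \<le> (\<Sum>k\<le>m. norm (c k * of_nat k * of_nat (k - 1))) * (1 + x) ^ (m - 2)"
      unfolding Q2_def using x by (intro norm_sum_powers_le) auto
    also have "\<dots> \<le> A * (1 + x) ^ (m - 2)"
      unfolding A_def using x 0 by (intro mult_right_mono) auto
    finally show "norm (Q2 (of_real x)) \<le> A * (1 + x) ^ (m - 2)" .
  qed
qed

lemma lower_part_small:
  assumes m: "1 \<le> m" and \<epsilon>: "0 < \<epsilon>"
  obtains C where "0 \<le> C" "\<And>x::real. 0 \<le> x \<Longrightarrow> norm (lower_part m a (of_real x)) \<le> \<epsilon> * x ^ m + C"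
proof -
  obtain A where A: "0 \<le> A" "\<And>x::real. 0 \<le> x \<Longrightarrow> norm (lower_part m a (of_real x)) \<le> A * (1 + x) ^ (m - 1)"
    using lower_part_bound by blast
  \<comment> \<open>Beyond \<open>x1\<close> one has
    \<open>A (1 + x)^(m-1) \<le> A (2 x)^(m-1) \<le> \<epsilon> x^m\<close>.\<close>
  define x1 where "x1 = max 1 (A * 2 ^ (m - 1) / \<epsilon>)"
  have "norm (lower_part m a (of_real x)) \<le> \<epsilon> * x ^ m + A * (1 + x1) ^ (m - 1)" if x: "0 \<le> x" for x
  proof (cases "x \<le> x1")
    case True
    have "A * (1 + x) ^ (m - 1) \<le> A * (1 + x1) ^ (m - 1)"
      using True x A(1) by (intro mult_left_mono power_mono) auto
    moreover have "0 \<le> \<epsilon> * x ^ m" using \<epsilon> x by simp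
    ultimately show ?thesis using A(2)[OF x] by linarith
  next
    case False
    then have "1 \<le> x" "A * 2 ^ (m - 1) / \<epsilon> \<le> x" by (auto simp: x1_def)
    then have x1: "1 \<le> x" "A * 2 ^ (m - 1) \<le> \<epsilon> * x"
      using \<epsilon> by (simp_all add: pos_divide_le_eq mult.commute)
    have "A * (1 + x) ^ (m - 1) \<le> A * (2 * x) ^ (m - 1)"
      using x1 A(1) by (intro mult_left_mono power_mono) auto
    also have "\<dots> = (A * 2 ^ (m - 1)) * x ^ (m - 1)" by (simp add: power_mult_distrib)
    also have "\<dots> \<le> (\<epsilon> * x) * x ^ (m - 1)" using x1 x by (intro mult_right_mono) auto
    also have "\<dots> = \<epsilon> * x ^ m" using m by (cases m) auto
    finally have "A * (1 + x) ^ (m - 1) \<le> \<epsilon> * x ^ m" .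
    moreover have "0 \<le> A * (1 + x1) ^ (m - 1)" using A(1) by (simp add: x1_def)
    ultimately show ?thesis using A(2)[OF x] by linarith
  qed
  moreover have "0 \<le> A * (1 + x1) ^ (m - 1)" using A(1) by (simp add: x1_def)
  ultimately show ?thesis using that by blast
qed

text \<open>The model potential \<open>x^m + \<mu>\<close> controls the real part of \<open>Q\<close>. It is available on the whole half
  line for \<open>l > 0\<close> (with \<open>\<mu> = l\<close>), and beyond the turning points for other \<open>l\<close> (with \<open>\<mu> = |l|\<close>).\<close>

definition near_model :: "nat \<Rightarrow> (nat \<Rightarrow> complex) \<Rightarrow> complex \<Rightarrow> real \<Rightarrow> real \<Rightarrow> bool" where
  "near_model m a l \<mu> x0 \<longleftrightarrow>
     (\<forall>x\<ge>x0. norm (Qpoly m a l (of_real x) - of_real (x ^ m + \<mu>)) \<le> (x ^ m + \<mu>) / 2)"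

text \<open>The lower part is at most \<open>x^m / 4 + C\<close>, and
  \<open>C \<le> |l| / 4\<close>. For complex \<open>l\<close>, replacing \<open>l\<close> by its
  modulus costs at most \<open>2 |l|\<close>, which is at most \<open>x^m / 8\<close> once
  \<open>x^m \<ge> 16 |l|\<close>.\<close>

lemma near_model_thresholds:
  assumes m: "1 \<le> m"
  obtains \<Lambda> where "1 \<le> \<Lambda>" "\<And>l x0. \<Lambda> \<le> l \<Longrightarrow> 0 \<le> x0 \<Longrightarrow> near_model m a (of_real l) l x0"
    "\<And>l x0. \<Lambda> \<le> norm l \<Longrightarrow> 0 \<le> x0 \<Longrightarrow> 16 * norm l \<le> x0 ^ m \<Longrightarrow> near_model m a l (norm l) x0"
proof -
  obtain C where C: "0 \<le> C" "\<And>x::real. 0 \<le> x \<Longrightarrow> norm (lower_part m a (of_real x)) \<le> 1/4 * x ^ m + C"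
    using lower_part_small[OF m, of "1/4"] by auto
  show ?thesis
  proof (rule that[of "max 1 (4 * C)"])
    fix l x0 :: real assume l: "max 1 (4 * C) \<le> l" and x0: "0 \<le> x0"
    show "near_model m a (of_real l) l x0"
      unfolding near_model_def
    proof (intro allI impI)
      fix x assume "x0 \<le> x"
      then have x: "0 \<le> x" using x0 by simp
      have "Qpoly m a (of_real l) (of_real x) - of_real (x ^ m + l) = lower_part m a (of_real x)"
        by (simp add: Qpoly_def)
      then show "norm (Qpoly m a (of_real l) (of_real x) - of_real (x ^ m + l)) \<le> (x ^ m + l) / 2"
        using C(2)[OF x] l zero_le_power[OF x, of m] by simp
    qed
  next
    fix l :: complex and x0 :: real
    assume l: "max 1 (4 * C) \<le> norm l" and x0: "0 \<le> x0" "16 * norm l \<le> x0 ^ m"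
    show "near_model m a l (norm l) x0"
      unfolding near_model_def
    proof (intro allI impI)
      fix x assume x: "x0 \<le> x"
      then have "x0 ^ m \<le> x ^ m" using x0 by (intro power_mono)
      then have xm: "16 * norm l \<le> x ^ m" using x0 by simp
      have "Qpoly m a l (of_real x) - of_real (x ^ m + norm l) = lower_part m a (of_real x) + (l - of_real (norm l))"
        by (simp add: Qpoly_def)
      then have "norm (Qpoly m a l (of_real x) - of_real (x ^ m + norm l)) \<le> norm (lower_part m a (of_real x)) + norm (l - of_real (norm l))"
        by (simp only: norm_triangle_ineq)
      moreover have "norm (l - of_real (norm l)) \<le> norm l + norm l"
        using norm_triangle_ineq4[of l "of_real (norm l)"] by simp
      moreover have "norm (lower_part m a (of_real x)) \<le> 1/4 * x ^ m + C" using x x0 by (intro C(2)) simp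
      ultimately show "norm (Qpoly m a l (of_real x) - of_real (x ^ m + norm l)) \<le> (x ^ m + norm l) / 2"
        using l xm by simp
    qed
  qed simp
qed

text \<open>The disc around the positive model lies in the right half plane, so principal square and
  fourth roots of the potential are smooth in \<open>x\<close> and have real parts bounded
  below.\<close>

lemma near_model_bounds:
  assumes "near_model m a l \<mu> x0" "0 \<le> x0" "1 \<le> \<mu>" "x0 \<le> x"
  shows "(x ^ m + \<mu>) / 2 \<le> Re (Qpoly m a l (of_real x))"
    and "(x ^ m + \<mu>) / 2 \<le> norm (Qpoly m a l (of_real x))"
    and "norm (Qpoly m a l (of_real x)) \<le> 2 * (x ^ m + \<mu>)"
    and "Qpoly m a l (of_real x) \<noteq> 0"
    and "Qpoly m a l (of_real x) \<notin> \<real>\<^sub>\<le>\<^sub>0"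
    and "sqrt ((x ^ m + \<mu>) / 2) \<le> Re (csqrt (Qpoly m a l (of_real x)))"
    and "1 / 2 \<le> Re (csqrt (csqrt (Qpoly m a l (of_real x))))"
proof -
  let ?Q = "Qpoly m a l (of_real x)" and ?T = "x ^ m + \<mu>"
  have T: "1 \<le> ?T" using assms by (simp add: add_increasing)
  have n: "norm (?Q - of_real ?T) \<le> ?T / 2" using assms(1,4) by (simp add: near_model_def)
  show Re: "?T / 2 \<le> Re ?Q"
    using n abs_Re_le_cmod[of "?Q - of_real ?T"] by simp
  then show no: "?T / 2 \<le> norm ?Q" using complex_Re_le_cmod[of ?Q] by simp
  have "norm (of_real ?T :: complex) = ?T" using T by (simp only: norm_of_real abs_of_nonneg)
  moreover have "b \<le> 2 * t" if "d \<le> t / 2" "b - c \<le> d" "c = t" "1 \<le> t" for b c d t :: real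
    using that by linarith
  ultimately show "norm ?Q \<le> 2 * ?T" using n norm_triangle_ineq2[of ?Q "of_real ?T"] T by blast
  show "?Q \<noteq> 0" using no T by auto
  show "?Q \<notin> \<real>\<^sub>\<le>\<^sub>0" using Re T by (auto simp: complex_nonpos_Reals_iff)
  show R: "sqrt (?T / 2) \<le> Re (csqrt ?Q)"
    unfolding csqrt.simps using Re no by (intro real_sqrt_le_mono) simp
  have s: "sqrt (1 / 4) = 1 / (2::real)" by (simp add: real_sqrt_divide)
  have "sqrt (1 / 4) \<le> sqrt (?T / 2)" using T by (intro real_sqrt_le_mono) simp
  then have R': "1 / 2 \<le> Re (csqrt ?Q)" using R s by linarith
  then have "1 / 4 \<le> (norm (csqrt ?Q) + Re (csqrt ?Q)) / 2"
  proof -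
    have "1 / 4 \<le> (c + r) / 2" if "1 / 2 \<le> r" "r \<le> c" for c r :: real using that by simp
    then show ?thesis using R' complex_Re_le_cmod by blast
  qed
  then have "sqrt (1 / 4) \<le> sqrt ((norm (csqrt ?Q) + Re (csqrt ?Q)) / 2)" by (rule real_sqrt_le_mono)
  then show "1 / 2 \<le> Re (csqrt (csqrt ?Q))" unfolding csqrt.simps(1)[of "csqrt ?Q"] s .
qed

lemma exists_primitive_from:
  fixes q :: "real \<Rightarrow> complex"
  assumes q: "continuous_on {x0..} q"
  obtains S where "S x0 = 0" "\<And>x. x0 \<le> x \<Longrightarrow> (S has_vector_derivative q x) (at x)"
    "\<And>x. x0 \<le> x \<Longrightarrow> S x = integral {x0..x} q"
proof -
  \<comment> \<open>Freezing \<open>q\<close> to the left of \<open>x0\<close> makes the primitive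
    differentiable from both sides at \<open>x0\<close>.\<close>
  define qe where "qe = (\<lambda>x. q (max x0 x))"
  have c: "continuous_on A qe" for A
    unfolding qe_def by (rule continuous_on_compose2[OF q]) (auto intro!: continuous_intros)
  define S where "S = (\<lambda>x. integral {x0 - 1..x} qe - integral {x0 - 1..x0} qe)"
  show ?thesis
  proof (rule that[of S])
    show "S x0 = 0" by (simp add: S_def)
    fix x assume x: "x0 \<le> x"
    have "((\<lambda>u. integral {x0 - 1..u} qe) has_vector_derivative qe x) (at x within {x0 - 1..x + 1})"
      using x by (intro integral_has_vector_derivative c) auto
    then have "((\<lambda>u. integral {x0 - 1..u} qe) has_vector_derivative q x) (at x)"
      using x by (subst (asm) at_within_interior) (auto simp: qe_def max_def)
    from has_vector_derivative_diff[OF this has_vector_derivative_const]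
    show "(S has_vector_derivative q x) (at x)" by (simp add: S_def)
    have "integral {x0 - 1..x0} qe + integral {x0..x} qe = integral {x0 - 1..x} qe"
      using x by (intro Henstock_Kurzweil_Integration.integral_combine integrable_continuous_real c) auto
    moreover have "integral {x0..x} qe = integral {x0..x} q"
      by (rule integral_cong) (simp add: qe_def max_def)
    ultimately show "S x = integral {x0..x} q" by (simp add: S_def algebra_simps)
  qed
qed

lemma near_model_primitive:
  assumes "near_model m a l \<mu> x0" "0 \<le> x0" "1 \<le> \<mu>"
  obtains S where "S x0 = 0" "\<And>x. x0 \<le> x \<Longrightarrow> (S has_vector_derivative csqrt (Qpoly m a l (of_real x))) (at x)"
    "\<And>x. x0 \<le> x \<Longrightarrow> S x = integral {x0..x} (\<lambda>x. csqrt (Qpoly m a l (of_real x)))"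
    "continuous_on {x0..} (\<lambda>x. csqrt (Qpoly m a l (of_real x)))"
proof -
  have c: "continuous_on {x0..} (\<lambda>x. csqrt (Qpoly m a l (of_real x)))"
  proof (rule continuous_on_compose2[OF continuous_on_csqrt])
    show "continuous_on {x0..} (\<lambda>x. Qpoly m a l (of_real x))"
      unfolding Qpoly_def lower_part_def by (intro continuous_intros)
    show "(\<lambda>x. Qpoly m a l (of_real x)) ` {x0..} \<subseteq> - \<real>\<^sub>\<le>\<^sub>0"
      using near_model_bounds(5)[OF assms] by auto
  qed
  from exists_primitive_from[OF c] obtain S where "S x0 = 0" "\<And>x. x0 \<le> x \<Longrightarrow> (S has_vector_derivative csqrt (Qpoly m a l (of_real x))) (at x)"
    "\<And>x. x0 \<le> x \<Longrightarrow> S x = integral {x0..x} (\<lambda>x. csqrt (Qpoly m a l (of_real x)))" by blast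
  then show ?thesis using that c by blast
qed

text \<open>For \<open>k = 1, 2\<close> the \<open>k\<close>-th derivative of the potential is at
  most \<open>K / (1 + x)^k\<close> times the potential, uniformly in \<open>l\<close>; this gives
  \<open>B = K + K^2\<close>. A large threshold for \<open>\<mu>\<close> meets the smallness
  condition of \<open>WKB_estimate\<close>. The term \<open>Q1 / (4 * Q)\<close> in the bound for
  the derivative is absorbed into the constant.\<close>

lemma sibuya_WKB:
  assumes sib: "sibuya_solution m f" and m: "3 \<le> m"
  obtains \<Lambda> B where "1 \<le> \<Lambda>" "0 \<le> B"
    "\<And>l \<mu> x0 x y. \<Lambda> \<le> \<mu> \<Longrightarrow> 0 \<le> x0 \<Longrightarrow> near_model m a l \<mu> x0 \<Longrightarrow> x0 \<le> x \<Longrightarrow> x \<le> y \<Longrightarrow>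
        norm (f (of_real y) a l) \<le> norm (f (of_real x) a l)"
    "\<And>l \<mu> x0. \<Lambda> \<le> \<mu> \<Longrightarrow> 0 \<le> x0 \<Longrightarrow> near_model m a l \<mu> x0 \<Longrightarrow>
        norm (deriv (\<lambda>z. f z a l) (of_real x0) + csqrt (Qpoly m a l (of_real x0)) * f (of_real x0) a l) \<le> B * norm (f (of_real x0) a l)"
    "\<And>l \<mu> x0 S X. \<Lambda> \<le> \<mu> \<Longrightarrow> 0 \<le> x0 \<Longrightarrow> near_model m a l \<mu> x0 \<Longrightarrow> S x0 = 0 \<Longrightarrow>
        (\<And>x. x0 \<le> x \<Longrightarrow> (S has_vector_derivative csqrt (Qpoly m a l (of_real x))) (at x)) \<Longrightarrow> x0 \<le> X \<Longrightarrow>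
        norm (f (of_real X) a l * csqrt (csqrt (Qpoly m a l (of_real X))) * exp (S X)
              - f (of_real x0) a l * csqrt (csqrt (Qpoly m a l (of_real x0))))
        \<le> 1/8 * norm (f (of_real x0) a l * csqrt (csqrt (Qpoly m a l (of_real x0))))"
proof -
  obtain A Q1 Q2 where A: "0 \<le> A"
    and dQ: "\<And>l z. (Qpoly m a l has_field_derivative Q1 z) (at z)"
    and dQ1: "\<And>z. (Q1 has_field_derivative Q2 z) (at z)"
    and Q1: "\<And>x::real. 0 \<le> x \<Longrightarrow> norm (Q1 (of_real x)) \<le> A * (1 + x) ^ (m - 1)"
    and Q2: "\<And>x::real. 0 \<le> x \<Longrightarrow> norm (Q2 (of_real x)) \<le> A * (1 + x) ^ (m - 2)"
    using Qpoly_derivs[OF m] by metis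
  define K where "K = A * 2 ^ (m + 1)"
  define B where "B = K + K\<^sup>2"
  define \<Lambda> where "\<Lambda> = max 1 (2 * (64 * B)\<^sup>2)"
  have K: "0 \<le> K" using A by (simp add: K_def)
  have B: "0 \<le> B" using K by (simp add: B_def)
  have frac: "norm w / norm (Qpoly m a l (of_real x)) \<le> K / (1 + x) ^ (m - k)"
    if "1 \<le> \<mu>" "0 \<le> x0" "near_model m a l \<mu> x0" "x0 \<le> x" "k \<le> m" "norm w \<le> A * (1 + x) ^ k" for l \<mu> x0 x w k
  proof -
    have x: "0 \<le> x" using that by simp
    have "(1 + x) ^ m \<le> 2 ^ m * (x ^ m + 1)" by (rule one_plus_power_le[OF x])
    also have "\<dots> \<le> 2 ^ m * (x ^ m + \<mu>)" using that by (intro mult_left_mono) auto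
    also have "\<dots> = 2 ^ (m + 1) * ((x ^ m + \<mu>) / 2)" by simp
    also have "\<dots> \<le> 2 ^ (m + 1) * norm (Qpoly m a l (of_real x))"
      using near_model_bounds(2)[of m a l \<mu> x0 x] that by (intro mult_left_mono) auto
    finally have le: "(1 + x) ^ m \<le> 2 ^ (m + 1) * norm (Qpoly m a l (of_real x))" .
    have Qp: "norm (Qpoly m a l (of_real x)) > 0" using near_model_bounds(4)[of m a l \<mu> x0 x] that by simp
    have "norm w * (1 + x) ^ (m - k) \<le> A * (1 + x) ^ k * (1 + x) ^ (m - k)"
      using that x by (intro mult_right_mono) auto
    also have "\<dots> = A * (1 + x) ^ m" using that by (simp add: mult.assoc flip: power_add)
    also have "\<dots> \<le> K * norm (Qpoly m a l (of_real x))"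
      using mult_left_mono[OF le A] by (simp add: K_def mult_ac)
    finally show ?thesis using Qp x by (simp add: field_simps)
  qed
  have bd: "norm (Q2 (of_real x)) / norm (Qpoly m a l (of_real x)) + (norm (Q1 (of_real x)) / norm (Qpoly m a l (of_real x)))\<^sup>2 \<le> B / (1 + x)\<^sup>2"
    if h: "1 \<le> \<mu>" "0 \<le> x0" "near_model m a l \<mu> x0" "x0 \<le> x" for l \<mu> x0 x
  proof -
    have x: "0 \<le> x" using h by simp
    have "norm (Q2 (of_real x)) / norm (Qpoly m a l (of_real x)) \<le> K / (1 + x)\<^sup>2"
      using frac[OF h, of "m - 2" "Q2 (of_real x)"] Q2[OF x] m by simp
    moreover have "norm (Q1 (of_real x)) / norm (Qpoly m a l (of_real x)) \<le> K / (1 + x)"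
      using frac[OF h, of "m - 1" "Q1 (of_real x)"] Q1[OF x] m by simp
    then have "(norm (Q1 (of_real x)) / norm (Qpoly m a l (of_real x)))\<^sup>2 \<le> (K / (1 + x))\<^sup>2"
      by (intro power_mono) auto
    ultimately show ?thesis by (simp add: B_def power_divide add_divide_distrib)
  qed
  have small: "64 * B \<le> sqrt (\<mu> / 2)" if "\<Lambda> \<le> \<mu>" for \<mu>
    using that by (intro real_le_rsqrt) (simp add: \<Lambda>_def)
  have \<Lambda>1: "1 \<le> \<Lambda>" by (simp add: \<Lambda>_def)
  show ?thesis
  proof (rule that[of \<Lambda> "3 * B"])
    fix l \<mu> x0 assume h: "\<Lambda> \<le> \<mu>" "0 \<le> x0" "near_model m a l \<mu> x0"
    note W = WKB_estimate[where f = "\<lambda>x. f (of_real x) a l" and f' = "\<lambda>x. deriv (\<lambda>z. f z a l) (of_real x)"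
        and Q = "\<lambda>x. Qpoly m a l (of_real x)"
        and B = B, OF _ _ B sibuya_ode_real(1)[OF sib] sibuya_ode_real(2)[OF sib]
        has_vector_derivative_real_field[OF dQ] has_vector_derivative_real_field[OF dQ1]]
    have \<mu>: "1 \<le> \<mu>" using h \<Lambda>1 by simp
    have n: "\<And>x. x0 \<le> x \<Longrightarrow> norm (Qpoly m a l (of_real x) - of_real (x ^ m + \<mu>)) \<le> (x ^ m + \<mu>) / 2"
      using h(3) by (simp add: near_model_def)
    obtain S where S: "S x0 = 0" "\<And>x. x0 \<le> x \<Longrightarrow> (S has_vector_derivative csqrt (Qpoly m a l (of_real x))) (at x)"
      using near_model_primitive[OF h(3,2) \<mu>] by blast
    note W' = W[OF h(2) \<mu> n bd[OF \<mu> h(2,3)] small[OF h(1)] sibuya_tendsto_0[OF sib]]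
    show "norm (f (of_real y) a l) \<le> norm (f (of_real x) a l)" if "x0 \<le> x" "x \<le> y" for x y
      by (rule W'(1)[where S = S]) (use S that in auto)
    show "norm (deriv (\<lambda>z. f z a l) (of_real x0) + csqrt (Qpoly m a l (of_real x0)) * f (of_real x0) a l) \<le> 3 * B * norm (f (of_real x0) a l)"
    proof -
      let ?d = "deriv (\<lambda>z. f z a l) (of_real x0)" and ?q = "csqrt (Qpoly m a l (of_real x0))" and ?f = "f (of_real x0) a l"
      let ?L = "Q1 (of_real x0) / (4 * Qpoly m a l (of_real x0))"
      have 1: "norm (?d + (?q + ?L) * ?f) \<le> 2 * B * norm ?f"
        by (rule W'(2)[where S = S]) (use S in auto)
      have "norm (Q1 (of_real x0)) / norm (Qpoly m a l (of_real x0)) \<le> K / (1 + x0)"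
        using frac[OF \<mu> h(2,3) order_refl, of "m - 1" "Q1 (of_real x0)"] Q1[OF h(2)] m by simp
      also have "\<dots> \<le> K / 1" using K h(2) by (intro divide_left_mono) auto
      finally have "norm ?L \<le> K" using K by (simp add: norm_divide norm_mult)
      then have "norm ?L \<le> B" by (simp add: B_def add_increasing2)
      then have 2: "norm (?L * ?f) \<le> B * norm ?f" unfolding norm_mult by (intro mult_right_mono) auto
      have "?d + ?q * ?f = (?d + (?q + ?L) * ?f) - ?L * ?f" by (simp add: algebra_simps)
      then have "norm (?d + ?q * ?f) \<le> norm (?d + (?q + ?L) * ?f) + norm (?L * ?f)"
        by (metis norm_triangle_ineq4)
      then show ?thesis using 1 2 by (simp add: algebra_simps)
    qed
    fix S X assume S: "S x0 = 0" "\<And>x. x0 \<le> x \<Longrightarrow> (S has_vector_derivative csqrt (Qpoly m a l (of_real x))) (at x)" and X: "x0 \<le> X"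
    show "norm (f (of_real X) a l * csqrt (csqrt (Qpoly m a l (of_real X))) * exp (S X)
              - f (of_real x0) a l * csqrt (csqrt (Qpoly m a l (of_real x0))))
        \<le> 1/8 * norm (f (of_real x0) a l * csqrt (csqrt (Qpoly m a l (of_real x0))))"
      by (rule W'(3)[where S = S]) (use S X in auto)
  qed (use \<Lambda>1 B in auto)
qed

section \<open>Comparison of two spectral parameters\<close>

lemma csqrt_diff_le:
  assumes "0 < c" "c \<le> Re (csqrt u + csqrt v)"
  shows "norm (csqrt u - csqrt v) \<le> norm (u - v) / c"
proof -
  have le: "c \<le> norm (csqrt u + csqrt v)" using assms complex_Re_le_cmod order_trans by blast
  have "(csqrt u - csqrt v) * (csqrt u + csqrt v) = (csqrt u)\<^sup>2 - (csqrt v)\<^sup>2"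
    by (simp add: power2_eq_square algebra_simps)
  then have "norm (csqrt u - csqrt v) * norm (csqrt u + csqrt v) = norm (u - v)"
    by (simp add: norm_mult[symmetric])
  moreover have "norm (csqrt u - csqrt v) * c \<le> norm (csqrt u - csqrt v) * norm (csqrt u + csqrt v)"
    using le by (intro mult_left_mono) auto
  ultimately show ?thesis using assms(1) by (simp add: field_simps)
qed

text \<open>The potentials differ by the constant \<open>l - l'\<close>, and a difference of square
  roots is the difference of the radicands divided by the sum of the roots. The real part of that
  sum is at least 1 and at least \<open>x^(m/2)\<close>; for \<open>m \<ge> 3\<close> the second
  bound is integrable at infinity.\<close>

lemma near_model_csqrt_diff:
  assumes n1: "near_model m a l \<mu> x0" "1 \<le> \<mu>" and n2: "near_model m a l' \<mu>' x0" "1 \<le> \<mu>'"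
    and x: "0 \<le> x0" "x0 \<le> x"
  shows "norm (csqrt (Qpoly m a l (of_real x)) - csqrt (Qpoly m a l' (of_real x))) \<le> norm (l - l')"
    and "0 < x \<Longrightarrow> norm (csqrt (Qpoly m a l (of_real x)) - csqrt (Qpoly m a l' (of_real x))) \<le> norm (l - l') * x powr (- (real m / 2))"
    and "norm (csqrt (csqrt (Qpoly m a l (of_real x))) - csqrt (csqrt (Qpoly m a l' (of_real x)))) \<le> norm (l - l')"
proof -
  let ?u = "Qpoly m a l (of_real x)" and ?v = "Qpoly m a l' (of_real x)"
  have d: "?u - ?v = l - l'" by (simp add: Qpoly_def)
  have xm: "0 \<le> x ^ m" using x by simp
  have "sqrt (1 / 2) \<le> sqrt ((x ^ m + \<mu>) / 2)" "sqrt (1 / 2) \<le> sqrt ((x ^ m + \<mu>') / 2)"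
    using xm n1 n2 by (intro real_sqrt_le_mono; simp)+
  moreover have "1 / 2 \<le> sqrt (1 / 2)" by (rule real_le_rsqrt) (simp add: power2_eq_square)
  moreover note R = near_model_bounds(6)[OF n1(1) x(1) n1(2) x(2)] near_model_bounds(6)[OF n2(1) x(1) n2(2) x(2)]
  ultimately have "1 \<le> Re (csqrt ?u) + Re (csqrt ?v)" by linarith
  then have s1: "1 \<le> Re (csqrt ?u + csqrt ?v)" unfolding plus_complex.sel .
  from csqrt_diff_le[OF _ s1] show q: "norm (csqrt ?u - csqrt ?v) \<le> norm (l - l')" by (simp add: d)
  show "norm (csqrt ?u - csqrt ?v) \<le> norm (l - l') * x powr (- (real m / 2))" if "0 < x"
  proof -
    let ?c = "x powr (real m / 2)"
    have "?c = sqrt (x ^ m)" using that by (simp add: powr_half_sqrt[symmetric] powr_powr flip: powr_realpow)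
    moreover have "sqrt (x ^ m) \<le> sqrt (x ^ m / 2) + sqrt (x ^ m / 2)"
    proof -
      have "sqrt (x ^ m) \<le> sqrt (4 * (x ^ m / 2))" using xm by (intro real_sqrt_le_mono) simp
      also have "\<dots> = 2 * sqrt (x ^ m / 2)" by (simp only: real_sqrt_mult[of 4] real_sqrt_four)
      finally show ?thesis by simp
    qed
    moreover have "sqrt (x ^ m / 2) \<le> sqrt ((x ^ m + \<mu>) / 2)" "sqrt (x ^ m / 2) \<le> sqrt ((x ^ m + \<mu>') / 2)"
      using n1 n2 by (intro real_sqrt_le_mono; simp)+
    ultimately have "?c \<le> Re (csqrt ?u) + Re (csqrt ?v)" using R by linarith
    then have "?c \<le> Re (csqrt ?u + csqrt ?v)" unfolding plus_complex.sel .
    from csqrt_diff_le[OF _ this] that show ?thesis by (simp add: d powr_minus_divide)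
  qed
  have "1 \<le> Re (csqrt (csqrt ?u)) + Re (csqrt (csqrt ?v))"
    using near_model_bounds(7)[OF n1(1) x(1) n1(2) x(2)] near_model_bounds(7)[OF n2(1) x(1) n2(2) x(2)] by linarith
  then have "1 \<le> Re (csqrt (csqrt ?u) + csqrt (csqrt ?v))" unfolding plus_complex.sel .
  from csqrt_diff_le[OF _ this] q
  show "norm (csqrt (csqrt ?u) - csqrt (csqrt ?v)) \<le> norm (l - l')" by (simp add: d)
qed

text \<open>The fourth roots differ by at most \<open>|l - l'|\<close>, while their moduli tend to
  infinity with \<open>x\<close>.\<close>

lemma near_model_fourth_root_ratio:
  assumes n1: "near_model m a l \<mu> x0" "1 \<le> \<mu>" and n2: "near_model m a l' \<mu>' x0" "1 \<le> \<mu>'"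
    and x0: "0 \<le> x0" and m: "1 \<le> m"
  shows "((\<lambda>x. csqrt (csqrt (Qpoly m a l (of_real x))) / csqrt (csqrt (Qpoly m a l' (of_real x)))) \<longlongrightarrow> 1) at_top"
proof -
  let ?r = "\<lambda>l x. csqrt (csqrt (Qpoly m a l (of_real x)))"
  have lim: "((\<lambda>x. norm (l - l') / sqrt (sqrt (x / 2))) \<longlongrightarrow> 0) at_top" by real_asymp
  have "((\<lambda>x. ?r l x / ?r l' x - 1) \<longlongrightarrow> 0) at_top"
  proof (rule Lim_null_comparison[OF _ lim])
    show "eventually (\<lambda>x. norm (?r l x / ?r l' x - 1) \<le> norm (l - l') / sqrt (sqrt (x / 2))) at_top"
      using eventually_ge_at_top[of "max 1 x0"]
    proof eventually_elim
      case (elim x)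
      then have x: "x0 \<le> x" "1 \<le> x" by auto
      have "x ^ 1 \<le> x ^ m" using x m by (intro power_increasing) auto
      then have "x / 2 \<le> norm (Qpoly m a l' (of_real x))"
        using near_model_bounds(2)[OF n2(1) x0 n2(2) x(1)] n2(2) by simp
      then have r_lo: "sqrt (sqrt (x / 2)) \<le> norm (?r l' x)" by simp
      have pos: "0 < sqrt (sqrt (x / 2))" using x by simp
      then have nz: "?r l' x \<noteq> 0" using r_lo by auto
      have "norm (?r l x / ?r l' x - 1) = norm (?r l x - ?r l' x) / norm (?r l' x)"
        using nz by (simp add: norm_divide[symmetric] diff_divide_distrib del: norm_csqrt)
      also have "\<dots> \<le> norm (l - l') / norm (?r l' x)"
        using near_model_csqrt_diff(3)[OF n1 n2 x0 x(1)] by (intro divide_right_mono) auto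
      also have "\<dots> \<le> norm (l - l') / sqrt (sqrt (x / 2))"
        using r_lo pos nz by (intro divide_left_mono) (auto intro: mult_pos_pos)
      finally show ?case .
    qed
  qed
  from tendsto_add[OF this tendsto_const[of 1]] show ?thesis by simp
qed

text \<open>With \<open>v = f Q^(1/4) exp S\<close> at two parameters, whose quotient has a known limit, the nearly constant
  amplitudes give the quotient of the initial values \<open>w\<close> without computing \<open>lim v\<close>.\<close>

lemma compare_amplitudes:
  fixes v1 v2 s :: "real \<Rightarrow> complex"
  assumes v1: "\<And>X. x0 \<le> X \<Longrightarrow> norm (v1 X - w1) \<le> 1/8 * norm w1"
    and v2: "\<And>X. x0 \<le> X \<Longrightarrow> norm (v2 X - w2) \<le> 1/8 * norm w2"
    and nz: "eventually (\<lambda>X. v1 X \<noteq> 0) at_top" "eventually (\<lambda>X. v2 X \<noteq> 0) at_top"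
    and lim: "((\<lambda>X. v1 X / v2 X * exp (- s X)) \<longlongrightarrow> 1) at_top"
  shows "w1 \<noteq> 0" "w2 \<noteq> 0" "eventually (\<lambda>X. norm (w1 / w2 * exp (- s X) - 1) \<le> 1/2) at_top"
proof -
  have ev: "eventually (\<lambda>X. x0 \<le> X \<and> v1 X \<noteq> 0 \<and> v2 X \<noteq> 0) at_top"
    using nz eventually_ge_at_top[of x0] by (simp add: eventually_conj_iff)
  then obtain X0 where X0: "x0 \<le> X0" "v1 X0 \<noteq> 0" "v2 X0 \<noteq> 0"
    using eventually_happens'[OF trivial_limit_at_top_linorder] by blast
  show w1: "w1 \<noteq> 0" using v1[OF X0(1)] X0(2) by auto
  show w2: "w2 \<noteq> 0" using v2[OF X0(1)] X0(3) by auto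
  have "eventually (\<lambda>X. norm (v1 X / v2 X * exp (- s X) - 1) < 1/100) at_top"
    using tendstoD[OF lim, of "1/100"] by (simp add: dist_norm)
  with ev show "eventually (\<lambda>X. norm (w1 / w2 * exp (- s X) - 1) \<le> 1/2) at_top"
  proof eventually_elim
    case (elim X)
    define G where "G = v1 X / v2 X * exp (- s X)"
    define e1 where "e1 = v1 X / w1"
    define e2 where "e2 = v2 X / w2"
    have e: "norm (e1 - 1) \<le> 1/8" "norm (e2 - 1) \<le> 1/8"
      using v1[of X] v2[of X] elim w1 w2
      by (simp_all add: e1_def e2_def norm_divide divide_simps diff_divide_eq_iff)
    have e10: "e1 \<noteq> 0" using elim w1 by (simp add: e1_def)
    have e1n: "7/8 \<le> norm e1" using norm_triangle_ineq2[of 1 "1 - e1"] e(1) by (simp add: norm_minus_commute)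
    have e2n: "norm e2 \<le> 9/8" using norm_triangle_ineq[of "e2 - 1" 1] e(2) by simp
    have "w1 / w2 * exp (- s X) - 1 = (G * e2 - e1) / e1"
      using elim w1 w2 by (simp add: G_def e1_def e2_def field_simps)
    also have "G * e2 - e1 = (G - 1) * e2 + (e2 - 1) - (e1 - 1)" by (simp add: algebra_simps)
    finally have "norm (w1 / w2 * exp (- s X) - 1) = norm ((G - 1) * e2 + (e2 - 1) - (e1 - 1)) / norm e1"
      by (simp add: norm_divide)
    also have "\<dots> \<le> (1/2 * norm e1) / norm e1"
    proof (rule divide_right_mono)
      have "norm ((G - 1) * e2) \<le> 1/100 * (9/8)"
        unfolding norm_mult using elim e2n by (intro mult_mono) (auto simp: G_def)
      moreover have "norm ((G - 1) * e2 + (e2 - 1) - (e1 - 1)) \<le> norm ((G - 1) * e2) + norm (e2 - 1) + norm (e1 - 1)"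
        by (meson norm_triangle_ineq4 norm_triangle_ineq order_trans add_right_mono)
      ultimately show "norm ((G - 1) * e2 + (e2 - 1) - (e1 - 1)) \<le> 1/2 * norm e1" using e e1n by linarith
    qed simp
    also have "\<dots> = 1/2" using e10 by simp
    finally show ?case .
  qed
qed

text \<open>Up to a controlled factor, the amplitudes \<open>f Q^(1/4)\<close> at \<open>x0\<close>
  for \<open>l\<close> and \<open>\<Lambda>\<close> have as quotient the exponential of the
  difference of the actions. This serves twice: with \<open>x0 = 0\<close> and \<open>l > 0\<close>
  for the precise asymptotics, and with \<open>x0\<close> of order \<open>|l|^(1/m)\<close> for the
  growth bound at complex \<open>l\<close>.\<close>

lemma sibuya_compare:
  assumes sib: "sibuya_solution m f" and m: "3 \<le> m"
  obtains \<Lambda> B where "1 \<le> \<Lambda>" "0 \<le> B"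
    "\<And>l x0. \<Lambda> \<le> l \<Longrightarrow> 0 \<le> x0 \<Longrightarrow> near_model m a (of_real l) l x0"
    "\<And>l x0. \<Lambda> \<le> norm l \<Longrightarrow> 0 \<le> x0 \<Longrightarrow> 16 * norm l \<le> x0 ^ m \<Longrightarrow> near_model m a l (norm l) x0"
    "\<And>l \<mu> x0 x y. \<Lambda> \<le> \<mu> \<Longrightarrow> 0 \<le> x0 \<Longrightarrow> near_model m a l \<mu> x0 \<Longrightarrow> x0 \<le> x \<Longrightarrow> x \<le> y \<Longrightarrow>
        norm (f (of_real y) a l) \<le> norm (f (of_real x) a l)"
    "\<And>l \<mu> x0. \<Lambda> \<le> \<mu> \<Longrightarrow> 0 \<le> x0 \<Longrightarrow> near_model m a l \<mu> x0 \<Longrightarrow>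
        norm (deriv (\<lambda>z. f z a l) (of_real x0) + csqrt (Qpoly m a l (of_real x0)) * f (of_real x0) a l) \<le> B * norm (f (of_real x0) a l)"
    "\<And>l \<mu> x0. \<Lambda> \<le> \<mu> \<Longrightarrow> 0 \<le> x0 \<Longrightarrow> near_model m a l \<mu> x0 \<Longrightarrow>
        f (of_real x0) a l * csqrt (csqrt (Qpoly m a l (of_real x0))) \<noteq> 0 \<and>
        eventually (\<lambda>X. norm (f (of_real x0) a l * csqrt (csqrt (Qpoly m a l (of_real x0)))
             / (f (of_real x0) a (of_real \<Lambda>) * csqrt (csqrt (Qpoly m a (of_real \<Lambda>) (of_real x0))))
             * exp (- integral {x0..X} (\<lambda>x. csqrt (Qpoly m a l (of_real x)) - csqrt (Qpoly m a (of_real \<Lambda>) (of_real x)))) - 1) \<le> 1/2) at_top"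
proof -
  have m1: "1 \<le> m" using m by simp
  from near_model_thresholds[OF m1, of a] obtain \<Lambda>1 where L1: "1 \<le> \<Lambda>1"
    "\<And>l x0. \<Lambda>1 \<le> l \<Longrightarrow> 0 \<le> x0 \<Longrightarrow> near_model m a (of_real l) l x0"
    "\<And>l x0. \<Lambda>1 \<le> norm l \<Longrightarrow> 0 \<le> x0 \<Longrightarrow> 16 * norm l \<le> x0 ^ m \<Longrightarrow> near_model m a l (norm l) x0"
    by blast
  from sibuya_WKB[OF sib m, of a] obtain \<Lambda>2 B where L2: "1 \<le> \<Lambda>2" "0 \<le> B"
    and mono: "\<And>l \<mu> x0 x y. \<Lambda>2 \<le> \<mu> \<Longrightarrow> 0 \<le> x0 \<Longrightarrow> near_model m a l \<mu> x0 \<Longrightarrow> x0 \<le> x \<Longrightarrow> x \<le> y \<Longrightarrow>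
        norm (f (of_real y) a l) \<le> norm (f (of_real x) a l)"
    and der: "\<And>l \<mu> x0. \<Lambda>2 \<le> \<mu> \<Longrightarrow> 0 \<le> x0 \<Longrightarrow> near_model m a l \<mu> x0 \<Longrightarrow>
        norm (deriv (\<lambda>z. f z a l) (of_real x0) + csqrt (Qpoly m a l (of_real x0)) * f (of_real x0) a l) \<le> B * norm (f (of_real x0) a l)"
    and amp: "\<And>l \<mu> x0 S X. \<Lambda>2 \<le> \<mu> \<Longrightarrow> 0 \<le> x0 \<Longrightarrow> near_model m a l \<mu> x0 \<Longrightarrow> S x0 = 0 \<Longrightarrow>
        (\<And>x. x0 \<le> x \<Longrightarrow> (S has_vector_derivative csqrt (Qpoly m a l (of_real x))) (at x)) \<Longrightarrow> x0 \<le> X \<Longrightarrow>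
        norm (f (of_real X) a l * csqrt (csqrt (Qpoly m a l (of_real X))) * exp (S X)
              - f (of_real x0) a l * csqrt (csqrt (Qpoly m a l (of_real x0))))
        \<le> 1/8 * norm (f (of_real x0) a l * csqrt (csqrt (Qpoly m a l (of_real x0))))"
    by blast
  define \<Lambda> where "\<Lambda> = max \<Lambda>1 \<Lambda>2"
  have L: "1 \<le> \<Lambda>" "\<Lambda>1 \<le> \<Lambda>" "\<Lambda>2 \<le> \<Lambda>" using L1 L2 by (auto simp: \<Lambda>_def)
  show ?thesis
  proof (rule that[of \<Lambda> B])
    fix l \<mu> x0 assume h: "\<Lambda> \<le> \<mu>" "0 \<le> x0" "near_model m a l \<mu> x0"
    have \<mu>: "1 \<le> \<mu>" "\<Lambda>2 \<le> \<mu>" using h L by auto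
    have n2: "near_model m a (of_real \<Lambda>) \<Lambda> x0" using L h by (intro L1) auto
    let ?r = "\<lambda>l x. csqrt (csqrt (Qpoly m a l (of_real x)))"
    obtain S1 where S1: "S1 x0 = 0" "\<And>x. x0 \<le> x \<Longrightarrow> (S1 has_vector_derivative csqrt (Qpoly m a l (of_real x))) (at x)"
      "\<And>x. x0 \<le> x \<Longrightarrow> S1 x = integral {x0..x} (\<lambda>x. csqrt (Qpoly m a l (of_real x)))"
      "continuous_on {x0..} (\<lambda>x. csqrt (Qpoly m a l (of_real x)))"
      using near_model_primitive[OF h(3,2) \<mu>(1)] by blast
    obtain S2 where S2: "S2 x0 = 0" "\<And>x. x0 \<le> x \<Longrightarrow> (S2 has_vector_derivative csqrt (Qpoly m a (of_real \<Lambda>) (of_real x))) (at x)"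
      "\<And>x. x0 \<le> x \<Longrightarrow> S2 x = integral {x0..x} (\<lambda>x. csqrt (Qpoly m a (of_real \<Lambda>) (of_real x)))"
      "continuous_on {x0..} (\<lambda>x. csqrt (Qpoly m a (of_real \<Lambda>) (of_real x)))"
      using near_model_primitive[OF n2 h(2) L(1)] by blast
    define v1 where "v1 = (\<lambda>X. f (of_real X) a l * ?r l X * exp (S1 X))"
    define v2 where "v2 = (\<lambda>X. f (of_real X) a (of_real \<Lambda>) * ?r (of_real \<Lambda>) X * exp (S2 X))"
    have nz: "eventually (\<lambda>X. v1 X \<noteq> 0) at_top"
      using sibuya_eventually_nonzero[OF sib, of a l] eventually_ge_at_top[of x0]
      by eventually_elim (use near_model_bounds(4)[OF h(3,2) \<mu>(1)] in \<open>simp add: v1_def\<close>)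
    have nz2: "eventually (\<lambda>X. v2 X \<noteq> 0) at_top"
      using sibuya_eventually_nonzero[OF sib, of a "of_real \<Lambda>"] eventually_ge_at_top[of x0]
      by eventually_elim (use near_model_bounds(4)[OF n2 h(2) L(1)] in \<open>simp add: v2_def\<close>)
    have lim: "((\<lambda>X. v1 X / v2 X * exp (- (S1 X - S2 X))) \<longlongrightarrow> 1) at_top"
    proof -
      have "((\<lambda>X. (f (of_real X) a l / f (of_real X) a (of_real \<Lambda>)) * (?r l X / ?r (of_real \<Lambda>) X)) \<longlongrightarrow> 1 * 1) at_top"
        using near_model_fourth_root_ratio[OF h(3) \<mu>(1) n2 L(1) h(2)] m
        by (intro tendsto_mult sibuya_ratio_lambda[OF sib]) auto
      moreover have "(f (of_real X) a l / f (of_real X) a (of_real \<Lambda>)) * (?r l X / ?r (of_real \<Lambda>) X) = v1 X / v2 X * exp (- (S1 X - S2 X))" for X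
        by (simp add: v1_def v2_def exp_diff)
      ultimately show ?thesis by simp
    qed
    have a1: "norm (v1 X - f (of_real x0) a l * ?r l x0) \<le> 1/8 * norm (f (of_real x0) a l * ?r l x0)" if "x0 \<le> X" for X
      unfolding v1_def by (rule amp[OF \<mu>(2) h(2,3) S1(1,2) that])
    have a2: "norm (v2 X - f (of_real x0) a (of_real \<Lambda>) * ?r (of_real \<Lambda>) x0) \<le> 1/8 * norm (f (of_real x0) a (of_real \<Lambda>) * ?r (of_real \<Lambda>) x0)" if "x0 \<le> X" for X
      unfolding v2_def by (rule amp[OF L(3) h(2) n2 S2(1,2) that])
    note c = compare_amplitudes(1,3)[OF a1 a2 nz nz2 lim]
    have e: "eventually (\<lambda>X. S1 X - S2 X = integral {x0..X} (\<lambda>x. csqrt (Qpoly m a l (of_real x)) - csqrt (Qpoly m a (of_real \<Lambda>) (of_real x)))) at_top"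
      using eventually_ge_at_top[of x0]
    proof eventually_elim
      case (elim X)
      have "(\<lambda>x. csqrt (Qpoly m a l (of_real x))) integrable_on {x0..X}" "(\<lambda>x. csqrt (Qpoly m a (of_real \<Lambda>) (of_real x))) integrable_on {x0..X}"
        by (rule integrable_continuous_real, rule continuous_on_subset[OF S1(4)], force,
            rule integrable_continuous_real, rule continuous_on_subset[OF S2(4)], force)
      then show ?case using elim S1(3) S2(3) by (simp add: integral_diff)
    qed
    define w1 where "w1 = f (of_real x0) a l * ?r l x0"
    define w2 where "w2 = f (of_real x0) a (of_real \<Lambda>) * ?r (of_real \<Lambda>) x0"
    define I where "I = (\<lambda>X. integral {x0..X} (\<lambda>x. csqrt (Qpoly m a l (of_real x)) - csqrt (Qpoly m a (of_real \<Lambda>) (of_real x))))"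
    have "eventually (\<lambda>X. norm (w1 / w2 * exp (- (S1 X - S2 X)) - 1) \<le> 1/2) at_top"
      unfolding w1_def w2_def by (rule c(2))
    moreover have "eventually (\<lambda>X. S1 X - S2 X = I X) at_top" unfolding I_def by (rule e)
    ultimately have "eventually (\<lambda>X. norm (w1 / w2 * exp (- I X) - 1) \<le> 1/2) at_top"
      by eventually_elim simp
    then have "eventually (\<lambda>X. norm (f (of_real x0) a l * ?r l x0 / (f (of_real x0) a (of_real \<Lambda>) * ?r (of_real \<Lambda>) x0) * exp (- integral {x0..X} (\<lambda>x. csqrt (Qpoly m a l (of_real x)) - csqrt (Qpoly m a (of_real \<Lambda>) (of_real x)))) - 1) \<le> 1/2) at_top"
      unfolding w1_def w2_def I_def .
    with c(1) show "f (of_real x0) a l * csqrt (csqrt (Qpoly m a l (of_real x0))) \<noteq> 0 \<and>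
        eventually (\<lambda>X. norm (f (of_real x0) a l * csqrt (csqrt (Qpoly m a l (of_real x0)))
             / (f (of_real x0) a (of_real \<Lambda>) * csqrt (csqrt (Qpoly m a (of_real \<Lambda>) (of_real x0))))
             * exp (- integral {x0..X} (\<lambda>x. csqrt (Qpoly m a l (of_real x)) - csqrt (Qpoly m a (of_real \<Lambda>) (of_real x)))) - 1) \<le> 1/2) at_top"
      by blast
    show "norm (f (of_real y) a l) \<le> norm (f (of_real x) a l)" if "x0 \<le> x" "x \<le> y" for x y
      by (rule mono[OF \<mu>(2) h(2,3) that])
    show "norm (deriv (\<lambda>z. f z a l) (of_real x0) + csqrt (Qpoly m a l (of_real x0)) * f (of_real x0) a l) \<le> B * norm (f (of_real x0) a l)"
      by (rule der[OF \<mu>(2) h(2,3)])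
  next
    show "near_model m a (of_real l) l x0" if "\<Lambda> \<le> l" "0 \<le> x0" for l x0
      using that L by (intro L1) auto
    show "near_model m a l (norm l) x0" if "\<Lambda> \<le> norm l" "0 \<le> x0" "16 * norm l \<le> x0 ^ m" for l x0
      using that L by (intro L1) auto
  qed (use L L2 in auto)
qed

text \<open>Gronwall's inequality run towards 0. The weight \<open>L\<close> balances the energy:
  for \<open>|Q| \<le> K * L\<close> both terms of its derivative are at most a multiple of
  \<open>sqrt L\<close> times the energy.\<close>

lemma backward_growth:
  fixes u u' Q :: "real \<Rightarrow> complex"
  assumes x0: "0 \<le> x0" and L: "0 < L"
    and u: "\<And>x. 0 \<le> x \<Longrightarrow> x \<le> x0 \<Longrightarrow> (u has_vector_derivative u' x) (at x)"
    and u': "\<And>x. 0 \<le> x \<Longrightarrow> x \<le> x0 \<Longrightarrow> (u' has_vector_derivative Q x * u x) (at x)"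
    and Q: "\<And>x. 0 \<le> x \<Longrightarrow> x \<le> x0 \<Longrightarrow> norm (Q x) \<le> K * L"
  shows "L * (norm (u 0))\<^sup>2 + (norm (u' 0))\<^sup>2
       \<le> (L * (norm (u x0))\<^sup>2 + (norm (u' x0))\<^sup>2) * exp ((1 + K) * sqrt L * x0)"
proof -
  define k where "k = (1 + K) * sqrt L"
  define N where "N = (\<lambda>x. L * inner (u x) (u x) + inner (u' x) (u' x))"
  define N' where "N' = (\<lambda>x. L * (2 * inner (u x) (u' x)) + 2 * inner (u' x) (Q x * u x))"
  have dN: "(N has_real_derivative N' x) (at x)" if "0 \<le> x" "x \<le> x0" for x
    using DERIV_add[OF DERIV_cmult[of _ "2 * inner (u x) (u' x)" _ _ L] ,
        of "\<lambda>x. inner (u x) (u x)" x UNIV "\<lambda>x. inner (u' x) (u' x)" "2 * inner (u' x) (Q x * u x)"]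
      bounded_bilinear.has_vector_derivative[OF bounded_bilinear_inner u[OF that] u[OF that]]
      bounded_bilinear.has_vector_derivative[OF bounded_bilinear_inner u'[OF that] u'[OF that]]
    by (simp add: N_def N'_def has_real_derivative_iff_has_vector_derivative inner_commute)
  have le: "- N' x \<le> k * N x" if x: "0 \<le> x" "x \<le> x0" for x
  proof -
    let ?a = "norm (u x)" and ?b = "norm (u' x)"
    have 1: "- inner (u x) (u' x) \<le> ?a * ?b" using norm_cauchy_schwarz[of "- u x" "u' x"] by simp
    have "- inner (u' x) (Q x * u x) \<le> ?b * norm (Q x * u x)" using norm_cauchy_schwarz[of "- u' x" "Q x * u x"] by simp
    also have "\<dots> \<le> ?b * (K * L * ?a)" unfolding norm_mult using Q[OF x] by (intro mult_left_mono mult_right_mono) auto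
    finally have 2: "- inner (u' x) (Q x * u x) \<le> K * L * (?a * ?b)" by (simp add: mult_ac)
    have "- N' x = 2 * L * (- inner (u x) (u' x)) + 2 * (- inner (u' x) (Q x * u x))" by (simp add: N'_def)
    also have "\<dots> \<le> 2 * L * (?a * ?b) + 2 * (K * L * (?a * ?b))"
      using 1 2 L by (intro add_mono mult_left_mono) auto
    also have "\<dots> = (1 + K) * (2 * L * (?a * ?b))" by (simp add: algebra_simps)
    also have "\<dots> \<le> (1 + K) * (sqrt L * (L * ?a\<^sup>2 + ?b\<^sup>2))"
    proof (rule mult_left_mono)
      have "0 \<le> (sqrt L * ?a - ?b)\<^sup>2" by simp
      then have "2 * (sqrt L * ?a * ?b) \<le> L * ?a\<^sup>2 + ?b\<^sup>2"
        using L by (simp add: power2_diff power_mult_distrib)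
      then have "sqrt L * (2 * (sqrt L * ?a * ?b)) \<le> sqrt L * (L * ?a\<^sup>2 + ?b\<^sup>2)"
        using L by (intro mult_left_mono) auto
      moreover have "sqrt L * (2 * (sqrt L * ?a * ?b)) = 2 * (sqrt L * sqrt L) * (?a * ?b)" by (simp add: mult_ac)
      ultimately show "2 * L * (?a * ?b) \<le> sqrt L * (L * ?a\<^sup>2 + ?b\<^sup>2)" using L by simp
      have "0 \<le> K * L" using Q[of x0] x0 norm_ge_zero[of "Q x0"] order_trans by blast
      then show "0 \<le> 1 + K" using L by (simp add: zero_le_mult_iff)
    qed
    finally show ?thesis by (simp add: k_def N_def power2_norm_eq_inner mult_ac)
  qed
  have "N 0 * exp (k * 0) \<le> N x0 * exp (k * x0)"
  proof (rule DERIV_nonneg_imp_nondecreasing[OF x0])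
    fix x assume x: "0 \<le> x" "x \<le> x0"
    have "((\<lambda>x. N x * exp (k * x)) has_real_derivative (N' x + k * N x) * exp (k * x)) (at x)"
      by (auto intro!: derivative_eq_intros dN x simp: algebra_simps)
    moreover have "0 \<le> (N' x + k * N x) * exp (k * x)" using le[OF x] by simp
    ultimately show "\<exists>y. ((\<lambda>x. N x * exp (k * x)) has_real_derivative y) (at x) \<and> 0 \<le> y" by blast
  qed
  then show ?thesis by (simp add: N_def k_def power2_norm_eq_inner)
qed

text \<open>Beyond \<open>x0 = (16 |l|)^(1/m)\<close> the model applies and the difference of
  actions is \<open>O(|l|^\<rho>)\<close>. From \<open>x0\<close> back to 0 the energy grows at most
  by the exponential of a multiple of \<open>sqrt |l| x0\<close>, which is again of order
  \<open>|l|^\<rho>\<close>.\<close>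

lemma sibuya_growth_large:
  assumes sib: "sibuya_solution m f" and m: "3 \<le> m"
  obtains \<Lambda> C where "1 \<le> \<Lambda>" "0 \<le> C"
    "\<And>l. \<Lambda> \<le> norm l \<Longrightarrow> (norm (f 0 a l))\<^sup>2 + (norm (deriv (\<lambda>z. f z a l) 0))\<^sup>2 \<le> exp (C * norm l powr (1/2 + 1 / real m))"
proof -
  from sibuya_compare[OF sib m, of a] obtain \<Lambda> B where L: "1 \<le> \<Lambda>" and B: "0 \<le> B"
    and n1: "\<And>l x0. \<Lambda> \<le> l \<Longrightarrow> 0 \<le> x0 \<Longrightarrow> near_model m a (of_real l) l x0"
    and n2: "\<And>l x0. \<Lambda> \<le> norm l \<Longrightarrow> 0 \<le> x0 \<Longrightarrow> 16 * norm l \<le> x0 ^ m \<Longrightarrow> near_model m a l (norm l) x0"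
    and mono: "\<And>l \<mu> x0 x y. \<Lambda> \<le> \<mu> \<Longrightarrow> 0 \<le> x0 \<Longrightarrow> near_model m a l \<mu> x0 \<Longrightarrow> x0 \<le> x \<Longrightarrow> x \<le> y \<Longrightarrow>
        norm (f (of_real y) a l) \<le> norm (f (of_real x) a l)"
    and der: "\<And>l \<mu> x0. \<Lambda> \<le> \<mu> \<Longrightarrow> 0 \<le> x0 \<Longrightarrow> near_model m a l \<mu> x0 \<Longrightarrow>
        norm (deriv (\<lambda>z. f z a l) (of_real x0) + csqrt (Qpoly m a l (of_real x0)) * f (of_real x0) a l) \<le> B * norm (f (of_real x0) a l)"
    and cmp: "\<And>l \<mu> x0. \<Lambda> \<le> \<mu> \<Longrightarrow> 0 \<le> x0 \<Longrightarrow> near_model m a l \<mu> x0 \<Longrightarrow>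
        f (of_real x0) a l * csqrt (csqrt (Qpoly m a l (of_real x0))) \<noteq> 0 \<and>
        eventually (\<lambda>X. norm (f (of_real x0) a l * csqrt (csqrt (Qpoly m a l (of_real x0)))
             / (f (of_real x0) a (of_real \<Lambda>) * csqrt (csqrt (Qpoly m a (of_real \<Lambda>) (of_real x0))))
             * exp (- integral {x0..X} (\<lambda>x. csqrt (Qpoly m a l (of_real x)) - csqrt (Qpoly m a (of_real \<Lambda>) (of_real x)))) - 1) \<le> 1/2) at_top"
    by blast
  define \<rho> where "\<rho> = 1/2 + 1 / real m"
  obtain A where A: "0 \<le> A" "\<And>x::real. 0 \<le> x \<Longrightarrow> norm (lower_part m a (of_real x)) \<le> A * (1 + x) ^ (m - 1)"
    using lower_part_bound by blast
  define K where "K = A * 2 ^ m * 17 + 17"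
  define F where "F = norm (f 0 a (of_real \<Lambda>))"
  define C1 where "C1 = 102 * F"
  define C2 where "C2 = C1\<^sup>2 + ((34 + B) * C1)\<^sup>2"
  define C where "C = C2 + 16 + 16 * (1 + K)"
  have K: "0 \<le> K" using A by (simp add: K_def)
  have C2: "0 \<le> C2" by (simp add: C2_def)
  show ?thesis
  proof (rule that[of \<Lambda> C])
    show "0 \<le> C" using C2 K by (simp add: C_def)
    fix l :: complex assume l: "\<Lambda> \<le> norm l"
    define M where "M = norm l"
    have M: "1 \<le> M" "\<Lambda> \<le> M" using l L by (auto simp: M_def)
    define x0 where "x0 = (16 * M) powr (1 / real m)"
    have x0m: "x0 ^ m = 16 * M" using M m by (simp add: x0_def powr_power)
    have x01: "1 \<le> x0" unfolding x0_def using M by (intro ge_one_powr_ge_zero) auto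
    have x0: "0 \<le> x0" "0 < x0" using x01 by auto
    have nl: "near_model m a l M x0" unfolding M_def by (rule n2) (use l x0 x0m in \<open>auto simp: M_def\<close>)
    have nL: "near_model m a (of_real \<Lambda>) \<Lambda> x0" using x0 by (intro n1) auto
    let ?q = "\<lambda>l x. csqrt (Qpoly m a l (of_real x))"
    let ?y = "M powr \<rho>"
    have x0_sqrt: "sqrt M * x0 \<le> 16 * ?y"
    proof -
      have "16 powr (1 / real m) \<le> 16 powr (1::real)" using m by (intro powr_mono) auto
      then have "x0 \<le> 16 * M powr (1 / real m)"
        using M unfolding x0_def by (subst powr_mult) (auto intro: mult_right_mono)
      then have "sqrt M * x0 \<le> sqrt M * (16 * M powr (1 / real m))" using M by (intro mult_left_mono) auto
      also have "\<dots> = 16 * ?y" using M by (simp add: powr_half_sqrt[symmetric] powr_add[symmetric] \<rho>_def)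
      finally show ?thesis .
    qed
    have y1: "1 \<le> ?y" using M by (intro ge_one_powr_ge_zero) (auto simp: \<rho>_def)
    have s_bound: "norm (integral {x0..X} (\<lambda>x. ?q l x - ?q (of_real \<Lambda>) x)) \<le> 4 * ?y" if X: "x0 \<le> X" for X
    proof -
      have c: "continuous_on {x0..} (\<lambda>x. ?q l x - ?q (of_real \<Lambda>) x)"
      proof (rule continuous_on_diff)
        show "continuous_on {x0..} (?q l)" using near_model_primitive[OF nl x0(1) M(1)] by blast
        show "continuous_on {x0..} (?q (of_real \<Lambda>))" using near_model_primitive[OF nL x0(1) L] by blast
      qed
      obtain S where S: "S x0 = 0" "\<And>x. x0 \<le> x \<Longrightarrow> (S has_vector_derivative ?q l x - ?q (of_real \<Lambda>) x) (at x)"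
        "\<And>x. x0 \<le> x \<Longrightarrow> S x = integral {x0..x} (\<lambda>x. ?q l x - ?q (of_real \<Lambda>) x)"
        using exists_primitive_from[OF c] by blast
      \<comment> \<open>The integral of \<open>x^(-m/2)\<close> over \<open>x \<ge> x0\<close> is
        \<open>x0^(-e) / e\<close> with \<open>e \<ge> 1/2\<close>, and
        \<open>M x0^(-e) \<le> M^(1 - e/m) = M^\<rho>\<close>.\<close>
      define e where "e = real m / 2 - 1"
      have e: "1/2 \<le> e" using m by (simp add: e_def)
      define g where "g = (\<lambda>x. - (2 * M / e) * x powr (- e))"
      have "norm (S X - S x0) \<le> g X - g x0"
      proof (rule norm_diff_le_of_deriv_le[OF X])
        fix x assume x: "x0 \<le> x" "x \<le> X"
        then have xp: "0 < x" using x0 by simp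
        show "(S has_vector_derivative ?q l x - ?q (of_real \<Lambda>) x) (at x)" by (rule S(2)[OF x(1)])
        show "(g has_real_derivative 2 * M * x powr (- (real m / 2))) (at x)"
        proof -
          have "((\<lambda>x. x powr (- e)) has_real_derivative (- e) * x powr (- e - 1)) (at x)"
            by (rule has_real_derivative_powr[OF xp])
          from DERIV_cmult[OF this, of "- (2 * M / e)"]
          have "(g has_real_derivative - (2 * M / e) * ((- e) * x powr (- e - 1))) (at x)" by (simp add: g_def)
          moreover have "- e - 1 = - (real m / 2)" by (simp add: e_def)
          moreover have "- (2 * M / e) * ((- e) * z) = 2 * M * z" for z using e by simp
          ultimately show ?thesis by metis
        qed
        have "norm (l - of_real \<Lambda>) \<le> 2 * M"
          using norm_triangle_ineq4[of l "of_real \<Lambda>"] M L by (simp add: M_def)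
        then have "norm (l - of_real \<Lambda>) * x powr (- (real m / 2)) \<le> 2 * M * x powr (- (real m / 2))"
          by (intro mult_right_mono) auto
        then show "norm (?q l x - ?q (of_real \<Lambda>) x) \<le> 2 * M * x powr (- (real m / 2))"
          using near_model_csqrt_diff(2)[OF nl M(1) nL L x0(1) x(1) xp] by simp
      qed
      also have "\<dots> \<le> 2 * M / e * x0 powr (- e)" using M e by (simp add: g_def)
      also have "\<dots> \<le> 4 * M * x0 powr (- e)"
      proof (rule mult_right_mono)
        have "2 * M * 1 \<le> 2 * M * (2 * e)" using M e by (intro mult_left_mono) auto
        then show "2 * M / e \<le> 4 * M" using e by (simp add: field_simps)
      qed auto
      also have "x0 powr (- e) \<le> M powr (- e / real m)"
      proof -
        have "x0 powr (- e) = (16 * M) powr (- e / real m)" by (simp add: x0_def powr_powr)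
        also have "\<dots> \<le> M powr (- e / real m)" using M e m by (intro powr_mono2') (auto simp: divide_nonpos_nonneg)
        finally show ?thesis .
      qed
      then have "4 * M * x0 powr (- e) \<le> 4 * M * M powr (- e / real m)" using M by (intro mult_left_mono) auto
      also have "\<dots> = 4 * ?y"
      proof -
        have "1 + - e / real m = \<rho>" using m by (simp add: e_def \<rho>_def field_simps)
        moreover have "M * M powr z = M powr (1 + z)" for z using M by (simp add: powr_add)
        ultimately show ?thesis by (metis mult.assoc)
      qed
      finally show ?thesis using S(1) S(3)[OF X] by simp
    qed
    let ?r = "\<lambda>l x. csqrt (?q l x)"
    let ?w1 = "f (of_real x0) a l * ?r l x0" and ?w2 = "f (of_real x0) a (of_real \<Lambda>) * ?r (of_real \<Lambda>) x0"
    have Q_le: "norm (Qpoly m a l (of_real x0)) \<le> 34 * M" "norm (Qpoly m a (of_real \<Lambda>) (of_real x0)) \<le> 34 * M"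
      using near_model_bounds(3)[OF nl x0(1) M(1) order_refl] near_model_bounds(3)[OF nL x0(1) L order_refl] x0m M by auto
    have sqrt_le: "sqrt y \<le> max 1 y" if "0 \<le> y" for y :: real
    proof (cases "1 \<le> y")
      case True
      then have "y * 1 \<le> y * y" by (intro mult_left_mono) auto
      then have "sqrt y \<le> y" using True by (intro real_le_lsqrt) (auto simp: power2_eq_square)
      then show ?thesis by simp
    qed (use that in auto)
    have "eventually (\<lambda>X. x0 \<le> X \<and> norm (?w1 / ?w2 * exp (- integral {x0..X} (\<lambda>x. ?q l x - ?q (of_real \<Lambda>) x)) - 1) \<le> 1/2) at_top"
      using cmp[OF M(2) x0(1) nl] eventually_ge_at_top[of x0] by (simp add: eventually_conj_iff)
    then obtain X where X: "x0 \<le> X" "norm (?w1 / ?w2 * exp (- integral {x0..X} (\<lambda>x. ?q l x - ?q (of_real \<Lambda>) x)) - 1) \<le> 1/2"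
      using eventually_happens'[OF trivial_limit_at_top_linorder] by blast
    define I where "I = integral {x0..X} (\<lambda>x. ?q l x - ?q (of_real \<Lambda>) x)"
    have w2: "?w2 \<noteq> 0" using cmp[OF order_refl x0(1) nL] by blast
    define W where "W = ?w1 / ?w2"
    have "norm (W * exp (- I) - 1) \<le> 1/2" unfolding W_def I_def by (rule X(2))
    then have "norm (W * exp (- I)) \<le> 3/2"
      using norm_triangle_ineq2[of "W * exp (- I)" 1] by simp
    then have "norm W * exp (- Re I) \<le> 3/2" by (simp add: norm_mult norm_exp_eq_Re)
    then have "norm W \<le> 3/2 * exp (Re I)" by (simp add: exp_minus field_simps)
    then have "norm (?w1 / ?w2) \<le> 3/2 * exp (Re I)" unfolding W_def .
    also have "\<dots> \<le> 3/2 * exp (4 * ?y)"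
      using s_bound[OF X(1)] abs_Re_le_cmod[of I] by (auto simp: I_def)
    finally have w: "norm ?w1 \<le> 3/2 * exp (4 * ?y) * norm ?w2"
      using w2 by (simp add: norm_divide field_simps del: norm_csqrt)
    have r2: "norm (?r (of_real \<Lambda>) x0) \<le> 34 * M"
    proof -
      have "norm (?r (of_real \<Lambda>) x0) \<le> max 1 (sqrt (norm (Qpoly m a (of_real \<Lambda>) (of_real x0))))"
        using sqrt_le[of "sqrt (norm (Qpoly m a (of_real \<Lambda>) (of_real x0)))"] by simp
      also have "\<dots> \<le> max 1 (max 1 (norm (Qpoly m a (of_real \<Lambda>) (of_real x0))))"
        using sqrt_le[of "norm (Qpoly m a (of_real \<Lambda>) (of_real x0))"] by auto
      also have "\<dots> \<le> 34 * M" using Q_le M by auto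
      finally show ?thesis .
    qed
    \<comment> \<open>At the real parameter \<open>\<Lambda>\<close> the model holds from 0 on, so
      \<open>|f|\<close> is decreasing and its value at 0 serves for every
      \<open>x0\<close>.\<close>
    have "norm (f (of_real x0) a (of_real \<Lambda>)) \<le> F"
      using mono[OF order_refl _ n1[OF order_refl], of 0 0 x0] x0 by (simp add: F_def)
    then have w2': "norm ?w2 \<le> F * (34 * M)" unfolding norm_mult using r2 by (intro mult_mono) (auto simp: F_def)
    have r1: "1/2 \<le> norm (?r l x0)"
      using near_model_bounds(7)[OF nl x0(1) M(1) order_refl] complex_Re_le_cmod order_trans by blast
    have "norm (f (of_real x0) a l) * (1/2) \<le> norm ?w1"
      unfolding norm_mult by (rule mult_left_mono[OF r1]) simp
    also have "\<dots> \<le> 3/2 * exp (4 * ?y) * (F * (34 * M))" using w w2' by (elim order_trans) (intro mult_left_mono; simp)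
    finally have fb: "norm (f (of_real x0) a l) \<le> C1 * M * exp (4 * ?y)" by (simp add: C1_def)
    let ?E = "exp (4 * ?y)"
    have F0: "0 \<le> C1" by (simp add: C1_def F_def)
    have "norm (deriv (\<lambda>z. f z a l) (of_real x0)) \<le> norm (?q l x0 * f (of_real x0) a l) + B * norm (f (of_real x0) a l)"
      using der[OF M(2) x0(1) nl] norm_triangle_ineq4[of "deriv (\<lambda>z. f z a l) (of_real x0) + ?q l x0 * f (of_real x0) a l" "?q l x0 * f (of_real x0) a l"]
      by simp
    also have "\<dots> = (norm (?q l x0) + B) * norm (f (of_real x0) a l)" by (simp add: norm_mult algebra_simps)
    also have "\<dots> \<le> ((34 + B) * M) * (C1 * M * ?E)"
    proof (rule mult_mono)
      have "norm (?q l x0) \<le> 34 * M" using sqrt_le[of "norm (Qpoly m a l (of_real x0))"] Q_le M by auto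
      moreover have "B * 1 \<le> B * M" using B M by (intro mult_left_mono) auto
      ultimately show "norm (?q l x0) + B \<le> (34 + B) * M" by (simp add: algebra_simps)
    qed (use fb B M in auto)
    finally have db: "norm (deriv (\<lambda>z. f z a l) (of_real x0)) \<le> (34 + B) * C1 * M ^ 2 * ?E" by (simp add: power2_eq_square mult_ac)
    let ?N = "M * (norm (f (of_real x0) a l))\<^sup>2 + (norm (deriv (\<lambda>z. f z a l) (of_real x0)))\<^sup>2"
    have N: "?N \<le> C2 * M ^ 4 * exp (8 * ?y)"
    proof -
      have "M * (norm (f (of_real x0) a l))\<^sup>2 \<le> M ^ 2 * (C1 * M * ?E)\<^sup>2"
        using fb M by (intro mult_mono power_mono) (auto simp: power2_eq_square)
      moreover have "(norm (deriv (\<lambda>z. f z a l) (of_real x0)))\<^sup>2 \<le> ((34 + B) * C1 * M ^ 2 * ?E)\<^sup>2"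
        using db by (intro power_mono) auto
      moreover have "M ^ 2 * (C1 * M * e)\<^sup>2 = C1\<^sup>2 * M ^ 4 * e\<^sup>2" "((34 + B) * C1 * M ^ 2 * e)\<^sup>2 = ((34 + B) * C1)\<^sup>2 * M ^ 4 * e\<^sup>2" for e :: real
        by algebra+
      ultimately have "?N \<le> C1\<^sup>2 * M ^ 4 * ?E\<^sup>2 + ((34 + B) * C1)\<^sup>2 * M ^ 4 * ?E\<^sup>2"
        using add_mono by metis
      also have "\<dots> = C2 * M ^ 4 * ?E\<^sup>2" by (simp only: C2_def distrib_right)
      also have "?E\<^sup>2 = exp (8 * ?y)" by (simp add: power2_eq_square exp_add[symmetric])
      finally show ?thesis .
    qed
    have Qb: "norm (Qpoly m a l (of_real x)) \<le> K * M" if x: "0 \<le> x" "x \<le> x0" for x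
    proof -
      have "norm (lower_part m a (of_real x)) \<le> A * (1 + x) ^ (m - 1)" by (rule A(2)[OF x(1)])
      also have "\<dots> \<le> A * (1 + x0) ^ m"
      proof (rule mult_left_mono[OF _ A(1)])
        have "(1 + x) ^ (m - 1) \<le> (1 + x0) ^ (m - 1)" using x by (intro power_mono) auto
        also have "\<dots> \<le> (1 + x0) ^ m" using x0 by (intro power_increasing) auto
        finally show "(1 + x) ^ (m - 1) \<le> (1 + x0) ^ m" .
      qed
      also have "\<dots> \<le> A * (2 ^ m * (x0 ^ m + 1))" by (intro mult_left_mono one_plus_power_le x0 A)
      also have "\<dots> \<le> A * (2 ^ m * (17 * M))" unfolding x0m using M A by (intro mult_left_mono) auto
      finally have 1: "norm (lower_part m a (of_real x)) \<le> A * 2 ^ m * 17 * M" by (simp add: mult_ac)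
      have "x ^ m \<le> x0 ^ m" using x by (intro power_mono) auto
      then have 2: "norm (of_real x ^ m :: complex) \<le> 16 * M" using x x0m by (simp add: norm_power)
      have "norm (Qpoly m a l (of_real x)) \<le> norm (of_real x ^ m :: complex) + norm (lower_part m a (of_real x)) + norm l"
        unfolding Qpoly_def by (meson add_mono norm_triangle_ineq order_trans order_refl)
      then show ?thesis using 1 2 by (simp add: K_def M_def algebra_simps)
    qed
    have "M * (norm (f (of_real 0) a l))\<^sup>2 + (norm (deriv (\<lambda>z. f z a l) (of_real 0)))\<^sup>2 \<le> ?N * exp ((1 + K) * sqrt M * x0)"
      using M by (intro backward_growth[where Q = "\<lambda>x. Qpoly m a l (of_real x)"] x0 sibuya_ode_real[OF sib] Qb) auto
    also have "\<dots> \<le> (C2 * M ^ 4 * exp (8 * ?y)) * exp (16 * (1 + K) * ?y)"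
    proof (rule mult_mono[OF N])
      have "(1 + K) * (sqrt M * x0) \<le> (1 + K) * (16 * ?y)" using x0_sqrt K by (intro mult_left_mono) auto
      moreover have "(1 + K) * sqrt M * x0 = (1 + K) * (sqrt M * x0)" "16 * (1 + K) * ?y = (1 + K) * (16 * ?y)"
        by simp_all
      ultimately show "exp ((1 + K) * sqrt M * x0) \<le> exp (16 * (1 + K) * ?y)" by (simp only: exp_le_cancel_iff)
    qed (use C2 M in auto)
    \<comment> \<open>The constant and the power \<open>M^4\<close> are absorbed into exponentials
      of \<open>M^\<rho>\<close>, using \<open>M \<le> (M^\<rho>)^2\<close>.\<close>
    also have "\<dots> \<le> (exp (C2 * ?y) * exp (8 * ?y) * exp (8 * ?y)) * exp (16 * (1 + K) * ?y)"
    proof (intro mult_right_mono mult_mono)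
      have "C2 * 1 \<le> C2 * ?y" using C2 y1 by (intro mult_left_mono) auto
      then show "C2 \<le> exp (C2 * ?y)" using exp_ge_add_one_self[of "C2 * ?y"] by linarith
      have "M powr 1 \<le> M powr (2 * \<rho>)" using M by (intro powr_mono) (auto simp: \<rho>_def)
      then have "M \<le> ?y ^ 2" using M by (simp add: power2_eq_square powr_add[symmetric])
      then have "M ^ 4 \<le> (?y ^ 2) ^ 4" using M by (intro power_mono) auto
      also have "\<dots> = ?y ^ 8" by simp
      also have "\<dots> \<le> exp ?y ^ 8"
      proof (rule power_mono)
        show "?y \<le> exp ?y" using exp_ge_add_one_self[of ?y] by linarith
      qed (use y1 in simp)
      also have "\<dots> = exp (8 * ?y)" by (simp add: exp_of_nat_mult[symmetric])
      finally show "M ^ 4 \<le> exp (8 * ?y)" .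
    qed (use C2 M in auto)
    also have "\<dots> = exp (C * ?y)" by (simp add: exp_add[symmetric] C_def algebra_simps)
    finally have fin: "M * (norm (f 0 a l))\<^sup>2 + (norm (deriv (\<lambda>z. f z a l) 0))\<^sup>2 \<le> exp (C * ?y)" by simp
    have "1 * (norm (f 0 a l))\<^sup>2 \<le> M * (norm (f 0 a l))\<^sup>2" using M by (intro mult_right_mono) auto
    then show "(norm (f 0 a l))\<^sup>2 + (norm (deriv (\<lambda>z. f z a l) 0))\<^sup>2 \<le> exp (C * norm l powr (1/2 + 1 / real m))"
      using fin by (simp add: M_def \<rho>_def)
  qed (use L in auto)
qed

text \<open>Compactness handles \<open>|l| \<le> \<Lambda>\<close>. With base \<open>1 + |l|\<close>
  the power is at least 1, so that constants can be absorbed into the exponent.\<close>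

lemma sibuya_growth:
  assumes sib: "sibuya_solution m f" and m: "3 \<le> m"
  obtains C where "0 \<le> C"
    "\<And>l. norm (\<alpha> * f 0 a l + \<beta> * deriv (\<lambda>z. f z a l) 0) \<le> exp (C * (1 + norm l) powr (1/2 + 1 / real m))"
proof -
  define \<rho> where "\<rho> = 1/2 + 1 / real m"
  define D where "D = (\<lambda>l. \<alpha> * f 0 a l + \<beta> * deriv (\<lambda>z. f z a l) 0)"
  from sibuya_growth_large[OF sib m, of a] obtain \<Lambda> C where C: "1 \<le> \<Lambda>" "0 \<le> C"
    "\<And>l. \<Lambda> \<le> norm l \<Longrightarrow> (norm (f 0 a l))\<^sup>2 + (norm (deriv (\<lambda>z. f z a l) 0))\<^sup>2 \<le> exp (C * norm l powr \<rho>)"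
    unfolding \<rho>_def by blast
  have "(\<lambda>l. f 0 a l) holomorphic_on UNIV" using sib unfolding sibuya_solution_def by blast
  then have "D holomorphic_on UNIV"
    unfolding D_def by (intro holomorphic_intros sibuya_deriv_holomorphic[OF sib])
  then have "continuous_on (cball 0 \<Lambda>) D" by (meson continuous_on_subset holomorphic_on_imp_continuous_on subset_UNIV)
  then have "bounded (D ` cball 0 \<Lambda>)" by (intro compact_imp_bounded compact_continuous_image) auto
  then obtain M where M: "M > 0" "\<And>l. l \<in> cball 0 \<Lambda> \<Longrightarrow> norm (D l) \<le> M" unfolding bounded_pos by auto
  define C' where "C' = M + C + norm \<alpha> + norm \<beta>"
  have "norm (D l) \<le> exp (C' * (1 + norm l) powr \<rho>)" for l
  proof -
    let ?y = "(1 + norm l) powr \<rho>"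
    have y1: "1 \<le> ?y" by (intro ge_one_powr_ge_zero) (auto simp: \<rho>_def)
    show ?thesis
    proof (cases "norm l \<le> \<Lambda>")
      case True
      have "M * 1 \<le> C' * ?y" using M(1) C(2) y1 by (intro mult_mono) (auto simp: C'_def)
      moreover have "norm (D l) \<le> M" using M(2)[of l] True by simp
      ultimately show ?thesis using exp_ge_add_one_self[of "C' * ?y"] by linarith
    next
      case False
      let ?e = "exp (C * ?y)"
      have le: "(norm (f 0 a l))\<^sup>2 + (norm (deriv (\<lambda>z. f z a l) 0))\<^sup>2 \<le> ?e"
      proof (rule order_trans[OF C(3)])
        show "exp (C * norm l powr \<rho>) \<le> ?e"
          using C(2) by (simp add: mult_left_mono powr_mono2 \<rho>_def)
      qed (use False in simp)
      have e1: "1 \<le> ?e" using C(2) y1 by simp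
      have "?e * 1 \<le> ?e * ?e" using e1 by (intro mult_left_mono) auto
      then have "?e \<le> ?e\<^sup>2" by (simp add: power2_eq_square)
      moreover have "(norm (f 0 a l))\<^sup>2 \<le> ?e" "(norm (deriv (\<lambda>z. f z a l) 0))\<^sup>2 \<le> ?e"
        using le zero_le_power2[of "norm (f 0 a l)"] zero_le_power2[of "norm (deriv (\<lambda>z. f z a l) 0)"] by linarith+
      ultimately have "(norm (f 0 a l))\<^sup>2 \<le> ?e\<^sup>2 \<and> (norm (deriv (\<lambda>z. f z a l) 0))\<^sup>2 \<le> ?e\<^sup>2"
        by linarith
      then have b: "norm (f 0 a l) \<le> ?e" "norm (deriv (\<lambda>z. f z a l) 0) \<le> ?e"
        by (auto intro: power2_le_imp_le)
      have "norm (D l) \<le> norm \<alpha> * ?e + norm \<beta> * ?e"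
        unfolding D_def using b by (intro order_trans[OF norm_triangle_ineq] add_mono) (auto simp: norm_mult mult_left_mono)
      also have "\<dots> = (norm \<alpha> + norm \<beta>) * ?e" by (simp add: algebra_simps)
      also have "\<dots> \<le> exp ((norm \<alpha> + norm \<beta>) * ?y) * ?e"
      proof (rule mult_right_mono)
        have "(norm \<alpha> + norm \<beta>) * 1 \<le> (norm \<alpha> + norm \<beta>) * ?y" using y1 by (intro mult_left_mono) auto
        moreover have "z \<le> exp z" for z :: real using exp_ge_add_one_self[of z] by linarith
        ultimately show "norm \<alpha> + norm \<beta> \<le> exp ((norm \<alpha> + norm \<beta>) * ?y)"
          unfolding mult_1_right using order_trans by blast
      qed simp
      also have "\<dots> \<le> exp (C' * ?y)"
        using M(1) y1 by (simp add: exp_add[symmetric] C'_def algebra_simps)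
      finally show ?thesis .
    qed
  qed
  moreover have "0 \<le> C'" using M C by (simp add: C'_def)
  ultimately show ?thesis using that unfolding D_def \<rho>_def by blast
qed

section \<open>Expansion of the action integral\<close>

lemma set_integrable_halfline_bound:
  fixes f :: "real \<Rightarrow> 'b::{banach, second_countable_topology}"
  assumes "continuous_on {0<..} f" "set_integrable lborel {0<..} g"
    and "\<And>x. 0 < x \<Longrightarrow> norm (f x) \<le> (g x :: real)"
  shows "set_integrable lborel {0<..} f"
proof (rule set_integrable_bound[OF assms(2)])
  show "set_borel_measurable lborel {0<..} f"
    unfolding set_borel_measurable_def using borel_measurable_continuous_on_indicator[OF _ assms(1)] by simp
  have "norm (f x) \<le> norm (g x)" if "0 < x" for x
    using assms(3)[OF that] by simp
  then show "AE x in lborel. x \<in> {0<..} \<longrightarrow> norm (f x) \<le> norm (g x)" by simp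
qed

lemma set_integral_norm_le:
  fixes f :: "real \<Rightarrow> 'b::{banach, second_countable_topology}"
  assumes "set_integrable lborel A f" "set_integrable lborel A g"
    and "\<And>x. x \<in> A \<Longrightarrow> norm (f x) \<le> (g x :: real)"
  shows "norm (LBINT x:A. f x) \<le> (LBINT x:A. g x)"
proof -
  have "norm (LBINT x:A. f x) \<le> (LBINT x:A. norm (f x))"
    unfolding set_lebesgue_integral_def
    by (rule order_trans[OF integral_norm_bound]) (simp add: norm_scaleR indicator_def)
  also have "\<dots> \<le> (LBINT x:A. g x)"
    using assms by (intro set_integral_mono set_integrable_norm) auto
  finally show ?thesis .
qed

lemma set_integrable_halfline_scale:
  fixes f :: "real \<Rightarrow> 'b::{banach, second_countable_topology}"
  assumes "0 < c"
  shows "set_integrable lborel {0<..} (\<lambda>x. f (c * x)) \<longleftrightarrow> set_integrable lborel {0<..} f"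
    and "(LBINT x:{0<..}. f x) = c *\<^sub>R (LBINT x:{0<..}. f (c * x))"
proof -
  have ind: "indicator {0<..} (c * x) = (indicator {0<..} x :: real)" for x
    using assms by (auto simp: indicator_def zero_less_mult_iff)
  show "set_integrable lborel {0<..} (\<lambda>x. f (c * x)) \<longleftrightarrow> set_integrable lborel {0<..} f"
    using lborel_integrable_real_affine_iff[of c "\<lambda>x. indicator {0<..} x *\<^sub>R f x" 0] assms
    by (simp add: set_integrable_def ind)
  show "(LBINT x:{0<..}. f x) = c *\<^sub>R (LBINT x:{0<..}. f (c * x))"
    using lborel_integral_real_affine[of c "\<lambda>x. indicator {0<..} x *\<^sub>R f x" 0] assms
    by (simp add: set_lebesgue_integral_def ind)
qed

lemma set_integral_sum_finite:
  fixes f :: "'i \<Rightarrow> real \<Rightarrow> 'b::{banach, second_countable_topology}"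
  assumes "finite I" "\<And>i. i \<in> I \<Longrightarrow> set_integrable M A (f i)"
  shows "set_integrable M A (\<lambda>x. \<Sum>i\<in>I. f i x)" "(LINT x:A|M. \<Sum>i\<in>I. f i x) = (\<Sum>i\<in>I. LINT x:A|M. f i x)"
  using assms unfolding set_integrable_def set_lebesgue_integral_def scaleR_sum_right
  by (intro Bochner_Integration.integrable_sum Bochner_Integration.integral_sum; simp)+

lemma set_integrable_one_plus_powr:
  assumes "e < -1"
  shows "set_integrable lborel {0<..} (\<lambda>x::real. (1 + x) powr e)"
proof -
  have "set_integrable lborel (einterval 0 \<infinity>) (\<lambda>x::real. (1 + x) powr e)"
  proof (rule interval_integral_FTC_nonneg(1)[where F = "\<lambda>x. (1 + x) powr (e + 1) / (e + 1)" and A = "1 / (e + 1)" and B = 0])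
    show "((\<lambda>x. (1 + x) powr (e + 1) / (e + 1)) has_real_derivative (1 + x) powr e) (at x)" if "0 < ereal x" for x
      using that assms by (auto intro!: derivative_eq_intros)
    show "isCont (\<lambda>x. (1 + x) powr e) x" if "0 < ereal x" for x
      using that by (intro continuous_intros) auto
    have "((\<lambda>x::real. (1 + x) powr (e + 1) / (e + 1)) \<longlongrightarrow> (1 + 0) powr (e + 1) / (e + 1)) (at_right 0)"
      using assms by (intro tendsto_intros) auto
    then show "(((\<lambda>x. (1 + x) powr (e + 1) / (e + 1)) \<circ> real_of_ereal) \<longlongrightarrow> 1 / (e + 1)) (at_right 0)"
      unfolding zero_ereal_def ereal_tendsto_simps1 by simp
    have "((\<lambda>x::real. (1 + x) powr (e + 1)) \<longlongrightarrow> 0) at_top"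
      using assms by (intro tendsto_neg_powr) (auto intro!: filterlim_tendsto_add_at_top filterlim_ident)
    from tendsto_divide[OF this tendsto_const[of "e + 1"]]
    show "(((\<lambda>x. (1 + x) powr (e + 1) / (e + 1)) \<circ> real_of_ereal) \<longlongrightarrow> 0) (at_left \<infinity>)"
      unfolding ereal_tendsto_simps1 using assms by simp
  qed auto
  then show ?thesis by (simp add: zero_ereal_def)
qed

text \<open>A common majorant for the integrals in \<open>K_coeff\<close>: it behaves like
  \<open>t^(-1/2)\<close> at 0, the worst case \<open>s = (m + 1) / 2\<close>, and like
  \<open>t^(-3/2)\<close> at infinity. Its primitive is \<open>2 * arctan (sqrt t)\<close>.\<close>

lemma set_integrable_inverse_sqrt_kernel:
  "set_integrable lborel {0<..} (\<lambda>t::real. t powr (-1/2) / (1 + t))"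
proof -
  have "set_integrable lborel (einterval 0 \<infinity>) (\<lambda>t::real. t powr (-1/2) / (1 + t))"
  proof (rule interval_integral_FTC_nonneg(1)[where F = "\<lambda>x. 2 * arctan (sqrt x)" and A = 0 and B = pi])
    fix x assume "0 < ereal x"
    then have x: "0 < x" by simp
    have e: "x powr (-1/2) = inverse (sqrt x)" using x by (simp add: powr_minus powr_half_sqrt)
    have "((\<lambda>x. 2 * arctan (sqrt x)) has_real_derivative 2 * (inverse (1 + (sqrt x)\<^sup>2) * (inverse (sqrt x) / 2))) (at x)"
      using x by (intro DERIV_cmult DERIV_chain2[OF DERIV_arctan DERIV_real_sqrt])
    then show "((\<lambda>x. 2 * arctan (sqrt x)) has_real_derivative x powr (-1/2) / (1 + x)) (at x)"
    proof -
      have "2 * (a * (b / 2)) = b * a" for a b :: real by simp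
      then have "2 * (inverse (1 + (sqrt x)\<^sup>2) * (inverse (sqrt x) / 2)) = inverse (sqrt x) / (1 + x)"
        unfolding divide_inverse[of "inverse (sqrt x)" "1 + x"] using x by (simp only: real_sqrt_pow2 less_imp_le)
      moreover assume "((\<lambda>x. 2 * arctan (sqrt x)) has_real_derivative 2 * (inverse (1 + (sqrt x)\<^sup>2) * (inverse (sqrt x) / 2))) (at x)"
      ultimately show ?thesis unfolding e by (simp only:)
    qed
    show "isCont (\<lambda>x. x powr (-1/2) / (1 + x)) x" using x by (intro continuous_intros) auto
  next
    have "((\<lambda>x. 2 * arctan (sqrt x)) \<longlongrightarrow> 2 * arctan (sqrt 0)) (at_right 0)" by (intro tendsto_intros)
    then show "(((\<lambda>x. 2 * arctan (sqrt x)) \<circ> real_of_ereal) \<longlongrightarrow> 0) (at_right 0)"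
      unfolding zero_ereal_def ereal_tendsto_simps1 by simp
    have "((\<lambda>x. 2 * arctan (sqrt x)) \<longlongrightarrow> 2 * (pi / 2)) at_top"
      by (intro tendsto_mult tendsto_const filterlim_compose[OF tendsto_arctan_at_top sqrt_at_top])
    then show "(((\<lambda>x. 2 * arctan (sqrt x)) \<circ> real_of_ereal) \<longlongrightarrow> pi) (at_left \<infinity>)"
      unfolding ereal_tendsto_simps1 by simp
  qed auto
  then show ?thesis by (simp add: zero_ereal_def)
qed

text \<open>At \<open>l = 1\<close> this is the integrand of \<open>K_int\<close>. The subtracted
  power is free of \<open>l\<close> and cancels when two parameters are compared.\<close>

definition K_integrand :: "nat \<Rightarrow> nat \<Rightarrow> nat \<Rightarrow> real \<Rightarrow> real \<Rightarrow> real" where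
  "K_integrand m s k l x = x ^ (m * k - s) * (x ^ m + l) powr (1/2 - real k) - x powr (real m / 2 - real s)"

lemma K_int_eq: "K_int m s k = (LBINT t:{0<..}. K_integrand m s k 1 t)"
proof -
  have "u / v powr (real k - 1/2) = u * v powr (1/2 - real k)" for u v :: real
    using powr_minus_divide[of v "real k - 1/2"] by simp
  then show ?thesis by (simp add: K_int_def K_integrand_def)
qed

lemma abs_exp_minus_one_le:
  fixes y :: real
  shows "\<bar>exp y - 1\<bar> \<le> \<bar>y\<bar> * exp \<bar>y\<bar>"
proof (cases "0 \<le> y")
  case True
  have "exp y * (1 - y) \<le> exp y * exp (- y)"
    using exp_ge_add_one_self[of "- y"] by (intro mult_left_mono) auto
  then have "exp y - 1 \<le> y * exp y" by (simp add: algebra_simps flip: exp_add)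
  then show ?thesis using True by simp
next
  case False
  have "1 - exp y \<le> - y" using exp_ge_add_one_self[of y] by linarith
  also have "\<dots> \<le> - y * exp (- y)" using False mult_left_mono[of 1 "exp (- y)" "- y"] by simp
  finally show ?thesis using False by simp
qed

lemma powr_minus_one_bound:
  fixes u e :: real
  assumes "0 \<le> u" "u \<le> 1"
  shows "\<bar>(1 + u) powr e - 1\<bar> \<le> \<bar>e\<bar> * exp \<bar>e\<bar> * u"
proof -
  define y where "y = e * ln (1 + u)"
  have ln: "0 \<le> ln (1 + u)" "ln (1 + u) \<le> u" using assms ln_add_one_self_le_self by auto
  have y: "\<bar>y\<bar> \<le> \<bar>e\<bar> * u" unfolding y_def abs_mult using ln by (intro mult_left_mono) auto
  have y': "\<bar>y\<bar> \<le> \<bar>e\<bar>" using y mult_left_mono[OF assms(2), of "\<bar>e\<bar>"] by simp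
  have "\<bar>exp y - 1\<bar> \<le> \<bar>y\<bar> * exp \<bar>y\<bar>" by (rule abs_exp_minus_one_le)
  also have "\<dots> \<le> \<bar>e\<bar> * u * exp \<bar>e\<bar>" using y y' assms by (intro mult_mono) auto
  finally show ?thesis using assms by (simp add: powr_def y_def mult_ac)
qed

text \<open>Substituting \<open>l^(1/m) x\<close> makes \<open>x^m + l\<close> homogeneous; both
  terms acquire the factor \<open>l^((m/2 - s)/m)\<close>.\<close>

lemma K_integrand_scale:
  assumes "0 < l" "0 < x" "1 \<le> m" "s \<le> m * k"
  shows "K_integrand m s k l (l powr (1 / real m) * x) = l powr ((real m / 2 - real s) / real m) * K_integrand m s k 1 x"
proof -
  define c where "c = l powr (1 / real m)"
  have c: "0 < c" using assms by (simp add: c_def)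
  have cm: "c ^ m = l" using assms by (simp add: c_def powr_power)
  have pw: "c powr y = l powr (y / real m)" for y by (simp add: c_def powr_powr)
  have "(c * x) ^ m + l = c ^ m * (x ^ m + 1)" by (simp add: power_mult_distrib cm algebra_simps)
  then have "((c * x) ^ m + l) powr (1/2 - real k) = (c ^ m) powr (1/2 - real k) * (x ^ m + 1) powr (1/2 - real k)"
    using assms c by (simp add: powr_mult)
  also have "(c ^ m) powr (1/2 - real k) = c powr (real m * (1/2 - real k))"
    using c by (simp add: powr_realpow[symmetric] powr_powr)
  finally have 1: "((c * x) ^ m + l) powr (1/2 - real k) = c powr (real m * (1/2 - real k)) * (x ^ m + 1) powr (1/2 - real k)" .
  have 2: "(c * x) ^ (m * k - s) = c powr (real m * real k - real s) * x ^ (m * k - s)"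
  proof -
    have "c ^ (m * k - s) = c powr real (m * k - s)" using c by (simp add: powr_realpow)
    moreover have "real (m * k - s) = real m * real k - real s" using assms(4) by (simp add: of_nat_diff)
    ultimately show ?thesis by (simp add: power_mult_distrib)
  qed
  have 3: "c powr (real m * real k - real s) * c powr (real m * (1/2 - real k)) = c powr (real m / 2 - real s)"
    by (simp add: powr_add[symmetric] algebra_simps)
  have "K_integrand m s k l (c * x) = c powr (real m / 2 - real s) * K_integrand m s k 1 x"
    unfolding K_integrand_def 1 2 using c assms
    by (simp add: powr_mult right_diff_distrib 3[symmetric])
  then show ?thesis unfolding pw unfolding c_def .
qed

text \<open>Near 0 the two terms are separately \<open>O(t^(-1/2))\<close> because
  \<open>s \<le> (m + 1) / 2\<close>. For \<open>t \<ge> 1\<close> they cancel to leading order: the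
  difference is \<open>t^(m/2-s)\<close> times \<open>(1 + t^(-m))^(1/2-k) - 1\<close>, a gain of
  \<open>t^(-m)\<close>.\<close>

lemma K_integrand_bound:
  assumes m: "3 \<le> m" and s: "real s \<le> (real m + 1) / 2" "s \<le> m * k" and t: "0 < t"
  shows "\<bar>K_integrand m s k 1 t\<bar> \<le> (6 + 2 * \<bar>1/2 - real k\<bar> * exp \<bar>1/2 - real k\<bar>) * (t powr (-1/2) / (1 + t))"
proof -
  let ?e = "1/2 - real k"
  let ?C = "\<bar>?e\<bar> * exp \<bar>?e\<bar>"
  have C: "0 \<le> ?C" by simp
  show ?thesis
  proof (cases "t \<le> 1")
    case True
    have p: "1 \<le> t powr (-1/2)"
    proof -
      have "t powr 0 \<le> t powr (-1/2)" using True t by (intro powr_mono') auto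
      then show ?thesis using t by simp
    qed
    have "(t ^ m + 1) powr ?e \<le> (t ^ m + 1) powr 1" using t by (intro powr_mono) auto
    also have "\<dots> \<le> 2" using t True power_le_one[of t m] by simp
    finally have "t ^ (m * k - s) * (t ^ m + 1) powr ?e \<le> 1 * 2"
      using t True by (intro mult_mono power_le_one) auto
    then have 1: "t ^ (m * k - s) * (t ^ m + 1) powr ?e \<le> 2 * t powr (-1/2)" using p by linarith
    have 2: "t powr (real m / 2 - real s) \<le> t powr (-1/2)" using True t s by (intro powr_mono') auto
    have "\<bar>K_integrand m s k 1 t\<bar> \<le> t ^ (m * k - s) * (t ^ m + 1) powr ?e + t powr (real m / 2 - real s)"
      unfolding K_integrand_def using t by (intro order_trans[OF abs_triangle_ineq4]) auto
    also have "\<dots> \<le> 3 * t powr (-1/2)" using 1 2 by simp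
    also have "\<dots> \<le> 6 * (t powr (-1/2) / (1 + t))" using True t by (simp add: field_simps)
    also have "\<dots> \<le> (6 + 2 * ?C) * (t powr (-1/2) / (1 + t))"
      using t C by (intro mult_right_mono) auto
    finally show ?thesis by (simp add: mult_ac)
  next
    case False
    then have t1: "1 \<le> t" by simp
    define u where "u = t powr (- real m)"
    have u: "0 \<le> u" "u \<le> 1"
      using t1 powr_mono[of "- real m" 0 t] by (auto simp: u_def)
    have tm: "t ^ m = t powr real m" using t by (simp add: powr_realpow)
    have "t ^ m + 1 = t powr real m * (1 + u)" using t by (simp add: tm u_def algebra_simps flip: powr_add)
    then have f1: "(t ^ m + 1) powr ?e = t powr (real m * ?e) * (1 + u) powr ?e"
      using t u by (simp add: powr_mult powr_powr)
    have f2: "t ^ (m * k - s) = t powr (real m * real k - real s)"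
      using t s(2) by (simp add: of_nat_diff flip: powr_realpow)
    have f3: "t powr (real m * real k - real s) * t powr (real m * ?e) = t powr (real m / 2 - real s)"
      by (simp add: powr_add[symmetric] algebra_simps)
    have "t ^ (m * k - s) * (t ^ m + 1) powr ?e = t powr (real m / 2 - real s) * (1 + u) powr ?e"
      unfolding f1 f2 by (simp only: mult.assoc[symmetric] f3)
    then have "K_integrand m s k 1 t = t powr (real m / 2 - real s) * ((1 + u) powr ?e - 1)"
      by (simp add: K_integrand_def right_diff_distrib)
    then have "\<bar>K_integrand m s k 1 t\<bar> = t powr (real m / 2 - real s) * \<bar>(1 + u) powr ?e - 1\<bar>"
      by (simp add: abs_mult)
    also have "\<dots> \<le> t powr (real m / 2 - real s) * (?C * u)"
      using powr_minus_one_bound[OF u] by (intro mult_left_mono) auto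
    also have "\<dots> = ?C * t powr (real m / 2 - real s - real m)" by (simp add: u_def powr_add[symmetric] mult_ac)
    also have "\<dots> \<le> ?C * t powr (-1/2 - 1)"
      using t1 m by (intro mult_left_mono powr_mono) auto
    also have "t powr (-1/2 - 1) = t powr (-1/2) / t" by (subst powr_diff) (use t in simp)
    also have "?C * (t powr (-1/2) / t) \<le> ?C * (2 * (t powr (-1/2) / (1 + t)))"
      using t1 C by (intro mult_left_mono) (auto simp: field_simps)
    also have "\<dots> \<le> (6 + 2 * ?C) * (t powr (-1/2) / (1 + t))"
    proof -
      have *: "c * (2 * w) \<le> (6 + 2 * c) * w" if "0 \<le> w" for c w :: real
        using that by (simp add: algebra_simps)
      show ?thesis by (rule *) (use t in simp)
    qed
    finally show ?thesis by (simp add: mult_ac)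
  qed
qed

lemma continuous_on_K_integrand:
  assumes "0 \<le> l"
  shows "continuous_on {0<..} (K_integrand m s k l)"
  unfolding K_integrand_def
proof (intro continuous_intros ballI)
  fix x :: real assume "x \<in> {0<..}"
  then have "0 < x ^ m" by simp
  then show "x ^ m + l \<noteq> 0" using assms by linarith
qed auto

lemma K_integrand_integral:
  assumes m: "3 \<le> m" and s: "real s \<le> (real m + 1) / 2" "s \<le> m * k" and l: "0 < l"
  shows "set_integrable lborel {0<..} (K_integrand m s k l)"
    and "(LBINT x:{0<..}. K_integrand m s k l x) = l powr (1/2 + (1 - real s) / real m) * K_int m s k"
proof -
  have i1: "set_integrable lborel {0<..} (K_integrand m s k 1)"
    by (rule set_integrable_halfline_bound[OF continuous_on_K_integrand
          set_integrable_mult_right[OF set_integrable_inverse_sqrt_kernel]])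
      (use K_integrand_bound[OF m s] in auto)
  define c where "c = l powr (1 / real m)"
  have c: "0 < c" using l by (simp add: c_def)
  have eq: "K_integrand m s k l (c * x) = l powr ((real m / 2 - real s) / real m) * K_integrand m s k 1 x" if "0 < x" for x
    using K_integrand_scale[OF l that, of m s k] m s by (simp add: c_def)
  have "set_integrable lborel {0<..} (\<lambda>x. l powr ((real m / 2 - real s) / real m) * K_integrand m s k 1 x)"
    using i1 by simp
  then have "set_integrable lborel {0<..} (\<lambda>x. K_integrand m s k l (c * x))"
    by (rule set_integrable_cong[THEN iffD1, rotated -1]) (simp_all add: eq)
  then show "set_integrable lborel {0<..} (K_integrand m s k l)"
    using set_integrable_halfline_scale(1)[OF c, of "K_integrand m s k l"] by simp
  have "(LBINT x:{0<..}. K_integrand m s k l x) = c * (LBINT x:{0<..}. K_integrand m s k l (c * x))"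
    using set_integrable_halfline_scale(2)[OF c, of "K_integrand m s k l"] by simp
  also have "(LBINT x:{0<..}. K_integrand m s k l (c * x)) = (LBINT x:{0<..}. l powr ((real m / 2 - real s) / real m) * K_integrand m s k 1 x)"
    by (rule set_lebesgue_integral_cong) (auto simp: eq)
  also have "\<dots> = l powr ((real m / 2 - real s) / real m) * K_int m s k" by (simp add: K_int_eq)
  also have "c * (l powr ((real m / 2 - real s) / real m) * K_int m s k)
      = l powr (1/2 + (1 - real s) / real m) * K_int m s k"
  proof -
    have "1 / real m + (real m / 2 - real s) / real m = 1/2 + (1 - real s) / real m"
      using m by (simp add: field_simps)
    then show ?thesis by (simp add: c_def mult.assoc[symmetric] powr_add[symmetric])
  qed
  finally show "(LBINT x:{0<..}. K_integrand m s k l x) = l powr (1/2 + (1 - real s) / real m) * K_int m s k" .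
qed

text \<open>For \<open>k = 1\<close> the integrand is strictly negative, since
  \<open>(x^m + 1)^(-1/2) < x^(-m/2)\<close>. A vanishing integral would make it zero almost
  everywhere, in particular on the interval from 0 to 1.\<close>

lemma K_int_1_nonzero:
  assumes m: "3 \<le> m" and s: "real s \<le> (real m + 1) / 2" "s \<le> m"
  shows "K_int m s 1 \<noteq> 0"
proof
  assume "K_int m s 1 = 0"
  have neg: "K_integrand m s 1 1 x < 0" if x: "0 < x" for x
  proof -
    have "x ^ (m - s) = x powr (real m - real s)" using x s by (simp add: of_nat_diff flip: powr_realpow)
    moreover have "(x ^ m + 1) powr (- (1/2)) < (x ^ m) powr (- (1/2))" using x by (intro powr_less_mono2_neg) auto
    moreover have "(x ^ m) powr (- (1/2)) = x powr (- (real m / 2))" using x by (simp add: powr_powr flip: powr_realpow)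
    ultimately have "x ^ (m - s) * (x ^ m + 1) powr (- (1/2)) < x powr (real m - real s) * x powr (- (real m / 2))"
      using x by simp
    also have "\<dots> = x powr (real m / 2 - real s)" by (simp add: powr_add[symmetric] field_simps)
    finally show ?thesis by (simp add: K_integrand_def)
  qed
  have int: "integrable lborel (\<lambda>x. indicator {0<..} x *\<^sub>R (- K_integrand m s 1 1 x))"
    using K_integrand_integral(1)[OF m s(1), of 1 1] s by (simp add: set_integrable_def)
  have "(\<integral>x. indicator {0<..} x *\<^sub>R (- K_integrand m s 1 1 x) \<partial>lborel) = 0"
    using \<open>K_int m s 1 = 0\<close> by (simp add: K_int_eq set_lebesgue_integral_def)
  then have "AE x in lborel. indicator {0<..} x *\<^sub>R (- K_integrand m s 1 1 x) = 0"
    using neg by (subst (asm) integral_nonneg_eq_0_iff_AE[OF int]) (auto simp: indicator_def less_imp_le)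
  moreover have "indicator {0<..} x *\<^sub>R (- K_integrand m s 1 1 x) = 0 \<longrightarrow> x \<notin> {0<..<1::real}" for x
    using neg[of x] by (auto simp: indicator_def)
  ultimately have "AE x in lborel. x \<notin> {0<..<1::real}" by (auto elim!: eventually_mono)
  then have "{0<..<1::real} \<in> null_sets lborel" by (subst AE_iff_null_sets) auto
  then have "emeasure lborel {0<..<1::real} = 0" by (rule null_setsD1)
  then show False unfolding emeasure_lborel_Ioo[OF zero_le_one] by simp
qed

section \<open>Expansion of the square root of the potential\<close>

lemma poly_sum_powers_multi_sum:
  "(\<Sum>i=1..m-1. v i * y ^ i) ^ k = (\<Sum>s\<le>(m-1)*k. multi_sum m v k s * y ^ s)"
proof -
  define p where "p = (\<Sum>i=1..m-1. monom (v i) i)"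
  have fps: "fps_of_poly p = coeff_fps m v"
    unfolding p_def coeff_fps_def fps_of_poly_sum by (simp add: fps_of_poly_monom)
  have coeff: "poly.coeff (p ^ k) s = multi_sum m v k s" for s
    by (simp add: multi_sum_eq_nth fps[symmetric] fps_of_poly_power[symmetric])
  have "degree p \<le> m - 1"
    unfolding p_def by (intro degree_sum_le) (auto intro: order_trans[OF degree_monom_le])
  then have deg: "degree (p ^ k) \<le> (m - 1) * k"
    using degree_power_le[of p k] mult_le_mono1[of "degree p" "m - 1" k] by linarith
  have "(\<Sum>i=1..m-1. v i * y ^ i) ^ k = poly (p ^ k) y"
    by (simp add: p_def poly_sum poly_monom poly_power)
  also have "\<dots> = (\<Sum>s\<le>(m-1)*k. multi_sum m v k s * y ^ s)"
    unfolding poly_altdef coeff using deg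
    by (intro sum.mono_neutral_left) (auto simp: coeff[symmetric] coeff_eq_0)
  finally show ?thesis .
qed

text \<open>Factoring out \<open>z^m\<close> leaves a polynomial in \<open>1/z\<close> whose powers
  are multi-index sums; \<open>z = 0\<close> is treated apart. The bound
  \<open>s \<le> (m-1) k\<close> keeps the exponent \<open>m k - s\<close> free of
  truncation.\<close>

lemma lower_part_power:
  assumes m: "1 \<le> m"
  shows "lower_part m a z ^ k = (\<Sum>s\<le>(m-1)*k. multi_sum m a k s * z ^ (m * k - s))"
proof (cases "z = 0")
  case True
  have 0: "lower_part m a z = 0" using m by (auto simp: lower_part_def True intro!: sum.neutral)
  show ?thesis
  proof (cases "k = 0")
    case False
    have "s < m * k" if "s \<le> (m - 1) * k" for s
    proof -
      have "(m - 1) * k < m * k" using m False by simp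
      then show ?thesis using that by linarith
    qed
    then have "(\<Sum>s\<le>(m-1)*k. multi_sum m a k s * z ^ (m * k - s)) = 0"
      unfolding True by (intro sum.neutral) auto
    then show ?thesis using False by (simp add: 0)
  qed (simp add: multi_sum_0)
next
  case False
  have "lower_part m a z = z ^ m * (\<Sum>i=1..m-1. a i * inverse z ^ i)"
    unfolding lower_part_def sum_distrib_left
    using False by (intro sum.cong) (auto simp: power_diff field_simps)
  then have "lower_part m a z ^ k = z ^ (m * k) * (\<Sum>s\<le>(m-1)*k. multi_sum m a k s * inverse z ^ s)"
    by (simp only: power_mult_distrib poly_sum_powers_multi_sum power_mult)
  also have "\<dots> = (\<Sum>s\<le>(m-1)*k. multi_sum m a k s * z ^ (m * k - s))"
    unfolding sum_distrib_left
  proof (rule sum.cong[OF refl])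
    fix s assume "s \<in> {..(m-1)*k}"
    then have "s \<le> m * k" using order_trans[of s "(m-1)*k" "m*k"] by simp
    then show "z ^ (m * k) * (multi_sum m a k s * inverse z ^ s) = multi_sum m a k s * z ^ (m * k - s)"
      using False by (simp add: power_diff field_simps)
  qed
  finally show ?thesis .
qed

text \<open>After \<open>|z|^(n+1)\<close> is split off, the tail is dominated by the series of
  absolute values at radius 1/2, inside the disc of convergence.\<close>

lemma binomial_series_tail:
  fixes a :: complex
  obtains C where "0 \<le> C" "\<And>z. norm z \<le> 1/2 \<Longrightarrow> norm ((1 + z) powr a - (\<Sum>k\<le>n. (a gchoose k) * z ^ k)) \<le> C * norm z ^ (n + 1)"
proof
  define c where "c = (\<lambda>k. norm (a gchoose (k + (n + 1))) * (1/2) ^ k)"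
  have "summable (\<lambda>k. norm ((a gchoose k) * (1/2 :: complex) ^ k))"
    by (rule powser_insidea[where x = "3/4"]) (use gen_binomial_complex[of "3/4" a] in \<open>auto simp: sums_iff\<close>)
  then have "summable (\<lambda>k. norm (a gchoose (k + (n + 1))) * (1/2) ^ (k + (n + 1)))"
    by (subst summable_iff_shift) (simp add: norm_mult norm_power norm_divide)
  then have "summable (\<lambda>k. 2 ^ (n + 1) * (norm (a gchoose (k + (n + 1))) * (1/2) ^ (k + (n + 1))))"
    by (rule summable_mult)
  then have c: "summable c" by (simp add: c_def power_add power_one_over)
  show "0 \<le> suminf c" using c by (rule suminf_nonneg) (simp add: c_def)
  fix z :: complex assume z: "norm z \<le> 1/2"
  have sums: "(\<lambda>k. (a gchoose k) * z ^ k) sums (1 + z) powr a" using z by (intro gen_binomial_complex) auto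
  have "(1 + z) powr a - (\<Sum>k\<le>n. (a gchoose k) * z ^ k) = (\<Sum>k. (a gchoose (k + (n + 1))) * z ^ (k + (n + 1)))"
    using suminf_minus_initial_segment[of "\<lambda>k. (a gchoose k) * z ^ k" "n + 1"] sums
    by (simp add: sums_iff lessThan_Suc_atMost)
  also have "norm \<dots> \<le> (\<Sum>k. c k * norm z ^ (n + 1))"
  proof (rule norm_suminf_le)
    fix k
    have "norm z ^ k \<le> (1/2) ^ k" using z by (intro power_mono) auto
    then have "norm (a gchoose (k + (n + 1))) * norm z ^ k * norm z ^ (n + 1) \<le> c k * norm z ^ (n + 1)"
      unfolding c_def by (intro mult_right_mono mult_left_mono) auto
    then show "norm ((a gchoose (k + (n + 1))) * z ^ (k + (n + 1))) \<le> c k * norm z ^ (n + 1)"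
      by (simp only: norm_mult norm_power power_add[of _ k] mult.assoc)
  qed (use c in \<open>rule summable_mult2\<close>)
  also have "\<dots> = suminf c * norm z ^ (n + 1)" using suminf_mult2[OF c] by simp
  finally show "norm ((1 + z) powr a - (\<Sum>k\<le>n. (a gchoose k) * z ^ k)) \<le> suminf c * norm z ^ (n + 1)" .
qed

lemma csqrt_of_real_mult_left:
  assumes "0 \<le> r"
  shows "csqrt (of_real r * z) = of_real (sqrt r) * csqrt z"
proof (cases "r = 0")
  case False
  then have r: "0 < sqrt r" using assms by simp
  show ?thesis
  proof (rule csqrt_unique)
    show "(of_real (sqrt r) * csqrt z)\<^sup>2 = of_real r * z"
      using assms by (simp add: power_mult_distrib flip: of_real_power)
    show "0 < Re (of_real (sqrt r) * csqrt z) \<or> Re (of_real (sqrt r) * csqrt z) = 0 \<and> 0 \<le> Im (of_real (sqrt r) * csqrt z)"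
      using csqrt_principal[of z] r by (auto simp del: csqrt.simps intro: mult_pos_pos)
  qed
qed simp

text \<open>With \<open>B = A (1 + y)\<close> the relative difference is at most 1 and at most
  \<open>q y\<close>, hence at most a multiple of \<open>y^\<theta>\<close> for every
  \<open>\<theta>\<close> between 0 and 1. A small \<open>\<theta>\<close> costs little growth in
  the parameter.\<close>

lemma powr_neg_diff_bound:
  fixes A B q \<theta> :: real
  assumes A: "0 < A" "A \<le> B" and q: "0 < q" and \<theta>: "0 \<le> \<theta>" "\<theta> \<le> 1"
  shows "\<bar>B powr (- q) - A powr (- q)\<bar> \<le> (q + 1) * ((B - A) / A) powr \<theta> * A powr (- q)"
proof -
  define y where "y = (B - A) / A"
  have y: "0 \<le> y" using A by (simp add: y_def)
  have B: "B = A * (1 + y)" using A by (simp add: y_def field_simps)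
  have "B powr (- q) = A powr (- q) * (1 + y) powr (- q)" unfolding B using A y by (subst powr_mult) auto
  then have eq: "A powr (- q) - B powr (- q) = A powr (- q) * (1 - (1 + y) powr (- q))" by (simp add: algebra_simps)
  have le1: "(1 + y) powr (- q) \<le> 1" using y q powr_mono[of "- q" 0 "1 + y"] by simp
  have "1 - (1 + y) powr (- q) \<le> (q + 1) * y powr \<theta>"
  proof (cases "1 \<le> y")
    case True
    have "1 * 1 \<le> (q + 1) * y powr \<theta>"
      using True q \<theta> by (intro mult_mono ge_one_powr_ge_zero) auto
    moreover have "0 \<le> (1 + y) powr (- q)" by simp
    ultimately show ?thesis by linarith
  next
    case False
    have "ln (1 + y) \<le> y" using y by (rule ln_add_one_self_le_self)
    then have "q * ln (1 + y) \<le> q * y" using q by (intro mult_left_mono) auto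
    moreover have "1 - q * ln (1 + y) \<le> (1 + y) powr (- q)"
      using y exp_ge_add_one_self[of "- q * ln (1 + y)"] by (simp add: powr_def)
    ultimately have "1 - (1 + y) powr (- q) \<le> q * y" by linarith
    also have "q * y \<le> (q + 1) * y powr \<theta>"
    proof (rule mult_mono)
      show "y \<le> y powr \<theta>"
      proof (cases "y = 0")
        case False
        then show ?thesis using powr_mono'[of \<theta> 1 y] y \<open>\<not> 1 \<le> y\<close> \<theta> by simp
      qed simp
    qed (use q y in auto)
    finally show ?thesis .
  qed
  then have "A powr (- q) * (1 - (1 + y) powr (- q)) \<le> A powr (- q) * ((q + 1) * y powr \<theta>)"
    by (intro mult_left_mono) auto
  moreover have "0 \<le> A powr (- q) * (1 - (1 + y) powr (- q))" using le1 by simp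
  ultimately show ?thesis using eq by (simp add: y_def mult_ac abs_minus_commute)
qed

lemma power_plus_lower_bound:
  fixes x l :: real
  assumes "0 \<le> x" "1 \<le> l"
  shows "(1 + x) powr real m / 2 ^ m \<le> x ^ m + l"
proof -
  have "(1 + x) ^ m \<le> 2 ^ m * (x ^ m + 1)" by (rule one_plus_power_le[OF assms(1)])
  also have "\<dots> \<le> 2 ^ m * (x ^ m + l)" using assms by (intro mult_left_mono) auto
  finally show ?thesis using assms by (simp add: powr_realpow field_simps)
qed

lemma power_plus_powr_neg_bound:
  fixes x l q :: real
  assumes "0 \<le> x" "1 \<le> l" "0 \<le> q"
  shows "(x ^ m + l) powr (- q) \<le> (2 ^ m) powr q * (1 + x) powr (- (real m * q))"
proof -
  have pos: "0 < (1 + x) powr real m / 2 ^ m" using assms by simp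
  have "(x ^ m + l) powr (- q) \<le> ((1 + x) powr real m / 2 ^ m) powr (- q)"
    using power_plus_lower_bound[OF assms(1,2), of m] pos assms by (intro powr_mono2') auto
  also have "\<dots> = (2 ^ m) powr q * (1 + x) powr (- (real m * q))"
    using assms by (simp add: powr_divide powr_powr powr_minus field_simps)
  finally show ?thesis .
qed

text \<open>For \<open>s \<ge> m/2 + 1\<close> a single term decays like \<open>x^(m/2-s)\<close>,
  which may fail to be integrable. Interpolation with \<open>\<theta> = 1/(4m)\<close> costs
  \<open>l^\<theta>\<close> and gains \<open>x^(-m \<theta>) = x^(-1/4)\<close>, so the difference
  decays at least like \<open>x^(-5/4)\<close>. The exponents \<open>1/(4m)\<close> and
  \<open>-5/4\<close> in what follows originate in this choice.\<close>

lemma high_order_term_bound: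
  fixes x l \<Lambda> :: real
  assumes m: "3 \<le> m" and k: "1 \<le> k" and s: "real m / 2 + 1 \<le> real s" "s \<le> m * k"
    and \<Lambda>: "1 \<le> \<Lambda>" "\<Lambda> \<le> l" and x: "0 \<le> x"
  defines "\<theta> \<equiv> 1 / (4 * real m)"
  shows "\<bar>x ^ (m * k - s) * (x ^ m + l) powr (1/2 - real k) - x ^ (m * k - s) * (x ^ m + \<Lambda>) powr (1/2 - real k)\<bar>
     \<le> (real k + 1) * (2 ^ m) powr (real k - 1/2 + \<theta>) * l powr \<theta> * (1 + x) powr (-5/4)"
proof -
  define q where "q = real k - 1/2"
  have q: "0 < q" "q + 1 \<le> real k + 1" using k by (auto simp: q_def)
  have \<theta>: "0 \<le> \<theta>" "\<theta> \<le> 1" "real m * \<theta> = 1/4" using m by (auto simp: \<theta>_def field_simps)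
  define A where "A = x ^ m + \<Lambda>"
  define B where "B = x ^ m + l"
  have A: "0 < A" "A \<le> B" "B - A \<le> l" using \<Lambda> x by (auto simp: A_def B_def add_nonneg_pos)
  have "\<bar>B powr (- q) - A powr (- q)\<bar> \<le> (q + 1) * ((B - A) / A) powr \<theta> * A powr (- q)"
    by (rule powr_neg_diff_bound[OF A(1,2) q(1) \<theta>(1,2)])
  also have "\<dots> \<le> (real k + 1) * (l / A) powr \<theta> * A powr (- q)"
    using q A \<theta> by (intro mult_right_mono mult_mono powr_mono2 divide_right_mono) auto
  also have "(l / A) powr \<theta> = l powr \<theta> * A powr (- \<theta>)"
    using A \<Lambda> by (simp add: powr_divide powr_minus field_simps)
  also have "(real k + 1) * (l powr \<theta> * A powr (- \<theta>)) * A powr (- q) = (real k + 1) * l powr \<theta> * A powr (- (q + \<theta>))"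
    by (simp add: powr_add[symmetric] algebra_simps)
  also have "\<dots> \<le> (real k + 1) * l powr \<theta> * ((2 ^ m) powr (q + \<theta>) * (1 + x) powr (- (real m * (q + \<theta>))))"
    unfolding A_def using q \<theta> by (intro mult_left_mono power_plus_powr_neg_bound x \<Lambda>) auto
  finally have 1: "\<bar>B powr (- q) - A powr (- q)\<bar> \<le> (real k + 1) * (2 ^ m) powr (q + \<theta>) * l powr \<theta> * (1 + x) powr (- (real m * (q + \<theta>)))"
    by (simp add: mult_ac)
  have 2: "x ^ (m * k - s) \<le> (1 + x) powr (real m * real k - real s)"
  proof -
    have "x ^ (m * k - s) \<le> (1 + x) ^ (m * k - s)" using x by (intro power_mono) auto
    also have "\<dots> = (1 + x) powr (real m * real k - real s)" using x s(2) by (simp add: of_nat_diff flip: powr_realpow)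
    finally show ?thesis .
  qed
  have "\<bar>x ^ (m * k - s) * B powr (- q) - x ^ (m * k - s) * A powr (- q)\<bar> = x ^ (m * k - s) * \<bar>B powr (- q) - A powr (- q)\<bar>"
    using x by (simp add: right_diff_distrib[symmetric] abs_mult)
  also have "\<dots> \<le> (1 + x) powr (real m * real k - real s) * ((real k + 1) * (2 ^ m) powr (q + \<theta>) * l powr \<theta> * (1 + x) powr (- (real m * (q + \<theta>))))"
    using 1 2 x by (intro mult_mono) auto
  also have "\<dots> = (real k + 1) * (2 ^ m) powr (q + \<theta>) * l powr \<theta> * (1 + x) powr (real m * real k - real s - real m * (q + \<theta>))"
  proof -
    have "(1 + x) powr a * (c * (1 + x) powr b) = c * (1 + x) powr (a + b)" for a b c :: real
      by (simp add: powr_add)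
    then show ?thesis by (simp only: diff_conv_add_uminus)
  qed
  also have "\<dots> \<le> (real k + 1) * (2 ^ m) powr (q + \<theta>) * l powr \<theta> * (1 + x) powr (-5/4)"
  proof (intro mult_left_mono powr_mono)
    have "real m * real k - real s - real m * (q + \<theta>) = real m / 2 - real s - real m * \<theta>"
      by (simp add: q_def algebra_simps)
    then show "real m * real k - real s - real m * (q + \<theta>) \<le> -5/4" using s \<theta> by simp
  qed (use x in auto)
  finally show ?thesis by (simp add: q_def A_def B_def)
qed

text \<open>Factoring out \<open>sqrt T\<close> reduces the claim to the binomial series at
  \<open>P / T\<close>, of modulus at most 1/2.\<close>

lemma csqrt_Taylor_remainder:
  obtains C where "0 \<le> C"
    "\<And>T P. 0 < T \<Longrightarrow> norm P \<le> T / 2 \<Longrightarrow>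
       norm (csqrt (of_real T + P) - (\<Sum>k\<le>n. ((1/2) gchoose k) * P ^ k * of_real (T powr (1/2 - real k))))
       \<le> C * norm P ^ (n + 1) * T powr (1/2 - real (n + 1))"
proof -
  obtain C where C: "0 \<le> C" "\<And>z :: complex. norm z \<le> 1/2 \<Longrightarrow> norm ((1 + z) powr (1/2) - (\<Sum>k\<le>n. ((1/2) gchoose k) * z ^ k)) \<le> C * norm z ^ (n + 1)"
    using binomial_series_tail[of "1/2" n] by blast
  show ?thesis
  proof (rule that[OF C(1)])
    fix T :: real and P :: complex assume T: "0 < T" and P: "norm P \<le> T / 2"
    define z where "z = P / of_real T"
    have z: "norm z \<le> 1/2" using T P by (simp add: z_def norm_divide field_simps)
    have pw: "of_real (T powr (1/2 - real k)) = of_real (sqrt T) / (of_real T ^ k :: complex)" for k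
      using T by (simp add: powr_diff powr_half_sqrt powr_realpow flip: of_real_power)
    have "of_real T + P = of_real T * (1 + z)" using T by (simp add: z_def field_simps)
    then have "csqrt (of_real T + P) = of_real (sqrt T) * (1 + z) powr (1/2)"
      using csqrt_of_real_mult_left[of T "1 + z"] T by (simp add: csqrt_conv_powr)
    moreover have "(\<Sum>k\<le>n. ((1/2) gchoose k) * P ^ k * of_real (T powr (1/2 - real k))) = of_real (sqrt T) * (\<Sum>k\<le>n. ((1/2) gchoose k) * z ^ k)"
      unfolding sum_distrib_left pw z_def by (intro sum.cong) (simp_all add: power_divide)
    ultimately have "csqrt (of_real T + P) - (\<Sum>k\<le>n. ((1/2) gchoose k) * P ^ k * of_real (T powr (1/2 - real k)))
       = of_real (sqrt T) * ((1 + z) powr (1/2) - (\<Sum>k\<le>n. ((1/2) gchoose k) * z ^ k))"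
      by (simp add: right_diff_distrib)
    then have "norm (csqrt (of_real T + P) - (\<Sum>k\<le>n. ((1/2) gchoose k) * P ^ k * of_real (T powr (1/2 - real k))))
       = sqrt T * norm ((1 + z) powr (1/2) - (\<Sum>k\<le>n. ((1/2) gchoose k) * z ^ k))"
      using T by (simp add: norm_mult)
    also have "\<dots> \<le> sqrt T * (C * norm z ^ (n + 1))" using C(2)[OF z] T by (intro mult_left_mono) auto
    also have "\<dots> = C * norm P ^ (n + 1) * (sqrt T / T ^ (n + 1))" using T by (simp add: z_def norm_divide power_divide)
    also have "sqrt T / T ^ (n + 1) = T powr (1/2 - real (n + 1))"
      using T by (simp only: powr_diff powr_half_sqrt powr_realpow less_imp_le)
    finally show "norm (csqrt (of_real T + P) - (\<Sum>k\<le>n. ((1/2) gchoose k) * P ^ k * of_real (T powr (1/2 - real k))))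
       \<le> C * norm P ^ (n + 1) * T powr (1/2 - real (n + 1))" .
  qed
qed

lemma min_one_powr_le:
  fixes x :: real
  assumes "3 \<le> m" "0 < x"
  shows "min 1 (x powr (- (real m / 2))) \<le> 4 * (1 + x) powr (-5/4)"
proof (cases "x \<le> 1")
  case True
  have "(2::real) powr (5/4) \<le> 2 powr 2" by (intro powr_mono) auto
  then have "2 powr (-2) \<le> (2::real) powr (-5/4)" by (intro powr_mono) auto
  also have "\<dots> \<le> (1 + x) powr (-5/4)" using True assms by (intro powr_mono2') auto
  finally have "1 / 4 \<le> (1 + x) powr (-5/4)" by (simp add: powr_minus powr_numeral)
  then show ?thesis by simp
next
  case False
  then have x: "1 \<le> x" by simp
  have "x powr (- (real m / 2)) \<le> x powr (-5/4)" using x assms by (intro powr_mono) auto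
  also have "\<dots> \<le> ((1 + x) / 2) powr (-5/4)" using x by (intro powr_mono2') auto
  also have "\<dots> = (1 + x) powr (-5/4) * 2 powr (5/4)" using x by (simp add: powr_divide powr_minus field_simps)
  also have "\<dots> \<le> (1 + x) powr (-5/4) * 2 powr 2" by (intro mult_left_mono powr_mono) auto
  finally show ?thesis by simp
qed

text \<open>The difference to the fixed reference parameter \<open>\<Lambda>\<close> makes the integral converge. The terms with
  \<open>s > (m + 1)/2\<close>, for which the integral in \<open>K_coeff\<close> diverges at 0, are absorbed into the error.\<close>

lemma action_expansion:
  assumes m: "3 \<le> m" and \<Lambda>: "1 \<le> \<Lambda>"
    and near: "\<And>l. \<Lambda> \<le> l \<Longrightarrow> near_model m a (of_real l) l 0"
  obtains \<Phi> c0 \<kappa> C where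
    "\<And>l. \<Lambda> \<le> l \<Longrightarrow> ((\<lambda>X. integral {0..X} (\<lambda>x. csqrt (Qpoly m a (of_real l) (of_real x)) - csqrt (Qpoly m a (of_real \<Lambda>) (of_real x)))) \<longlongrightarrow> \<Phi> l) at_top"
    "continuous_on {\<Lambda>..} \<Phi>"
    "\<And>l. \<Lambda> \<le> l \<Longrightarrow> norm (\<Phi> l - (c0 + \<kappa> * of_real (l powr (1/2 + 1 / real m))
        + (\<Sum>s=1..(m+1) div 2. K_coeff m a s * of_real (l powr (1/2 + (1 - real s) / real m))))) \<le> C * l powr (1 / (4 * real m))"
proof -
  define q where "q = (\<lambda>l x. csqrt (Qpoly m a (of_real l) (of_real x)))"
  define J where "J = (m + 1) div 2"
  \<comment> \<open>The Taylor remainder of order \<open>n\<close> decays like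
    \<open>x^(m/2 - n - 1)\<close>; since \<open>J \<ge> m/2\<close>, this choice makes the exponent
    at most -2.\<close>
  define n where "n = J + 1"
  define \<theta> where "\<theta> = 1 / (4 * real m)"
  define w where "w = (\<lambda>x::real. (1 + x) powr (-5/4))"
  have J: "real m / 2 \<le> real J" "real J \<le> (real m + 1) / 2" by (auto simp: J_def field_simps)
  have w: "set_integrable lborel {0<..} w" unfolding w_def by (rule set_integrable_one_plus_powr) simp
  have w0: "0 \<le> w x" for x by (simp add: w_def)
  have cont: "continuous_on {0..} (q l)" if "\<Lambda> \<le> l" for l
    using near_model_primitive[OF near[OF that]] \<Lambda> that unfolding q_def by fastforce
  have cont': "continuous_on {0<..} (\<lambda>x. q l x - q l' x)" if "\<Lambda> \<le> l" "\<Lambda> \<le> l'" for l l'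
    by (intro continuous_on_diff continuous_on_subset[OF cont[OF that(1)]] continuous_on_subset[OF cont[OF that(2)]]) auto
  have q_diff: "norm (q l x - q l' x) \<le> \<bar>l - l'\<bar> * (4 * w x)" if l: "\<Lambda> \<le> l" "\<Lambda> \<le> l'" and x: "0 < x" for l l' x
  proof -
    have n: "norm (complex_of_real l - of_real l') = \<bar>l - l'\<bar>" by (metis norm_of_real of_real_diff)
    have "norm (q l x - q l' x) \<le> \<bar>l - l'\<bar> * min 1 (x powr (- (real m / 2)))"
      using near_model_csqrt_diff(1,2)[OF near[OF l(1)] _ near[OF l(2)], of x] x l \<Lambda>
      unfolding q_def n by (auto simp: min_def)
    also have "\<dots> \<le> \<bar>l - l'\<bar> * (4 * w x)"
      unfolding w_def by (intro mult_left_mono min_one_powr_le m x) auto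
    finally show ?thesis .
  qed
  have int: "set_integrable lborel {0<..} (\<lambda>x. q l x - q l' x)" if "\<Lambda> \<le> l" "\<Lambda> \<le> l'" for l l'
    by (rule set_integrable_halfline_bound[OF cont'[OF that], of "\<lambda>x. \<bar>l - l'\<bar> * (4 * w x)"])
      (use w q_diff that in auto)
  define \<Phi> where "\<Phi> = (\<lambda>l. LBINT x:{0<..}. q l x - q \<Lambda> x)"
  \<comment> \<open>The integrals over \<open>{0..X}\<close> converge to the Lebesgue integral over
    the half line, whose endpoint 0 is a null set.\<close>
  have lim: "((\<lambda>X. integral {0..X} (\<lambda>x. q l x - q \<Lambda> x)) \<longlongrightarrow> \<Phi> l) at_top" if l: "\<Lambda> \<le> l" for l
  proof -
    let ?f = "\<lambda>x. q l x - q \<Lambda> x"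
    have c: "continuous_on {0..} ?f" by (intro continuous_on_diff cont l order_refl)
    have meas: "(\<lambda>x. indicator {0<..} x *\<^sub>R ?f x) \<in> borel_measurable lborel" "(\<lambda>x. indicator {0..} x *\<^sub>R ?f x) \<in> borel_measurable lborel"
      using borel_measurable_continuous_on_indicator[OF _ cont'[OF l order_refl]] borel_measurable_continuous_on_indicator[OF _ c] by auto
    have ae: "AE x in lborel. indicator {0<..} x *\<^sub>R ?f x = indicator {0..} x *\<^sub>R ?f x"
      using AE_lborel_singleton[of "0::real"] by eventually_elim (auto simp: indicator_def)
    have i: "set_integrable lborel {0..} ?f"
      using int[OF l order_refl] integrable_cong_AE[OF meas ae] by (simp add: set_integrable_def)
    have "\<Phi> l = (LBINT x:{0..}. ?f x)"
      unfolding \<Phi>_def set_lebesgue_integral_def by (rule integral_cong_AE[OF meas ae])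
    moreover have "((\<lambda>b. LBINT x:{0..b}. ?f x) \<longlongrightarrow> (LBINT x:{0..}. ?f x)) at_top"
      by (rule tendsto_set_lebesgue_integral_at_top[OF _ i]) auto
    moreover have "(LBINT x:{0..b}. ?f x) = integral {0..b} ?f" for b
      by (rule set_borel_integral_eq_integral(2)) (rule set_integrable_subset[OF i], auto)
    ultimately show ?thesis by simp
  qed
  \<comment> \<open>The integrable majorant for \<open>q l - q l'\<close> is proportional to
    \<open>|l - l'|\<close>, so \<open>\<Phi>\<close> is Lipschitz.\<close>
  have contPhi: "continuous_on {\<Lambda>..} \<Phi>"
  proof (rule lipschitz_on_continuous_on[OF lipschitz_onI])
    define W where "W = (LBINT x:{0<..}. 4 * w x)"
    show "0 \<le> W" unfolding W_def set_lebesgue_integral_def by (intro integral_nonneg_AE) (auto simp: w0)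
    fix l l' assume l: "l \<in> {\<Lambda>..}" "l' \<in> {\<Lambda>..}"
    have "\<Phi> l - \<Phi> l' = (LBINT x:{0<..}. (q l x - q \<Lambda> x) - (q l' x - q \<Lambda> x))"
      unfolding \<Phi>_def using l int by (intro set_integral_diff(2)[symmetric]) auto
    also have "\<dots> = (LBINT x:{0<..}. q l x - q l' x)" by simp
    also have "norm \<dots> \<le> (LBINT x:{0<..}. \<bar>l - l'\<bar> * (4 * w x))"
      using l w q_diff by (intro set_integral_norm_le int) auto
    also have "\<dots> = \<bar>l - l'\<bar> * W" unfolding W_def by (rule set_integral_mult_right)
    finally show "dist (\<Phi> l) (\<Phi> l') \<le> W * dist l l'" by (simp add: dist_norm mult.commute)
  qed
  \<comment> \<open>Pairs \<open>(k, s)\<close> of the Taylor order \<open>k\<close> and the weight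
    \<open>s\<close> of the multi-indices occurring in \<open>P^k\<close>.\<close>
  define I where "I = Sigma {..n} (\<lambda>k. {..(m-1)*k})"
  define c where "c = (\<lambda>(k, s). ((1/2) gchoose k) * multi_sum m a k s :: complex)"
  define H where "H = (\<lambda>l (k, s) x. x ^ (m * k - s) * (x ^ m + l) powr (1/2 - real k))"
  \<comment> \<open>In the difference to \<open>\<Lambda>\<close> the powers subtracted in
    \<open>K_integrand\<close> cancel, so the Taylor terms with \<open>s \<le> J\<close> can be
    integrated one by one.\<close>
  define Kd where "Kd = (\<lambda>l (k, s) x. K_integrand m s k l x - K_integrand m s k \<Lambda> x)"
  define P where "P = (\<lambda>x::real. lower_part m a (of_real x))"
  define R where "R = (\<lambda>l x. q l x - (\<Sum>i\<in>I. c i * of_real (H l i x)))"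
  have finI: "finite I" by (simp add: I_def)
  have Kd_H: "Kd l i x = H l i x - H \<Lambda> i x" for l i x
    by (cases i) (simp add: Kd_def H_def K_integrand_def)
  obtain A where A: "0 \<le> A" "\<And>x::real. 0 \<le> x \<Longrightarrow> norm (P x) \<le> A * (1 + x) ^ (m - 1)"
    unfolding P_def using lower_part_bound by blast
  obtain Ct where Ct: "0 \<le> Ct" "\<And>T P. 0 < T \<Longrightarrow> norm P \<le> T / 2 \<Longrightarrow>
       norm (csqrt (of_real T + P) - (\<Sum>k\<le>n. ((1/2) gchoose k) * P ^ k * of_real (T powr (1/2 - real k))))
       \<le> Ct * norm P ^ (n + 1) * T powr (1/2 - real (n + 1))"
    using csqrt_Taylor_remainder by blast
  define CR where "CR = Ct * A ^ (n + 1) * (2 ^ m) powr (real n + 1/2)"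
  have CR: "0 \<le> CR" using Ct A by (simp add: CR_def)
  have R_bound: "norm (R l x) \<le> CR * w x" if l: "\<Lambda> \<le> l" and x: "0 < x" for l x
  proof -
    let ?T = "x ^ m + l"
    have T: "0 < ?T" using x l \<Lambda> by (simp add: add_pos_pos)
    have PT: "norm (P x) \<le> ?T / 2"
      using near[OF l] x by (simp add: near_model_def Qpoly_def P_def)
    have qT: "q l x = csqrt (of_real ?T + P x)" by (simp add: q_def Qpoly_def P_def algebra_simps)
    have "(\<Sum>i\<in>I. c i * of_real (H l i x)) = (\<Sum>k\<le>n. \<Sum>s\<le>(m-1)*k. c (k, s) * of_real (H l (k, s) x))"
      unfolding I_def by (subst sum.Sigma) auto
    also have "\<dots> = (\<Sum>k\<le>n. ((1/2) gchoose k) * P x ^ k * of_real (?T powr (1/2 - real k)))"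
    proof (rule sum.cong[OF refl])
      fix k
      have m1: "1 \<le> m" using m by simp
      show "(\<Sum>s\<le>(m-1)*k. c (k, s) * of_real (H l (k, s) x)) = ((1/2) gchoose k) * P x ^ k * of_real (?T powr (1/2 - real k))"
        unfolding P_def lower_part_power[OF m1] sum_distrib_left sum_distrib_right
        by (simp add: c_def H_def mult_ac)
    qed
    finally have "R l x = csqrt (of_real ?T + P x) - (\<Sum>k\<le>n. ((1/2) gchoose k) * P x ^ k * of_real (?T powr (1/2 - real k)))"
      by (simp only: R_def qT)
    then have "norm (R l x) \<le> Ct * norm (P x) ^ (n + 1) * ?T powr (1/2 - real (n + 1))"
      using Ct(2)[OF T PT] by simp
    also have "\<dots> \<le> Ct * (A * (1 + x) ^ (m - 1)) ^ (n + 1) * ((2 ^ m) powr (real n + 1/2) * (1 + x) powr (- (real m * (real n + 1/2))))"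
    proof (intro mult_mono power_mono)
      show "norm (P x) \<le> A * (1 + x) ^ (m - 1)" using A(2) x by simp
      have e: "1/2 - real (n + 1) = - (real n + 1/2)" by simp
      show "?T powr (1/2 - real (n + 1)) \<le> (2 ^ m) powr (real n + 1/2) * (1 + x) powr (- (real m * (real n + 1/2)))"
        unfolding e by (rule power_plus_powr_neg_bound) (use x l \<Lambda> in auto)
    qed (use Ct A x in auto)
    also have "\<dots> = CR * ((1 + x) powr (real (m - 1) * real (n + 1)) * (1 + x) powr (- (real m * (real n + 1/2))))"
    proof -
      have "((1 + x) ^ (m - 1)) ^ (n + 1) = (1 + x) powr (real (m - 1) * real (n + 1))"
        using x by (simp only: power_mult[symmetric] of_nat_mult[symmetric]) (subst powr_realpow, simp_all)
      then show ?thesis unfolding CR_def power_mult_distrib by (simp only: mult_ac)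
    qed
    also have "\<dots> = CR * (1 + x) powr (real (m - 1) * real (n + 1) - real m * (real n + 1/2))"
      by (simp only: powr_add[symmetric] diff_conv_add_uminus)
    also have "\<dots> \<le> CR * w x"
      unfolding w_def
    proof (intro mult_left_mono powr_mono CR)
      have "real (m - 1) = real m - 1" using m by (simp add: of_nat_diff)
      then have "real (m - 1) * real (n + 1) - real m * (real n + 1/2) = real m / 2 - real n - 1"
        by (simp add: algebra_simps)
      then show "real (m - 1) * real (n + 1) - real m * (real n + 1/2) \<le> -5/4" using J by (simp add: n_def)
    qed (use x in simp)
    finally show ?thesis .
  qed
  define I1 where "I1 = {i \<in> I. snd i \<le> J}"
  define I2 where "I2 = {i \<in> I. \<not> snd i \<le> J}"
  have fin12: "finite I1" "finite I2" using finI by (auto simp: I1_def I2_def)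
  have split: "(\<Sum>i\<in>I. F i) = (\<Sum>i\<in>I1. F i) + (\<Sum>i\<in>I2. F i)" for F :: "nat \<times> nat \<Rightarrow> complex"
    unfolding I1_def I2_def by (subst sum.union_disjoint[symmetric]) (use finI in \<open>auto intro!: sum.cong\<close>)
  \<comment> \<open>What remains of the integrand after the terms with convergent integrals are
    removed: terms of weight above \<open>J\<close> and Taylor remainders.\<close>
  define G where "G = (\<lambda>l x. (q l x - q \<Lambda> x) - (\<Sum>i\<in>I1. c i * of_real (Kd l i x)))"
  have G_eq: "G l x = (\<Sum>i\<in>I2. c i * of_real (Kd l i x)) + (R l x - R \<Lambda> x)" for l x
    unfolding G_def R_def split[of "\<lambda>i. c i * of_real (H l i x)"] split[of "\<lambda>i. c i * of_real (H \<Lambda> i x)"] Kd_H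
    by (simp add: algebra_simps sum_subtractf sum.distrib)
  define CH where "CH = (\<Sum>i\<in>I2. norm (c i) * ((real (fst i) + 1) * (2 ^ m) powr (real (fst i) - 1/2 + \<theta>)))"
  have CH: "0 \<le> CH" unfolding CH_def by (intro sum_nonneg) auto
  have G_bound: "norm (G l x) \<le> (CH + 2 * CR) * l powr \<theta> * w x" if l: "\<Lambda> \<le> l" and x: "0 < x" for l x
  proof -
    have lt: "1 \<le> l powr \<theta>" using l \<Lambda> by (intro ge_one_powr_ge_zero) (auto simp: \<theta>_def)
    have "norm (c i * of_real (Kd l i x)) \<le> norm (c i) * ((real (fst i) + 1) * (2 ^ m) powr (real (fst i) - 1/2 + \<theta>) * l powr \<theta> * w x)"
      if i: "i \<in> I2" for i
    proof -
      obtain k s where ks: "i = (k, s)" by (cases i)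
      have s: "s \<le> (m - 1) * k" "J < s" using i by (auto simp: I2_def I_def ks)
      then have k: "1 \<le> k" by (cases k) auto
      have "(m - 1) * k \<le> m * k" by simp
      then have smk: "s \<le> m * k" using s by linarith
      have "real J + 1 \<le> real s" using s by simp
      then have s': "real m / 2 + 1 \<le> real s" using J by linarith
      have "\<bar>Kd l i x\<bar> \<le> (real k + 1) * (2 ^ m) powr (real k - 1/2 + \<theta>) * l powr \<theta> * w x"
        using high_order_term_bound[OF m k s' smk \<Lambda> l, of x] x by (simp add: Kd_H H_def ks \<theta>_def w_def)
      then show ?thesis unfolding norm_mult norm_of_real ks fst_conv by (intro mult_left_mono) auto
    qed
    then have "norm (\<Sum>i\<in>I2. c i * of_real (Kd l i x)) \<le> (\<Sum>i\<in>I2. norm (c i) * ((real (fst i) + 1) * (2 ^ m) powr (real (fst i) - 1/2 + \<theta>) * l powr \<theta> * w x))"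
      by (intro order_trans[OF norm_sum] sum_mono)
    also have "\<dots> = CH * l powr \<theta> * w x"
      unfolding CH_def sum_distrib_right by (intro sum.cong refl) (simp only: mult_ac)
    finally have 1: "norm (\<Sum>i\<in>I2. c i * of_real (Kd l i x)) \<le> CH * l powr \<theta> * w x" .
    have "norm (R l x - R \<Lambda> x) \<le> CR * w x + CR * w x"
      using R_bound[OF l x] R_bound[OF order_refl x] by (intro order_trans[OF norm_triangle_ineq4] add_mono)
    also have "\<dots> \<le> 2 * CR * l powr \<theta> * w x"
    proof -
      have "(2 * CR * w x) * 1 \<le> (2 * CR * w x) * l powr \<theta>" using lt CR w0 by (intro mult_left_mono) auto
      then show ?thesis by (simp add: mult_ac)
    qed
    finally have 2: "norm (R l x - R \<Lambda> x) \<le> 2 * CR * l powr \<theta> * w x" .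
    show ?thesis unfolding G_eq by (rule order_trans[OF norm_triangle_ineq]) (use 1 2 in \<open>simp add: distrib_right\<close>)
  qed
  have I1D: "real s \<le> (real m + 1) / 2" "s \<le> m * k" if "(k, s) \<in> I1" for k s
  proof -
    have "s \<le> (m - 1) * k" "s \<le> J" using that by (auto simp: I1_def I_def)
    moreover have "(m - 1) * k \<le> m * k" by simp
    ultimately show "real s \<le> (real m + 1) / 2" "s \<le> m * k" using J by (auto intro: order_trans)
  qed
  define \<sigma> where "\<sigma> = (\<lambda>s. 1/2 + (1 - real s) / real m)"
  define S where "S = (\<lambda>l. \<Sum>i\<in>I1. c i * of_real (l powr \<sigma> (snd i) * K_int m (snd i) (fst i)))"
  have Kd_int: "set_integrable lborel {0<..} (Kd l i)" "(LBINT x:{0<..}. Kd l i x) = l powr \<sigma> (snd i) * K_int m (snd i) (fst i) - \<Lambda> powr \<sigma> (snd i) * K_int m (snd i) (fst i)"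
    if l: "\<Lambda> \<le> l" and i: "i \<in> I1" for l i
  proof -
    obtain k s where ks: "i = (k, s)" by (cases i)
    have lp: "0 < l" "0 < \<Lambda>" using l \<Lambda> by auto
    note d = I1D[OF i[unfolded ks]]
    show "set_integrable lborel {0<..} (Kd l i)"
      unfolding Kd_def ks prod.case by (intro set_integral_diff K_integrand_integral(1)[OF m d] lp)
    show "(LBINT x:{0<..}. Kd l i x) = l powr \<sigma> (snd i) * K_int m (snd i) (fst i) - \<Lambda> powr \<sigma> (snd i) * K_int m (snd i) (fst i)"
      unfolding Kd_def ks prod.case \<sigma>_def
      by (subst set_integral_diff(2)) (use K_integrand_integral[OF m d] lp in auto)
  qed
  define W where "W = (LBINT x:{0<..}. w x)"
  have main: "norm (\<Phi> l - (S l - S \<Lambda>)) \<le> (CH + 2 * CR) * W * l powr \<theta>" if l: "\<Lambda> \<le> l" for l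
  proof -
    have iK: "set_integrable lborel {0<..} (\<lambda>x. c i * of_real (Kd l i x))" if "i \<in> I1" for i
    proof -
      have "integrable lborel (\<lambda>x. complex_of_real (indicator {0<..} x *\<^sub>R Kd l i x))"
        using Kd_int(1)[OF l that] unfolding set_integrable_def by (rule integrable_of_real)
      then have "set_integrable lborel {0<..} (\<lambda>x. complex_of_real (Kd l i x))"
        by (simp add: set_integrable_def scaleR_conv_of_real)
      then show ?thesis by simp
    qed
    have iS: "set_integrable lborel {0<..} (\<lambda>x. \<Sum>i\<in>I1. c i * of_real (Kd l i x))"
      by (rule set_integral_sum_finite(1)[OF fin12(1) iK])
    have iG: "set_integrable lborel {0<..} (G l)"
      unfolding G_def by (intro set_integral_diff int l order_refl iS)
    have "(LBINT x:{0<..}. \<Sum>i\<in>I1. c i * of_real (Kd l i x)) = (\<Sum>i\<in>I1. c i * of_real (LBINT x:{0<..}. Kd l i x))"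
      using set_integral_sum_finite(2)[OF fin12(1) iK] by (simp add: set_integral_complex_of_real)
    also have "\<dots> = S l - S \<Lambda>"
      unfolding S_def sum_subtractf[symmetric]
      by (intro sum.cong refl) (simp add: Kd_int(2)[OF l] algebra_simps)
    finally have "(LBINT x:{0<..}. G l x) = \<Phi> l - (S l - S \<Lambda>)"
      unfolding G_def \<Phi>_def by (subst set_integral_diff(2)) (use int l iS in auto)
    then have "norm (\<Phi> l - (S l - S \<Lambda>)) = norm (LBINT x:{0<..}. G l x)" by simp
    also have "\<dots> \<le> (LBINT x:{0<..}. (CH + 2 * CR) * l powr \<theta> * w x)"
      using w G_bound[OF l] by (intro set_integral_norm_le iG) auto
    also have "\<dots> = (CH + 2 * CR) * l powr \<theta> * W"
      unfolding W_def by (rule set_integral_mult_right)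
    finally show ?thesis by (simp add: mult_ac)
  qed
  define \<kappa> where "\<kappa> = c (0, 0) * of_real (K_int m 0 0)"
  have S_eq: "S l = \<kappa> * of_real (l powr (1/2 + 1 / real m)) + (\<Sum>s=1..J. K_coeff m a s * of_real (l powr \<sigma> s))" for l
  proof -
    define F where "F = (\<lambda>(k, s). c (k, s) * of_real (l powr \<sigma> s * K_int m s k))"
    \<comment> \<open>Since \<open>multi_sum m a k s\<close> vanishes for \<open>s < k\<close> and
      for \<open>k = 0 < s\<close>, the index set \<open>I1\<close> may be exchanged for the
      triangle \<open>k \<le> s \<le> J\<close>.\<close>
    define I3 where "I3 = {(k, s). k \<le> s \<and> s \<le> J}"
    have I3: "finite I3" by (rule finite_subset[of _ "{..J} \<times> {..J}"]) (auto simp: I3_def)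
    have mJ: "J \<le> m - 1" using m by (auto simp: J_def)
    have F0: "F (k, s) = 0" if "s < k \<or> (k = 0 \<and> 0 < s)" for k s
      using that by (auto simp: F_def c_def multi_sum_less multi_sum_0)
    have "S l = (\<Sum>i\<in>I1. F i)" by (simp add: S_def F_def case_prod_unfold)
    also have "\<dots> = (\<Sum>i\<in>I3. F i)"
    proof (rule sum.mono_neutral_cong[OF I3 fin12(1)])
      fix i assume i: "i \<in> I3 - I1"
      obtain k s where ks: "i = (k, s)" by (cases i)
      have "k \<le> s" "s \<le> J" using i by (auto simp: I3_def ks)
      moreover have "\<not> s \<le> (m - 1) * k" using i by (auto simp: I1_def I_def I3_def ks n_def)
      moreover have "J \<le> (m - 1) * k" if "1 \<le> k" using mJ that by (cases k) (auto intro: trans_le_add1)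
      ultimately have "k = 0" "0 < s" by (cases k; force)+
      then show "F i = 0" using F0 ks by simp
    next
      fix i assume i: "i \<in> I1 - I3"
      obtain k s where ks: "i = (k, s)" by (cases i)
      have "s < k" using i by (auto simp: I1_def I3_def ks)
      then show "F i = 0" using F0 ks by simp
    qed auto
    also have "\<dots> = (\<Sum>(s, k)\<in>Sigma {..J} (\<lambda>s. {..s}). F (k, s))"
      by (rule sum.reindex_bij_witness[of _ "\<lambda>(s, k). (k, s)" "\<lambda>(k, s). (s, k)"]) (auto simp: I3_def)
    also have "\<dots> = (\<Sum>s\<le>J. \<Sum>k\<le>s. F (k, s))" by (subst sum.Sigma) auto
    also have "\<dots> = F (0, 0) + (\<Sum>s=1..J. \<Sum>k\<le>s. F (k, s))"
      by (simp add: atMost_atLeast0 sum.atLeast_Suc_atMost[of 0 J])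
    also have "(\<Sum>s=1..J. \<Sum>k\<le>s. F (k, s)) = (\<Sum>s=1..J. K_coeff m a s * of_real (l powr \<sigma> s))"
    proof (rule sum.cong[OF refl])
      fix s assume s: "s \<in> {1..J}"
      have "(\<Sum>k\<le>s. F (k, s)) = (\<Sum>k=1..s. F (k, s))"
        using s F0[of s 0] by (simp add: atMost_atLeast0 sum.atLeast_Suc_atMost[of 0 s])
      then show "(\<Sum>k\<le>s. F (k, s)) = K_coeff m a s * of_real (l powr \<sigma> s)"
        using s by (simp add: K_coeff_def F_def c_def b_coeff_def sum_distrib_left sum_distrib_right mult_ac)
    qed
    also have "F (0, 0) = \<kappa> * of_real (l powr (1/2 + 1 / real m))" by (simp add: F_def \<kappa>_def \<sigma>_def mult_ac)
    finally show ?thesis .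
  qed
  show ?thesis
  proof (rule that[of \<Phi> "- S \<Lambda>" \<kappa> "(CH + 2 * CR) * W"])
    show "norm (\<Phi> l - (- S \<Lambda> + \<kappa> * of_real (l powr (1/2 + 1 / real m))
        + (\<Sum>s=1..(m+1) div 2. K_coeff m a s * of_real (l powr (1/2 + (1 - real s) / real m))))) \<le> (CH + 2 * CR) * W * l powr (1 / (4 * real m))"
      if "\<Lambda> \<le> l" for l
      using main[OF that] unfolding S_eq[of l] by (simp add: J_def \<sigma>_def \<theta>_def algebra_simps)
  qed (use lim contPhi in \<open>auto simp: q_def\<close>)
qed

section \<open>Asymptotics of the characteristic function\<close>

lemma norm_Ln_le_of_near_1:
  assumes "norm (z - 1) \<le> 1/2"
  shows "z \<notin> \<real>\<^sub>\<le>\<^sub>0" "norm (Ln z) \<le> 5"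
proof -
  have Re: "1/2 \<le> Re z" using assms abs_Re_le_cmod[of "z - 1"] by simp
  then show "z \<notin> \<real>\<^sub>\<le>\<^sub>0" by (auto simp: complex_nonpos_Reals_iff)
  have z0: "z \<noteq> 0" using Re by auto
  have n: "1/2 \<le> norm z" "norm z \<le> 3/2"
    using Re complex_Re_le_cmod[of z] assms norm_triangle_ineq2[of z 1] by auto
  have "ln (norm z) \<le> norm z - 1" using n by (intro ln_le_minus_one) auto
  moreover have "- ln (norm z) \<le> inverse (norm z) - 1"
    using z0 ln_le_minus_one[of "inverse (norm z)"] ln_inverse[of "norm z"] by simp
  moreover have "inverse (norm z) \<le> 2" using n le_imp_inverse_le[of "1/2" "norm z"] by simp
  ultimately have "\<bar>ln (norm z)\<bar> \<le> 1" using n by linarith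
  moreover have "\<bar>Im (Ln z)\<bar> \<le> pi" using mpi_less_Im_Ln[OF z0] Im_Ln_le_pi[OF z0] by simp
  moreover have "norm (Ln z) \<le> \<bar>Re (Ln z)\<bar> + \<bar>Im (Ln z)\<bar>" by (rule cmod_le)
  ultimately show "norm (Ln z) \<le> 5" using pi_less_4 z0 by simp
qed

lemma ln_le_powr_div:
  fixes x e :: real
  assumes "1 \<le> x" "0 < e"
  shows "ln x \<le> x powr e / e"
proof -
  have "e * ln x = ln (x powr e)" using assms by simp
  also have "\<dots> \<le> x powr e" using assms by (intro order_trans[OF ln_le_minus_one]) auto
  finally show ?thesis using assms by (simp add: field_simps)
qed

text \<open>The characteristic function is written exactly as
  \<open>\<gamma> l^e exp (\<Phi> l)\<close> times factors \<open>\<tau>\<close> and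
  \<open>\<tau>2\<close> within 1/2 of 1. Their principal logarithms are bounded and continuous, so
  \<open>\<zeta>\<close> is a continuous logarithm that differs from \<open>\<Phi>\<close> by
  \<open>O(1 + ln l)\<close>, which \<open>l^(1/(4m))\<close> absorbs.\<close>

lemma sibuya_log_asymptotics:
  assumes sib: "sibuya_solution m f" and m: "3 \<le> m" and ab: "(\<alpha>, \<beta>) \<noteq> (0, 0)"
  obtains \<Lambda> \<zeta> c0 \<kappa> C where "1 \<le> \<Lambda>" "continuous_on {\<Lambda>..} \<zeta>"
    "\<And>l. \<Lambda> \<le> l \<Longrightarrow> \<alpha> * f 0 a (of_real l) + \<beta> * deriv (\<lambda>z. f z a (of_real l)) 0 = exp (\<zeta> l)"
    "\<And>l. \<Lambda> \<le> l \<Longrightarrow> norm (\<zeta> l - (c0 + \<kappa> * of_real (l powr (1/2 + 1 / real m))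
        + (\<Sum>s=1..(m+1) div 2. K_coeff m a s * of_real (l powr (1/2 + (1 - real s) / real m))))) \<le> C * l powr (1 / (4 * real m))"
proof -
  define D where "D = (\<lambda>l. \<alpha> * f 0 a l + \<beta> * deriv (\<lambda>z. f z a l) 0)"
  have m0: "m \<noteq> 0" using m by simp
  have Q0: "Qpoly m a l 0 = l" for l
  proof -
    have "(\<Sum>i=1..m-1. a i * 0 ^ (m - i)) = 0" by (rule sum.neutral) auto
    then show ?thesis using m0 by (simp add: Qpoly_def lower_part_def)
  qed
  from sibuya_compare[OF sib m, of a] obtain \<Lambda> B where L: "1 \<le> \<Lambda>" "0 \<le> B"
    and n1: "\<And>l x0. \<Lambda> \<le> l \<Longrightarrow> 0 \<le> x0 \<Longrightarrow> near_model m a (of_real l) l x0"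
    and n2: "\<And>l x0. \<Lambda> \<le> norm l \<Longrightarrow> 0 \<le> x0 \<Longrightarrow> 16 * norm l \<le> x0 ^ m \<Longrightarrow> near_model m a l (norm l) x0"
    and mono: "\<And>l \<mu> x0 x y. \<Lambda> \<le> \<mu> \<Longrightarrow> 0 \<le> x0 \<Longrightarrow> near_model m a l \<mu> x0 \<Longrightarrow> x0 \<le> x \<Longrightarrow> x \<le> y \<Longrightarrow>
        norm (f (of_real y) a l) \<le> norm (f (of_real x) a l)"
    and der: "\<And>l \<mu> x0. \<Lambda> \<le> \<mu> \<Longrightarrow> 0 \<le> x0 \<Longrightarrow> near_model m a l \<mu> x0 \<Longrightarrow>
        norm (deriv (\<lambda>z. f z a l) (of_real x0) + csqrt (Qpoly m a l (of_real x0)) * f (of_real x0) a l) \<le> B * norm (f (of_real x0) a l)"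
    and cmp: "\<And>l \<mu> x0. \<Lambda> \<le> \<mu> \<Longrightarrow> 0 \<le> x0 \<Longrightarrow> near_model m a l \<mu> x0 \<Longrightarrow>
        f (of_real x0) a l * csqrt (csqrt (Qpoly m a l (of_real x0))) \<noteq> 0 \<and>
        eventually (\<lambda>X. norm (f (of_real x0) a l * csqrt (csqrt (Qpoly m a l (of_real x0)))
             / (f (of_real x0) a (of_real \<Lambda>) * csqrt (csqrt (Qpoly m a (of_real \<Lambda>) (of_real x0))))
             * exp (- integral {x0..X} (\<lambda>x. csqrt (Qpoly m a l (of_real x)) - csqrt (Qpoly m a (of_real \<Lambda>) (of_real x)))) - 1) \<le> 1/2) at_top"
    by blast
  have near0: "\<And>l. \<Lambda> \<le> l \<Longrightarrow> near_model m a (of_real l) l 0" by (rule n1) auto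
  from action_expansion[OF m L(1) near0] obtain \<Phi> c0 \<kappa> C where
    lim: "\<And>l. \<Lambda> \<le> l \<Longrightarrow> ((\<lambda>X. integral {0..X} (\<lambda>x. csqrt (Qpoly m a (of_real l) (of_real x)) - csqrt (Qpoly m a (of_real \<Lambda>) (of_real x)))) \<longlongrightarrow> \<Phi> l) at_top"
    and cPhi: "continuous_on {\<Lambda>..} \<Phi>"
    and exp_Phi: "\<And>l. \<Lambda> \<le> l \<Longrightarrow> norm (\<Phi> l - (c0 + \<kappa> * of_real (l powr (1/2 + 1 / real m))
        + (\<Sum>s=1..(m+1) div 2. K_coeff m a s * of_real (l powr (1/2 + (1 - real s) / real m))))) \<le> C * l powr (1 / (4 * real m))"
    by blast
  define r where "r = (\<lambda>l::real. of_real (sqrt (sqrt l)) :: complex)"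
  have r: "csqrt (csqrt (of_real l)) = r l" if "0 \<le> l" for l using that by (simp add: r_def)
  define w where "w = f 0 a (of_real \<Lambda>) * r \<Lambda>"
  have fnz: "f 0 a (of_real l) \<noteq> 0" if l: "\<Lambda> \<le> l" for l
    using cmp[OF l order_refl n1[OF l order_refl]] by auto
  have rnz: "r l \<noteq> 0" if "\<Lambda> \<le> l" for l using that L by (simp add: r_def)
  have wnz: "w \<noteq> 0" using fnz rnz by (simp add: w_def)
  define \<tau> where "\<tau> = (\<lambda>l. f 0 a (of_real l) * r l / w * exp (- \<Phi> l))"
  have \<tau>: "norm (\<tau> l - 1) \<le> 1/2" if l: "\<Lambda> \<le> l" for l
  proof (rule tendsto_upperbound)
    let ?I = "\<lambda>X. integral {0..X} (\<lambda>x. csqrt (Qpoly m a (of_real l) (of_real x)) - csqrt (Qpoly m a (of_real \<Lambda>) (of_real x)))"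
    show "((\<lambda>X. norm (f 0 a (of_real l) * r l / w * exp (- ?I X) - 1)) \<longlongrightarrow> norm (\<tau> l - 1)) at_top"
      unfolding \<tau>_def by (intro tendsto_intros lim l)
    show "eventually (\<lambda>X. norm (f 0 a (of_real l) * r l / w * exp (- ?I X) - 1) \<le> 1/2) at_top"
      using cmp[OF l order_refl n1[OF l order_refl]] l L by (simp add: Q0 r_def w_def)
  qed simp
  \<comment> \<open>For \<open>\<beta> \<noteq> 0\<close> the derivative dominates:
    \<open>f' / f\<close> is \<open>- sqrt l\<close> up to a bounded error, so \<open>D\<close> is
    close to \<open>- \<beta> sqrt l f\<close>.\<close>
  define \<tau>2 where "\<tau>2 = (\<lambda>l. if \<beta> = 0 then 1 else D (of_real l) / (- \<beta> * of_real (sqrt l) * f 0 a (of_real l)))"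
  \<comment> \<open>Chosen to make \<open>(|\<alpha> / \<beta>| + B) / sqrt l\<close> at most
    1/2.\<close>
  define \<Lambda>' where "\<Lambda>' = max \<Lambda> ((2 * (norm (\<alpha> / \<beta>) + B))\<^sup>2)"
  have \<tau>2: "norm (\<tau>2 l - 1) \<le> 1/2" if l: "\<Lambda>' \<le> l" for l
  proof (cases "\<beta> = 0")
    case False
    have l': "\<Lambda> \<le> l" "1 \<le> l" "(2 * (norm (\<alpha> / \<beta>) + B))\<^sup>2 \<le> l" using l L by (auto simp: \<Lambda>'_def)
    have sl: "2 * (norm (\<alpha> / \<beta>) + B) \<le> sqrt l" using l'(3) by (rule real_le_rsqrt)
    have sl0: "0 < sqrt l" using l' by simp
    let ?F = "f 0 a (of_real l)" and ?F' = "deriv (\<lambda>z. f z a (of_real l)) 0"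
    define \<epsilon> where "\<epsilon> = (?F' + of_real (sqrt l) * ?F) / ?F"
    have d: "norm (?F' + of_real (sqrt l) * ?F) \<le> B * norm ?F"
      using der[OF l'(1) order_refl n1[OF l'(1) order_refl]] l' by (simp add: Q0)
    have \<epsilon>: "norm \<epsilon> \<le> B" using d fnz[OF l'(1)] by (simp add: \<epsilon>_def norm_divide field_simps)
    have F': "?F' = (\<epsilon> - of_real (sqrt l)) * ?F" using fnz[OF l'(1)] by (simp add: \<epsilon>_def field_simps)
    have "D (of_real l) = (\<alpha> + \<beta> * \<epsilon> - \<beta> * of_real (sqrt l)) * ?F" unfolding D_def F' by (simp add: algebra_simps)
    then have "\<tau>2 l = (\<alpha> + \<beta> * \<epsilon> - \<beta> * of_real (sqrt l)) / (- \<beta> * of_real (sqrt l))"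
      using False fnz[OF l'(1)] by (simp add: \<tau>2_def)
    also have "\<dots> = 1 - (\<alpha> / \<beta> + \<epsilon>) / of_real (sqrt l)" using False sl0 by (simp add: field_simps)
    finally have "norm (\<tau>2 l - 1) = norm (\<alpha> / \<beta> + \<epsilon>) / sqrt l" using l' by (simp add: norm_divide)
    also have "\<dots> \<le> (norm (\<alpha> / \<beta>) + B) / sqrt l"
      using \<epsilon> l' by (intro divide_right_mono order_trans[OF norm_triangle_ineq] add_left_mono) auto
    also have "\<dots> \<le> 1/2" using sl sl0 by (simp add: field_simps)
    finally show ?thesis .
  qed (simp add: \<tau>2_def)
  define \<gamma> where "\<gamma> = (if \<beta> = 0 then \<alpha> else - \<beta>) * w"
  \<comment> \<open>The solution itself contributes \<open>l^(-1/4)\<close>; the factor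
    \<open>sqrt l\<close> from the derivative raises this to \<open>l^(1/4)\<close>.\<close>
  define e where "e = (if \<beta> = 0 then -1/4 else 1/4 :: real)"
  have \<gamma>: "\<gamma> \<noteq> 0" using ab wnz by (auto simp: \<gamma>_def)
  define \<zeta> where "\<zeta> = (\<lambda>l. Ln \<gamma> + of_real (e * ln l) + \<Phi> l + Ln (\<tau> l) + Ln (\<tau>2 l))"
  have L': "1 \<le> \<Lambda>'" "\<Lambda> \<le> \<Lambda>'" using L by (auto simp: \<Lambda>'_def)
  have D_eq: "D (of_real l) = exp (\<zeta> l)" if l: "\<Lambda>' \<le> l" for l
  proof -
    have l': "\<Lambda> \<le> l" "0 < l" using l L' L by auto
    have nz: "\<tau> l \<noteq> 0" "\<tau>2 l \<noteq> 0" using norm_Ln_le_of_near_1(1)[OF \<tau>[OF l'(1)]] norm_Ln_le_of_near_1(1)[OF \<tau>2[OF l]] by auto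
    have "exp (\<zeta> l) = \<gamma> * of_real (l powr e) * exp (\<Phi> l) * \<tau> l * \<tau>2 l"
      unfolding \<zeta>_def exp_add using nz \<gamma> l' by (simp add: powr_def flip: exp_of_real)
    also have "\<dots> = (\<gamma> / w) * of_real (l powr e) * (f 0 a (of_real l) * r l) * \<tau>2 l"
      using wnz by (simp add: \<tau>_def exp_minus field_simps)
    also have "r l = of_real (l powr (1/4))"
      using l' by (simp add: r_def powr_half_sqrt[symmetric] powr_powr)
    also have "(\<gamma> / w) * of_real (l powr e) * (f 0 a (of_real l) * of_real (l powr (1/4))) * \<tau>2 l
       = (\<gamma> / w) * f 0 a (of_real l) * of_real (l powr (e + 1/4)) * \<tau>2 l"
      by (simp add: powr_add mult_ac)
    also have "\<dots> = D (of_real l)"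
    proof (cases "\<beta> = 0")
      case True
      then show ?thesis using l' wnz by (simp add: e_def \<gamma>_def \<tau>2_def D_def)
    next
      case False
      have "l powr (e + 1/4) = sqrt l" using l' False by (simp add: e_def powr_half_sqrt)
      then show ?thesis using False fnz[OF l'(1)] l' wnz by (simp add: \<gamma>_def \<tau>2_def)
    qed
    finally show ?thesis by simp
  qed
  have cont: "continuous_on {\<Lambda>'..} \<zeta>"
  proof -
    have holf: "(\<lambda>l. f 0 a l) holomorphic_on UNIV" using sib unfolding sibuya_solution_def by blast
    have cf: "continuous_on {\<Lambda>'..} (\<lambda>l. f 0 a (of_real l))"
      by (rule continuous_on_compose2[OF holomorphic_on_imp_continuous_on[OF holf]]) (auto intro!: continuous_intros)
    have "D holomorphic_on UNIV"
      unfolding D_def using holf by (intro holomorphic_intros sibuya_deriv_holomorphic[OF sib])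
    then have cD: "continuous_on {\<Lambda>'..} (\<lambda>l. D (of_real l))"
      by (intro continuous_on_compose2[OF holomorphic_on_imp_continuous_on[of D UNIV]]) (auto intro!: continuous_intros)
    have cP: "continuous_on {\<Lambda>'..} \<Phi>" by (rule continuous_on_subset[OF cPhi]) (use L' in auto)
    have c1: "continuous_on {\<Lambda>'..} \<tau>"
      unfolding \<tau>_def r_def using wnz by (intro continuous_intros cf cP) auto
    have c2: "continuous_on {\<Lambda>'..} \<tau>2"
    proof (cases "\<beta> = 0")
      case False
      have "continuous_on {\<Lambda>'..} (\<lambda>l. D (of_real l) / (- \<beta> * of_real (sqrt l) * f 0 a (of_real l)))"
        using False fnz L' L by (intro continuous_intros cD cf) auto
      then show ?thesis using False by (simp add: \<tau>2_def)
    qed (simp add: \<tau>2_def)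
    have "continuous_on {\<Lambda>'..} (\<lambda>l. Ln (\<tau> l))"
      using norm_Ln_le_of_near_1(1)[OF \<tau>] L' by (intro continuous_on_Ln' c1) auto
    moreover have "continuous_on {\<Lambda>'..} (\<lambda>l. Ln (\<tau>2 l))"
      using norm_Ln_le_of_near_1(1)[OF \<tau>2] by (intro continuous_on_Ln' c2) auto
    moreover have "continuous_on {\<Lambda>'..} (\<lambda>l. of_real (e * ln l) :: complex)"
      using L' by (intro continuous_intros) auto
    ultimately show ?thesis unfolding \<zeta>_def by (intro continuous_on_add continuous_on_const cP)
  qed
  show ?thesis
  proof (rule that[OF L'(1) cont])
    fix l assume l: "\<Lambda>' \<le> l"
    show "\<alpha> * f 0 a (of_real l) + \<beta> * deriv (\<lambda>z. f z a (of_real l)) 0 = exp (\<zeta> l)"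
      using D_eq[OF l] by (simp add: D_def)
    have l': "\<Lambda> \<le> l" "1 \<le> l" using l L' by auto
    let ?\<theta> = "1 / (4 * real m)"
    let ?M = "c0 + \<kappa> * of_real (l powr (1/2 + 1 / real m))
        + (\<Sum>s=1..(m+1) div 2. K_coeff m a s * of_real (l powr (1/2 + (1 - real s) / real m)))"
    have lt: "1 \<le> l powr ?\<theta>" using l' by (intro ge_one_powr_ge_zero) auto
    have "\<zeta> l - ?M = (\<Phi> l - ?M) + (Ln \<gamma> + of_real (e * ln l) + Ln (\<tau> l) + Ln (\<tau>2 l))" by (simp add: \<zeta>_def)
    also have "norm \<dots> \<le> norm (\<Phi> l - ?M) + (norm (Ln \<gamma>) + norm (of_real (e * ln l) :: complex) + norm (Ln (\<tau> l)) + norm (Ln (\<tau>2 l)))"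
      by (intro order_trans[OF norm_triangle_ineq] add_mono order_refl)
    also have "\<dots> \<le> C * l powr ?\<theta> + (norm (Ln \<gamma>) * l powr ?\<theta> + real m * l powr ?\<theta> + 5 * l powr ?\<theta> + 5 * l powr ?\<theta>)"
    proof (intro add_mono exp_Phi l')
      show "norm (Ln \<gamma>) \<le> norm (Ln \<gamma>) * l powr ?\<theta>" using lt mult_left_mono[of 1 "l powr ?\<theta>" "norm (Ln \<gamma>)"] by simp
      have "ln l \<le> l powr ?\<theta> / ?\<theta>" using l' m by (intro ln_le_powr_div) auto
      then have "ln l / 4 \<le> real m * l powr ?\<theta>" by (simp add: mult_ac)
      moreover have "norm (of_real (e * ln l) :: complex) = ln l / 4" using l' by (auto simp: e_def abs_mult norm_mult)
      ultimately show "norm (of_real (e * ln l) :: complex) \<le> real m * l powr ?\<theta>" by simp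
      show "norm (Ln (\<tau> l)) \<le> 5 * l powr ?\<theta>" using norm_Ln_le_of_near_1(2)[OF \<tau>[OF l'(1)]] lt by linarith
      show "norm (Ln (\<tau>2 l)) \<le> 5 * l powr ?\<theta>" using norm_Ln_le_of_near_1(2)[OF \<tau>2[OF l]] lt by linarith
    qed
    also have "\<dots> = (C + norm (Ln \<gamma>) + real m + 10) * l powr ?\<theta>" by (simp add: algebra_simps)
    finally show "norm (\<zeta> l - ?M) \<le> (C + norm (Ln \<gamma>) + real m + 10) * l powr ?\<theta>" .
  qed
qed

section \<open>Beta integrals and the resolvent sum\<close>

text \<open>The substitution \<open>x = (u / (1 - u))^(1/p)\<close>, that is
  \<open>u = x^p / (1 + x^p)\<close>, leads back to Euler's integral over the unit interval.\<close>

lemma Beta_integral_halfline: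
  fixes p A B :: real
  assumes p: "0 < p" and A: "0 < A + 1/p" and B: "0 < B - A - 1/p"
  shows "set_integrable lborel {0<..} (\<lambda>x. x powr (p * A) / (1 + x powr p) powr B)"
    and "(LBINT x:{0<..}. x powr (p * A) / (1 + x powr p) powr B) = Beta (A + 1/p) (B - A - 1/p) / p"
proof -
  define f where "f = (\<lambda>x::real. x powr (p * A) / (1 + x powr p) powr B)"
  define g where "g = (\<lambda>u::real. (u / (1 - u)) powr (1/p))"
  define g' where "g' = (\<lambda>u::real. (1/p) * (u / (1 - u)) powr (1/p - 1) * (1 / (1 - u)\<^sup>2))"
  define h where "h = (\<lambda>u::real. (1/p) * (u powr (A + 1/p - 1) * (1 - u) powr (B - A - 1/p - 1)))"
  have fg: "f (g u) * g' u = h u" if "0 < u" "u < 1" for u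
  proof -
    define v where "v = 1 - u"
    have v: "0 < v" "0 < u" using that by (auto simp: v_def)
    have 1: "g u powr (p * A) = u powr A * v powr (- A)"
      using v p by (simp add: g_def v_def[symmetric] powr_powr powr_divide powr_minus field_simps)
    have "g u powr p = u / v" using v p by (simp add: g_def v_def[symmetric] powr_powr)
    then have "1 + g u powr p = v powr (-1)" using v by (simp add: v_def powr_minus field_simps)
    then have 2: "(1 + g u powr p) powr B = v powr (- B)" by (simp only: powr_powr) simp
    have 3: "g' u = (1/p) * (u powr (1/p - 1) * v powr (1 - 1/p) * v powr (-2))"
      using v by (simp add: g'_def v_def[symmetric] powr_divide powr_diff powr_minus field_simps)
    have "f (g u) * g' u = (1/p) * ((u powr A * u powr (1/p - 1)) * (v powr (- A) * v powr B * v powr (1 - 1/p) * v powr (-2)))"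
      unfolding f_def 1 2 3 using v by (simp add: powr_minus field_simps)
    also have "\<dots> = h u"
      by (simp add: powr_add[symmetric] h_def v_def algebra_simps)
    finally show ?thesis .
  qed
  have hint: "(h has_integral (1/p) * Beta (A + 1/p) (B - A - 1/p)) {0<..<1}"
    unfolding h_def using has_integral_mult_right[OF has_integral_Beta_real[OF A B], of "1/p"]
    by (simp add: has_integral_Icc_iff_Ioo)
  have "h absolutely_integrable_on {0<..<1}"
  proof (rule nonnegative_absolutely_integrable_1)
    show "h integrable_on {0<..<1}" using hint by (rule has_integral_integrable)
    show "0 \<le> h x" if "x \<in> {0<..<1}" for x using that p by (simp add: h_def)
  qed
  moreover have "set_borel_measurable lborel {0<..<1} h"
    unfolding set_borel_measurable_def h_def by measurable
  ultimately have hi: "set_integrable lborel {0<..<1} h"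
    by (simp add: set_integrable_def set_borel_measurable_def integrable_completion)
  have hv: "(LBINT x:{0<..<1}. h x) = (1/p) * Beta (A + 1/p) (B - A - 1/p)"
    using set_borel_integral_eq_integral(2)[OF hi] integral_unique[OF hint] by simp
  have e01: "einterval 0 1 = {0<..<1}" by (auto simp: einterval_def)
  have eq: "set_integrable lborel {0<..<1} (\<lambda>x. f (g x) * g' x) = set_integrable lborel {0<..<1} h"
    unfolding set_integrable_def by (intro Bochner_Integration.integrable_cong) (auto simp: indicator_def fg)
  have deriv_g: "DERIV g u :> g' u" and cont_f: "isCont f (g u)" and cont_g': "isCont g' u" and "0 \<le> f (g u)"
    if "0 < ereal u" "ereal u < 1" for u
  proof -
    have u: "0 < u" "u < 1" using that by auto
    show "DERIV g u :> g' u" unfolding g_def g'_def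
      using u p by (auto intro!: derivative_eq_intros simp: powr_diff field_simps power2_eq_square)
    have "0 < g u" using u by (simp add: g_def)
    then have "1 + g u powr p \<noteq> 0" by (simp add: add_pos_pos less_imp_neq[symmetric])
    then show "isCont f (g u)" unfolding f_def using \<open>0 < g u\<close> p
      by (intro continuous_intros) (auto simp: add_pos_pos less_imp_neq[symmetric])
    show "isCont g' u" unfolding g'_def using u by (intro continuous_intros) auto
    show "0 \<le> f (g u)" by (simp add: f_def)
  qed
  moreover have "0 \<le> g' u" for u using p by (simp add: g'_def)
  moreover have "((ereal \<circ> g \<circ> real_of_ereal) \<longlongrightarrow> 0) (at_right 0)"
  proof -
    have "((\<lambda>u::real. (u / (1 - u)) powr (1/p)) \<longlongrightarrow> (0 / (1 - 0)) powr (1/p)) (at_right 0)"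
      using p eventually_at_right[of 0 "1::real"]
      by (intro tendsto_intros) (auto intro!: exI[of _ 1] simp: eventually_at_right[of 0 "1::real"])
    then show ?thesis
      unfolding zero_ereal_def ereal_tendsto_simps by (simp add: g_def)
  qed
  moreover have "((ereal \<circ> g \<circ> real_of_ereal) \<longlongrightarrow> \<infinity>) (at_left 1)"
  proof -
    have "filterlim (\<lambda>u::real. (u / (1 - u)) powr (1/p)) at_top (at_left 1)"
      using p by real_asymp
    then show ?thesis
      unfolding one_ereal_def ereal_tendsto_simps by (simp add: g_def)
  qed
  moreover have "set_integrable lborel (einterval 0 1) (\<lambda>x. f (g x) * g' x)" unfolding e01 eq by (rule hi)
  ultimately have *: "set_integrable lborel (einterval 0 \<infinity>) f" "(LBINT x=0..\<infinity>. f x) = (LBINT x=0..1. f (g x) * g' x)"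
    using interval_integral_substitution_nonneg[of 0 1 g g' f 0 \<infinity>] by simp_all
  have "(LBINT x=0..1. f (g x) * g' x) = (LBINT x:{0<..<1}. h x)"
    unfolding interval_lebesgue_integral_def e01 set_lebesgue_integral_def
    by (simp, intro Bochner_Integration.integral_cong) (auto simp: indicator_def fg)
  moreover have "einterval 0 \<infinity> = {0<..}" by (simp add: zero_ereal_def)
  ultimately show "set_integrable lborel {0<..} (\<lambda>x. x powr (p * A) / (1 + x powr p) powr B)"
    "(LBINT x:{0<..}. x powr (p * A) / (1 + x powr p) powr B) = Beta (A + 1/p) (B - A - 1/p) / p"
    using * hv by (simp_all add: f_def interval_lebesgue_integral_def)
qed

text \<open>\<open>Gamma (s + k)\<close> is \<open>Gamma s\<close> times a rising factorial, and the
  reflection formula evaluates \<open>Gamma s * Gamma (1 - s)\<close>. The resulting binomial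
  coefficients are those of exponent \<open>- s\<close>; through them \<open>fps_cpow\<close> enters
  the resolvent expansion.\<close>

lemma Beta_plus_nat_reflection:
  fixes s :: real
  assumes "0 < s" "s < 1"
  shows "(-1) ^ k * Beta (real k + s) (1 - s) = ((- s) gchoose k) * (pi / sin (pi * s))"
proof -
  have G: "Gamma s * Gamma (1 - s) = pi / sin (pi * s)"
  proof -
    have "complex_of_real (Gamma s * Gamma (1 - s)) = of_real (pi / sin (pi * s))"
      using Gamma_reflection_complex[of "of_real s"]
      by (simp add: Gamma_complex_of_real[symmetric] sin_of_real[symmetric])
    then show ?thesis by (simp only: of_real_eq_iff)
  qed
  have "s \<notin> \<int>\<^sub>\<le>\<^sub>0" using assms by (auto elim!: nonpos_Ints_cases)
  then have p: "Gamma (s + real k) = pochhammer s k * Gamma s"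
    using pochhammer_Gamma[of s k] Gamma_real_pos[OF assms(1)] by (simp add: field_simps)
  have "Beta (real k + s) (1 - s) = pochhammer s k * Gamma s * Gamma (1 - s) / fact k"
    using p by (simp add: Beta_def Gamma_fact[symmetric] add_ac)
  then show ?thesis
    unfolding gbinomial_pochhammer G[symmetric] by simp
qed

lemma multi_sum_double_sum:
  fixes F :: "nat \<Rightarrow> nat \<Rightarrow> complex"
  shows "(\<Sum>i\<le>j. \<Sum>k\<le>i. multi_sum m c k i * F k i) = (\<Sum>k\<le>j. \<Sum>i\<le>j. multi_sum m c k i * F k i)"
proof -
  have "(\<Sum>i\<le>j. \<Sum>k\<le>i. multi_sum m c k i * F k i) = (\<Sum>i\<le>j. \<Sum>k\<le>j. multi_sum m c k i * F k i)"
    by (intro sum.cong refl sum.mono_neutral_left) (auto simp: multi_sum_less)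
  then show ?thesis by (subst sum.swap)
qed

text \<open>The geometric series in \<open>- z w\<close>, cut after order \<open>j\<close>, with
  \<open>w^k\<close> replaced by the part of \<open>(\<Sum> c_i y^i)^k\<close> up to
  \<open>y^j\<close>. The factor \<open>z\<close> in front of the error will compensate the growth
  of \<open>y\<close> near the origin.\<close>

lemma geometric_multi_sum_approx:
  fixes w :: complex and y z :: real
  assumes w: "norm w \<le> 1/2" and z: "0 \<le> z" "z \<le> 1"
  shows "norm (1 / (1 + of_real z * w) - (\<Sum>i\<le>j. \<Sum>k\<le>i. multi_sum m c k i * ((-1) ^ k * of_real z ^ k * of_real y ^ i)))
    \<le> z * ((\<Sum>k=1..j. norm (w ^ k - (\<Sum>i\<le>j. multi_sum m c k i * of_real y ^ i))) + 2 * norm w ^ (j + 1))"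
proof -
  define u where "u = - (of_real z * w)"
  define d where "d = (\<lambda>k. w ^ k - (\<Sum>i\<le>j. multi_sum m c k i * of_real y ^ i))"
  have nu: "norm u \<le> z * norm w" using z by (simp add: u_def norm_mult)
  then have nu2: "norm u \<le> 1/2" using mult_mono[OF z(2) w] z w by simp
  then have u1: "1/2 \<le> norm (1 - u)" using norm_triangle_ineq2[of 1 u] by simp
  then have u1': "1 - u \<noteq> 0" by auto
  have "1 / (1 - u) = (\<Sum>k\<le>j. u ^ k) + u ^ (j + 1) / (1 - u)"
    using sum_gp0[of u j] u1' by (simp add: field_simps)
  moreover have "u ^ k - (\<Sum>i\<le>j. multi_sum m c k i * ((-1) ^ k * of_real z ^ k * of_real y ^ i)) = (-1) ^ k * of_real z ^ k * d k" for k
  proof -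
    have "u ^ k = (-1) ^ k * of_real z ^ k * w ^ k" unfolding u_def power_minus[of "of_real z * w"] by (simp add: power_mult_distrib)
    then show ?thesis by (simp add: d_def right_diff_distrib sum_distrib_left mult_ac)
  qed
  moreover have "1 + of_real z * w = 1 - u" by (simp add: u_def)
  ultimately have "1 / (1 + of_real z * w) - (\<Sum>i\<le>j. \<Sum>k\<le>i. multi_sum m c k i * ((-1) ^ k * of_real z ^ k * of_real y ^ i))
    = (\<Sum>k\<le>j. (-1) ^ k * of_real z ^ k * d k) + u ^ (j + 1) / (1 - u)"
    unfolding multi_sum_double_sum by (simp flip: sum_subtractf)
  also have "(\<Sum>k\<le>j. (-1) ^ k * of_real z ^ k * d k) = (\<Sum>k=1..j. (-1) ^ k * of_real z ^ k * d k)"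
  proof (rule sum.mono_neutral_right)
    have "d 0 = 0" by (simp add: d_def multi_sum_0 if_distrib[where f = "\<lambda>x. x * _"] sum.delta cong: if_cong)
    then have "d k = 0" if "k < 1" for k using that by simp
    then show "\<forall>i\<in>{..j} - {1..j}. (-1) ^ i * of_real z ^ i * d i = 0" by (auto simp: not_le)
  qed auto
  also have "norm (\<dots> + u ^ (j + 1) / (1 - u)) \<le> (\<Sum>k=1..j. z * norm (d k)) + z * (2 * norm w ^ (j + 1))"
  proof (intro norm_triangle_mono sum_norm_le)
    fix k assume k: "k \<in> {1..j}"
    then have "z ^ k \<le> z" using power_decreasing[of 1 k z] z by simp
    then show "norm ((-1) ^ k * of_real z ^ k * d k) \<le> z * norm (d k)"
      using z by (simp add: norm_mult norm_power mult_right_mono)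
  next
    have "norm u ^ (j + 1) \<le> (z * norm w) ^ (j + 1)" using nu by (intro power_mono) auto
    also have "\<dots> = z ^ (j + 1) * norm w ^ (j + 1)" by (rule power_mult_distrib)
    also have "\<dots> \<le> z * norm w ^ (j + 1)" using power_decreasing[of 1 "j + 1" z] z by (intro mult_right_mono) auto
    finally have "norm u ^ (j + 1) / norm (1 - u) \<le> z * norm w ^ (j + 1) / (1/2)" using u1 z by (intro frac_le) auto
    then show "norm (u ^ (j + 1) / (1 - u)) \<le> z * (2 * norm w ^ (j + 1))"
      by (simp only: norm_divide norm_power) (simp add: mult_ac)
  qed
  finally show ?thesis by (simp add: d_def distrib_left sum_distrib_left)
qed

text \<open>Here \<open>w\<close> is the polynomial in \<open>y\<close> plus \<open>o(y^j)\<close>,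
  and \<open>w = O(y)\<close>. So \<open>w^k\<close> is the \<open>k\<close>-th power of the
  polynomial up to \<open>o(y^j)\<close>, and both the powers beyond \<open>y^j\<close> and
  \<open>w^(j+1)\<close> are \<open>O(y^(j+1))\<close>.\<close>

lemma multi_sum_power_tendsto:
  fixes w :: "real \<Rightarrow> complex" and y :: "real \<Rightarrow> real"
  assumes y: "(y \<longlongrightarrow> 0) F" "\<forall>\<^sub>F t in F. 0 < y t" and j: "1 \<le> j" "j \<le> m - 1"
    and w: "((\<lambda>t. (w t - (\<Sum>i=1..m-1. c i * of_real (y t) ^ i)) / of_real (y t) ^ j) \<longlongrightarrow> 0) F"
  shows "((\<lambda>t. ((\<Sum>k=1..j. norm (w t ^ k - (\<Sum>i\<le>j. multi_sum m c k i * of_real (y t) ^ i))) + 2 * norm (w t) ^ (j + 1)) / y t ^ j) \<longlongrightarrow> 0) F"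
proof -
  define P where "P = (\<lambda>t. \<Sum>i=1..m-1. c i * of_real (y t) ^ i)"
  define r where "r = (\<lambda>t. (w t - P t) / of_real (y t) ^ j)"
  have r: "(r \<longlongrightarrow> 0) F" using w by (simp add: r_def P_def)
  have yc: "((\<lambda>t. complex_of_real (y t)) \<longlongrightarrow> 0) F" using tendsto_of_real[OF y(1)] by simp
  have P0: "(P \<longlongrightarrow> (\<Sum>i=1..m-1. c i * 0 ^ i)) F" unfolding P_def by (intro tendsto_intros yc)
  then have P: "(P \<longlongrightarrow> 0) F" by (simp add: sum.neutral power_0_left)
  have w_eq: "\<forall>\<^sub>F t in F. P t + r t * of_real (y t) ^ j = w t"
    using y(2) by eventually_elim (simp add: r_def)
  have "((\<lambda>t. P t + r t * of_real (y t) ^ j) \<longlongrightarrow> 0 + 0 * 0 ^ j) F" by (intro tendsto_intros P r yc)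
  then have "(w \<longlongrightarrow> 0 + 0 * 0 ^ j) F" using w_eq by (rule Lim_transform_eventually)
  then have w0: "(w \<longlongrightarrow> 0) F" by simp
  have wy: "((\<lambda>t. w t / of_real (y t)) \<longlongrightarrow> (\<Sum>i=1..m-1. c i * 0 ^ (i - 1)) + 0 * 0 ^ (j - 1)) F"
  proof (rule Lim_transform_eventually)
    show "((\<lambda>t. (\<Sum>i=1..m-1. c i * of_real (y t) ^ (i - 1)) + r t * of_real (y t) ^ (j - 1)) \<longlongrightarrow>
       (\<Sum>i=1..m-1. c i * 0 ^ (i - 1)) + 0 * 0 ^ (j - 1)) F" by (intro tendsto_intros r yc)
    show "\<forall>\<^sub>F t in F. (\<Sum>i=1..m-1. c i * of_real (y t) ^ (i - 1)) + r t * of_real (y t) ^ (j - 1) = w t / of_real (y t)"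
      using y(2) w_eq
    proof eventually_elim
      case (elim t)
      have "P t = (\<Sum>i=1..m-1. c i * of_real (y t) ^ (i - 1)) * of_real (y t)"
        unfolding P_def sum_distrib_right mult.assoc by (intro sum.cong refl) (auto simp flip: power_Suc2)
      moreover have "of_real (y t) ^ j = of_real (y t) ^ (j - 1) * complex_of_real (y t)" using j by (simp flip: power_Suc2)
      ultimately show ?case using elim by (simp add: field_simps flip: elim(2))
    qed
  qed
  have one: "((\<lambda>t. (w t ^ k - (\<Sum>i\<le>j. multi_sum m c k i * of_real (y t) ^ i)) / of_real (y t) ^ j) \<longlongrightarrow> 0) F"
    if k: "k \<in> {1..j}" for k
  proof (rule Lim_transform_eventually)
    have jk: "j \<le> (m - 1) * k" using k j by (cases k) auto
    show "((\<lambda>t. r t * (\<Sum>i<k. P t ^ (k - Suc i) * w t ^ i) + (\<Sum>s\<in>{j+1..(m-1)*k}. multi_sum m c k s * of_real (y t) ^ (s - j))) \<longlongrightarrow> 0) F"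
    proof -
      have "((\<lambda>t. r t * (\<Sum>i<k. P t ^ (k - Suc i) * w t ^ i) + (\<Sum>s\<in>{j+1..(m-1)*k}. multi_sum m c k s * of_real (y t) ^ (s - j)))
        \<longlongrightarrow> 0 * (\<Sum>i<k. 0 ^ (k - Suc i) * 0 ^ i) + (\<Sum>s\<in>{j+1..(m-1)*k}. multi_sum m c k s * 0 ^ (s - j))) F"
        by (intro tendsto_intros r P w0 yc)
      moreover have "(\<Sum>s\<in>{j+1..(m-1)*k}. multi_sum m c k s * 0 ^ (s - j)) = 0"
        by (intro sum.neutral) (auto simp: power_0_left)
      ultimately show ?thesis by simp
    qed
    show "\<forall>\<^sub>F t in F. r t * (\<Sum>i<k. P t ^ (k - Suc i) * w t ^ i) + (\<Sum>s\<in>{j+1..(m-1)*k}. multi_sum m c k s * of_real (y t) ^ (s - j))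
      = (w t ^ k - (\<Sum>i\<le>j. multi_sum m c k i * of_real (y t) ^ i)) / of_real (y t) ^ j"
      using y(2)
    proof eventually_elim
      case (elim t)
      define S where "S = (\<lambda>A. \<Sum>s\<in>A. multi_sum m c k s * complex_of_real (y t) ^ s)"
      have "w t ^ k - P t ^ k = (w t - P t) * (\<Sum>i<k. P t ^ (k - Suc i) * w t ^ i)"
        by (rule power_diff_sumr2)
      moreover have "P t ^ k = S {..(m-1)*k}"
        unfolding P_def S_def by (rule poly_sum_powers_multi_sum)
      moreover have "S {..(m-1)*k} = S {..j} + S {j+1..(m-1)*k}"
        unfolding S_def using jk by (subst sum.union_disjoint[symmetric]) (auto intro!: sum.cong)
      moreover have "S {j+1..(m-1)*k} = (\<Sum>s\<in>{j+1..(m-1)*k}. multi_sum m c k s * of_real (y t) ^ (s - j)) * of_real (y t) ^ j"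
        unfolding S_def sum_distrib_right mult.assoc power_add[symmetric] by (intro sum.cong) auto
      ultimately have "w t ^ k - S {..j} = (w t - P t) * (\<Sum>i<k. P t ^ (k - Suc i) * w t ^ i) +
        (\<Sum>s\<in>{j+1..(m-1)*k}. multi_sum m c k s * of_real (y t) ^ (s - j)) * of_real (y t) ^ j"
        by (simp add: algebra_simps)
      moreover have "q * s + v = (a * s + v * Y) / Y" if "Y \<noteq> 0" "q = a / Y" for q s v a Y :: complex
        using that by (simp add: field_simps)
      ultimately show ?case using elim by (simp add: S_def r_def)
    qed
  qed
  have "((\<lambda>t. (\<Sum>k=1..j. norm ((w t ^ k - (\<Sum>i\<le>j. multi_sum m c k i * of_real (y t) ^ i)) / of_real (y t) ^ j))
      + 2 * norm ((w t / of_real (y t)) ^ (j + 1) * of_real (y t)))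
      \<longlongrightarrow> (\<Sum>k=1..j. norm (0 :: complex)) + 2 * norm (((\<Sum>i=1..m-1. c i * 0 ^ (i - 1)) + 0 * 0 ^ (j - 1)) ^ (j + 1) * 0)) F"
    by (intro tendsto_intros one wy yc)
  then have *: "((\<lambda>t. (\<Sum>k=1..j. norm ((w t ^ k - (\<Sum>i\<le>j. multi_sum m c k i * of_real (y t) ^ i)) / of_real (y t) ^ j))
      + 2 * norm ((w t / of_real (y t)) ^ (j + 1) * of_real (y t))) \<longlongrightarrow> 0) F" by simp
  show ?thesis
  proof (rule Lim_transform_eventually[OF *])
    show "\<forall>\<^sub>F t in F. (\<Sum>k=1..j. norm ((w t ^ k - (\<Sum>i\<le>j. multi_sum m c k i * of_real (y t) ^ i)) / of_real (y t) ^ j))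
      + 2 * norm ((w t / of_real (y t)) ^ (j + 1) * of_real (y t))
      = ((\<Sum>k=1..j. norm (w t ^ k - (\<Sum>i\<le>j. multi_sum m c k i * of_real (y t) ^ i))) + 2 * norm (w t) ^ (j + 1)) / y t ^ j"
      using y(2)
    proof eventually_elim
      case (elim t)
      have "norm ((w t / of_real (y t)) ^ (j + 1) * of_real (y t)) = norm (w t) ^ (j + 1) / y t ^ j"
        using elim by (simp add: norm_mult norm_divide norm_power power_divide field_simps)
      then show ?case using elim by (simp add: norm_divide norm_power add_divide_distrib sum_divide_distrib)
    qed
  qed
qed

text \<open>Rescaling \<open>t\<close> by \<open>l^(1/p) / \<kappa>\<close> reduces the integral to
  the Beta integral.\<close>

lemma power_model_integral:
  fixes p \<kappa> l A B :: real
  assumes p: "0 < p" and \<kappa>: "0 < \<kappa>" and l: "0 < l" and A: "0 < A + 1/p" and B: "0 < B - A - 1/p"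
  shows "set_integrable lborel {0<..} (\<lambda>t. ((\<kappa> * t) powr p) powr A / (l + (\<kappa> * t) powr p) powr B)"
    and "(LBINT t:{0<..}. ((\<kappa> * t) powr p) powr A / (l + (\<kappa> * t) powr p) powr B)
      = l powr (A - B + 1/p) / \<kappa> * (Beta (A + 1/p) (B - A - 1/p) / p)"
proof -
  define f where "f = (\<lambda>t. ((\<kappa> * t) powr p) powr A / (l + (\<kappa> * t) powr p) powr B)"
  define C where "C = l powr (1/p) / \<kappa>"
  have C: "0 < C" using l \<kappa> by (simp add: C_def)
  define h where "h = (\<lambda>t::real. t powr (p * A) / (1 + t powr p) powr B)"
  have f: "f (C * t) = l powr (A - B) * h t" if "0 < t" for t
  proof -
    have x: "(\<kappa> * (C * t)) powr p = l * t powr p"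
      using \<kappa> l p that by (simp add: C_def powr_mult powr_powr)
    have "l + l * t powr p = l * (1 + t powr p)" by (simp add: algebra_simps)
    then show ?thesis unfolding f_def x h_def using l that
      by (simp add: powr_mult powr_powr powr_diff add_nonneg_nonneg)
  qed
  note h = Beta_integral_halfline[OF p A B, folded h_def]
  have "set_integrable lborel {0<..} (\<lambda>t. f (C * t)) \<longleftrightarrow> set_integrable lborel {0<..} (\<lambda>t. l powr (A - B) * h t)"
    unfolding set_integrable_def by (intro Bochner_Integration.integrable_cong) (auto simp: indicator_def f)
  then show "set_integrable lborel {0<..} (\<lambda>t. ((\<kappa> * t) powr p) powr A / (l + (\<kappa> * t) powr p) powr B)"
    using h(1) set_integrable_halfline_scale(1)[OF C, of f] by (simp add: f_def)
  have "(LBINT t:{0<..}. f (C * t)) = (LBINT t:{0<..}. l powr (A - B) * h t)"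
    unfolding set_lebesgue_integral_def by (intro Bochner_Integration.integral_cong) (auto simp: indicator_def f)
  also have "\<dots> = l powr (A - B) * (Beta (A + 1/p) (B - A - 1/p) / p)" by (simp add: h(2))
  finally have "(LBINT t:{0<..}. f t) = C * (l powr (A - B) * (Beta (A + 1/p) (B - A - 1/p) / p))"
    by (subst set_integrable_halfline_scale(2)[OF C]) simp
  then show "(LBINT t:{0<..}. ((\<kappa> * t) powr p) powr A / (l + (\<kappa> * t) powr p) powr B)
      = l powr (A - B + 1/p) / \<kappa> * (Beta (A + 1/p) (B - A - 1/p) / p)"
    by (simp add: f_def C_def powr_add)
qed

text \<open>In terms of a continuous index \<open>t\<close>, \<open>x t\<close> is the leading term of the eigenvalue, \<open>y\<close> is
  \<open>x\<close> to the power \<open>-1/m\<close> and \<open>x (1 + w)\<close> is the eigenvalue itself, so that \<open>w\<close> agrees with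
  \<open>\<Sum> c_i y^i\<close> up to \<open>o(y^j)\<close>, and \<open>G l\<close> is the summand of the resolvent sum.\<close>

locale resolvent_model =
  fixes m j :: nat and p \<kappa> :: real and c :: "nat \<Rightarrow> complex" and w :: "real \<Rightarrow> complex"
  assumes m: "3 \<le> m" and j: "1 \<le> j" "2 * j \<le> m + 1" and p: "p = 2 * real m / (real m + 2)" and \<kappa>: "0 < \<kappa>"
    and w_meas: "w \<in> borel_measurable borel" and w_le: "\<And>t. norm (w t) \<le> 1/2"
    and w_lim: "((\<lambda>t. (w t - (\<Sum>i=1..m-1. c i * of_real (((\<kappa> * t) powr p) powr (-1 / real m)) ^ i))
      / of_real (((\<kappa> * t) powr p) powr (-1 / real m)) ^ j) \<longlongrightarrow> 0) at_top"
begin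

definition "x t = (\<kappa> * t) powr p"
definition "y t = x t powr (-1 / real m)"
definition "\<sigma> i = 1/2 + (1 - real i) / real m"
definition "G l t = 1 / (complex_of_real l + of_real (x t) * (1 + w t))"
text \<open>Equals \<open>x^k y^i / (l + x)^(k+1)\<close>, up to sign the factor of
  \<open>y^i\<close> in \<open>w^k\<close> when \<open>1 / (l + x + x w)\<close> is expanded
  geometrically in \<open>w\<close>.\<close>

definition "mterm l k i t = x t powr (real k - real i / real m) / (l + x t) powr (real k + 1)"
definition "model l t = (\<Sum>i\<le>j. \<Sum>k\<le>i. multi_sum m c k i * (-1) ^ k * of_real (mterm l k i t))"

lemma x_pos: "0 < t \<Longrightarrow> 0 < x t" using \<kappa> by (simp add: x_def)
lemma y_pos: "0 < t \<Longrightarrow> 0 < y t" by (metis powr_gt_zero x_pos y_def less_irrefl)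
lemma p_pos: "0 < p" using p m by simp

lemma inverse_p: "1 / p = 1/2 + 1 / real m"
  using m by (simp add: p field_simps)

text \<open>From \<open>2 * j \<le> m + 1\<close> and \<open>m \<ge> 3\<close>. The two inequalities
  are the convergence conditions of the Beta integrals at the two ends.\<close>

lemma \<sigma>_bounds: assumes "i \<le> j" shows "0 < \<sigma> i" "\<sigma> i < 1"
proof -
  have i: "2 * real i \<le> real m + 1" using assms j by linarith
  show "0 < \<sigma> i" "\<sigma> i < 1" using i m by (simp_all add: \<sigma>_def field_simps)
qed

lemma \<sigma>_strict: "i < k \<Longrightarrow> \<sigma> k < \<sigma> i"
  using m by (simp add: \<sigma>_def divide_strict_right_mono)

lemma denominator_ge:
  assumes "0 < l" "0 < t"
  shows "(l + x t) / 2 \<le> norm (of_real l + of_real (x t) * (1 + w t))"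
proof -
  have "norm (of_real (l + x t) :: complex) - norm (- (of_real (x t) * w t)) \<le> norm (of_real (l + x t) - - (of_real (x t) * w t))"
    by (rule norm_triangle_ineq2)
  moreover have "norm (- (of_real (x t) * w t)) \<le> x t * (1/2)"
    using x_pos[OF assms(2)] w_le[of t] by (simp only: norm_minus_cancel norm_mult norm_of_real) (simp add: mult_left_mono)
  ultimately show ?thesis using assms x_pos[OF assms(2)] by (simp add: algebra_simps del: of_real_add) (simp add: algebra_simps)
qed

lemma mterm_integral:
  assumes l: "0 < l" and i: "i \<le> j" "k \<le> i" "1 \<le> k \<or> i = 0"
  shows "set_integrable lborel {0<..} (mterm l k i)"
    "(LBINT t:{0<..}. mterm l k i t) = l powr (\<sigma> i - 1) / (p * \<kappa>) * Beta (real k + \<sigma> i) (1 - \<sigma> i)"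
proof -
  have e: "real k - real i / real m + 1/p = real k + \<sigma> i" "real k + 1 - (real k - real i / real m) - 1/p = 1 - \<sigma> i"
    "real k - real i / real m - (real k + 1) + 1/p = \<sigma> i - 1"
    using m unfolding inverse_p \<sigma>_def by (simp_all add: field_simps)
  have "0 < real k - real i / real m + 1/p" "0 < real k + 1 - (real k - real i / real m) - 1/p"
    unfolding e using \<sigma>_bounds[OF i(1)] by auto
  note * = power_model_integral[OF p_pos \<kappa> l this, unfolded e]
  show "set_integrable lborel {0<..} (mterm l k i)" using *(1) by (simp add: mterm_def[abs_def] x_def)
  show "(LBINT t:{0<..}. mterm l k i t) = l powr (\<sigma> i - 1) / (p * \<kappa>) * Beta (real k + \<sigma> i) (1 - \<sigma> i)"
    using *(2) by (simp add: mterm_def x_def)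
qed

lemma G_integrable:
  assumes l: "0 < l"
  shows "set_integrable lborel {0<..} (G l)"
proof (rule set_integrable_bound)
  show "set_integrable lborel {0<..} (\<lambda>t. 2 * mterm l 0 0 t)"
    using mterm_integral(1)[OF l, of 0 0] by simp
  show "set_borel_measurable lborel {0<..} (G l)"
    unfolding set_borel_measurable_def G_def x_def using w_meas by measurable
  have "norm (G l t) \<le> norm (2 * mterm l 0 0 t)" if t: "0 < t" for t
  proof -
    have "norm (G l t) \<le> 1 / ((l + x t) / 2)"
      unfolding G_def norm_divide norm_one using denominator_ge[OF l t] l x_pos[OF t] by (intro frac_le) auto
    then show ?thesis using l x_pos[OF t] by (simp add: mterm_def)
  qed
  then show "AE t in lborel. t \<in> {0<..} \<longrightarrow> norm (G l t) \<le> norm (2 * mterm l 0 0 t)" by auto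
qed

text \<open>For fixed \<open>i\<close> the sum over \<open>k\<close> turns the Beta values into
  binomial coefficients of exponent \<open>- \<sigma> i\<close>; with the multi-index sums they form
  the coefficient of \<open>y^i\<close> in
  \<open>(1 + \<Sum> c_r y^r)^(- \<sigma> i)\<close>.\<close>

lemma model_integral:
  assumes l: "0 < l"
  shows "set_integrable lborel {0<..} (model l)"
    "(LBINT t:{0<..}. model l t) = (\<Sum>i\<le>j. of_real (l powr (\<sigma> i - 1)) *
      (of_real (pi / (p * \<kappa> * sin (pi * \<sigma> i))) * fps_cpow (coeff_fps m c) (- of_real (\<sigma> i)) $ i))"
proof -
  define I where "I = Sigma {..j} (\<lambda>i. {..i})"
  have fin: "finite I" by (simp add: I_def)
  have eq: "model l t = (\<Sum>q\<in>I. multi_sum m c (snd q) (fst q) * (-1) ^ snd q * of_real (mterm l (snd q) (fst q) t))" for t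
    unfolding model_def I_def by (subst sum.Sigma) (auto simp: case_prod_beta)
  have one: "set_integrable lborel {0<..} (\<lambda>t. multi_sum m c k i * (-1) ^ k * complex_of_real (mterm l k i t))"
    "(LBINT t:{0<..}. multi_sum m c k i * (-1) ^ k * complex_of_real (mterm l k i t))
      = multi_sum m c k i * (-1) ^ k * of_real (l powr (\<sigma> i - 1) / (p * \<kappa>) * Beta (real k + \<sigma> i) (1 - \<sigma> i))"
    if "i \<le> j" "k \<le> i" for i k
  proof -
    have "set_integrable lborel {0<..} (\<lambda>t. multi_sum m c k i * (-1) ^ k * complex_of_real (mterm l k i t)) \<and>
    (LBINT t:{0<..}. multi_sum m c k i * (-1) ^ k * complex_of_real (mterm l k i t))
      = multi_sum m c k i * (-1) ^ k * of_real (l powr (\<sigma> i - 1) / (p * \<kappa>) * Beta (real k + \<sigma> i) (1 - \<sigma> i))"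
    proof (cases "1 \<le> k \<or> i = 0")
      case True
      note * = mterm_integral[OF l that True]
      have "set_integrable lborel {0<..} (\<lambda>t. complex_of_real (mterm l k i t))"
        using *(1) unfolding set_integrable_def
        by (simp flip: of_real_mult add: scaleR_conv_of_real)
      moreover have "(LBINT t:{0<..}. complex_of_real (mterm l k i t)) = of_real (LBINT t:{0<..}. mterm l k i t)"
        by (rule set_integral_complex_of_real)
      ultimately show ?thesis using *(2) by simp
    next
      case False
      then have "multi_sum m c k i = 0" by (cases k) (auto simp: multi_sum_0)
      then show ?thesis by (simp add: set_integrable_def)
    qed
    then show "set_integrable lborel {0<..} (\<lambda>t. multi_sum m c k i * (-1) ^ k * complex_of_real (mterm l k i t))"
    "(LBINT t:{0<..}. multi_sum m c k i * (-1) ^ k * complex_of_real (mterm l k i t))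
      = multi_sum m c k i * (-1) ^ k * of_real (l powr (\<sigma> i - 1) / (p * \<kappa>) * Beta (real k + \<sigma> i) (1 - \<sigma> i))"
      by blast+
  qed
  have int: "set_integrable lborel {0<..} (\<lambda>t. multi_sum m c (snd q) (fst q) * (-1) ^ snd q * complex_of_real (mterm l (snd q) (fst q) t))" if "q \<in> I" for q
    using that one(1) by (auto simp: I_def)
  show "set_integrable lborel {0<..} (model l)"
    unfolding eq[abs_def] by (rule set_integral_sum_finite(1)[OF fin int])
  have "(LBINT t:{0<..}. model l t) = (\<Sum>q\<in>I. LBINT t:{0<..}. multi_sum m c (snd q) (fst q) * (-1) ^ snd q * complex_of_real (mterm l (snd q) (fst q) t))"
    unfolding eq by (rule set_integral_sum_finite(2)[OF fin int])
  also have "\<dots> = (\<Sum>q\<in>I. multi_sum m c (snd q) (fst q) * (-1) ^ snd q * of_real (l powr (\<sigma> (fst q) - 1) / (p * \<kappa>) * Beta (real (snd q) + \<sigma> (fst q)) (1 - \<sigma> (fst q))))"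
    using one(2) by (intro sum.cong refl) (auto simp: I_def)
  also have "\<dots> = (\<Sum>i\<le>j. \<Sum>k\<le>i. multi_sum m c k i * (-1) ^ k * of_real (l powr (\<sigma> i - 1) / (p * \<kappa>) * Beta (real k + \<sigma> i) (1 - \<sigma> i)))"
    unfolding I_def by (subst sum.Sigma) (auto simp: case_prod_beta)
  also have "\<dots> = (\<Sum>i\<le>j. of_real (l powr (\<sigma> i - 1)) *
      (of_real (pi / (p * \<kappa> * sin (pi * \<sigma> i))) * fps_cpow (coeff_fps m c) (- of_real (\<sigma> i)) $ i))"
  proof (rule sum.cong[OF refl])
    fix i assume "i \<in> {..j}"
    then have i: "i \<le> j" by simp
    have "multi_sum m c k i * (-1) ^ k * of_real (l powr (\<sigma> i - 1) / (p * \<kappa>) * Beta (real k + \<sigma> i) (1 - \<sigma> i))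
      = of_real (l powr (\<sigma> i - 1)) * of_real (pi / (p * \<kappa> * sin (pi * \<sigma> i))) * (((- of_real (\<sigma> i)) gchoose k) * multi_sum m c k i)" for k
    proof -
      have "(-1) ^ k * complex_of_real (Beta (real k + \<sigma> i) (1 - \<sigma> i)) = of_real (((- \<sigma> i) gchoose k) * (pi / sin (pi * \<sigma> i)))"
        unfolding Beta_plus_nat_reflection[OF \<sigma>_bounds[OF i], symmetric] by simp
      then have "(-1) ^ k * complex_of_real (Beta (real k + \<sigma> i) (1 - \<sigma> i)) = ((- of_real (\<sigma> i)) gchoose k) * of_real (pi / sin (pi * \<sigma> i))"
        by (simp only: of_real_mult of_real_gbinomial of_real_minus)
      moreover have "M * N * (L / Q * B) = L * (W / Q) * (g * M)" if "N * B = g * W" for M N L Q B W g :: complex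
        using that by (cases "Q = 0") (simp_all add: field_simps)
      ultimately have "multi_sum m c k i * (-1) ^ k * (of_real (l powr (\<sigma> i - 1)) / of_real (p * \<kappa>) * of_real (Beta (real k + \<sigma> i) (1 - \<sigma> i)))
        = of_real (l powr (\<sigma> i - 1)) * (of_real (pi / sin (pi * \<sigma> i)) / of_real (p * \<kappa>)) * (((- of_real (\<sigma> i)) gchoose k) * multi_sum m c k i)" by blast
      then show ?thesis by (simp add: mult_ac)
    qed
    then show "(\<Sum>k\<le>i. multi_sum m c k i * (-1) ^ k * of_real (l powr (\<sigma> i - 1) / (p * \<kappa>) * Beta (real k + \<sigma> i) (1 - \<sigma> i)))
      = of_real (l powr (\<sigma> i - 1)) * (of_real (pi / (p * \<kappa> * sin (pi * \<sigma> i))) * fps_cpow (coeff_fps m c) (- of_real (\<sigma> i)) $ i)"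
      unfolding fps_cpow_coeff_fps_nth by (simp add: sum_distrib_left atMost_atLeast0 mult.assoc)
  qed
  finally show "(LBINT t:{0<..}. model l t) = (\<Sum>i\<le>j. of_real (l powr (\<sigma> i - 1)) *
      (of_real (pi / (p * \<kappa> * sin (pi * \<sigma> i))) * fps_cpow (coeff_fps m c) (- of_real (\<sigma> i)) $ i))" .
qed

definition "defect t = (\<Sum>k=1..j. norm (w t ^ k - (\<Sum>i\<le>j. multi_sum m c k i * of_real (y t) ^ i))) + 2 * norm (w t) ^ (j + 1)"

text \<open>Factoring \<open>1 / (l + x)\<close> out of \<open>G\<close> leaves
  \<open>1 / (1 + z w)\<close> with \<open>z = x / (l + x)\<close> between 0 and 1.\<close>

lemma G_minus_model:
  assumes l: "0 < l" and t: "0 < t"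
  shows "norm (G l t - model l t) \<le> x t / (l + x t) powr 2 * defect t"
proof -
  define z where "z = x t / (l + x t)"
  have s: "0 < l + x t" using l x_pos[OF t] by simp
  have z: "0 \<le> z" "z \<le> 1" using l x_pos[OF t] by (auto simp: z_def)
  have G: "G l t = of_real (1 / (l + x t)) * (1 / (1 + of_real z * w t))"
  proof -
    have "of_real (l + x t) * (1 + of_real z * w t) = complex_of_real l + of_real (x t) * (1 + w t)"
    proof -
      have "(l + x t) * z = x t" using s by (simp add: z_def)
      then have "of_real (l + x t) * of_real z = complex_of_real (x t)" by (simp only: of_real_mult[symmetric])
      then have "of_real (l + x t) * (1 + of_real z * w t) = of_real (l + x t) + of_real (x t) * w t"
        by (simp only: distrib_left mult_1_right mult.assoc[symmetric])
      then show ?thesis by (simp add: algebra_simps)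
    qed
    moreover have "of_real (1 / s) * (1 / q) = 1 / (of_real s * q)" for s :: real and q :: complex by simp
    ultimately show ?thesis by (simp only: G_def)
  qed
  have "multi_sum m c k i * (-1) ^ k * complex_of_real (mterm l k i t) = of_real (1 / (l + x t)) * (multi_sum m c k i * ((-1) ^ k * of_real z ^ k * of_real (y t) ^ i))" for k i
  proof -
    have "mterm l k i t = 1 / (l + x t) * (z ^ k * y t ^ i)"
    proof -
      have "x t powr (real k - real i / real m) = x t ^ k * y t ^ i"
        using x_pos[OF t] unfolding y_def
        by (simp add: powr_realpow[symmetric] powr_powr powr_add[symmetric])
      moreover have "(l + x t) powr (real k + 1) = (l + x t) ^ k * (l + x t)"
        using s by (simp add: powr_realpow[symmetric] powr_add)
      ultimately show ?thesis by (simp add: mterm_def z_def power_divide)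
    qed
    then show ?thesis by (simp add: mult_ac)
  qed
  then have "model l t = of_real (1 / (l + x t)) * (\<Sum>i\<le>j. \<Sum>k\<le>i. multi_sum m c k i * ((-1) ^ k * of_real z ^ k * of_real (y t) ^ i))"
    unfolding model_def by (simp add: sum_distrib_left)
  then have "norm (G l t - model l t) = 1 / (l + x t) * norm (1 / (1 + of_real z * w t) - (\<Sum>i\<le>j. \<Sum>k\<le>i. multi_sum m c k i * ((-1) ^ k * of_real z ^ k * of_real (y t) ^ i)))"
  proof -
    have *: "norm (of_real r * a - of_real r * b) = r * norm (a - b)" if "0 < r" for r and a b :: complex
      using that unfolding right_diff_distrib[symmetric] norm_mult norm_of_real by simp
    show ?thesis unfolding G \<open>model l t = _\<close> by (rule *) (use s in simp)
  qed
  also have "\<dots> \<le> 1 / (l + x t) * (z * defect t)"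
    using geometric_multi_sum_approx[OF w_le z, of t m c "y t" j] s unfolding defect_def by (intro mult_left_mono) auto
  also have "\<dots> = x t / (l + x t) powr 2 * defect t"
    using s by (simp add: z_def power2_eq_square)
  finally show ?thesis .
qed

lemma defect_tendsto: "((\<lambda>t. defect t / y t ^ j) \<longlongrightarrow> 0) at_top"
  unfolding defect_def
proof (rule multi_sum_power_tendsto)
  show "(y \<longlongrightarrow> 0) at_top"
  proof -
    have "filterlim (\<lambda>t. \<kappa> * t) at_top at_top" using \<kappa> by real_asymp
    then have "((\<lambda>t. (\<kappa> * t) powr (p * (-1 / real m))) \<longlongrightarrow> 0) at_top"
      using p_pos m by (intro tendsto_neg_powr) (auto simp: divide_neg_pos)
    then show ?thesis by (simp add: y_def[abs_def] x_def powr_powr)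
  qed
  show "\<forall>\<^sub>F t in at_top. 0 < y t" by (rule eventually_mono[OF eventually_gt_at_top[of 0] y_pos])
  show "1 \<le> j" "j \<le> m - 1" using j m by linarith+
  show "((\<lambda>t. (w t - (\<Sum>i=1..m-1. c i * of_real (y t) ^ i)) / of_real (y t) ^ j) \<longlongrightarrow> 0) at_top"
    using w_lim by (simp only: y_def x_def)
qed

text \<open>For small \<open>t\<close> the powers of \<open>y\<close> in \<open>defect\<close> are
  unbounded, but \<open>x y^i = x^(1 - i/m)\<close> stays bounded because
  \<open>i \<le> m\<close>.\<close>

lemma defect_bounded: obtains C where "0 \<le> C" "\<And>t. 0 < t \<Longrightarrow> t \<le> T \<Longrightarrow> x t * defect t \<le> C"
proof
  define X where "X = (\<kappa> * \<bar>T\<bar>) powr p"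
  show "0 \<le> X * (real j + 2) + (\<Sum>k=1..j. \<Sum>i\<le>j. norm (multi_sum m c k i) * (1 + X))" (is "0 \<le> ?C")
    unfolding X_def by (intro add_nonneg_nonneg sum_nonneg mult_nonneg_nonneg) auto
  fix t assume t: "0 < t" "t \<le> T"
  have x0: "0 < x t" using t x_pos by auto
  have xX: "x t \<le> X" unfolding x_def X_def using \<kappa> p_pos t by (intro powr_mono2) auto
  have w1: "norm (w t) ^ k \<le> 1" for k using w_le[of t] by (intro power_le_one) auto
  have xy: "x t * y t ^ i \<le> 1 + X" if "i \<le> j" for i
  proof -
    have "real i \<le> real m" using that j m by linarith
    then have im: "0 \<le> 1 - real i / real m" "1 - real i / real m \<le> 1" using m by auto
    have "x t * y t ^ i = x t powr (1 - real i / real m)"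
      using x0 unfolding y_def by (simp add: powr_realpow[symmetric] powr_powr powr_diff powr_minus field_simps)
    also have "\<dots> \<le> max 1 (x t) powr (1 - real i / real m)" using x0 im by (intro powr_mono2) auto
    also have "\<dots> \<le> max 1 (x t) powr 1" using im by (intro powr_mono) auto
    also have "\<dots> \<le> 1 + X" using xX x0 by auto
    finally show ?thesis .
  qed
  have "defect t \<le> (\<Sum>k=1..j. 1 + (\<Sum>i\<le>j. norm (multi_sum m c k i) * y t ^ i)) + 2"
    unfolding defect_def
  proof (intro add_mono sum_mono)
    fix k
    have "norm (\<Sum>i\<le>j. multi_sum m c k i * of_real (y t) ^ i) \<le> (\<Sum>i\<le>j. norm (multi_sum m c k i) * y t ^ i)"
      using y_pos[OF t(1)] by (intro sum_norm_le) (simp add: norm_mult norm_power)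
    then show "norm (w t ^ k - (\<Sum>i\<le>j. multi_sum m c k i * of_real (y t) ^ i)) \<le> 1 + (\<Sum>i\<le>j. norm (multi_sum m c k i) * y t ^ i)"
      using w1[of k] by (intro order_trans[OF norm_triangle_ineq4]) (simp add: norm_power)
  next
    show "2 * norm (w t) ^ (j + 1) \<le> 2" using w1[of "j + 1"] by linarith
  qed
  then have "x t * defect t \<le> x t * ((\<Sum>k=1..j. 1 + (\<Sum>i\<le>j. norm (multi_sum m c k i) * y t ^ i)) + 2)"
    using x0 by (intro mult_left_mono) auto
  also have "\<dots> = x t * (real j + 2) + (\<Sum>k=1..j. \<Sum>i\<le>j. norm (multi_sum m c k i) * (x t * y t ^ i))"
    by (simp add: sum.distrib sum_distrib_left distrib_left mult_ac)
  also have "\<dots> \<le> ?C"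
    using xX xy by (intro add_mono mult_right_mono sum_mono mult_left_mono) auto
  finally show "x t * defect t \<le> ?C" .
qed

text \<open>The integral is cut at a point \<open>T\<close> beyond which
  \<open>defect \<le> \<delta> y^j\<close>. The outer part is at most \<open>\<delta>\<close> times
  the integral of \<open>mterm l 1 j\<close>, a multiple of \<open>l^(\<sigma> j - 1)\<close>; the
  inner part is \<open>O(l^(-2))\<close>, which is smaller since
  \<open>\<sigma> j > 0\<close>.\<close>

lemma G_asymptotics:
  "((\<lambda>l. ((LBINT t:{0<..}. G l t) - (\<Sum>i\<le>j. of_real (l powr (\<sigma> i - 1)) *
      (of_real (pi / (p * \<kappa> * sin (pi * \<sigma> i))) * fps_cpow (coeff_fps m c) (- of_real (\<sigma> i)) $ i))) / of_real (l powr (\<sigma> j - 1))) \<longlongrightarrow> 0) at_top"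
proof (rule tendstoI)
  fix e :: real assume e: "0 < e"
  define B where "B = Beta (1 + \<sigma> j) (1 - \<sigma> j) / (p * \<kappa>)"
  have B: "0 \<le> B" using \<sigma>_bounds[of j] p_pos \<kappa> by (auto simp: B_def Beta_def intro!: divide_nonneg_pos mult_nonneg_nonneg Gamma_real_nonneg)
  define \<delta> where "\<delta> = e / (2 * (B + 1))"
  have \<delta>: "0 < \<delta>" using e B by (simp add: \<delta>_def)
  have \<delta>B: "\<delta> * B \<le> e / 2" using e B by (simp add: \<delta>_def field_simps)
  from defect_tendsto \<delta> have "\<forall>\<^sub>F t in at_top. dist (defect t / y t ^ j) 0 < \<delta>" by (rule tendstoD)
  then obtain T0 where T0: "\<And>t. T0 \<le> t \<Longrightarrow> dist (defect t / y t ^ j) 0 < \<delta>" unfolding eventually_at_top_linorder by blast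
  define T where "T = max 1 T0"
  obtain C where C: "0 \<le> C" "\<And>t. 0 < t \<Longrightarrow> t \<le> T \<Longrightarrow> x t * defect t \<le> C" using defect_bounded[of T] by blast
  have pt: "norm (G l t - model l t) \<le> \<delta> * mterm l 1 j t + C / l\<^sup>2 * indicator {0<..T} t" if l: "0 < l" and t: "0 < t" for l t
  proof -
    have x0: "0 < x t" using x_pos[OF t] .
    have mt: "mterm l 1 j t = x t / (l + x t) powr 2 * y t ^ j"
      using x0 unfolding mterm_def y_def by (simp add: powr_realpow[symmetric] powr_powr powr_diff powr_minus field_simps)
    show ?thesis
    proof (cases "t \<le> T")
      case True
      have "norm (G l t - model l t) \<le> x t / (l + x t) powr 2 * defect t" by (rule G_minus_model[OF l t])
      also have "\<dots> = (x t * defect t) / (l + x t) powr 2" by simp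
      also have "\<dots> \<le> C / l\<^sup>2" using C x0 l t True by (intro frac_le) (auto intro: power_mono)
      also have "\<dots> \<le> \<delta> * mterm l 1 j t + C / l\<^sup>2 * indicator {0<..T} t"
        using True t \<delta> x0 by (simp add: mterm_def)
      finally show ?thesis .
    next
      case False
      then have "\<bar>defect t / y t ^ j\<bar> < \<delta>" using T0[of t] by (simp add: T_def)
      then have "defect t \<le> \<delta> * y t ^ j" using y_pos[OF t] by (simp add: abs_if field_simps split: if_splits)
      then have "x t / (l + x t) powr 2 * defect t \<le> x t / (l + x t) powr 2 * (\<delta> * y t ^ j)" using x0 by (intro mult_left_mono) auto
      also have "\<dots> = \<delta> * mterm l 1 j t" unfolding mt by (simp only: mult_ac)
      finally have "norm (G l t - model l t) \<le> \<delta> * mterm l 1 j t" using G_minus_model[OF l t] by linarith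
      then show ?thesis using False by simp
    qed
  qed
  have bound: "norm ((LBINT t:{0<..}. G l t) - (LBINT t:{0<..}. model l t)) \<le> \<delta> * (l powr (\<sigma> j - 1) * B) + C * T / l\<^sup>2" if l: "0 < l" for l
  proof -
    have i1: "set_integrable lborel {0<..} (\<lambda>t. \<delta> * mterm l 1 j t)" using mterm_integral(1)[OF l, of j 1] j by simp
    have em: "integrable lborel (indicat_real {0<..T})" by (rule integrable_real_indicator) (auto simp: T_def)
    have ind: "indicator {0<..} t *\<^sub>R indicat_real {0<..T} t = indicator {0<..T} t" for t :: real by (auto simp: indicator_def)
    have em': "set_integrable lborel {0<..} (indicat_real {0<..T})" unfolding set_integrable_def ind by (rule em)
    have i2: "set_integrable lborel {0<..} (\<lambda>t. C / l\<^sup>2 * indicator {0<..T} t)"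
      by (intro set_integrable_mult_right em')
    have "(LBINT t:{0<..}. G l t) - (LBINT t:{0<..}. model l t) = (LBINT t:{0<..}. G l t - model l t)"
      by (rule set_integral_diff(2)[symmetric, OF G_integrable[OF l] model_integral(1)[OF l]])
    also have "norm \<dots> \<le> (LBINT t:{0<..}. \<delta> * mterm l 1 j t + C / l\<^sup>2 * indicator {0<..T} t)"
      using pt[OF l] by (intro set_integral_norm_le set_integral_diff set_integral_add G_integrable model_integral l i1 i2) auto
    also have "\<dots> = (LBINT t:{0<..}. \<delta> * mterm l 1 j t) + (LBINT t:{0<..}. C / l\<^sup>2 * indicator {0<..T} t)"
      by (rule set_integral_add(2)[OF i1 i2])
    also have "(LBINT t:{0<..}. \<delta> * mterm l 1 j t) = \<delta> * (l powr (\<sigma> j - 1) * B)"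
      using mterm_integral(2)[OF l, of j 1] j by (simp add: B_def)
    also have "(LBINT t:{0<..}. C / l\<^sup>2 * indicator {0<..T} t) = C * T / l\<^sup>2"
    proof -
      have "(LBINT t:{0<..}. indicat_real {0<..T} t) = T"
        unfolding set_lebesgue_integral_def ind by (simp add: T_def)
      then show ?thesis by simp
    qed
    finally show ?thesis .
  qed
  have "((\<lambda>l. C * T / l\<^sup>2 / l powr (\<sigma> j - 1)) \<longlongrightarrow> 0) at_top"
  proof -
    have "((\<lambda>l. C * T * l powr (- 1 - \<sigma> j)) \<longlongrightarrow> C * T * 0) at_top"
      using \<sigma>_bounds[of j] by (intro tendsto_mult tendsto_const tendsto_neg_powr filterlim_ident) auto
    moreover have "\<forall>\<^sub>F l in at_top. C * T * l powr (- 1 - \<sigma> j) = C * T / l\<^sup>2 / l powr (\<sigma> j - 1)"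
      using eventually_gt_at_top[of 0]
    proof eventually_elim
      case (elim l)
      have "l powr (- 1 - \<sigma> j) = l powr (-2) * l powr (- (\<sigma> j - 1))" by (simp add: powr_add[symmetric])
      moreover have "l powr (-2) = 1 / l\<^sup>2" using elim by (simp add: powr_minus divide_inverse)
      ultimately show ?case by (simp only: powr_minus[of l "\<sigma> j - 1"] divide_inverse mult_1 mult.assoc)
    qed
    ultimately show ?thesis by (simp add: filterlim_cong)
  qed
  then have "\<forall>\<^sub>F l in at_top. dist (C * T / l\<^sup>2 / l powr (\<sigma> j - 1)) 0 < e / 2" using e by (intro tendstoD) auto
  then show "\<forall>\<^sub>F l in at_top. dist (((LBINT t:{0<..}. G l t) - (\<Sum>i\<le>j. of_real (l powr (\<sigma> i - 1)) *
      (of_real (pi / (p * \<kappa> * sin (pi * \<sigma> i))) * fps_cpow (coeff_fps m c) (- of_real (\<sigma> i)) $ i))) / of_real (l powr (\<sigma> j - 1))) 0 < e"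
    using eventually_gt_at_top[of 0]
  proof eventually_elim
    case (elim l)
    define L where "L = l powr (\<sigma> j - 1)"
    have L: "0 < L" using elim by (simp add: L_def)
    have "norm (((LBINT t:{0<..}. G l t) - (LBINT t:{0<..}. model l t)) / of_real L) \<le> (\<delta> * (L * B) + C * T / l\<^sup>2) / L"
      unfolding norm_divide norm_of_real using bound[OF elim(2)] L by (simp add: L_def divide_right_mono)
    also have "\<dots> = \<delta> * B + C * T / l\<^sup>2 / L" using L by (simp add: add_divide_distrib)
    also have "\<dots> < e" using elim(1) \<delta>B unfolding dist_real_def L_def by linarith
    finally show ?case unfolding model_integral(2)[OF elim(2)] by (simp add: L_def)
  qed
qed

end

section \<open>From the eigenvalue index to a continuous variable\<close>

lemma abs_powr_minus_one_le:
  fixes u q :: real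
  assumes "\<bar>u\<bar> \<le> 1/2"
  shows "\<bar>(1 + u) powr q - 1\<bar> \<le> 2 * \<bar>q\<bar> * exp \<bar>q\<bar> * \<bar>u\<bar>"
proof -
  have u: "u\<^sup>2 \<le> \<bar>u\<bar> * (1/2)" using assms mult_left_mono[of "\<bar>u\<bar>" "1/2" "\<bar>u\<bar>"] by (simp add: power2_eq_square flip: abs_mult)
  have "\<bar>ln (1 + u) - u\<bar> \<le> 2 * u\<^sup>2" using assms by (rule abs_ln_one_plus_x_minus_x_bound)
  then have ln: "\<bar>ln (1 + u)\<bar> \<le> 2 * \<bar>u\<bar>" using u by linarith
  then have y: "\<bar>q * ln (1 + u)\<bar> \<le> \<bar>q\<bar> * (2 * \<bar>u\<bar>)" unfolding abs_mult by (intro mult_left_mono) auto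
  also have "\<dots> \<le> \<bar>q\<bar>" using assms mult_left_mono[of "2 * \<bar>u\<bar>" 1 "\<bar>q\<bar>"] by simp
  finally have y': "\<bar>q * ln (1 + u)\<bar> \<le> \<bar>q\<bar>" .
  have "\<bar>(1 + u) powr q - 1\<bar> = \<bar>exp (q * ln (1 + u)) - 1\<bar>" using assms by (auto simp: powr_def)
  also have "\<dots> \<le> \<bar>q * ln (1 + u)\<bar> * exp \<bar>q * ln (1 + u)\<bar>" by (rule abs_exp_minus_one_le)
  also have "\<dots> \<le> (\<bar>q\<bar> * (2 * \<bar>u\<bar>)) * exp \<bar>q\<bar>" using y y' by (intro mult_mono) auto
  finally show ?thesis by (simp add: mult_ac)
qed

text \<open>A bounded shift of the argument changes \<open>t^q\<close> by \<open>O(t^(q-1))\<close>.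
  This covers both the passage from \<open>t\<close> to its integer part and the shift by 1/4 in
  \<open>E_lead\<close>.\<close>

lemma floor_shift_powr_diff_tendsto:
  fixes d q r :: real
  assumes "\<bar>d\<bar> \<le> 1" "q < r + 1"
  shows "((\<lambda>t. ((of_int \<lfloor>t\<rfloor> + d) powr q - t powr q) / t powr r) \<longlongrightarrow> 0) at_top"
proof (rule tendsto_0_le[where K = 1])
  have "((\<lambda>t. 4 * \<bar>q\<bar> * exp \<bar>q\<bar> * t powr (q - r - 1)) \<longlongrightarrow> 4 * \<bar>q\<bar> * exp \<bar>q\<bar> * 0) at_top"
    using assms by (intro tendsto_mult tendsto_const tendsto_neg_powr filterlim_ident) auto
  then show "((\<lambda>t. 4 * \<bar>q\<bar> * exp \<bar>q\<bar> * t powr (q - r - 1)) \<longlongrightarrow> 0) at_top" by simp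
  show "\<forall>\<^sub>F t in at_top. norm (((of_int \<lfloor>t\<rfloor> + d) powr q - t powr q) / t powr r) \<le> norm (4 * \<bar>q\<bar> * exp \<bar>q\<bar> * t powr (q - r - 1)) * 1"
    using eventually_ge_at_top[of 4]
  proof eventually_elim
    case (elim t)
    define u where "u = (of_int \<lfloor>t\<rfloor> + d - t) / t"
    have "\<bar>of_int \<lfloor>t\<rfloor> + d - t\<bar> \<le> 2" using assms(1) floor_correct[of t] by linarith
    then have u: "\<bar>u\<bar> \<le> 2 / t" using elim by (simp add: u_def divide_right_mono)
    moreover have "2 / t \<le> 1/2" using elim by (simp add: field_simps)
    ultimately have u2: "\<bar>u\<bar> \<le> 1/2" by linarith
    have "of_int \<lfloor>t\<rfloor> + d = t * (1 + u)" using elim by (simp add: u_def field_simps)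
    then have "(of_int \<lfloor>t\<rfloor> + d) powr q = t powr q * (1 + u) powr q" using elim u2 by (simp add: powr_mult)
    then have "(of_int \<lfloor>t\<rfloor> + d) powr q - t powr q = t powr q * ((1 + u) powr q - 1)" by (simp add: algebra_simps)
    then have "\<bar>((of_int \<lfloor>t\<rfloor> + d) powr q - t powr q) / t powr r\<bar> = t powr q / t powr r * \<bar>(1 + u) powr q - 1\<bar>"
      by (simp add: abs_mult)
    also have "\<dots> \<le> t powr q / t powr r * (2 * \<bar>q\<bar> * exp \<bar>q\<bar> * (2 / t))"
      using u by (intro mult_left_mono order_trans[OF abs_powr_minus_one_le[OF u2]]) auto
    also have "\<dots> = 4 * \<bar>q\<bar> * exp \<bar>q\<bar> * t powr (q - r - 1)"
      using elim by (simp add: powr_diff)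
    finally show ?case by simp
  qed
qed

definition "lead_const m = 2 * sqrt pi * Gamma (3/2 + 1 / real m) / Gamma (1 + 1 / real m)"

lemma lead_const_pos: "1 \<le> m \<Longrightarrow> 0 < lead_const m"
  unfolding lead_const_def by (intro divide_pos_pos mult_pos_pos Gamma_real_pos add_pos_pos) auto

lemma E_lead_floor_powr_diff_tendsto:
  assumes m: "1 \<le> m" and q: "2 * real m / (real m + 2) * e < q + 1"
  shows "((\<lambda>t. (E_lead m \<beta> \<lfloor>t\<rfloor> powr e - ((lead_const m * t) powr (2 * real m / (real m + 2))) powr e) / t powr q) \<longlongrightarrow> 0) at_top"
proof -
  define p where "p = 2 * real m / (real m + 2)"
  define d :: real where "d = (if \<beta> = 0 then - (1/4) else 1/4)"
  have d: "\<bar>d\<bar> \<le> 1" by (simp add: d_def)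
  have k: "0 < lead_const m" using lead_const_pos[OF m] .
  have "((\<lambda>t. lead_const m powr (p * e) * (((of_int \<lfloor>t\<rfloor> + d) powr (p * e) - t powr (p * e)) / t powr q)) \<longlongrightarrow> lead_const m powr (p * e) * 0) at_top"
    using q by (intro tendsto_mult tendsto_const floor_shift_powr_diff_tendsto d) (simp add: p_def)
  moreover have "\<forall>\<^sub>F t in at_top. lead_const m powr (p * e) * (((of_int \<lfloor>t\<rfloor> + d) powr (p * e) - t powr (p * e)) / t powr q)
    = (E_lead m \<beta> \<lfloor>t\<rfloor> powr e - ((lead_const m * t) powr p) powr e) / t powr q"
    using eventually_ge_at_top[of 2]
  proof eventually_elim
    case (elim t)
    have n: "2 \<le> \<lfloor>t\<rfloor>" using elim by linarith
    have n': "(2::real) \<le> of_int \<lfloor>t\<rfloor>" using n by linarith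
    have E: "E_lead m \<beta> \<lfloor>t\<rfloor> = (lead_const m * (of_int \<lfloor>t\<rfloor> + d)) powr p"
      using k n' by (auto simp: E_lead_def lead_const_def[symmetric] p_def[symmetric] d_def powr_mult)
    have "0 \<le> of_int \<lfloor>t\<rfloor> + d" using n' d by linarith
    then show ?case unfolding E powr_powr using k elim by (simp add: powr_mult right_diff_distrib)
  qed
  ultimately have "((\<lambda>t. (E_lead m \<beta> \<lfloor>t\<rfloor> powr e - ((lead_const m * t) powr p) powr e) / t powr q) \<longlongrightarrow> lead_const m powr (p * e) * 0) at_top"
    by (rule Lim_transform_eventually)
  then show ?thesis by (simp add: p_def)
qed

text \<open>Division by the leading term \<open>x\<close> turns the expansion into one in powers of
  \<open>y = x^(-1/m)\<close>, now as a function of a real variable whose integer part is the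
  index.\<close>

lemma expansion_floor_tendsto:
  fixes m j :: nat
  defines "p \<equiv> 2 * real m / (real m + 2)" and "\<kappa> \<equiv> lead_const m"
  assumes m: "3 \<le> m" and j: "1 \<le> j" "2 * j \<le> m + 1" and ex: "has_expansion m \<beta> j c E" and c: "\<And>i. j < i \<Longrightarrow> c i = 0"
  shows "((\<lambda>t. ((E \<lfloor>t\<rfloor> - of_real ((\<kappa> * t) powr p)) / of_real ((\<kappa> * t) powr p)
      - (\<Sum>i=1..m-1. c i * of_real (((\<kappa> * t) powr p) powr (-1 / real m)) ^ i))
      / of_real (((\<kappa> * t) powr p) powr (-1 / real m)) ^ j) \<longlongrightarrow> 0) at_top"
proof -
  define x where "x = (\<lambda>t. (\<kappa> * t) powr p)"
  define y where "y = (\<lambda>t. x t powr (-1 / real m))"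
  define q where "q = p * (1 - real j / real m)"
  define X where "X = (\<lambda>t::real. E_lead m \<beta> \<lfloor>t\<rfloor>)"
  have k: "0 < \<kappa>" using lead_const_pos[of m] m by (simp add: \<kappa>_def)
  have p: "0 < p" using m by (simp add: p_def)
  have q': "q = (2 * real m - 2 * real j) / (real m + 2)"
  proof -
    have "1 - real j / real m = (real m - real j) / real m" using m by (simp add: field_simps)
    moreover have "2 * M / N * ((M - J) / M) = (2 * M - 2 * J) / N" if "M \<noteq> 0" for M N J :: real
      using that by (cases "N = 0") (simp_all add: field_simps)
    ultimately show ?thesis using m by (simp add: q_def p_def)
  qed
  have q0: "0 \<le> q" using j m by (simp add: q')
  \<comment> \<open>Equivalent to \<open>2 * j < m + 2\<close>: the error \<open>O(t^(p-1))\<close>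
    caused by integer part and shift is below the precision \<open>t^q\<close> of the
    expansion.\<close>
  have pq: "p < q + 1"
  proof -
    have "(2 * real m - 2 * real j) / (real m + 2) + 1 = (2 * real m - 2 * real j + (real m + 2)) / (real m + 2)"
    proof -
      have "U / N + 1 = (U + N) / N" if "N \<noteq> 0" for U N :: real using that by (simp add: add_divide_distrib)
      then show ?thesis by (simp add: add_nonneg_eq_0_iff)
    qed
    moreover have "2 * real m < 2 * real m - 2 * real j + (real m + 2)" using j by linarith
    ultimately have "2 * real m / (real m + 2) < (2 * real m - 2 * real j) / (real m + 2) + 1"
      by (simp only: divide_strict_right_mono)
    then show ?thesis by (simp only: p_def q')
  qed
  have d: "((\<lambda>t. (X t powr e - x t powr e) / t powr q) \<longlongrightarrow> 0) at_top" if "0 \<le> e" "e \<le> 1" for e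
  proof -
    have "p * e \<le> p * 1" using that p by (intro mult_left_mono) auto
    then have "p * e < q + 1" using pq by linarith
    then show ?thesis unfolding X_def x_def p_def \<kappa>_def using m by (intro E_lead_floor_powr_diff_tendsto) auto
  qed
  have dc: "((\<lambda>t. complex_of_real ((X t powr e - x t powr e) / t powr q)) \<longlongrightarrow> 0) at_top" if "0 \<le> e" "e \<le> 1" for e
    using tendsto_of_real[OF d[OF that], where 'a = complex] by (simp only: of_real_0)
  define R where "R = (\<lambda>n. E n - (of_real (E_lead m \<beta> n) + (\<Sum>i=1..j. c i * of_real (E_lead m \<beta> n powr (1 - real i / real m)))))"
  have "R \<in> o[at_top](\<lambda>n. of_real (real_of_int n powr q))" using ex unfolding has_expansion_def R_def q' .
  then have "((\<lambda>n. R n / of_real (real_of_int n powr q)) \<longlongrightarrow> 0) at_top" by (rule smalloD_tendsto)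
  moreover have fl: "filterlim (floor :: real \<Rightarrow> int) at_top at_top" by (rule filterlim_floor_sequentially)
  ultimately have "((\<lambda>t::real. R \<lfloor>t\<rfloor> / of_real (real_of_int \<lfloor>t\<rfloor> powr q)) \<longlongrightarrow> 0) at_top"
    by (rule filterlim_compose)
  then have R0: "((\<lambda>t::real. R \<lfloor>t\<rfloor> / of_real (t powr q)) \<longlongrightarrow> 0) at_top"
  proof (rule tendsto_0_le[where K = 1])
    show "\<forall>\<^sub>F t in at_top. norm (R \<lfloor>t\<rfloor> / complex_of_real (t powr q)) \<le> norm (R \<lfloor>t\<rfloor> / complex_of_real (real_of_int \<lfloor>t\<rfloor> powr q)) * 1"
      using eventually_ge_at_top[of 1]
    proof eventually_elim
      case (elim t)
      have "1 \<le> \<lfloor>t\<rfloor>" using elim by linarith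
      then have n: "0 < real_of_int \<lfloor>t\<rfloor>" by linarith
      have "real_of_int \<lfloor>t\<rfloor> powr q \<le> t powr q" using n q0 by (intro powr_mono2) auto
      moreover have "0 < real_of_int \<lfloor>t\<rfloor> powr q" using n by (simp only: powr_gt_zero less_imp_neq[symmetric] not_False_eq_True)
      ultimately show ?case unfolding norm_divide norm_of_real mult_1_right
        by (intro frac_le) auto
    qed
  qed
  have "((\<lambda>t. (R \<lfloor>t\<rfloor> / of_real (t powr q) + of_real ((X t powr 1 - x t powr 1) / t powr q)
     + (\<Sum>i=1..j. c i * of_real ((X t powr (1 - real i / real m) - x t powr (1 - real i / real m)) / t powr q))) / of_real (\<kappa> powr q))
     \<longlongrightarrow> (0 + 0 + (\<Sum>i=1..j. c i * 0)) / of_real (\<kappa> powr q)) at_top"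
    using j m k by (intro tendsto_divide tendsto_add tendsto_sum tendsto_mult tendsto_const R0 dc) auto
  then have *: "((\<lambda>t. (R \<lfloor>t\<rfloor> / of_real (t powr q) + of_real ((X t powr 1 - x t powr 1) / t powr q)
     + (\<Sum>i=1..j. c i * of_real ((X t powr (1 - real i / real m) - x t powr (1 - real i / real m)) / t powr q))) / of_real (\<kappa> powr q))
     \<longlongrightarrow> 0) at_top" by simp
  have "((\<lambda>t. ((E \<lfloor>t\<rfloor> - of_real (x t)) / of_real (x t) - (\<Sum>i=1..m-1. c i * of_real (y t) ^ i)) / of_real (y t) ^ j) \<longlongrightarrow> 0) at_top"
  proof (rule Lim_transform_eventually[OF *])
    show "\<forall>\<^sub>F t in at_top. (R \<lfloor>t\<rfloor> / of_real (t powr q) + of_real ((X t powr 1 - x t powr 1) / t powr q)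
     + (\<Sum>i=1..j. c i * of_real ((X t powr (1 - real i / real m) - x t powr (1 - real i / real m)) / t powr q))) / of_real (\<kappa> powr q)
     = ((E \<lfloor>t\<rfloor> - of_real (x t)) / of_real (x t) - (\<Sum>i=1..m-1. c i * of_real (y t) ^ i)) / of_real (y t) ^ j"
      using eventually_ge_at_top[of 1]
    proof eventually_elim
      case (elim t)
      have x0: "0 < x t" using k elim by (simp add: x_def)
      have y0: "0 < y t" using x0 by (simp add: y_def)
      have X0: "0 \<le> X t" by (simp add: X_def E_lead_def)
      have xy: "x t powr (1 - real i / real m) = x t * y t ^ i" for i
        using x0 unfolding y_def by (simp add: powr_realpow[symmetric] powr_powr powr_diff powr_minus field_simps)
      have tq: "t powr q * \<kappa> powr q = x t * y t ^ j"
        using elim k unfolding xy[symmetric] by (simp add: x_def q_def powr_powr powr_mult)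
      have sum_m: "(\<Sum>i=1..m-1. c i * of_real (y t) ^ i) = (\<Sum>i=1..j. c i * of_real (y t) ^ i)"
        using j m by (intro sum.mono_neutral_right) (auto simp: c)
      define T where "T = complex_of_real (t powr q)"
      define S where "S = (\<lambda>z::real. \<Sum>i=1..j. c i * complex_of_real (z powr (1 - real i / real m)))"
      have S1: "(\<Sum>i=1..j. c i * of_real ((X t powr (1 - real i / real m) - x t powr (1 - real i / real m)) / t powr q)) = (S (X t) - S (x t)) / T"
        by (simp add: S_def T_def sum_divide_distrib sum_subtractf[symmetric] right_diff_distrib diff_divide_distrib)
      have Sx: "S (x t) = of_real (x t) * (\<Sum>i=1..j. c i * of_real (y t) ^ i)"
        unfolding S_def xy by (simp add: sum_distrib_left mult_ac)
      have Rt: "R \<lfloor>t\<rfloor> = E \<lfloor>t\<rfloor> - of_real (X t) - S (X t)" by (simp add: R_def X_def S_def)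
      have TK: "T * of_real (\<kappa> powr q) = of_real (x t) * of_real (y t) ^ j"
        unfolding T_def of_real_mult[symmetric] tq by simp
      have gen: "((e - X - SX) / T + (X - x) / T + (SX - x * s) / T) / K = ((e - x) / x - s) / Y"
        if "T * K = x * Y" "x \<noteq> 0" "Y \<noteq> 0" for e X SX T x s K Y :: complex
      proof -
        have "((e - X - SX) / T + (X - x) / T + (SX - x * s) / T) / K = (e - x - x * s) / (T * K)"
          by (simp add: add_divide_distrib[symmetric])
        also have "\<dots> = ((e - x) / x - s) / Y" unfolding that(1) using that by (simp add: field_simps)
        finally show ?thesis .
      qed
      have TD: "complex_of_real ((X t powr 1 - x t powr 1) / t powr q) = (of_real (X t) - of_real (x t)) / T"
        using X0 x0 by (simp add: T_def)
      show ?case unfolding S1 Sx Rt sum_m T_def[symmetric] TD by (rule gen[OF TK]) (use x0 y0 in auto)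
    qed
  qed
  then show ?thesis by (simp only: x_def y_def)
qed

text \<open>Over each unit interval the step function integrates to one term, so the series is an
  integral without any error.\<close>

lemma step_function_integral:
  fixes h :: "int \<Rightarrow> complex" and N :: nat
  assumes int: "set_integrable lborel {real N..} (\<lambda>t. h \<lfloor>t\<rfloor>)" and summ: "summable (\<lambda>i. norm (h (int N + int i)))"
  shows "(h has_sum (LBINT t:{real N..}. h \<lfloor>t\<rfloor>)) {int N..}"
proof -
  define A where "A = (\<lambda>i::nat. {real N + real i..<real N + real i + 1})"
  have floor: "\<lfloor>t\<rfloor> = int N + int i" if "t \<in> A i" for t i
    using that by (intro floor_unique) (auto simp: A_def)
  have Un: "(\<Union>i. A i) = {real N..}"
  proof (intro equalityI subsetI)
    fix t assume t: "t \<in> {real N..}"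
    define i where "i = nat (\<lfloor>t\<rfloor> - int N)"
    have "int N \<le> \<lfloor>t\<rfloor>" using t by (simp add: le_floor_iff)
    then have "\<lfloor>t\<rfloor> = int N + int i" by (simp add: i_def)
    then have "real_of_int \<lfloor>t\<rfloor> = real N + real i" by simp
    then have "t \<in> A i" using floor_correct[of t] by (simp add: A_def)
    then show "t \<in> (\<Union>i. A i)" by blast
  qed (auto simp: A_def)
  have one: "(LBINT t:A i. h \<lfloor>t\<rfloor>) = h (int N + int i)" for i
  proof -
    have "(LBINT t:A i. h \<lfloor>t\<rfloor>) = (LBINT t:A i. h (int N + int i))"
      unfolding set_lebesgue_integral_def by (intro Bochner_Integration.integral_cong refl) (auto simp: indicator_def floor)
    also have "\<dots> = h (int N + int i)"
      unfolding set_lebesgue_integral_def A_def by (simp add: measure_def)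
    finally show ?thesis .
  qed
  have "(LBINT t:(\<Union>i. A i). h \<lfloor>t\<rfloor>) = (\<Sum>i. (LBINT t:A i. h \<lfloor>t\<rfloor>))"
  proof (rule lebesgue_integral_countable_add)
    show "A i \<inter> A k = {}" if "i \<noteq> k" for i k using floor[of _ i] floor[of _ k] that by fastforce
    show "set_integrable lborel (\<Union>i. A i) (\<lambda>t. h \<lfloor>t\<rfloor>)" unfolding Un by (rule int)
  qed (simp add: A_def)
  then have I: "(LBINT t:{real N..}. h \<lfloor>t\<rfloor>) = (\<Sum>i. h (int N + int i))" by (simp add: Un one)
  have "((\<lambda>i. h (int N + int i)) has_sum (\<Sum>i. h (int N + int i))) UNIV"
    using summ summable_norm_cancel[OF summ] by (intro norm_summable_imp_has_sum) (auto simp: summable_sums)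
  moreover have "{int N..} = (\<lambda>i. int N + int i) ` UNIV"
  proof -
    have "n \<in> (\<lambda>i. int N + int i) ` UNIV" if "int N \<le> n" for n
      using that by (intro image_eqI[of _ _ "nat (n - int N)"]) auto
    then show ?thesis by auto
  qed
  ultimately show ?thesis unfolding I by (simp add: has_sum_reindex inj_on_def o_def)
qed

lemma resolvent_term_small:
  fixes z :: complex
  assumes "s < 1"
  shows "((\<lambda>l. 1 / (of_real l + z) / of_real (l powr (- s))) \<longlongrightarrow> 0) at_top"
proof (rule tendsto_0_le[where K = 1])
  have "((\<lambda>l. 2 * l powr (s - 1)) \<longlongrightarrow> 2 * 0) at_top"
    using assms by (intro tendsto_mult tendsto_const tendsto_neg_powr filterlim_ident) auto
  then show "((\<lambda>l::real. 2 * l powr (s - 1)) \<longlongrightarrow> 0) at_top" by simp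
  show "\<forall>\<^sub>F l in at_top. norm (1 / (of_real l + z) / of_real (l powr (- s))) \<le> norm (2 * l powr (s - 1)) * 1"
    using eventually_ge_at_top[of "max 1 (2 * norm z)"]
  proof eventually_elim
    case (elim l)
    then have l: "1 \<le> l" "2 * norm z \<le> l" by auto
    have "l / 2 \<le> norm (of_real l + z)" using norm_diff_ineq[of "of_real l" z] l by simp
    then have "norm (1 / (of_real l + z)) \<le> 1 / (l / 2)" unfolding norm_divide norm_one using l by (intro frac_le) auto
    then have "norm (1 / (of_real l + z)) / l powr (- s) \<le> 2 / l / l powr (- s)" by (intro divide_right_mono) auto
    also have "\<dots> = 2 * l powr (s - 1)" using l by (simp add: powr_diff powr_minus field_simps)
    finally show ?case using l by (simp add: norm_divide norm_mult)
  qed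
qed

text \<open>From some \<open>N\<close> on the terms sum to the integral of \<open>G l\<close> over
  \<open>t \<ge> N\<close>. The finitely many earlier terms and the integral over
  \<open>0 < t < N\<close>, where \<open>w = 0\<close>, are \<open>O(1/l)\<close> and hence below
  \<open>l^(\<sigma> j - 1)\<close>.\<close>

lemma resolvent_sum_asymptotics:
  fixes m j :: nat
  defines "\<rho> \<equiv> 1/2 + 1 / real m" and "\<sigma> \<equiv> \<lambda>i. 1/2 + (1 - real i) / real m"
  assumes m: "3 \<le> m" and j: "1 \<le> j" "2 * j \<le> m + 1" and ex: "has_expansion m \<beta> j c E"
  shows "\<forall>\<^sub>F l in at_top. (\<lambda>n. 1 / (complex_of_real l + E n)) summable_on {n0..}"
    and "((\<lambda>l. ((\<Sum>\<^sub>\<infinity>n\<in>{n0..}. 1 / (complex_of_real l + E n)) - (\<Sum>i\<le>j. of_real (l powr (\<sigma> i - 1)) *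
      (of_real (\<rho> * pi / (lead_const m * sin (pi * \<sigma> i))) * fps_cpow (coeff_fps m c) (- of_real (\<sigma> i)) $ i))) / of_real (l powr (\<sigma> j - 1))) \<longlongrightarrow> 0) at_top"
proof -
  define p where "p = 2 * real m / (real m + 2)"
  define \<kappa> where "\<kappa> = lead_const m"
  \<comment> \<open>The expansion involves \<open>c 1, ..., c j\<close>; zeros beyond
    \<open>j\<close> fit the sum up to \<open>m - 1\<close> in the locale.\<close>
  define c' where "c' = (\<lambda>i. if i \<le> j then c i else 0)"
  define v where "v = (\<lambda>t. (E \<lfloor>t\<rfloor> - of_real ((\<kappa> * t) powr p)) / of_real ((\<kappa> * t) powr p))"
  define P where "P = (\<lambda>t. \<Sum>i=1..m-1. c' i * of_real (((\<kappa> * t) powr p) powr (-1 / real m)) ^ i)"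
  define Y where "Y = (\<lambda>t. complex_of_real (((\<kappa> * t) powr p) powr (-1 / real m)))"
  have k: "0 < \<kappa>" using lead_const_pos[of m] m by (simp add: \<kappa>_def)
  have p0: "0 < p" using m by (simp add: p_def)
  have p1: "1 < p" using m by (simp add: p_def field_simps)
  have inv_p: "\<rho> = 1 / p" using m by (simp add: \<rho>_def p_def field_simps)
  have ex': "has_expansion m \<beta> j c' E" using ex by (simp add: has_expansion_def c'_def cong: sum.cong_simp)
  have lim: "((\<lambda>t. (v t - P t) / Y t ^ j) \<longlongrightarrow> 0) at_top"
    unfolding v_def P_def Y_def \<kappa>_def p_def
    by (rule expansion_floor_tendsto[OF m j ex']) (simp add: c'_def)
  have Y0: "(Y \<longlongrightarrow> 0) at_top"
  proof -
    have "filterlim (\<lambda>t. \<kappa> * t) at_top at_top" using k by real_asymp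
    then have "((\<lambda>t. (\<kappa> * t) powr (p * (-1 / real m))) \<longlongrightarrow> 0) at_top"
      using p0 m by (intro tendsto_neg_powr) (auto simp: divide_neg_pos)
    then have "((\<lambda>t. complex_of_real ((\<kappa> * t) powr (p * (-1 / real m)))) \<longlongrightarrow> of_real 0) at_top" by (rule tendsto_of_real)
    then show ?thesis by (simp add: Y_def[abs_def] powr_powr)
  qed
  have "((\<lambda>t. (v t - P t) / Y t ^ j * Y t ^ j + (\<Sum>i=1..m-1. c' i * Y t ^ i)) \<longlongrightarrow> 0 * 0 ^ j + (\<Sum>i=1..m-1. c' i * 0 ^ i)) at_top"
    by (intro tendsto_intros lim Y0)
  moreover have "(\<Sum>i=1..m-1. c' i * 0 ^ i) = 0" by (intro sum.neutral) auto
  moreover have "\<forall>\<^sub>F t in at_top. (v t - P t) / Y t ^ j * Y t ^ j + (\<Sum>i=1..m-1. c' i * Y t ^ i) = v t"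
    using eventually_gt_at_top[of 0]
  proof eventually_elim
    case (elim t)
    then have "Y t \<noteq> 0" using k by (simp add: Y_def)
    then show ?case by (simp add: P_def Y_def)
  qed
  ultimately have v0: "(v \<longlongrightarrow> 0) at_top" using Lim_transform_eventually by fastforce
  then have "\<forall>\<^sub>F t in at_top. dist (v t) 0 < 1/2" by (rule tendstoD) simp
  then obtain T where T: "\<And>t. T \<le> t \<Longrightarrow> norm (v t) < 1/2" unfolding eventually_at_top_linorder by auto
  \<comment> \<open>From \<open>N\<close> on the relative deviation \<open>v\<close> is below 1/2
    and all indices belong to the numbering; below \<open>N\<close> it will be replaced by
    0.\<close>
  define N where "N = nat (max 1 (max \<lceil>T\<rceil> n0))"
  have N: "1 \<le> N" "T \<le> real N" "n0 \<le> int N" unfolding N_def by linarith+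
  define w where "w = (\<lambda>t. if t < real N then 0 else v t)"
  have w_eq: "\<forall>\<^sub>F t in at_top. v t = w t" using eventually_ge_at_top[of "real N"] by eventually_elim (simp add: w_def)
  note sigma = \<sigma>_def
  interpret resolvent_model m j p \<kappa> c' w
  proof
    have "(\<lambda>t::real. E \<lfloor>t\<rfloor>) \<in> borel_measurable borel"
      by (rule measurable_compose[OF measurable_real_floor]) simp
    then show "w \<in> borel_measurable borel" unfolding w_def v_def by measurable
    show "norm (w t) \<le> 1/2" for t using T[of t] N by (auto simp: w_def less_imp_le)
    show "((\<lambda>t. (w t - (\<Sum>i=1..m-1. c' i * of_real (((\<kappa> * t) powr p) powr (-1 / real m)) ^ i))
      / of_real (((\<kappa> * t) powr p) powr (-1 / real m)) ^ j) \<longlongrightarrow> 0) at_top"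
      using lim w_eq unfolding P_def Y_def
      by (rule Lim_transform_eventually[OF _ eventually_mono]) auto
  qed (use m j k in \<open>auto simp: p_def\<close>)
  have \<sigma>_eq: "resolvent_model.\<sigma> m = \<sigma>" unfolding sigma \<sigma>_def ..
  have Gt: "G l t = 1 / (of_real l + E \<lfloor>t\<rfloor>)" if "real N \<le> t" for l t
  proof -
    have "x t \<noteq> 0" using x_pos[of t] that N by linarith
    then have "complex_of_real (x t) * (1 + w t) = E \<lfloor>t\<rfloor>"
      using that by (simp add: w_def v_def x_def field_simps)
    then show ?thesis by (simp add: G_def)
  qed
  have sum_N: "((\<lambda>n. 1 / (complex_of_real l + E n)) has_sum (LBINT t:{real N..}. G l t)) {int N..}" if l: "0 < l" for l
  proof -
    have "set_integrable lborel {real N..} (G l)"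
      using G_integrable[OF l] by (rule set_integrable_subset) (use N in auto)
    moreover have "set_integrable lborel {real N..} (G l) = set_integrable lborel {real N..} (\<lambda>t. 1 / (complex_of_real l + E \<lfloor>t\<rfloor>))"
      unfolding set_integrable_def by (intro Bochner_Integration.integrable_cong) (auto simp: indicator_def Gt)
    ultimately have i: "set_integrable lborel {real N..} (\<lambda>t. 1 / (complex_of_real l + E \<lfloor>t\<rfloor>))" by simp
    have "summable (\<lambda>i. norm (1 / (complex_of_real l + E (int N + int i))))"
    proof (rule summable_comparison_test)
      have "summable (\<lambda>n. 2 * \<kappa> powr (- p) * real n powr (- p))"
        using p1 by (intro summable_mult) (simp add: summable_real_powr_iff)
      then show "summable (\<lambda>i. 2 * \<kappa> powr (- p) * real (i + N) powr (- p))"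
        by (subst summable_iff_shift)
      have "norm (norm (1 / (complex_of_real l + E (int N + int i)))) \<le> 2 * \<kappa> powr (- p) * real (i + N) powr (- p)" for i
      proof -
        define t where "t = real (i + N)"
        have t: "0 < t" "real N \<le> t" "\<lfloor>t\<rfloor> = int N + int i" using N by (auto simp: t_def)
        have "norm (G l t) \<le> 1 / (x t / 2)"
          unfolding G_def norm_divide norm_one using denominator_ge[OF l t(1)] l x_pos[OF t(1)] by (intro frac_le) auto
        also have "\<dots> = 2 * \<kappa> powr (- p) * t powr (- p)"
        proof -
          have "x t = \<kappa> powr p * t powr p" unfolding x_def using k t by (simp add: powr_mult)
          then show ?thesis unfolding powr_minus by (simp only: divide_inverse inverse_mult_distrib inverse_inverse_eq mult_ac mult_1)
        qed
        finally show ?thesis unfolding Gt[OF t(2)] t(3) real_norm_def abs_norm_cancel unfolding t_def .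
      qed
      then show "\<exists>M. \<forall>i\<ge>M. norm (norm (1 / (complex_of_real l + E (int N + int i)))) \<le> 2 * \<kappa> powr (- p) * real (i + N) powr (- p)" by blast
    qed
    from step_function_integral[OF i this]
    have "((\<lambda>n. 1 / (complex_of_real l + E n)) has_sum (LBINT t:{real N..}. 1 / (complex_of_real l + E \<lfloor>t\<rfloor>))) {int N..}" .
    moreover have "(LBINT t:{real N..}. 1 / (complex_of_real l + E \<lfloor>t\<rfloor>)) = (LBINT t:{real N..}. G l t)"
      unfolding set_lebesgue_integral_def by (intro Bochner_Integration.integral_cong) (auto simp: indicator_def Gt)
    ultimately show ?thesis by simp
  qed
  have split: "{n0..} = {n0..<int N} \<union> {int N..}" using N by auto
  have sum_n0: "((\<lambda>n. 1 / (complex_of_real l + E n)) has_sum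
      ((\<Sum>n\<in>{n0..<int N}. 1 / (complex_of_real l + E n)) + (LBINT t:{real N..}. G l t))) {n0..}" if l: "0 < l" for l
    unfolding split by (intro has_sum_Un_disjoint sum_N l has_sum_finite) auto
  show "\<forall>\<^sub>F l in at_top. (\<lambda>n. 1 / (complex_of_real l + E n)) summable_on {n0..}"
    by (rule eventually_mono[OF eventually_gt_at_top[of 0]]) (rule has_sum_imp_summable[OF sum_n0])
  have s: "1 - \<sigma> j < 1" "0 < \<sigma> j" using \<sigma>_bounds[of j] by (auto simp: \<sigma>_eq)
  have init: "((\<lambda>l. (\<Sum>n\<in>{n0..<int N}. 1 / (complex_of_real l + E n) / of_real (l powr (- (1 - \<sigma> j))))) \<longlongrightarrow> (\<Sum>n\<in>{n0..<int N}. 0)) at_top"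
    by (intro tendsto_sum resolvent_term_small s)
  have piece: "((\<lambda>l. (LBINT t:{0<..<real N}. G l t) / of_real (l powr (- (1 - \<sigma> j)))) \<longlongrightarrow> 0) at_top"
  proof (rule tendsto_0_le[where K = "real N"])
    show "((\<lambda>l. 1 / (complex_of_real l + 0) / of_real (l powr (- (1 - \<sigma> j)))) \<longlongrightarrow> 0) at_top"
      by (rule resolvent_term_small[OF s(1)])
    show "\<forall>\<^sub>F l in at_top. norm ((LBINT t:{0<..<real N}. G l t) / of_real (l powr (- (1 - \<sigma> j))))
      \<le> norm (1 / (complex_of_real l + 0) / of_real (l powr (- (1 - \<sigma> j)))) * real N"
      using eventually_gt_at_top[of 0]
    proof eventually_elim
      case (elim l)
      have "norm (LBINT t:{0<..<real N}. G l t) \<le> (LBINT t:{0<..<real N}. 1 / l)"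
      proof (rule set_integral_norm_le)
        show "set_integrable lborel {0<..<real N} (G l)"
          using G_integrable[OF elim] by (rule set_integrable_subset) auto
        show "set_integrable lborel {0<..<real N} (\<lambda>t. 1 / l)" by (simp add: set_integrable_def)
        fix t assume "t \<in> {0<..<real N}"
        then have t: "0 < t" "w t = 0" by (auto simp: w_def)
        have "norm (G l t) = 1 / (l + x t)" using elim x_pos[OF t(1)] by (simp add: G_def t norm_divide flip: of_real_add)
        also have "\<dots> \<le> 1 / l" using elim x_pos[OF t(1)] by (intro frac_le) auto
        finally show "norm (G l t) \<le> 1 / l" .
      qed
      also have "\<dots> = real N * (1 / l)" by (simp add: set_lebesgue_integral_def)
      finally have "norm (LBINT t:{0<..<real N}. G l t) / l powr (- (1 - \<sigma> j)) \<le> real N * (1 / l) / l powr (- (1 - \<sigma> j))"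
        by (intro divide_right_mono) auto
      then show ?case using elim by (simp add: norm_divide norm_mult)
    qed
  qed
  have fps: "fps_cpow (coeff_fps m c') (- of_real (\<sigma> i)) $ i = fps_cpow (coeff_fps m c) (- of_real (\<sigma> i)) $ i" if "i \<le> j" for i
    unfolding fps_cpow_coeff_fps_nth
  proof (intro sum.cong refl arg_cong2[where f = "(*)"] multi_sum_cong)
    fix k \<xi> r assume "\<xi> \<in> multi_indices m k i" "\<xi> r \<noteq> 0"
    then have "r < i + 1" by (rule multi_index_small) simp
    then show "c' r = c r" using that by (simp add: c'_def)
  qed
  define M where "M = (\<lambda>l. \<Sum>i\<le>j. complex_of_real (l powr (\<sigma> i - 1)) *
      (of_real (\<rho> * pi / (lead_const m * sin (pi * \<sigma> i))) * fps_cpow (coeff_fps m c) (- of_real (\<sigma> i)) $ i))"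
  have "(\<Sum>i\<le>j. complex_of_real (l powr (\<sigma> i - 1)) *
      (of_real (pi / (p * \<kappa> * sin (pi * \<sigma> i))) * fps_cpow (coeff_fps m c') (- of_real (\<sigma> i)) $ i)) = M l" for l
    unfolding M_def using fps p0 by (intro sum.cong refl) (simp add: inv_p \<kappa>_def)
  then have G: "((\<lambda>l. ((LBINT t:{0<..}. G l t) - M l) / of_real (l powr (\<sigma> j - 1))) \<longlongrightarrow> 0) at_top"
    using G_asymptotics unfolding \<sigma>_eq by simp
  have "((\<lambda>l. (\<Sum>n\<in>{n0..<int N}. 1 / (complex_of_real l + E n) / of_real (l powr (- (1 - \<sigma> j))))
     - (LBINT t:{0<..<real N}. G l t) / of_real (l powr (- (1 - \<sigma> j)))
     + ((LBINT t:{0<..}. G l t) - M l) / of_real (l powr (\<sigma> j - 1))) \<longlongrightarrow> (\<Sum>n\<in>{n0..<int N}. 0) - 0 + 0) at_top"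
    by (intro tendsto_add tendsto_diff init piece G)
  then have *: "((\<lambda>l. (\<Sum>n\<in>{n0..<int N}. 1 / (complex_of_real l + E n) / of_real (l powr (- (1 - \<sigma> j))))
     - (LBINT t:{0<..<real N}. G l t) / of_real (l powr (- (1 - \<sigma> j)))
     + ((LBINT t:{0<..}. G l t) - M l) / of_real (l powr (\<sigma> j - 1))) \<longlongrightarrow> 0) at_top" by simp
  have "((\<lambda>l. ((\<Sum>\<^sub>\<infinity>n\<in>{n0..}. 1 / (complex_of_real l + E n)) - M l) / of_real (l powr (\<sigma> j - 1))) \<longlongrightarrow> 0) at_top"
  proof (rule Lim_transform_eventually[OF *])
    show "\<forall>\<^sub>F l in at_top. (\<Sum>n\<in>{n0..<int N}. 1 / (complex_of_real l + E n) / of_real (l powr (- (1 - \<sigma> j))))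
     - (LBINT t:{0<..<real N}. G l t) / of_real (l powr (- (1 - \<sigma> j)))
     + ((LBINT t:{0<..}. G l t) - M l) / of_real (l powr (\<sigma> j - 1))
     = ((\<Sum>\<^sub>\<infinity>n\<in>{n0..}. 1 / (complex_of_real l + E n)) - M l) / of_real (l powr (\<sigma> j - 1))"
      using eventually_gt_at_top[of 0]
    proof eventually_elim
      case (elim l)
      have Un: "{0<..<real N} \<union> {real N..} = {0<..}" using N by auto
      have "(LBINT t:{0<..<real N} \<union> {real N..}. G l t) = (LBINT t:{0<..<real N}. G l t) + (LBINT t:{real N..}. G l t)"
      proof (rule set_integral_Un)
        show "set_integrable lborel {0<..<real N} (G l)" by (rule set_integrable_subset[OF G_integrable[OF elim]]) auto
        show "set_integrable lborel {real N..} (G l)" by (rule set_integrable_subset[OF G_integrable[OF elim]]) (use N in auto)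
      qed auto
      then have "(LBINT t:{0<..}. G l t) = (LBINT t:{0<..<real N}. G l t) + (LBINT t:{real N..}. G l t)"
        unfolding Un .
      moreover have "(\<Sum>\<^sub>\<infinity>n\<in>{n0..}. 1 / (complex_of_real l + E n))
         = (\<Sum>n\<in>{n0..<int N}. 1 / (complex_of_real l + E n)) + (LBINT t:{real N..}. G l t)"
        by (rule infsumI[OF sum_n0[OF elim]])
      moreover have "- (1 - \<sigma> j) = \<sigma> j - 1" by simp
      ultimately show ?case
        by (simp only: sum_divide_distrib[symmetric] add_divide_distrib[symmetric] diff_divide_distrib[symmetric]) (simp add: algebra_simps)
    qed
  qed
  then show "((\<lambda>l. ((\<Sum>\<^sub>\<infinity>n\<in>{n0..}. 1 / (complex_of_real l + E n)) - (\<Sum>i\<le>j. of_real (l powr (\<sigma> i - 1)) *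
      (of_real (\<rho> * pi / (lead_const m * sin (pi * \<sigma> i))) * fps_cpow (coeff_fps m c) (- of_real (\<sigma> i)) $ i))) / of_real (l powr (\<sigma> j - 1))) \<longlongrightarrow> 0) at_top"
    unfolding M_def .
qed

section \<open>Eigenvalues as zeros\<close>

text \<open>The eigenfunction is \<open>f\<close> on the half line. If it were constant, its decay
  would make it 0, but \<open>f\<close> is eventually nonzero by its asymptotics.\<close>

lemma sibuya_zero_is_eigenvalue:
  assumes sib: "sibuya_solution m f" and D0: "\<alpha> * f 0 a (- x) + \<beta> * deriv (\<lambda>z. f z a (- x)) 0 = 0"
  shows "is_eigenvalue m a \<alpha> \<beta> x"
  unfolding is_eigenvalue_def
proof (intro exI conjI allI impI)
  define u where "u = (\<lambda>t::real. f (of_real t) a (- x))"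
  show "(u has_vector_derivative deriv (\<lambda>z. f z a (- x)) (of_real t)) (at t within {0..})" for t
    unfolding u_def by (rule has_vector_derivative_at_within[OF sibuya_ode_real(1)[OF sib]])
  show "((\<lambda>t::real. deriv (\<lambda>z. f z a (- x)) (of_real t)) has_vector_derivative Qpoly m a (- x) (of_real t) * u t) (at t within {0..})" for t
    unfolding u_def by (rule has_vector_derivative_at_within[OF sibuya_ode_real(2)[OF sib]])
  show "- (Qpoly m a (- x) (of_real t) * u t) + (of_real t ^ m + lower_part m a (of_real t)) * u t = x * u t" for t
    by (simp add: Qpoly_def algebra_simps)
  show "\<alpha> * u 0 + \<beta> * deriv (\<lambda>z. f z a (- x)) (of_real 0) = 0" using D0 by (simp add: u_def)
  show lim: "(u \<longlongrightarrow> 0) at_top" unfolding u_def by (rule sibuya_tendsto_0[OF sib])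
  show "\<not> u constant_on {0..}"
  proof
    assume "u constant_on {0..}"
    then obtain k where k: "\<And>t. 0 \<le> t \<Longrightarrow> u t = k" unfolding constant_on_def by auto
    have "\<forall>\<^sub>F t in at_top. u t = k" by (rule eventually_mono[OF eventually_ge_at_top[of 0]]) (rule k)
    with lim have "((\<lambda>t::real. k) \<longlongrightarrow> 0) at_top" by (rule Lim_transform_eventually)
    then have "k = 0" by (simp add: tendsto_const_iff trivial_limit_at_top_linorder)
    moreover have "\<forall>\<^sub>F t in at_top. u t \<noteq> 0" unfolding u_def by (rule sibuya_eventually_nonzero[OF sib])
    then have "\<forall>\<^sub>F t in at_top. u t \<noteq> 0 \<and> 0 \<le> (t::real)" using eventually_ge_at_top[of 0] by eventually_elim simp
    then obtain t :: real where "u t \<noteq> 0" "0 \<le> t" by (auto dest!: eventually_happens)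
    ultimately show False using k by auto
  qed
qed

text \<open>Factoring \<open>D\<close> at \<open>z\<close> shows that \<open>D\<close> has no other
  zeros near \<open>z\<close>, the condition under which the order is meaningful.\<close>

lemma entire_zorder_pos_iff:
  assumes D: "D holomorphic_on UNIV" "D w \<noteq> 0"
  shows "0 < zorder D z \<longleftrightarrow> D z = 0"
proof (rule zorder_pos_iff[OF D(1)])
  obtain n h where h: "h holomorphic_on UNIV" "h z \<noteq> 0" "\<And>y. D y = (y - z) ^ n * h y"
    using entire_factor_zero[OF D, of z] by blast
  have "isCont h z" using holomorphic_on_imp_continuous_on[OF h(1)] by (simp add: continuous_on_eq_continuous_at)
  then have "\<forall>\<^sub>F y in at z. h y \<noteq> 0" using h(2) unfolding isCont_def by (rule tendsto_imp_eventually_ne)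
  moreover have "\<forall>\<^sub>F y in at z. y \<noteq> z" by (simp add: eventually_at_filter)
  ultimately have "\<forall>\<^sub>F y in at z. D y \<noteq> 0" by eventually_elim (simp add: h(3))
  then show "\<exists>\<^sub>F y in at z. D y \<noteq> 0" by (intro eventually_frequently) auto
qed auto

text \<open>Zeros are eigenvalues, with \<open>f\<close> as eigenfunction. The converse is read off
  the numbering: a listed value occurs at least once and finitely often, so its algebraic
  multiplicity, the order of the zero, is positive.\<close>

lemma eigenvalue_numbering_zeros:
  assumes sib: "sibuya_solution m f" and num: "eigenvalue_numbering m a \<alpha> \<beta> f n0 E"
  defines "D \<equiv> \<lambda>l. \<alpha> * f 0 a l + \<beta> * deriv (\<lambda>z. f z a l) 0"
  assumes D: "D holomorphic_on UNIV" "D w \<noteq> 0"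
  shows "D y = 0 \<longleftrightarrow> (\<exists>n\<ge>n0. - E n = y)"
    and "D y = 0 \<Longrightarrow> finite {n. n \<ge> n0 \<and> - E n = y} \<and> card {n. n \<ge> n0 \<and> - E n = y} = nat (zorder D y)"
proof -
  have set_eq: "{n. n \<ge> n0 \<and> - E n = y} = {n. n \<ge> n0 \<and> E n = - y}" for y by (metis minus_minus)
  have ev: "finite {n. n \<ge> n0 \<and> - E n = y} \<and> card {n. n \<ge> n0 \<and> - E n = y} = nat (zorder D y)"
    if "is_eigenvalue m a \<alpha> \<beta> (- y)" for y
    using num that unfolding eigenvalue_numbering_def alg_mult_def set_eq D_def by simp
  have zero: "is_eigenvalue m a \<alpha> \<beta> (- y)" if "D y = 0" for y
    using that unfolding D_def by (intro sibuya_zero_is_eigenvalue[OF sib]) simp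
  show "D y = 0 \<Longrightarrow> finite {n. n \<ge> n0 \<and> - E n = y} \<and> card {n. n \<ge> n0 \<and> - E n = y} = nat (zorder D y)"
    by (intro ev zero)
  show "D y = 0 \<longleftrightarrow> (\<exists>n\<ge>n0. - E n = y)"
  proof
    assume y: "\<exists>n\<ge>n0. - E n = y"
    then have "is_eigenvalue m a \<alpha> \<beta> (- y)" using num unfolding eigenvalue_numbering_def by auto
    then have *: "finite {n. n \<ge> n0 \<and> - E n = y}" "card {n. n \<ge> n0 \<and> - E n = y} = nat (zorder D y)" using ev by auto
    then have "card {n. n \<ge> n0 \<and> - E n = y} \<noteq> 0" using y by (subst card_0_eq) auto
    then have "0 < zorder D y" using *(2) by simp
    then show "D y = 0" using entire_zorder_pos_iff[OF D] by blast
  next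
    assume D0: "D y = 0"
    have "0 < zorder D y" using D0 entire_zorder_pos_iff[OF D] by blast
    then have "card {n. n \<ge> n0 \<and> - E n = y} \<noteq> 0" using ev[OF zero[OF D0]] by simp
    then have "{n. n \<ge> n0 \<and> - E n = y} \<noteq> {}" by (metis card.empty)
    then show "\<exists>n\<ge>n0. - E n = y" by blast
  qed
qed

text \<open>Near \<open>l\<close> the continuous logarithm stays within \<open>pi\<close> of
  \<open>\<zeta> l\<close> and so coincides with \<open>\<zeta> l + Ln (D s / D l)\<close>, which is
  differentiable.\<close>

lemma log_has_vector_derivative:
  fixes D :: "complex \<Rightarrow> complex" and \<zeta> :: "real \<Rightarrow> complex"
  assumes D: "D holomorphic_on UNIV" and \<zeta>: "continuous_on {\<Lambda>..} \<zeta>"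
    and eq: "\<And>l. \<Lambda> \<le> l \<Longrightarrow> D (of_real l) = exp (\<zeta> l)" and l: "\<Lambda> < l"
  shows "(\<zeta> has_vector_derivative deriv D (of_real l) / D (of_real l)) (at l)"
proof -
  have nz: "D (of_real l) \<noteq> 0" using eq[of l] l by simp
  have "D field_differentiable at (of_real l)" using D by (rule holomorphic_on_imp_differentiable_at) auto
  then have "(D has_field_derivative deriv D (of_real l)) (at (of_real l))" by (simp add: DERIV_deriv_iff_field_differentiable)
  then have "((\<lambda>z. \<zeta> l + Ln (D z / D (of_real l))) has_field_derivative deriv D (of_real l) / D (of_real l)) (at (of_real l))"
    using nz by (auto intro!: derivative_eq_intros)
  from has_vector_derivative_real_field[OF this]
  have der: "((\<lambda>s::real. \<zeta> l + Ln (D (of_real s) / D (of_real l))) has_vector_derivative deriv D (of_real l) / D (of_real l)) (at l)" .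
  have "isCont \<zeta> l" using \<zeta> l by (intro continuous_on_interior[OF \<zeta>]) (auto simp: interior_Ici)
  then have "\<forall>\<^sub>F s in at l. dist (\<zeta> s) (\<zeta> l) < pi" unfolding isCont_def by (rule tendstoD) simp
  then have "\<forall>\<^sub>F s in nhds l. dist (\<zeta> s) (\<zeta> l) < pi" unfolding eventually_at_filter by (rule eventually_mono) auto
  moreover have "\<forall>\<^sub>F s in nhds l. \<Lambda> < s" using l by (rule order_tendstoD(1)[OF filterlim_ident])
  ultimately have "\<forall>\<^sub>F s in nhds l. \<zeta> l + Ln (D (of_real s) / D (of_real l)) = \<zeta> s"
  proof eventually_elim
    case (elim s)
    have "D (of_real s) / D (of_real l) = exp (\<zeta> s - \<zeta> l)" using elim l by (simp add: eq exp_diff)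
    moreover have "\<bar>Im (\<zeta> s - \<zeta> l)\<bar> < pi" using abs_Im_le_cmod[of "\<zeta> s - \<zeta> l"] elim by (simp add: dist_norm)
    then have "Ln (exp (\<zeta> s - \<zeta> l)) = \<zeta> s - \<zeta> l" by (intro Ln_exp) (auto simp: abs_less_iff)
    ultimately show ?case by simp
  qed
  then have ev: "\<forall>\<^sub>F s in nhds l. s \<in> UNIV \<longrightarrow> \<zeta> l + Ln (D (of_real s) / D (of_real l)) = \<zeta> s" by simp
  then have "\<zeta> l + Ln (D (of_real l) / D (of_real l)) = \<zeta> l" using eventually_nhds_x_imp_x by blast
  with der show ?thesis by (subst (asm) has_vector_derivative_cong_ev[OF ev]) auto
qed

text \<open>A little-o relation survives integration, and \<open>s > 0\<close> makes the constant of
  integration negligible; differentiation would not preserve it.\<close>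

lemma small_o_integrate:
  fixes \<Psi> :: "real \<Rightarrow> complex"
  assumes s: "0 < s" and \<Psi>: "\<And>l. \<Lambda> < l \<Longrightarrow> (\<Psi> has_vector_derivative \<psi> l) (at l)"
    and o: "((\<lambda>l. \<psi> l / of_real (l powr (s - 1))) \<longlongrightarrow> 0) at_top"
  shows "((\<lambda>l. \<Psi> l / of_real (l powr s)) \<longlongrightarrow> 0) at_top"
proof (rule tendstoI)
  fix e :: real assume e: "0 < e"
  have "\<forall>\<^sub>F l in at_top. dist (\<psi> l / of_real (l powr (s - 1))) 0 < e / 2 * s" using o by (rule tendstoD) (use e s in simp)
  then obtain L0 where L0: "\<And>l. L0 \<le> l \<Longrightarrow> dist (\<psi> l / of_real (l powr (s - 1))) 0 < e / 2 * s" unfolding eventually_at_top_linorder by blast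
  define L where "L = max 1 (max L0 (\<Lambda> + 1))"
  have L: "1 \<le> L" "L0 \<le> L" "\<Lambda> < L" by (auto simp: L_def)
  have \<psi>: "norm (\<psi> l) \<le> e / 2 * (s * l powr (s - 1))" if "L \<le> l" for l
  proof -
    have "norm (\<psi> l) / l powr (s - 1) < e / 2 * s" using L0[of l] that L by (simp add: norm_divide)
    then show ?thesis using that L by (simp add: field_simps)
  qed
  have bd: "norm (\<Psi> l) \<le> norm (\<Psi> L) + e / 2 * l powr s" if l: "L \<le> l" for l
  proof -
    have "norm (\<Psi> l - \<Psi> L) \<le> e / 2 * l powr s - e / 2 * L powr s"
    proof (rule norm_diff_le_of_deriv_le[OF l])
      show "(\<Psi> has_vector_derivative \<psi> t) (at t)" if "L \<le> t" for t using that L by (intro \<Psi>) auto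
      show "((\<lambda>t. e / 2 * t powr s) has_real_derivative e / 2 * (s * t powr (s - 1))) (at t)" if "L \<le> t" for t
        using that L by (auto intro!: derivative_eq_intros)
    qed (use \<psi> in auto)
    moreover have "0 \<le> e / 2 * L powr s" using e by simp
    ultimately show ?thesis using norm_triangle_ineq2[of "\<Psi> l" "\<Psi> L"] by linarith
  qed
  have "((\<lambda>l. norm (\<Psi> L) * l powr (- s)) \<longlongrightarrow> norm (\<Psi> L) * 0) at_top"
    using s by (intro tendsto_mult tendsto_const tendsto_neg_powr filterlim_ident) auto
  then have "\<forall>\<^sub>F l in at_top. norm (\<Psi> L) * l powr (- s) < e / 2" using e by (intro order_tendstoD(2)) auto
  then show "\<forall>\<^sub>F l in at_top. dist (\<Psi> l / of_real (l powr s)) 0 < e"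
    using eventually_ge_at_top[of L]
  proof eventually_elim
    case (elim l)
    have l: "0 < l powr s" using elim L by simp
    have "norm (\<Psi> l) / l powr s \<le> (norm (\<Psi> L) + e / 2 * l powr s) / l powr s" using bd[OF elim(2)] l by (intro divide_right_mono) auto
    also have "\<dots> = norm (\<Psi> L) * l powr (- s) + e / 2" using l unfolding powr_minus add_divide_distrib by (simp only: divide_inverse mult.assoc right_inverse less_imp_neq[symmetric]) simp
    also have "\<dots> < e" using elim(1) by linarith
    finally show ?case by (simp add: norm_divide)
  qed
qed

lemma powr_difference_tendsto_0:
  fixes a b :: real
  assumes "a < b"
  shows "((\<lambda>l. complex_of_real (l powr a) / of_real (l powr b)) \<longlongrightarrow> 0) at_top"
proof -
  have "((\<lambda>l. complex_of_real (l powr (a - b))) \<longlongrightarrow> of_real 0) at_top"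
    using assms by (intro tendsto_of_real tendsto_neg_powr filterlim_ident) auto
  then show ?thesis by (simp add: powr_diff)
qed

text \<open>Once the earlier coefficients vanish, division by the largest remaining power
  \<open>l^(\<sigma> i)\<close> isolates \<open>A i\<close> in the limit.\<close>

lemma powers_independent:
  fixes A :: "nat \<Rightarrow> complex" and \<sigma> :: "nat \<Rightarrow> real"
  assumes \<sigma>: "\<And>i k. i < k \<Longrightarrow> \<sigma> k < \<sigma> i"
    and lim: "((\<lambda>l. (\<Sum>i\<le>j. A i * of_real (l powr \<sigma> i)) / of_real (l powr \<sigma> j)) \<longlongrightarrow> 0) at_top"
    and i: "i \<le> j"
  shows "A i = 0"
  using i
proof (induction i rule: less_induct)
  case (less i)
  have "((\<lambda>l. (\<Sum>k\<in>{i<..j}. A k * (of_real (l powr \<sigma> k) / of_real (l powr \<sigma> i)))) \<longlongrightarrow> (\<Sum>k\<in>{i<..j}. A k * 0)) at_top"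
    using \<sigma> by (intro tendsto_sum tendsto_mult tendsto_const powr_difference_tendsto_0) auto
  then have "((\<lambda>l. A i + (\<Sum>k\<in>{i<..j}. A k * (of_real (l powr \<sigma> k) / of_real (l powr \<sigma> i)))) \<longlongrightarrow> A i + 0) at_top"
    by (intro tendsto_add tendsto_const) simp
  moreover have "((\<lambda>l. A i + (\<Sum>k\<in>{i<..j}. A k * (of_real (l powr \<sigma> k) / of_real (l powr \<sigma> i)))) \<longlongrightarrow> 0) at_top"
  proof (rule tendsto_0_le[OF lim, where K = 1])
    show "\<forall>\<^sub>F l in at_top. norm (A i + (\<Sum>k\<in>{i<..j}. A k * (of_real (l powr \<sigma> k) / of_real (l powr \<sigma> i))))
      \<le> norm ((\<Sum>i\<le>j. A i * of_real (l powr \<sigma> i)) / of_real (l powr \<sigma> j)) * 1"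
      using eventually_ge_at_top[of 1]
    proof eventually_elim
      case (elim l)
      have "(\<Sum>k\<le>j. A k * of_real (l powr \<sigma> k)) = (\<Sum>k\<in>insert i {i<..j}. A k * of_real (l powr \<sigma> k))"
        using less by (intro sum.mono_neutral_right) (auto simp: not_less le_less)
      also have "\<dots> = of_real (l powr \<sigma> i) * (A i + (\<Sum>k\<in>{i<..j}. A k * (of_real (l powr \<sigma> k) / of_real (l powr \<sigma> i))))"
        using elim by (simp add: distrib_left sum_distrib_left)
      finally have eq: "(\<Sum>k\<le>j. A k * of_real (l powr \<sigma> k)) = of_real (l powr \<sigma> i) * (A i + (\<Sum>k\<in>{i<..j}. A k * (of_real (l powr \<sigma> k) / of_real (l powr \<sigma> i))))" .
      have "\<sigma> j \<le> \<sigma> i" using \<sigma>[of i j] less.prems by (cases "i = j") auto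
      then have "l powr \<sigma> j \<le> l powr \<sigma> i" using elim by (intro powr_mono) auto
      then have "1 \<le> l powr \<sigma> i / l powr \<sigma> j" using elim by simp
      then show ?case unfolding eq norm_divide norm_mult norm_of_real
        using mult_right_mono[of 1 "l powr \<sigma> i / l powr \<sigma> j"] by simp
    qed
  qed
  ultimately show ?case using tendsto_unique[OF trivial_limit_at_top_linorder] by fastforce
qed

section \<open>Comparison of coefficients\<close>

lemma sibuya_boundary_holomorphic:
  assumes "sibuya_solution m f"
  shows "(\<lambda>l. \<alpha> * f 0 a l + \<beta> * deriv (\<lambda>z. f z a l) 0) holomorphic_on UNIV"
  using assms by (intro holomorphic_intros sibuya_deriv_holomorphic[OF assms]) (auto simp: sibuya_solution_def)

text \<open>The same function \<open>\<zeta>\<close> is expanded by WKB and by integrating the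
  resolvent sum, whence the factor \<open>\<sigma> i\<close>. Independence of the powers
  \<open>l^(\<sigma> i)\<close> equates the coefficients.\<close>

lemma expansion_coefficients:
  fixes m j :: nat
  defines "\<rho> \<equiv> 1/2 + 1 / real m" and "\<sigma> \<equiv> \<lambda>i. 1/2 + (1 - real i) / real m"
  assumes sib: "sibuya_solution m f" and m: "3 \<le> m" and ab: "(\<alpha>, \<beta>) \<noteq> (0, 0)"
    and j: "1 \<le> j" "2 * j \<le> m + 1"
    and num: "eigenvalue_numbering m a \<alpha> \<beta> f n0 E" and ex: "has_expansion m \<beta> j c E"
    and i: "1 \<le> i" "i \<le> j"
  shows "of_real (\<sigma> i) * K_coeff m a i
    = of_real (\<rho> * pi / (lead_const m * sin (pi * \<sigma> i))) * fps_cpow (coeff_fps m c) (- of_real (\<sigma> i)) $ i"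
proof -
  define D where "D = (\<lambda>l. \<alpha> * f 0 a l + \<beta> * deriv (\<lambda>z. f z a l) 0)"
  define G where "G = (\<lambda>i. of_real (\<rho> * pi / (lead_const m * sin (pi * \<sigma> i))) * fps_cpow (coeff_fps m c) (- of_real (\<sigma> i)) $ i)"
  define S where "S = (\<lambda>l::real. \<Sum>\<^sub>\<infinity>n\<in>{n0..}. 1 / (complex_of_real l + E n))"
  have \<rho>: "0 < \<rho>" "\<rho> < 1" using m by (auto simp: \<rho>_def field_simps)
  \<comment> \<open>This margin, a consequence of \<open>2 * i \<le> m + 1\<close>, separates the
    powers from the error exponent \<open>1/(4m)\<close>.\<close>
  have \<sigma>_lower: "1 / (2 * real m) \<le> \<sigma> i" if "i \<le> j" for i
  proof -
    have "2 * real i \<le> real m + 1" using that j by linarith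
    then show ?thesis using m by (simp add: \<sigma>_def field_simps)
  qed
  then have \<sigma>_pos: "0 < \<sigma> i" if "i \<le> j" for i
  proof -
    have "0 < 1 / (2 * real m)" using m by simp
    then show ?thesis using \<sigma>_lower[OF that] by linarith
  qed
  have \<sigma>_anti: "\<sigma> k < \<sigma> i" if "i < k" for i k using that m by (simp add: \<sigma>_def divide_strict_right_mono)
  have D: "D holomorphic_on UNIV" unfolding D_def by (rule sibuya_boundary_holomorphic[OF sib])
  obtain \<Lambda> \<zeta> c0 \<kappa> C where L: "1 \<le> \<Lambda>" and cont: "continuous_on {\<Lambda>..} \<zeta>"
    and exp: "\<And>l. \<Lambda> \<le> l \<Longrightarrow> D (of_real l) = exp (\<zeta> l)"
    and asym: "\<And>l. \<Lambda> \<le> l \<Longrightarrow> norm (\<zeta> l - (c0 + \<kappa> * of_real (l powr (1/2 + 1 / real m))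
        + (\<Sum>s=1..(m+1) div 2. K_coeff m a s * of_real (l powr (1/2 + (1 - real s) / real m))))) \<le> C * l powr (1 / (4 * real m))"
    unfolding D_def using sibuya_log_asymptotics[OF sib m ab, of a] by blast
  have Dnz: "D (of_real \<Lambda>) \<noteq> 0" using exp[of \<Lambda>] by simp
  obtain B where B: "\<And>l. norm (D l) \<le> exp (B * (1 + norm l) powr \<rho>)"
    unfolding D_def \<rho>_def using sibuya_growth[OF sib m, of \<alpha> a \<beta>] by blast
  have zeros: "D y = 0 \<longleftrightarrow> (\<exists>n\<ge>n0. - E n = y)"
    "D y = 0 \<Longrightarrow> finite {n. n \<ge> n0 \<and> - E n = y} \<and> card {n. n \<ge> n0 \<and> - E n = y} = nat (zorder D y)" for y
    using eigenvalue_numbering_zeros[OF sib num D[unfolded D_def] Dnz[unfolded D_def], of y] by (simp_all only: D_def)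
  have "\<forall>\<^sub>F l in at_top. (\<lambda>n. 1 / (complex_of_real l + E n)) summable_on {n0..}"
    by (rule resolvent_sum_asymptotics(1)[OF m j ex])
  then obtain L1 where L1: "\<And>l. L1 \<le> l \<Longrightarrow> (\<lambda>n. 1 / (complex_of_real l + E n)) summable_on {n0..}"
    unfolding eventually_at_top_linorder by blast
  define L2 where "L2 = max L1 \<Lambda>"
  have logd: "deriv D (of_real l) / D (of_real l) = S l" if "L2 < l" for l
    unfolding S_def
  proof (rule log_deriv_eq_infsum[OF D _ B \<rho> zeros])
    show "D (of_real l) \<noteq> 0" using exp[of l] that by (simp add: L2_def)
    show "(\<lambda>n. 1 / (complex_of_real l + E n)) summable_on {n0..}" using L1[of l] that by (simp add: L2_def)
  qed
  define \<Psi> where "\<Psi> = (\<lambda>l. \<zeta> l - (\<Sum>i\<le>j. G i / of_real (\<sigma> i) * of_real (l powr \<sigma> i)))"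
  have \<Psi>: "(\<Psi> has_vector_derivative S l - (\<Sum>i\<le>j. of_real (l powr (\<sigma> i - 1)) * G i)) (at l)" if l: "L2 < l" for l
    unfolding \<Psi>_def
  proof (intro has_vector_derivative_diff has_vector_derivative_sum)
    show "(\<zeta> has_vector_derivative S l) (at l)"
      unfolding logd[OF l, symmetric] using l by (intro log_has_vector_derivative[OF D cont exp]) (auto simp: L2_def)
    fix i assume i: "i \<in> {..j}"
    have "((\<lambda>l. l powr \<sigma> i) has_real_derivative \<sigma> i * l powr (\<sigma> i - 1)) (at l)"
      using l L by (intro has_real_derivative_powr) (auto simp: L2_def)
    then have "((\<lambda>l. complex_of_real (l powr \<sigma> i)) has_vector_derivative of_real (\<sigma> i * l powr (\<sigma> i - 1))) (at l)"
      by (intro has_vector_derivative_of_real) (simp add: has_real_derivative_iff_has_vector_derivative)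
    then have "((\<lambda>l. G i / of_real (\<sigma> i) * complex_of_real (l powr \<sigma> i)) has_vector_derivative
       G i / of_real (\<sigma> i) * of_real (\<sigma> i * l powr (\<sigma> i - 1))) (at l)"
      by (rule has_vector_derivative_mult_right)
    moreover have "\<sigma> i \<noteq> 0" using \<sigma>_pos[of i] i by simp
    ultimately show "((\<lambda>l. G i / of_real (\<sigma> i) * complex_of_real (l powr \<sigma> i)) has_vector_derivative
       of_real (l powr (\<sigma> i - 1)) * G i) (at l)" by (simp add: mult_ac)
  qed
  have "((\<lambda>l. (S l - (\<Sum>i\<le>j. of_real (l powr (\<sigma> i - 1)) * G i)) / of_real (l powr (\<sigma> j - 1))) \<longlongrightarrow> 0) at_top"
    unfolding S_def G_def \<rho>_def \<sigma>_def by (rule resolvent_sum_asymptotics(2)[OF m j ex])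
  from small_o_integrate[OF \<sigma>_pos[OF order_refl] \<Psi> this]
  have \<Psi>0: "((\<lambda>l. \<Psi> l / of_real (l powr \<sigma> j)) \<longlongrightarrow> 0) at_top" by simp
  define N where "N = (m + 1) div 2"
  have jN: "j \<le> N" using j by (simp add: N_def)
  define Z where "Z = (\<lambda>l. \<zeta> l - (c0 + \<kappa> * of_real (l powr \<sigma> 0) + (\<Sum>s=1..N. K_coeff m a s * of_real (l powr \<sigma> s))))"
  have Z: "norm (Z l) \<le> C * l powr (1 / (4 * real m))" if "\<Lambda> \<le> l" for l
    using asym[OF that] by (simp add: Z_def \<sigma>_def N_def)
  have s4: "1 / (4 * real m) < \<sigma> j"
  proof -
    have "1 / (4 * real m) < 1 / (2 * real m)" using m by (simp add: field_simps)
    then show ?thesis using \<sigma>_lower[of j] by simp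
  qed
  have Z0: "((\<lambda>l. Z l / of_real (l powr \<sigma> j)) \<longlongrightarrow> 0) at_top"
  proof (rule tendsto_0_le[OF powr_difference_tendsto_0[OF s4], where K = C])
    show "\<forall>\<^sub>F l in at_top. norm (Z l / of_real (l powr \<sigma> j)) \<le> norm (of_real (l powr (1 / (4 * real m))) / complex_of_real (l powr \<sigma> j)) * C"
      using eventually_ge_at_top[of \<Lambda>]
    proof eventually_elim
      case (elim l)
      have "norm (Z l) / l powr \<sigma> j \<le> C * l powr (1 / (4 * real m)) / l powr \<sigma> j" using Z[OF elim] by (intro divide_right_mono) auto
      then show ?case by (simp add: norm_divide mult_ac)
    qed
  qed
  have c0: "((\<lambda>l. c0 * (of_real (l powr 0) / of_real (l powr \<sigma> j))) \<longlongrightarrow> c0 * 0) at_top"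
    using \<sigma>_pos[of j] by (intro tendsto_mult tendsto_const powr_difference_tendsto_0) auto
  \<comment> \<open>The WKB terms with \<open>j < s \<le> N\<close> are smaller than
    \<open>l^(\<sigma> j)\<close>, the precision of the given expansion.\<close>
  have tail: "((\<lambda>l. \<Sum>s=j+1..N. K_coeff m a s * (of_real (l powr \<sigma> s) / of_real (l powr \<sigma> j))) \<longlongrightarrow> (\<Sum>s=j+1..N. K_coeff m a s * 0)) at_top"
    by (intro tendsto_sum tendsto_mult tendsto_const powr_difference_tendsto_0 \<sigma>_anti) auto
  \<comment> \<open>Index 0 carries the constant \<open>\<kappa>\<close>, whose value is left open;
    the relation is extracted for \<open>i \<ge> 1\<close>.\<close>
  define A where "A = (\<lambda>i. (if i = 0 then \<kappa> else K_coeff m a i) - G i / of_real (\<sigma> i))"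
  have "((\<lambda>l. \<Psi> l / of_real (l powr \<sigma> j) - Z l / of_real (l powr \<sigma> j) - c0 * (of_real (l powr 0) / of_real (l powr \<sigma> j))
     - (\<Sum>s=j+1..N. K_coeff m a s * (of_real (l powr \<sigma> s) / of_real (l powr \<sigma> j)))) \<longlongrightarrow> 0 - 0 - c0 * 0 - (\<Sum>s=j+1..N. K_coeff m a s * 0)) at_top"
    by (intro tendsto_diff \<Psi>0 Z0 c0 tail)
  then have *: "((\<lambda>l. \<Psi> l / of_real (l powr \<sigma> j) - Z l / of_real (l powr \<sigma> j) - c0 * (of_real (l powr 0) / of_real (l powr \<sigma> j))
     - (\<Sum>s=j+1..N. K_coeff m a s * (of_real (l powr \<sigma> s) / of_real (l powr \<sigma> j)))) \<longlongrightarrow> 0) at_top" by simp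
  have "((\<lambda>l. (\<Sum>i\<le>j. A i * of_real (l powr \<sigma> i)) / of_real (l powr \<sigma> j)) \<longlongrightarrow> 0) at_top"
  proof (rule Lim_transform_eventually[OF *])
    show "\<forall>\<^sub>F l in at_top. \<Psi> l / of_real (l powr \<sigma> j) - Z l / of_real (l powr \<sigma> j) - c0 * (of_real (l powr 0) / of_real (l powr \<sigma> j))
     - (\<Sum>s=j+1..N. K_coeff m a s * (of_real (l powr \<sigma> s) / of_real (l powr \<sigma> j))) = (\<Sum>i\<le>j. A i * of_real (l powr \<sigma> i)) / of_real (l powr \<sigma> j)"
      using eventually_ge_at_top[of 1]
    proof eventually_elim
      case (elim l)
      have one: "complex_of_real (l powr 0) = 1" using elim by simp
      define K where "K = (\<lambda>I. \<Sum>s\<in>I. K_coeff m a s * complex_of_real (l powr \<sigma> s))"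
      have "{1..N} = {1..j} \<union> {j+1..N}" using jN j by auto
      then have KN: "K {1..N} = K {1..j} + K {j+1..N}" unfolding K_def by (simp only:) (intro sum.union_disjoint, auto)
      have split0: "(\<Sum>i\<le>j. h i) = h 0 + (\<Sum>i=1..j. h i)" for h :: "nat \<Rightarrow> complex"
        by (simp add: atMost_atLeast0 sum.atLeast_Suc_atMost)
      have "(\<Sum>i\<le>j. A i * of_real (l powr \<sigma> i)) = \<kappa> * of_real (l powr \<sigma> 0) + K {1..j} - (\<Sum>i\<le>j. G i / of_real (\<sigma> i) * of_real (l powr \<sigma> i))"
        unfolding split0 A_def K_def by (simp add: left_diff_distrib sum_subtractf)
      also have "\<dots> = \<Psi> l - Z l - c0 * of_real (l powr 0) - K {j+1..N}"
        unfolding \<Psi>_def Z_def K_def[symmetric] KN one by simp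
      finally show ?case by (simp add: diff_divide_distrib K_def sum_divide_distrib)
    qed
  qed
  then have "A i = 0" using \<sigma>_anti i by (intro powers_independent[where \<sigma> = \<sigma> and j = j and A = A and i = i])
  moreover have "\<sigma> i \<noteq> 0" using \<sigma>_pos[OF i(2)] by simp
  ultimately have "of_real (\<sigma> i) * K_coeff m a i = G i" using i by (simp add: A_def field_simps)
  then show ?thesis by (simp only: G_def)
qed

text \<open>By \<open>Gamma (1/2) = sqrt pi\<close> the normalization of \<open>E_lead\<close>
  matches \<open>d_0\<close>, so the factor \<open>pi / lead_const m\<close> of the resolvent
  expansion becomes \<open>d_0\<close>.\<close>

lemma d_coeff_0_lead_const:
  assumes "3 \<le> m"
  shows "d_coeff m a 0 = of_real (pi / lead_const m)"
proof -
  have "0 < Gamma (1 + 1 / real m)" "0 < Gamma (3/2 + 1 / real m)"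
    by (intro Gamma_real_pos add_pos_nonneg; simp)+
  then have "Gamma (1 + 1 / real m) \<noteq> 0" "Gamma (3/2 + 1 / real m) \<noteq> 0" by simp_all
  moreover have "Gamma (1/2 :: real) = sqrt pi" by (rule Gamma_one_half_real)
  moreover have "1/2 + (1 + 1 / real m) = 3/2 + 1 / real m" by simp
  moreover have "sqrt pi * sqrt pi = pi" by simp
  ultimately have "Beta (1/2) (1 + 1 / real m) / 2 = pi / lead_const m"
    unfolding Beta_def lead_const_def by (simp add: field_simps)
  then show ?thesis using d_coeff_0_nonzero(1)[OF assms, of a] by simp
qed

text \<open>The value of \<open>recovered_coeff m c k\<close> depends on \<open>m\<close> and the
  expansion coefficients alone, so the first part is an explicit determination of
  \<open>a k\<close>, and the second follows by applying the same formula to both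
  potentials.\<close>

theorem theorem1p7:
  fixes m j :: nat and \<alpha> \<beta> :: complex
    and f :: "complex \<Rightarrow> (nat \<Rightarrow> complex) \<Rightarrow> complex \<Rightarrow> complex"
  assumes "3 \<le> m"
    and "(\<alpha>, \<beta>) \<noteq> (0, 0)"
    and "1 \<le> j" and "real j \<le> (real m + 1) / 2"
    and "sibuya_solution m f"
  shows
    "(\<forall>a n0 E c.
        eigenvalue_numbering m a \<alpha> \<beta> f n0 E \<and> has_expansion m \<beta> j c E \<longrightarrow>
        (\<forall>k\<in>{1..j}. c k = e_coeff m a k \<and> a k = recovered_coeff m c k)) \<and>
     (\<forall>a a' n0 n0' E E' c.
        eigenvalue_numbering m a \<alpha> \<beta> f n0 E \<and> has_expansion m \<beta> j c E \<and>
        eigenvalue_numbering m a' \<alpha> \<beta> f n0' E' \<and> has_expansion m \<beta> j c E' \<longrightarrow>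
        (\<forall>k\<in>{1..j}. a k = a' k))"
proof -
  note m = assms(1)
  have "real (2 * j) \<le> real (m + 1)" using assms(4) by simp
  then have j2: "2 * j \<le> m + 1" by (simp only: of_nat_le_iff)
  have jm: "j \<le> m - 1" using j2 m by linarith
  have main: "c k = e_coeff m a k \<and> a k = recovered_coeff m c k"
    if num: "eigenvalue_numbering m a \<alpha> \<beta> f n0 E" and ex: "has_expansion m \<beta> j c E" and k: "k \<in> {1..j}" for a n0 E c k
  proof -
    have \<sigma>: "0 < 1/2 + (1 - real i) / real m \<and> 1/2 + (1 - real i) / real m < 1" if "i \<le> j" for i
    proof -
      have "2 * real i \<le> real m + 1" using that j2 by linarith
      then show ?thesis using m by (simp add: field_simps)
    qed
    have cof: "of_real (1/2 + 1 / real m) * fps_cpow (coeff_fps m c) (- of_real (1/2 + (1 - real i) / real m)) $ i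
      = of_real (1/2 + (1 - real i) / real m) * (d_coeff m a i / d_coeff m a 0)" if i: "1 \<le> i" "i \<le> j" for i
    proof -
      define s where "s = 1/2 + (1 - real i) / real m"
      have s: "0 < s" "s < 1" using \<sigma>[OF i(2)] by (auto simp: s_def)
      \<comment> \<open>For \<open>s = 1/2 + (1 - i)/m\<close> the sine from the reflection formula
        is the cosine factor in \<open>d_coeff\<close>; it turns \<open>K_coeff\<close> into
        \<open>d_coeff\<close> in the relation of coefficients.\<close>
      have "cos ((real i - 1) * pi / real m) = cos ((1 - real i) * pi / real m)"
        using cos_minus[of "(real i - 1) * pi / real m"] by (simp only: minus_divide_left minus_mult_left minus_diff_eq)
      also have "\<dots> = sin (pi * s)"
        unfolding cos_sin_eq s_def sin_pi_minus[of "pi * _", symmetric] by (simp add: algebra_simps)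
      finally have cs: "cos ((real i - 1) * pi / real m) = sin (pi * s)" .
      have "0 < sin (pi * s)" using s by (intro sin_gt_zero) auto
      then have sn: "complex_of_real (sin (pi * s)) \<noteq> 0" by (simp only: of_real_eq_0_iff less_imp_neq[symmetric] not_False_eq_True)
      have lc: "complex_of_real (lead_const m) \<noteq> 0" using lead_const_pos[of m] m by simp
      have "of_real s * K_coeff m a i
        = of_real ((1/2 + 1 / real m) * pi / (lead_const m * sin (pi * s))) * fps_cpow (coeff_fps m c) (- of_real s) $ i"
        unfolding s_def by (rule expansion_coefficients[OF assms(5) m assms(2,3) j2 num ex i])
      then have sK: "of_real s * K_coeff m a i
        = of_real (1/2 + 1 / real m) * of_real pi / (of_real (lead_const m) * of_real (sin (pi * s))) * fps_cpow (coeff_fps m c) (- of_real s) $ i"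
        by (simp only: of_real_mult of_real_divide[of _ "lead_const m * sin (pi * s)"])
      have gen: "r * F = x * (C * K / (p / k))" if "x * K = r * p / (k * C) * F" "C \<noteq> 0" "k \<noteq> 0" "p \<noteq> 0" for r F x C K p k :: complex
      proof -
        have "x * (C * K / (p / k)) = (x * K) * (C * k / p)" by simp
        also have "\<dots> = r * F" unfolding that(1) using that by simp
        finally show ?thesis ..
      qed
      show ?thesis
        unfolding d_coeff_0_lead_const[OF m] d_coeff_def[of m a i] cs s_def[symmetric] of_real_divide[of pi "lead_const m"]
        by (rule gen[OF sK sn lc]) simp
    qed
    have e: "c i = e_coeff m a i" if "1 \<le> i" "i \<le> j" for i
      using \<sigma> by (intro e_coeff_unique[OF m jm cof _ that]) (auto simp: less_imp_neq[symmetric])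
    moreover have "a i = recovered_coeff m c i" if "1 \<le> i" "i \<le> j" for i
    proof (rule recovered_coeff_eq[OF m jm assms(4) e _ that])
      fix s assume "1 \<le> s" "s \<le> j"
      moreover have "s \<le> m" using \<open>s \<le> j\<close> j2 m by linarith
      moreover have "real s \<le> (real m + 1) / 2" using of_nat_mono[OF \<open>s \<le> j\<close>, where 'a = real] assms(4) by linarith
      ultimately show "K_int m s 1 \<noteq> 0" by (intro K_int_1_nonzero[OF m])
    qed
    ultimately show ?thesis using k by simp
  qed
  then have "a k = a' k"
    if "eigenvalue_numbering m a \<alpha> \<beta> f n0 E" "has_expansion m \<beta> j c E"
      "eigenvalue_numbering m a' \<alpha> \<beta> f n0' E'" "has_expansion m \<beta> j c E'" "k \<in> {1..j}" for a a' n0 n0' E E' c k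
    using main[OF that(1,2,5)] main[OF that(3,4,5)] by simp
  with main show ?thesis by blast
qed

end
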